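(* Let $D$ be an admissible domain. Then for every sufficiently large $h$ there exist a set $X$ of initial conditions, a first return map $\mathcal F:X\to X$ and a map $\pi:X\to\mathcal L$ (namely the set $X$, the map $\mathcal F$ and the itinerary map $\pi$ described in the context) such that $\pi$ is continuous and surjective and $\pi\circ\mathcal F=\sigma_r\circ\pi$, where $\sigma_r:\mathcal L\to\mathcal L$ is the Bernoulli shift. In other words, for large enough $h$ the refraction billiard admits a symbolic dynamics.
   Context: Fix constants $\omega,\mu,\mathcal E>0$. $D\subset\mathbb R^2$ is a bounded open domain containing the origin, with $\overline D\subset\{z:\|z\|<\sqrt{2\mathcal E}/\omega\}$, whose boundary is a simple closed curve $\partial D=\gamma([0,L])$, with $\gamma:[0,L]\to\mathbb R^2$ an arc-length parametrization of class (at least) $C^1$. For $h>0$ put $V_E(z)=\mathcal E-\frac{\omega^2}{2}\|z\|^2$ (outer potential) and $V_I(z)=\mathcal E+h+\frac{\mu}{\|z\|}$ (inner potential). Let $t(\xi)=\dot\gamma(\xi)$ and let $n(\xi)$ be the outward unit normal to $\partial D$ at $\gamma(\xi)$. Outer-arc property. An open interval $(a,b)\subset[0,L]$ satisfies the outer-arc property if for all $\xi_1,\xi_2\in(a,b)$ there is a unique solution $z_E(\cdot;\gamma(\xi_1),\gamma(\xi_2))$ (the outer arc), for some $T=T_E(\xi_1,\xi_2)>0$, of $z''=-\omega^2z$ and $\frac12\|z'\|^2=V_E(z)$ on $[0,T]$, $z(s)\notin D$ for $s\in(0,T)$, $z(0)=\gamma(\xi_1)$, $z(T)=\gamma(\xi_2)$.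 Inner-arc property. Parameters $\xi_1,\xi_2\in[0,L]$ are antipodal if the origin belongs to the segment joining $\gamma(\xi_1)$ and $\gamma(\xi_2)$; two (possibly equal) intervals are not antipodal if no point of the first is antipodal to a point of the second. If $\xi_1,\xi_2$ are not antipodal, a continuous curve in $\mathbb R^2\setminus\{0\}$ from $\gamma(\xi_1)$ to $\gamma(\xi_2)$ is topologically non-trivial (TnT) if it is not homotopic in $\mathbb R^2\setminus\{0\}$ (with fixed endpoints) to the segment joining them. A set $\mathcal A$ satisfies the inner-arc property if: (IP0) $\mathcal A$ is a disjoint union of open intervals $(a_i,b_i)\subset[0,L]$, $i\in\mathcal I=\{1,\dots,m\}$, $m\ge2$; (IP1) for every $i$ there is $j\ne i$ such that both $(a_i,b_i)$ and $(a_j,b_j)$ are not antipodal to $(a_i,b_i)$; (IP2) there is $h_0>0$ such that for all $\xi_1,\xi_2$ belonging to two non-antipodal (possibly equal) intervals and all $h>h_0$ there is a unique TnT solution $z_I(\cdot;\gamma(\xi_1),\gamma(\xi_2);h)$ (the inner arc), for some $T=T_I(\xi_1,\xi_2;h)>0$, of $z''=-\mu z/\|z\|^3$ and $\frac12\|z'\|^2=V_I(z)$ on $[0,T]$, $z(s)\in D$ for $s\in(0,T)$, $z(0)=\gamma(\xi_1)$, $z(T)=\gamma(\xi_2)$; if $\xi_1=\xi_2$ the solution is meant in the Levi-Civita regularized sense (collision-ejection along the radial segment). Let $NA(i)=\{j\in\mathcal I:(a_i,b_i)\text{ and }(a_j,b_j)\text{ are not antipodal}\}$. Jacobi lengths.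 $S_E(\xi_1,\xi_2)=\int_0^{T_E}\|z_E'\|\sqrt{V_E(z_E)}\,ds$ and $S_I(\xi_1,\xi_2;h)=\int_0^{T_I}\|z_I'\|\sqrt{V_I(z_I)}\,ds$ along these arcs; $\partial_a,\partial_b$ are the partial derivatives in the first and second variable. Change-sign property. If $\mathcal A$ satisfies the inner-arc property and every $(a_i,b_i)$ the outer-arc property, $\mathcal A$ satisfies the change-sign property if there are $h_1\ge h_0$ and compact intervals $[\alpha_i,\beta_i]\subset(a_i,b_i)$, $i\in\mathcal I$, such that for all $h>h_1$, $i\in\mathcal I$, $\xi_E\in[\alpha_i,\beta_i]$, $\xi_I\in\bigcup_{j\in NA(i)}[\alpha_j,\beta_j]$, $$(\partial_bS_E(\xi_E,\alpha_i)+\partial_aS_I(\alpha_i,\xi_I;h))\,(\partial_bS_E(\xi_E,\beta_i)+\partial_aS_I(\beta_i,\xi_I;h))<0.$$ $D$ is admissible if $\gamma\in C^1$ and there is $\mathcal A=\bigcup_{i=1}^m(a_i,b_i)\subset[0,L]$, $m\ge2$, satisfying the inner-arc and change-sign properties and such that every $(a_i,b_i)$ satisfies the outer-arc property. Put $I^{(i)}=[\alpha_i,\beta_i]$. Return map. For $r\in\mathcal I$ let $\Xi_r^{\pm}=\{(\xi,v):\xi\in I^{(r)},\ v\in\mathbb R^2,\ \frac12\|v\|^2=V_E(\gamma(\xi)),\ \pm\langle n(\xi),v\rangle>0\}$. The refraction map (Snell's law $\sqrt{V_E}\sin\alpha_E=\sqrt{V_I}\sin\alpha_I$, angles from the normal)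 sends $v=a\,t(\xi)+b\,n(\xi)$ with $\|v\|^2=2V_E(\gamma(\xi))$ to $R_\xi(v)=a\,t(\xi)+\mathrm{sgn}(b)\sqrt{2V_I(\gamma(\xi))-a^2}\,n(\xi)$. The map $F$ is defined at $(\xi,v)\in\Xi_r^+$, $r\in\mathcal I$, if: (i) the solution of $z''=-\omega^2z$ with initial data $(\gamma(\xi),v)$ is outside $\overline D$ for $s\in(0,s_1)$ and at time $s_1>0$ has position and velocity $(\gamma(\xi_1),v_1)$ with $(\xi_1,v_1)\in\Xi_r^-$; (ii) the (regularized) solution of $z''=-\mu z/\|z\|^3$ with initial data $(\gamma(\xi_1),R_{\xi_1}(v_1))$ stays in $D$ for $s\in(0,s_2)$ and at time $s_2>0$ has position and velocity $(\gamma(\xi_2),R_{\xi_2}(v_2))$ with $(\xi_2,v_2)\in\Xi_{r'}^+$ for some $r'\in NA(r)$. Then $F(\xi,v)=(\xi_2,v_2)$. $X$ is the set of $(\xi,v)$ at which all iterates $F^k$, $k\in\mathbb Z$, are defined, with the Euclidean metric of $\mathbb R^3$, and $\mathcal F=F|_X$. Words. $\mathcal L=\{\underline\ell=(\ell_j)_{j\in\mathbb Z}\in\mathcal I^{\mathbb Z}:\ell_{j+1}\in NA(\ell_j)\ \forall j\}$ with metric $d(\underline\ell,\underline m)=\sum_k\rho(\ell_k,m_k)4^{-|k|}$, $\rho(i,j)=0$ if $i=j$ and $1$ otherwise. Put $\chi(\xi,v)=r$ iff $\xi\in I^{(r)}$ and $\pi(\xi,v)=(\chi(\mathcal F^j(\xi,v)))_{j\in\mathbb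 Z}$. The shift is $(\sigma_r\underline\ell)_j=\ell_{j+1}$. *)

theory Defs
  imports "HOL-Analysis.Analysis"
begin

text \<open>The plane is identified with the type of complex numbers (a Euclidean space of dimension two).
  A pair (position parameter, velocity) lives in \<open>real \<times> complex\<close>, whose
  metric is the Euclidean one of three-dimensional space.\<close>

text \<open>\<open>v\<close> is the velocity of \<open>z\<close>; derivatives at \<open>0\<close> and \<open>T\<close> are one-sided.\<close>
definition newton_solution ::
  "(complex \<Rightarrow> complex) \<Rightarrow> real \<Rightarrow> (real \<Rightarrow> complex) \<Rightarrow> (real \<Rightarrow> complex) \<Rightarrow> bool" where
  "newton_solution f T z v \<longleftrightarrow>
     (\<forall>s\<in>{0..T}. (z has_vector_derivative v s) (at s within {0..T}) \<and>
                 (v has_vector_derivative f (z s)) (at s within {0..T}))"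

text \<open>Levi-Civita regularization of \<open>z'' = - \<mu> z / |z|^3\<close> at energy
  \<open>|z'|^2 / 2 - \<mu> / |z| = H\<close>. With \<open>z = w^2\<close> and \<open>ds = |w|^2 d\<tau>\<close> the problem
  becomes \<open>w'' = (H / 2) w\<close>, \<open>2 |w'|^2 - H |w|^2 = \<mu>\<close>, and \<open>dz/ds = 2 w' / cnj w\<close>. The physical
  velocity \<open>v\<close> is constrained only away from collisions. A regularized solution without
  collisions is a classical solution of energy \<open>H\<close>, and conversely.\<close>
definition levi_civita_solution ::
  "real \<Rightarrow> real \<Rightarrow> real \<Rightarrow> (real \<Rightarrow> complex) \<Rightarrow> (real \<Rightarrow> complex) \<Rightarrow> bool" where
  "levi_civita_solution \<mu> H T z v \<longleftrightarrow>
     (\<exists>S w w'. S > 0 \<and>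
        newton_solution (\<lambda>u. (H / 2) *\<^sub>R u) S w w' \<and>
        (\<forall>\<tau>\<in>{0..S}. 2 * (norm (w' \<tau>))\<^sup>2 - H * (norm (w \<tau>))\<^sup>2 = \<mu>) \<and>
        integral {0..S} (\<lambda>u. (norm (w u))\<^sup>2) = T \<and>
        (\<forall>\<tau>\<in>{0..S}. let s = integral {0..\<tau>} (\<lambda>u. (norm (w u))\<^sup>2) in
           z s = (w \<tau>)\<^sup>2 \<and> (w \<tau> \<noteq> 0 \<longrightarrow> v s = 2 * w' \<tau> / cnj (w \<tau>))))"

text \<open>Curves on \<open>[0,T]\<close> are total functions, so uniqueness is uniqueness of \<open>T\<close> and of the
  values on \<open>[0,T]\<close>.\<close>
definition unique_arc :: "(real \<Rightarrow> (real \<Rightarrow> complex) \<Rightarrow> bool) \<Rightarrow> bool" where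
  "unique_arc P \<longleftrightarrow>
     (\<exists>T z. P T z \<and> (\<forall>T' z'. P T' z' \<longrightarrow> T' = T \<and> (\<forall>s\<in>{0..T}. z' s = z s)))"

definition topologically_nontrivial ::
  "real \<Rightarrow> (real \<Rightarrow> complex) \<Rightarrow> complex \<Rightarrow> complex \<Rightarrow> bool" where
  "topologically_nontrivial T z p q \<longleftrightarrow>
     continuous_on {0..T} z \<and> z ` {0..T} \<subseteq> - {0} \<and>
     \<not> homotopic_paths (- {0}) (\<lambda>u. z (T * u)) (linepath p q)"

definition jacobi_length :: "(complex \<Rightarrow> real) \<Rightarrow> real \<Rightarrow> (real \<Rightarrow> complex) \<Rightarrow> real" where
  "jacobi_length V T z =
     integral {0..T} (\<lambda>s. norm (vector_derivative z (at s within {0..T})) * sqrt (V (z s)))"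

text \<open>No matching of the one-sided derivatives of \<open>\<gamma>\<close> at \<open>0\<close> and \<open>L\<close> is
  required: \<open>\<gamma>\<close> is continuously differentiable as a map on \<open>[0,L]\<close>.\<close>
locale refraction_domain =
  fixes \<omega> \<mu> \<E> :: real and D :: "complex set" and \<gamma> :: "real \<Rightarrow> complex" and L :: real
  assumes \<omega>_pos: "\<omega> > 0" and \<mu>_pos: "\<mu> > 0" and \<E>_pos: "\<E> > 0"
    and D_open: "open D" and D_connected: "connected D" and D_bounded: "bounded D"
    and zero_in_D: "0 \<in> D"
    and D_in_Hill: "closure D \<subseteq> {z. norm z < sqrt (2 * \<E>) / \<omega>}"
    and L_pos: "L > 0"
    and boundary: "frontier D = \<gamma> ` {0..L}"
    and closed_curve: "\<gamma> 0 = \<gamma> L" and simple_curve: "inj_on \<gamma> {0..<L}"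
    and curve_diff: "\<And>\<xi>. \<xi> \<in> {0..L} \<Longrightarrow> \<gamma> differentiable (at \<xi> within {0..L})"
    and curve_C1: "continuous_on {0..L} (\<lambda>\<xi>. vector_derivative \<gamma> (at \<xi> within {0..L}))"
    and arc_length:
      "\<And>\<xi>. \<xi> \<in> {0..L} \<Longrightarrow> norm (vector_derivative \<gamma> (at \<xi> within {0..L})) = 1"
begin

definition V\<^sub>E :: "complex \<Rightarrow> real" where
  "V\<^sub>E z = \<E> - \<omega>\<^sup>2 / 2 * (norm z)\<^sup>2"

definition V\<^sub>I :: "real \<Rightarrow> complex \<Rightarrow> real" where
  "V\<^sub>I h z = \<E> + h + \<mu> / norm z"

definition harmonic_force :: "complex \<Rightarrow> complex" where
  "harmonic_force z = - (\<omega>\<^sup>2 *\<^sub>R z)"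

definition kepler_force :: "complex \<Rightarrow> complex" where
  "kepler_force z = - ((\<mu> / norm z ^ 3) *\<^sub>R z)"

definition tangent :: "real \<Rightarrow> complex" where
  "tangent \<xi> = vector_derivative \<gamma> (at \<xi> within {0..L})"

text \<open>The orientation of \<open>\<gamma>\<close> is not prescribed, so the outward unit normal is singled out
  among the two unit normals by pointing out of \<open>D\<close>.\<close>
definition outward_normal :: "real \<Rightarrow> complex" where
  "outward_normal \<xi> = (THE n. norm n = 1 \<and> inner n (tangent \<xi>) = 0 \<and>
     (\<forall>\<^sub>F s in at_right 0. \<gamma> \<xi> + s *\<^sub>R n \<notin> closure D))"

definition outer_arc :: "complex \<Rightarrow> complex \<Rightarrow> real \<Rightarrow> (real \<Rightarrow> complex) \<Rightarrow> bool" where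
  "outer_arc p q T z \<longleftrightarrow> T > 0 \<and>
     (\<exists>v. newton_solution harmonic_force T z v \<and>
          (\<forall>s\<in>{0..T}. (norm (v s))\<^sup>2 / 2 = V\<^sub>E (z s))) \<and>
     (\<forall>s\<in>{0<..<T}. z s \<notin> D) \<and> z 0 = p \<and> z T = q"

definition outer_arc_property :: "real \<Rightarrow> real \<Rightarrow> bool" where
  "outer_arc_property a b \<longleftrightarrow>
     (\<forall>\<xi>\<^sub>1\<in>{a<..<b}. \<forall>\<xi>\<^sub>2\<in>{a<..<b}. unique_arc (outer_arc (\<gamma> \<xi>\<^sub>1) (\<gamma> \<xi>\<^sub>2)))"

definition S\<^sub>E :: "real \<Rightarrow> real \<Rightarrow> real" where
  "S\<^sub>E \<xi>\<^sub>1 \<xi>\<^sub>2 = (THE l. \<exists>T z. outer_arc (\<gamma> \<xi>\<^sub>1) (\<gamma> \<xi>\<^sub>2) T z \<and> l = jacobi_length V\<^sub>E T z)"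

definition antipodal :: "real \<Rightarrow> real \<Rightarrow> bool" where
  "antipodal \<xi>\<^sub>1 \<xi>\<^sub>2 \<longleftrightarrow> 0 \<in> closed_segment (\<gamma> \<xi>\<^sub>1) (\<gamma> \<xi>\<^sub>2)"

definition not_antipodal_sets :: "real set \<Rightarrow> real set \<Rightarrow> bool" where
  "not_antipodal_sets J K \<longleftrightarrow> (\<forall>\<xi>\<in>J. \<forall>\<eta>\<in>K. \<not> antipodal \<xi> \<eta>)"

text \<open>Parameters always lie in \<open>(0,L)\<close>, where \<open>\<gamma>\<close> is injective, so equal end points mean
  equal parameters. In that case the arc is the regularized collision-ejection trajectory, which
  runs through the origin along the radial segment.\<close>
definition inner_arc :: "real \<Rightarrow> complex \<Rightarrow> complex \<Rightarrow> real \<Rightarrow> (real \<Rightarrow> complex) \<Rightarrow> bool" where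
  "inner_arc h p q T z \<longleftrightarrow> T > 0 \<and>
     (if p = q
      then (\<exists>v. levi_civita_solution \<mu> (\<E> + h) T z v) \<and> z ` {0..T} = closed_segment 0 p
      else (\<exists>v. newton_solution kepler_force T z v \<and>
                (\<forall>s\<in>{0..T}. z s \<noteq> 0 \<and> (norm (v s))\<^sup>2 / 2 = V\<^sub>I h (z s))) \<and>
           topologically_nontrivial T z p q) \<and>
     (\<forall>s\<in>{0<..<T}. z s \<in> D) \<and> z 0 = p \<and> z T = q"

definition S\<^sub>I :: "real \<Rightarrow> real \<Rightarrow> real \<Rightarrow> real" where
  "S\<^sub>I h \<xi>\<^sub>1 \<xi>\<^sub>2 =
     (THE l. \<exists>T z. inner_arc h (\<gamma> \<xi>\<^sub>1) (\<gamma> \<xi>\<^sub>2) T z \<and> l = jacobi_length (V\<^sub>I h) T z)"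

definition NA :: "nat \<Rightarrow> (nat \<Rightarrow> real) \<Rightarrow> (nat \<Rightarrow> real) \<Rightarrow> nat \<Rightarrow> nat set" where
  "NA m a b i = {j \<in> {1..m}. not_antipodal_sets {a i<..<b i} {a j<..<b j}}"

definition inner_arc_property ::
  "nat \<Rightarrow> (nat \<Rightarrow> real) \<Rightarrow> (nat \<Rightarrow> real) \<Rightarrow> real \<Rightarrow> bool" where
  "inner_arc_property m a b h\<^sub>0 \<longleftrightarrow>
     m \<ge> 2 \<and>
     (\<forall>i\<in>{1..m}. 0 \<le> a i \<and> a i < b i \<and> b i \<le> L) \<and>
     disjoint_family_on (\<lambda>i. {a i<..<b i}) {1..m} \<and>
     (\<forall>i\<in>{1..m}. i \<in> NA m a b i \<and> (\<exists>j\<in>NA m a b i. j \<noteq> i)) \<and>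
     h\<^sub>0 > 0 \<and>
     (\<forall>i\<in>{1..m}. \<forall>j\<in>NA m a b i. \<forall>\<xi>\<^sub>1\<in>{a i<..<b i}. \<forall>\<xi>\<^sub>2\<in>{a j<..<b j}. \<forall>h>h\<^sub>0.
        unique_arc (inner_arc h (\<gamma> \<xi>\<^sub>1) (\<gamma> \<xi>\<^sub>2)))"

text \<open>The existence of the partial derivatives is part of the property, since the library
  operator \<open>deriv\<close> is total.\<close>
definition change_sign_property ::
  "nat \<Rightarrow> (nat \<Rightarrow> real) \<Rightarrow> (nat \<Rightarrow> real) \<Rightarrow> (nat \<Rightarrow> real) \<Rightarrow> (nat \<Rightarrow> real) \<Rightarrow> real \<Rightarrow> bool" where
  "change_sign_property m a b \<alpha> \<beta> h\<^sub>1 \<longleftrightarrow>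
     (\<forall>i\<in>{1..m}. a i < \<alpha> i \<and> \<alpha> i \<le> \<beta> i \<and> \<beta> i < b i) \<and>
     (\<forall>h>h\<^sub>1. \<forall>i\<in>{1..m}. \<forall>\<xi>\<^sub>E\<in>{\<alpha> i..\<beta> i}. \<forall>\<xi>\<^sub>I\<in>(\<Union>j\<in>NA m a b i. {\<alpha> j..\<beta> j}).
        (\<forall>\<zeta>\<in>{\<alpha> i, \<beta> i}. (\<lambda>x. S\<^sub>E \<xi>\<^sub>E x) differentiable (at \<zeta>) \<and>
                           (\<lambda>x. S\<^sub>I h x \<xi>\<^sub>I) differentiable (at \<zeta>)) \<and>
        (deriv (\<lambda>x. S\<^sub>E \<xi>\<^sub>E x) (\<alpha> i) + deriv (\<lambda>x. S\<^sub>I h x \<xi>\<^sub>I) (\<alpha> i)) *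
        (deriv (\<lambda>x. S\<^sub>E \<xi>\<^sub>E x) (\<beta> i) + deriv (\<lambda>x. S\<^sub>I h x \<xi>\<^sub>I) (\<beta> i)) < 0)"

text \<open>\<open>D\<close> is admissible if such intervals exist; the return map below is built from the chosen
  \<open>[\<alpha> i, \<beta> i]\<close>, so the intervals are kept as arguments.\<close>
definition admissible_with ::
  "nat \<Rightarrow> (nat \<Rightarrow> real) \<Rightarrow> (nat \<Rightarrow> real) \<Rightarrow> (nat \<Rightarrow> real) \<Rightarrow> (nat \<Rightarrow> real) \<Rightarrow> bool" where
  "admissible_with m a b \<alpha> \<beta> \<longleftrightarrow>
     (\<forall>i\<in>{1..m}. outer_arc_property (a i) (b i)) \<and>
     (\<exists>h\<^sub>0. inner_arc_property m a b h\<^sub>0 \<and>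
           (\<exists>h\<^sub>1\<ge>h\<^sub>0. change_sign_property m a b \<alpha> \<beta> h\<^sub>1))"

definition admissible :: bool where
  "admissible \<longleftrightarrow> (\<exists>m a b \<alpha> \<beta>. admissible_with m a b \<alpha> \<beta>)"

definition \<Xi>_plus :: "(nat \<Rightarrow> real) \<Rightarrow> (nat \<Rightarrow> real) \<Rightarrow> nat \<Rightarrow> (real \<times> complex) set" where
  "\<Xi>_plus \<alpha> \<beta> r = {(\<xi>, v). \<xi> \<in> {\<alpha> r..\<beta> r} \<and> (norm v)\<^sup>2 / 2 = V\<^sub>E (\<gamma> \<xi>) \<and>
                        inner (outward_normal \<xi>) v > 0}"

definition \<Xi>_minus :: "(nat \<Rightarrow> real) \<Rightarrow> (nat \<Rightarrow> real) \<Rightarrow> nat \<Rightarrow> (real \<times> complex) set" where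
  "\<Xi>_minus \<alpha> \<beta> r = {(\<xi>, v). \<xi> \<in> {\<alpha> r..\<beta> r} \<and> (norm v)\<^sup>2 / 2 = V\<^sub>E (\<gamma> \<xi>) \<and>
                         inner (outward_normal \<xi>) v < 0}"

definition refract :: "real \<Rightarrow> real \<Rightarrow> complex \<Rightarrow> complex" where
  "refract h \<xi> v =
     (let a = inner v (tangent \<xi>); b = inner v (outward_normal \<xi>)
      in a *\<^sub>R tangent \<xi> + (sgn b * sqrt (2 * V\<^sub>I h (\<gamma> \<xi>) - a\<^sup>2)) *\<^sub>R outward_normal \<xi>)"

definition outer_step :: "real \<times> complex \<Rightarrow> real \<times> complex \<Rightarrow> bool" where
  "outer_step = (\<lambda>(\<xi>, v) (\<xi>\<^sub>1, v\<^sub>1). \<exists>s\<^sub>1>0. \<exists>z u.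
     newton_solution harmonic_force s\<^sub>1 z u \<and> z 0 = \<gamma> \<xi> \<and> u 0 = v \<and>
     (\<forall>s\<in>{0<..<s\<^sub>1}. z s \<notin> closure D) \<and> z s\<^sub>1 = \<gamma> \<xi>\<^sub>1 \<and> u s\<^sub>1 = v\<^sub>1)"

definition inner_step :: "real \<Rightarrow> real \<times> complex \<Rightarrow> real \<times> complex \<Rightarrow> bool" where
  "inner_step h = (\<lambda>(\<xi>\<^sub>1, v\<^sub>1) (\<xi>\<^sub>2, v\<^sub>2). \<exists>s\<^sub>2>0. \<exists>z u.
     levi_civita_solution \<mu> (\<E> + h) s\<^sub>2 z u \<and> z 0 = \<gamma> \<xi>\<^sub>1 \<and> u 0 = refract h \<xi>\<^sub>1 v\<^sub>1 \<and>
     (\<forall>s\<in>{0<..<s\<^sub>2}. z s \<in> D) \<and> z s\<^sub>2 = \<gamma> \<xi>\<^sub>2 \<and> u s\<^sub>2 = refract h \<xi>\<^sub>2 v\<^sub>2)"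

text \<open>The graph of the partial map \<open>F\<close>.\<close>
definition return_rel :: "nat \<Rightarrow> (nat \<Rightarrow> real) \<Rightarrow> (nat \<Rightarrow> real) \<Rightarrow> (nat \<Rightarrow> real) \<Rightarrow> (nat \<Rightarrow> real) \<Rightarrow>
    real \<Rightarrow> ((real \<times> complex) \<times> (real \<times> complex)) set" where
  "return_rel m a b \<alpha> \<beta> h = {(x, y). \<exists>r\<in>{1..m}. \<exists>r'\<in>NA m a b r. \<exists>x\<^sub>1\<in>\<Xi>_minus \<alpha> \<beta> r.
     x \<in> \<Xi>_plus \<alpha> \<beta> r \<and> outer_step x x\<^sub>1 \<and> inner_step h x\<^sub>1 y \<and> y \<in> \<Xi>_plus \<alpha> \<beta> r'}"

text \<open>All iterates \<open>F^k\<close>, \<open>k\<close> an integer, are defined: for nonnegative \<open>k\<close> the point lies in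
  the domain of the partial map \<open>F^k\<close>, for negative \<open>k\<close> in the range of \<open>F^(-k)\<close>.\<close>
definition initial_set :: "nat \<Rightarrow> (nat \<Rightarrow> real) \<Rightarrow> (nat \<Rightarrow> real) \<Rightarrow> (nat \<Rightarrow> real) \<Rightarrow> (nat \<Rightarrow> real) \<Rightarrow>
    real \<Rightarrow> (real \<times> complex) set" where
  "initial_set m a b \<alpha> \<beta> h =
     (\<Inter>k::nat. Domain (return_rel m a b \<alpha> \<beta> h ^^ k) \<inter> Range (return_rel m a b \<alpha> \<beta> h ^^ k))"

definition return_map :: "nat \<Rightarrow> (nat \<Rightarrow> real) \<Rightarrow> (nat \<Rightarrow> real) \<Rightarrow> (nat \<Rightarrow> real) \<Rightarrow> (nat \<Rightarrow> real) \<Rightarrow>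
    real \<Rightarrow> real \<times> complex \<Rightarrow> real \<times> complex" where
  "return_map m a b \<alpha> \<beta> h x = (THE y. (x, y) \<in> return_rel m a b \<alpha> \<beta> h)"

definition return_iterate :: "nat \<Rightarrow> (nat \<Rightarrow> real) \<Rightarrow> (nat \<Rightarrow> real) \<Rightarrow> (nat \<Rightarrow> real) \<Rightarrow> (nat \<Rightarrow> real) \<Rightarrow>
    real \<Rightarrow> int \<Rightarrow> real \<times> complex \<Rightarrow> real \<times> complex" where
  "return_iterate m a b \<alpha> \<beta> h k =
     (if 0 \<le> k then return_map m a b \<alpha> \<beta> h ^^ nat k
      else inv_into (initial_set m a b \<alpha> \<beta> h) (return_map m a b \<alpha> \<beta> h) ^^ nat (- k))"

definition symbol :: "nat \<Rightarrow> (nat \<Rightarrow> real) \<Rightarrow> (nat \<Rightarrow> real) \<Rightarrow> real \<times> complex \<Rightarrow> nat" where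
  "symbol m \<alpha> \<beta> x = (THE r. r \<in> {1..m} \<and> fst x \<in> {\<alpha> r..\<beta> r})"

definition itinerary :: "nat \<Rightarrow> (nat \<Rightarrow> real) \<Rightarrow> (nat \<Rightarrow> real) \<Rightarrow> (nat \<Rightarrow> real) \<Rightarrow> (nat \<Rightarrow> real) \<Rightarrow>
    real \<Rightarrow> real \<times> complex \<Rightarrow> int \<Rightarrow> nat" where
  "itinerary m a b \<alpha> \<beta> h x = (\<lambda>j. symbol m \<alpha> \<beta> (return_iterate m a b \<alpha> \<beta> h j x))"

definition admissible_words :: "nat \<Rightarrow> (nat \<Rightarrow> real) \<Rightarrow> (nat \<Rightarrow> real) \<Rightarrow> (int \<Rightarrow> nat) set" where
  "admissible_words m a b = {l. \<forall>j. l j \<in> {1..m} \<and> l (j + 1) \<in> NA m a b (l j)}"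

end

definition word_dist :: "(int \<Rightarrow> nat) \<Rightarrow> (int \<Rightarrow> nat) \<Rightarrow> real" where
  "word_dist l l' = (\<Sum>\<^sub>\<infinity>k\<in>UNIV. (if l k = l' k then 0 else 1) / 4 ^ nat \<bar>k\<bar>)"

definition bernoulli_shift :: "(int \<Rightarrow> nat) \<Rightarrow> int \<Rightarrow> nat" where
  "bernoulli_shift l = (\<lambda>j. l (j + 1))"

end

theory Submission
  imports Defs
begin

text \<open>Between two crossings of the boundary a trajectory is an outer harmonic arc or an inner Kepler arc,
  and both are determined by their end points. By the first variation formula the partial derivatives of
  the Jacobi lengths are the tangential components of the end velocities, so Snell's law at a node joining an
  outer and an inner arc says that the total length is stationary there. The change-sign property is the
  hypothesis of a Poincare--Miranda theorem on the product of the intervals prescribed by a bi-infinite word,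
  which therefore carries a chain of arcs satisfying Snell's law at every node. The inner arc is
  nearly radial for large \<open>h\<close>, hence transversal to the boundary, and the chain is an orbit of the return map.
  Continuity of the itinerary follows by compactness: a limit of outer or inner steps must agree with the step
  of the limit point, since the exits are transversal, and time reversal gives the same for the inverse steps.\<close>

section \<open>Harmonic arcs over a radial sector\<close>

text \<open>The outer-arc property gives existence and uniqueness of arcs avoiding the open set
  \<open>D\<close>; such an arc may a priori touch the boundary, start tangentially or turn far
  around the origin. The first variation and the product argument need more: a formula continuous in
  the end points, a transversal start, and arcs off the closure of \<open>D\<close>. All this is
  extracted from uniqueness. The loop from a boundary point to itself and the collision-ejection arc
  make \<open>D\<close> star-shaped over each interval, so that being outside \<open>D\<close> is an
  inequality along rays. An arc over the interval is then encoded by one real slope, a root of a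
  quadratic given by the end points. The larger root always gives the arc, since otherwise
  connectedness would produce a target reached with both roots; strict inequalities come from
  comparison with a slightly farther target. For inner arcs the Levi-Civita equation is linear, and
  topological nontriviality becomes an obtuse angle between square roots of the end points. This
  gives closed formulas for the velocities, hence their continuity on whole cells and their
  direction at high energy.\<close>

definition wedge :: "complex \<Rightarrow> complex \<Rightarrow> real" where
  "wedge p q = Re p * Im q - Im p * Re q"

lemma wedge_simps [simp]:
  "wedge p p = 0" "wedge 0 q = 0" "wedge p 0 = 0"
  "wedge (r *\<^sub>R p) q = r * wedge p q" "wedge p (r *\<^sub>R q) = r * wedge p q"
  "wedge (- p) q = - wedge p q" "wedge p (- q) = - wedge p q"
  by (auto simp: wedge_def algebra_simps)

lemma wedge_add:
  "wedge (p + p') q = wedge p q + wedge p' q" "wedge p (q + q') = wedge p q + wedge p q'"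
  "wedge (p - p') q = wedge p q - wedge p' q" "wedge p (q - q') = wedge p q - wedge p q'"
  by (auto simp: wedge_def algebra_simps)

lemma wedge_commute: "wedge q p = - wedge p q"
  by (simp add: wedge_def)

lemma tendsto_wedge [tendsto_intros]:
  "(f \<longlongrightarrow> x) F \<Longrightarrow> (g \<longlongrightarrow> y) F \<Longrightarrow> ((\<lambda>z. wedge (f z) (g z)) \<longlongrightarrow> wedge x y) F"
  unfolding wedge_def by (intro tendsto_intros)

lemma continuous_on_wedge [continuous_intros]:
  "continuous_on S f \<Longrightarrow> continuous_on S g \<Longrightarrow> continuous_on S (\<lambda>z. wedge (f z) (g z))"
  unfolding wedge_def by (intro continuous_intros)

lemma inner_wedge_sq: "(inner p q)\<^sup>2 + (wedge p q)\<^sup>2 = (norm p)\<^sup>2 * (norm q)\<^sup>2"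
  unfolding wedge_def inner_complex_def cmod_power2 by algebra

lemma wedge_zeroE:
  assumes "wedge p z = 0" "p \<noteq> 0"
  obtains r where "z = r *\<^sub>R p"
proof
  have n: "(norm p)\<^sup>2 \<noteq> 0" using assms by simp
  have "(norm p)\<^sup>2 *\<^sub>R z = inner p z *\<^sub>R p"
    using assms(1) unfolding complex_eq_iff wedge_def inner_complex_def cmod_power2
    by (auto; algebra)
  then show "z = (inner p z / (norm p)\<^sup>2) *\<^sub>R p"
    using n by (metis (no_types, lifting) divide_inverse_commute real_vector.scale_left_imp_eq
        scaleR_scaleR nonzero_mult_div_cancel_left times_divide_eq_right)
qed

text \<open>For a free arc \<open>\<phi> \<mapsto> cos \<phi> p + sin \<phi> w\<close> leaving \<open>p\<close> with slope
  \<open>k = \<langle>p, w\<rangle> / (s wedge p w)\<close>, the form is nonpositive at \<open>q\<close> iff the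
  arc's ellipse crosses the ray of \<open>q\<close> at or above \<open>q\<close>.\<close>
definition slope_form :: "real \<Rightarrow> real \<Rightarrow> complex \<Rightarrow> real \<Rightarrow> complex \<Rightarrow> real" where
  "slope_form \<rho> s p k q = \<rho> * (k * (s * wedge p q))\<^sup>2
     - 2 * (\<rho> - (norm p)\<^sup>2) * inner p q * (k * (s * wedge p q))
     + (norm p)\<^sup>2 * (wedge p q)\<^sup>2 + (\<rho> - (norm p)\<^sup>2) * (inner p q)\<^sup>2
     - ((norm p)\<^sup>2)\<^sup>2 * (\<rho> - (norm p)\<^sup>2)"

text \<open>A quarter of the discriminant of the quadratic solved by the cosine of the travel angle
  from \<open>p\<close> to \<open>q\<close>; where it is negative, no arc of this energy joins the
  two points. The quadratic in the slope has the same discriminant up to a positive factor, see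
  \<open>slope_form_square\<close>.\<close>

definition arc_disc :: "real \<Rightarrow> complex \<Rightarrow> complex \<Rightarrow> real" where
  "arc_disc \<rho> p q = (inner p q)\<^sup>2 + \<rho>\<^sup>2 - \<rho> * ((norm p)\<^sup>2 + (norm q)\<^sup>2)"

text \<open>The larger root in \<open>k\<close> of \<open>slope_form\<close> when
  \<open>s * wedge p q > 0\<close> and \<rho> is positive. By \<open>slope_cos\<close> it belongs to
  the arc with the smaller cosine, the high lob; hence the names \<open>lob_cos\<close> and
  \<open>lob_vec\<close>.\<close>

definition slope_plus :: "real \<Rightarrow> real \<Rightarrow> complex \<Rightarrow> complex \<Rightarrow> real" where
  "slope_plus \<rho> s p q =
     ((\<rho> - (norm p)\<^sup>2) * inner p q + (norm p)\<^sup>2 * sqrt (arc_disc \<rho> p q)) / (\<rho> * (s * wedge p q))"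

definition slope_minus :: "real \<Rightarrow> real \<Rightarrow> complex \<Rightarrow> complex \<Rightarrow> real" where
  "slope_minus \<rho> s p q =
     ((\<rho> - (norm p)\<^sup>2) * inner p q - (norm p)\<^sup>2 * sqrt (arc_disc \<rho> p q)) / (\<rho> * (s * wedge p q))"

text \<open>Apart from its constant term the form is homogeneous of degree two in \<open>q\<close>.
  Along a ray from the origin its sign therefore changes at most once, which separates the points
  above the ellipse from those below.\<close>

lemma slope_form_scale:
  "slope_form \<rho> s p k (r *\<^sub>R q) + ((norm p)\<^sup>2)\<^sup>2 * (\<rho> - (norm p)\<^sup>2) =
     r\<^sup>2 * (slope_form \<rho> s p k q + ((norm p)\<^sup>2)\<^sup>2 * (\<rho> - (norm p)\<^sup>2))"
  unfolding slope_form_def by (simp add: algebra_simps power2_eq_square)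

lemma slope_form_square:
  "\<rho> * slope_form \<rho> s p k q =
    (\<rho> * (k * (s * wedge p q)) - (\<rho> - (norm p)\<^sup>2) * inner p q)\<^sup>2 - ((norm p)\<^sup>2)\<^sup>2 * arc_disc \<rho> p q"
proof -
  have L: "(norm p)\<^sup>2 * (norm q)\<^sup>2 = (inner p q)\<^sup>2 + (wedge p q)\<^sup>2"
    by (simp add: inner_wedge_sq)
  have *: "((norm p)\<^sup>2)\<^sup>2 * arc_disc \<rho> p q =
     (norm p)\<^sup>2 * ((norm p)\<^sup>2 * ((inner p q)\<^sup>2 + \<rho>\<^sup>2 - \<rho> * (norm p)\<^sup>2) - \<rho> * ((inner p q)\<^sup>2 + (wedge p q)\<^sup>2))"
    unfolding arc_disc_def L[symmetric] by (simp add: algebra_simps power2_eq_square)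
  have gen: "\<rho> * (\<rho> * kZ\<^sup>2 - 2 * (\<rho> - P) * X * kZ + P * Y + (\<rho> - P) * X\<^sup>2 - P\<^sup>2 * (\<rho> - P)) =
    (\<rho> * kZ - (\<rho> - P) * X)\<^sup>2 - P * (P * (X\<^sup>2 + \<rho>\<^sup>2 - \<rho> * P) - \<rho> * (X\<^sup>2 + Y))" for kZ P X Y :: real
    by (simp add: algebra_simps power2_eq_square)
  show ?thesis
    unfolding * slope_form_def by (rule gen)
qed

lemma slope_form_nonpos_iff:
  assumes "s * s = 1" "\<rho> > 0" "s * wedge p q > 0" "p \<noteq> 0"
  shows "slope_form \<rho> s p k q \<le> 0 \<longleftrightarrow>
     0 \<le> arc_disc \<rho> p q \<and> slope_minus \<rho> s p q \<le> k \<and> k \<le> slope_plus \<rho> s p q" (is ?A)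
    and "slope_form \<rho> s p k q = 0 \<longleftrightarrow>
     0 \<le> arc_disc \<rho> p q \<and> (k = slope_minus \<rho> s p q \<or> k = slope_plus \<rho> s p q)" (is ?B)
    and "slope_form \<rho> s p k q < 0 \<longleftrightarrow>
     0 \<le> arc_disc \<rho> p q \<and> slope_minus \<rho> s p q < k \<and> k < slope_plus \<rho> s p q" (is ?C)
proof -
  define P where "P = (norm p)\<^sup>2"
  define u where "u = \<rho> * (k * (s * wedge p q)) - (\<rho> - P) * inner p q"
  define d where "d = arc_disc \<rho> p q"
  have P: "P > 0" using assms by (simp add: P_def)
  have sq: "\<rho> * slope_form \<rho> s p k q = u\<^sup>2 - P\<^sup>2 * d"
    unfolding u_def P_def d_def by (rule slope_form_square)
  have eq: "slope_form \<rho> s p k q = (u\<^sup>2 - P\<^sup>2 * d) / \<rho>" using sq assms by (simp add: field_simps)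
  have A1: "slope_form \<rho> s p k q \<le> 0 \<longleftrightarrow> u\<^sup>2 \<le> P\<^sup>2 * d" 
    and A2: "slope_form \<rho> s p k q = 0 \<longleftrightarrow> u\<^sup>2 = P\<^sup>2 * d"
    and A3: "slope_form \<rho> s p k q < 0 \<longleftrightarrow> u\<^sup>2 < P\<^sup>2 * d"
    unfolding eq using assms by (auto simp: field_simps)
  have pos: "\<rho> * (s * wedge p q) > 0" using assms by simp
  have km: "slope_minus \<rho> s p q \<le> k \<longleftrightarrow> - (P * sqrt d) \<le> u" "slope_minus \<rho> s p q < k \<longleftrightarrow> - (P * sqrt d) < u"
     "k = slope_minus \<rho> s p q \<longleftrightarrow> u = - (P * sqrt d)"
    unfolding slope_minus_def u_def P_def[symmetric] d_def
    using pos by (auto simp: divide_le_eq divide_less_eq eq_divide_eq algebra_simps)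
  have kp: "k \<le> slope_plus \<rho> s p q \<longleftrightarrow> u \<le> P * sqrt d" "k < slope_plus \<rho> s p q \<longleftrightarrow> u < P * sqrt d"
     "k = slope_plus \<rho> s p q \<longleftrightarrow> u = P * sqrt d"
    unfolding slope_plus_def u_def P_def[symmetric] d_def
    using pos by (auto simp: le_divide_eq less_divide_eq eq_divide_eq algebra_simps)
  have dn: "u\<^sup>2 \<le> P\<^sup>2 * d \<Longrightarrow> d \<ge> 0"
  proof -
    assume "u\<^sup>2 \<le> P\<^sup>2 * d"
    then have "0 \<le> P\<^sup>2 * d" by (smt (verit) zero_le_power2)
    then show ?thesis using P by (simp add: zero_le_mult_iff)
  qed
  have Pd: "d \<ge> 0 \<Longrightarrow> P\<^sup>2 * d = (P * sqrt d)\<^sup>2" by (simp add: power_mult_distrib)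
  have Pn: "d \<ge> 0 \<Longrightarrow> P * sqrt d \<ge> 0" using P by simp
  show ?A unfolding A1 km kp d_def[symmetric]
    using dn Pd Pn by (metis abs_le_iff abs_le_square_iff abs_of_nonneg minus_le_iff)
  show ?B unfolding A2 km kp d_def[symmetric]
    using dn Pd Pn by (metis order_refl power2_eq_iff)
  have "u\<^sup>2 < P\<^sup>2 * d \<longleftrightarrow> \<bar>u\<bar> < P * sqrt d" if "d \<ge> 0"
    unfolding Pd[OF that] using Pn[OF that] abs_le_square_iff[of "P * sqrt d" u] by auto
  moreover have "d \<ge> 0" if "u\<^sup>2 < P\<^sup>2 * d" using dn that by simp
  ultimately show ?C unfolding A3 km kp d_def[symmetric] by (auto simp: abs_less_iff)
qed

text \<open>Vieta: the sum of the two roots in \<open>k\<close> is explicit, so a known root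
  \<open>\<kappa>\<close> determines the other one.\<close>

lemma slope_form_factor:
  assumes "s * s = 1" "\<rho> \<noteq> 0" "s * wedge p q \<noteq> 0" "slope_form \<rho> s p \<kappa> q = 0"
  shows "slope_form \<rho> s p k q = \<rho> * (s * wedge p q)\<^sup>2 * (k - \<kappa>) *
     (k - (2 * (\<rho> - (norm p)\<^sup>2) * inner p q / (\<rho> * (s * wedge p q)) - \<kappa>))"
proof -
  define Y where "Y = s * wedge p q"
  define S where "S = \<rho> - (norm p)\<^sup>2"
  have Y: "Y \<noteq> 0" using assms by (simp add: Y_def)
  have d: "slope_form \<rho> s p k q - slope_form \<rho> s p \<kappa> q =
     \<rho> * (k * Y)\<^sup>2 - \<rho> * (\<kappa> * Y)\<^sup>2 - 2 * S * inner p q * (k * Y - \<kappa> * Y)" for k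
    by (simp add: slope_form_def Y_def[symmetric] S_def[symmetric] algebra_simps)
  have "\<rho> * Y\<^sup>2 * (k - \<kappa>) * (k - (2 * S * inner p q / (\<rho> * Y) - \<kappa>)) =
     Y * (k - \<kappa>) * (\<rho> * Y * (k - (2 * S * inner p q / (\<rho> * Y) - \<kappa>)))"
    by (simp add: power2_eq_square)
  also have "\<rho> * Y * (k - (2 * S * inner p q / (\<rho> * Y) - \<kappa>)) = \<rho> * Y * (k + \<kappa>) - 2 * S * inner p q"
    using Y assms(2) by (simp add: field_simps)
  also have "Y * (k - \<kappa>) * (\<rho> * Y * (k + \<kappa>) - 2 * S * inner p q) =
      \<rho> * (k * Y)\<^sup>2 - \<rho> * (\<kappa> * Y)\<^sup>2 - 2 * S * inner p q * (k * Y - \<kappa> * Y)"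
    by (simp add: algebra_simps power2_eq_square)
  finally show ?thesis using d[of k] assms(4) unfolding Y_def S_def by linarith
qed

text \<open>In the coordinates \<open>c\<close>, \<open>d\<close> along \<open>p\<close> and
  \<open>w\<close> the form is a multiple of c^2 + d^2 - 1, because inner^2 + wedge^2 of
  \<open>p\<close> and \<open>w\<close> equals |p|^2 |w|^2 and the energy fixes |w|.\<close>

lemma slope_form_on_arc:
  assumes "s * s = 1" "(norm w)\<^sup>2 = \<rho> - (norm p)\<^sup>2" "c\<^sup>2 + d\<^sup>2 = 1" "s * wedge p w \<noteq> 0"
    and k: "k = inner p w / (s * wedge p w)"
  shows "slope_form \<rho> s p k (c *\<^sub>R p + d *\<^sub>R w) = 0"
proof -
  define P where "P = (norm p)\<^sup>2"
  define j where "j = inner p w"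
  define g where "g = wedge p w"
  have jg: "j\<^sup>2 + g\<^sup>2 = P * (\<rho> - P)"
    using inner_wedge_sq[of p w] assms(2) by (simp add: j_def g_def P_def)
  have X: "inner p (c *\<^sub>R p + d *\<^sub>R w) = c * P + d * j"
    by (simp add: inner_add_right P_def j_def power2_norm_eq_inner)
  have Y: "wedge p (c *\<^sub>R p + d *\<^sub>R w) = d * g"
    by (simp add: wedge_add g_def)
  have kY: "k * (s * (d * g)) = d * j"
    using assms(4) unfolding k j_def g_def by (simp add: field_simps)
  show ?thesis
    unfolding slope_form_def X Y kY P_def[symmetric] using jg assms(3) by algebra
qed

text \<open>The slope fixes the direction of the initial velocity, that of
  \<open>Complex k s * p\<close>, and the energy its length. In the basis \<open>p\<close>,
  \<open>w\<close> the point \<open>q\<close> has coordinates \<open>c\<close>, \<open>d\<close>;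
  vanishing of the form means c^2 + d^2 = 1, and the orientation makes \<open>d\<close> positive, so
  the angle lies strictly between 0 and \<open>pi\<close>.\<close>

lemma arc_of_slope:
  assumes s: "s * s = 1" and p: "p \<noteq> 0" "(norm p)\<^sup>2 < \<rho>" and Y: "s * wedge p q > 0"
    and M: "slope_form \<rho> s p k q = 0"
  obtains \<theta> w where "w = sqrt ((\<rho> - (norm p)\<^sup>2) / ((norm p)\<^sup>2 * (1 + k\<^sup>2))) *\<^sub>R (Complex k s * p)"
    "0 < \<theta>" "\<theta> < pi" "(norm w)\<^sup>2 = \<rho> - (norm p)\<^sup>2" "cos \<theta> *\<^sub>R p + sin \<theta> *\<^sub>R w = q"
    "s * wedge p w > 0" "k = inner p w / (s * wedge p w)"
proof -
  define P where "P = (norm p)\<^sup>2"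
  define S where "S = \<rho> - P"
  define X where "X = inner p q"
  define Z where "Z = s * wedge p q"
  have P: "P > 0" and S: "S > 0" using p by (auto simp: P_def S_def)
  define c where "c = (X - k * Z) / P"
  define r where "r = sqrt (S / (P * (1 + k\<^sup>2)))"
  define w where "w = r *\<^sub>R (Complex k s * p)"
  define d where "d = Z / (P * r)"
  have k1: "1 + k\<^sup>2 > 0" by (smt (verit) zero_le_power2)
  have r: "r > 0" "r\<^sup>2 = S / (P * (1 + k\<^sup>2))" using P S k1 by (auto simp: r_def)
  have Zc: "Z\<^sup>2 = (wedge p q)\<^sup>2" using s by (simp add: Z_def power_mult_distrib power2_eq_square)
  have M': "\<rho> * (k * Z)\<^sup>2 - 2 * S * X * (k * Z) + P * Z\<^sup>2 + S * X\<^sup>2 - P\<^sup>2 * S = 0"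
    using M Zc unfolding slope_form_def X_def Z_def S_def P_def by simp
  have cd: "c\<^sup>2 + d\<^sup>2 = 1"
  proof -
    have "d\<^sup>2 = Z\<^sup>2 * (1 + k\<^sup>2) / (P * S)"
      unfolding d_def power_divide power_mult_distrib r(2) using P S k1 by (simp add: field_simps power2_eq_square)
    then have "(c\<^sup>2 + d\<^sup>2) * (P\<^sup>2 * S) = (X - k * Z)\<^sup>2 * S + P * (Z\<^sup>2 * (1 + k\<^sup>2))"
      unfolding c_def using P S by (simp add: field_simps power2_eq_square)
    also have "\<dots> = \<rho> * (k * Z)\<^sup>2 - 2 * S * X * (k * Z) + P * Z\<^sup>2 + S * X\<^sup>2"
      by (simp add: S_def algebra_simps power2_eq_square)
    also have "\<dots> = P\<^sup>2 * S"
      using M' by simp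
    finally show ?thesis using P S by simp
  qed
  have d: "d > 0" using Y P r by (simp add: d_def Z_def)
  have c: "- 1 < c" "c < 1"
  proof -
    have "c\<^sup>2 < 1" using cd d zero_less_power[of d 2] by linarith
    then have "\<bar>c\<bar> < 1" by (simp add: abs_square_less_1)
    then show "- 1 < c" "c < 1" by auto
  qed
  define \<theta> where "\<theta> = arccos c"
  have cos: "cos \<theta> = c" and th: "0 < \<theta>" "\<theta> < pi"
    using c arccos_lt_bounded[of c] by (auto simp: \<theta>_def)
  have sin: "sin \<theta> = d"
  proof -
    have "sin \<theta> > 0" using th by (simp add: sin_gt_zero)
    moreover have "(sin \<theta>)\<^sup>2 = d\<^sup>2" using cd cos sin_cos_squared_add[of \<theta>] by simp
    ultimately show ?thesis using d by (simp add: power2_eq_iff)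
  qed
  have s2: "s\<^sup>2 = 1" using s by (simp add: power2_eq_square)
  have nw: "(norm w)\<^sup>2 = S"
  proof -
    have "(norm w)\<^sup>2 = r\<^sup>2 * ((k\<^sup>2 + s\<^sup>2) * P)"
      by (simp add: w_def norm_mult power_mult_distrib P_def cmod_power2)
    also have "\<dots> = S * (P * (1 + k\<^sup>2)) / (P * (1 + k\<^sup>2))"
      unfolding r(2) s2 by (simp add: ac_simps)
    also have "\<dots> = S" using P k1 by simp
    finally show ?thesis .
  qed
  have crw: "wedge p w = r * (s * P)" and inw: "inner p w = r * (k * P)"
    unfolding P_def cmod_power2
    by (auto simp: w_def wedge_def inner_complex_def algebra_simps power2_eq_square)
  have Pq: "P *\<^sub>R q = X *\<^sub>R p + Z *\<^sub>R (Complex 0 s * p)"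
  proof -
    have Zs: "Z * s = wedge p q" using s by (simp add: Z_def mult.commute mult.left_commute)
    have "Z *\<^sub>R (Complex 0 s * p) = (Z * s) *\<^sub>R (\<i> * p)" by (simp add: complex_eq_iff)
    then show ?thesis
      unfolding Zs P_def X_def cmod_power2
      by (simp add: complex_eq_iff wedge_def inner_complex_def algebra_simps power2_eq_square)
  qed
  have "P *\<^sub>R (c *\<^sub>R p + d *\<^sub>R w) = (X - k * Z) *\<^sub>R p + Z *\<^sub>R (Complex k s * p)"
    using P r(1) by (simp add: c_def d_def w_def scaleR_add_right)
  also have "\<dots> = P *\<^sub>R q" unfolding Pq complex_eq_iff by (simp add: algebra_simps)
  finally have q: "c *\<^sub>R p + d *\<^sub>R w = q" using P by simp
  have crw': "s * wedge p w = r * P" unfolding crw using s by (metis mult.assoc mult.commute mult.left_neutral)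
  show ?thesis
  proof (rule that[of w \<theta>])
    show "w = sqrt ((\<rho> - (norm p)\<^sup>2) / ((norm p)\<^sup>2 * (1 + k\<^sup>2))) *\<^sub>R (Complex k s * p)"
      unfolding w_def r_def S_def P_def ..
    show "(norm w)\<^sup>2 = \<rho> - (norm p)\<^sup>2" using nw by (simp only: S_def P_def)
    show "cos \<theta> *\<^sub>R p + sin \<theta> *\<^sub>R w = q" unfolding cos sin by (rule q)
    show "s * wedge p w > 0" unfolding crw' using r P by simp
    show "k = inner p w / (s * wedge p w)" unfolding crw' inw using r P by simp
  qed (use th in auto)
qed

section \<open>Slopes of arcs over a sector seen from the origin\<close>

definition free_arc :: "complex set \<Rightarrow> real \<Rightarrow> complex \<Rightarrow> complex \<Rightarrow> real \<Rightarrow> complex \<Rightarrow> bool" where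
  "free_arc D \<rho> p q \<theta> w \<longleftrightarrow> 0 < \<theta> \<and> \<theta> < pi \<and> (norm w)\<^sup>2 = \<rho> - (norm p)\<^sup>2 \<and>
     cos \<theta> *\<^sub>R p + sin \<theta> *\<^sub>R w = q \<and> (\<forall>\<phi>\<in>{0<..<\<theta>}. cos \<phi> *\<^sub>R p + sin \<phi> *\<^sub>R w \<notin> D)"

text \<open>In \<open>free_arc\<close> time is an angle, \<omega> times the physical time, and
  \<open>w\<close> is the initial velocity divided by \<omega>. Uniqueness is assumed for the travel
  angle only: together with the end points it determines the slope (\<open>slope_cos\<close>). The
  sign \<open>s\<close> is a parameter so that the interval run backwards is again an
  instance.\<close>

locale arc_sector =
  fixes \<rho> s a b :: real and \<gamma> :: "real \<Rightarrow> complex" and D :: "complex set"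
  assumes s: "s * s = 1" and cont: "continuous_on {a<..<b} \<gamma>"
    and orient: "\<And>\<xi> \<eta>. a < \<xi> \<Longrightarrow> \<xi> < \<eta> \<Longrightarrow> \<eta> < b \<Longrightarrow> s * wedge (\<gamma> \<xi>) (\<gamma> \<eta>) > 0"
    and nz: "\<And>\<xi>. a < \<xi> \<Longrightarrow> \<xi> < b \<Longrightarrow> \<gamma> \<xi> \<noteq> 0"
    and bounded: "\<And>\<xi>. a < \<xi> \<Longrightarrow> \<xi> < b \<Longrightarrow> (norm (\<gamma> \<xi>))\<^sup>2 < \<rho>"
    and radial: "\<And>\<xi> r. a < \<xi> \<Longrightarrow> \<xi> < b \<Longrightarrow> 0 \<le> r \<Longrightarrow> r *\<^sub>R \<gamma> \<xi> \<in> D \<longleftrightarrow> r < 1"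
    and arc_ex: "\<And>\<xi> \<eta>. a < \<xi> \<Longrightarrow> \<xi> < b \<Longrightarrow> a < \<eta> \<Longrightarrow> \<eta> < b \<Longrightarrow> \<xi> \<noteq> \<eta> \<Longrightarrow>
        \<exists>\<theta> w. free_arc D \<rho> (\<gamma> \<xi>) (\<gamma> \<eta>) \<theta> w"
    and arc_uniq: "\<And>\<xi> \<eta> \<theta> w \<theta>' w'. a < \<xi> \<Longrightarrow> \<xi> < b \<Longrightarrow> a < \<eta> \<Longrightarrow> \<eta> < b \<Longrightarrow> \<xi> \<noteq> \<eta> \<Longrightarrow>
        free_arc D \<rho> (\<gamma> \<xi>) (\<gamma> \<eta>) \<theta> w \<Longrightarrow> free_arc D \<rho> (\<gamma> \<xi>) (\<gamma> \<eta>) \<theta>' w' \<Longrightarrow> \<theta> = \<theta>'"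
begin

text \<open>Reversing the parameter flips the orientation sign. Everything below is proved for
  increasing parameters; decreasing ones are reached through this instance.\<close>

lemma mirror: "arc_sector \<rho> (- s) (- b) (- a) (\<lambda>x. \<gamma> (- x)) D"
proof
  show "- s * - s = 1" using s by simp
  show "continuous_on {- b<..<- a} (\<lambda>x. \<gamma> (- x))"
    by (intro continuous_on_compose2[OF cont] continuous_intros) auto
  fix \<xi> \<eta> assume "- b < \<xi>" "\<xi> < \<eta>" "\<eta> < - a"
  then have "s * wedge (\<gamma> (- \<eta>)) (\<gamma> (- \<xi>)) > 0" by (intro orient) auto
  then show "- s * wedge (\<gamma> (- \<xi>)) (\<gamma> (- \<eta>)) > 0"
    using wedge_commute[of "\<gamma> (- \<eta>)" "\<gamma> (- \<xi>)"] by simp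
next
  fix \<xi> assume A: "- b < \<xi>" "\<xi> < - a"
  then have A': "a < - \<xi>" "- \<xi> < b" by auto
  show "\<gamma> (- \<xi>) \<noteq> 0" "(norm (\<gamma> (- \<xi>)))\<^sup>2 < \<rho>" using nz[OF A'] bounded[OF A'] by auto
  show "r *\<^sub>R \<gamma> (- \<xi>) \<in> D \<longleftrightarrow> r < 1" if "0 \<le> r" for r using radial[OF A' that] .
  fix \<eta> assume B: "- b < \<eta>" "\<eta> < - a" "\<xi> \<noteq> \<eta>"
  then have B': "a < - \<eta>" "- \<eta> < b" "- \<xi> \<noteq> - \<eta>" by auto
  show "\<exists>\<theta> w. free_arc D \<rho> (\<gamma> (- \<xi>)) (\<gamma> (- \<eta>)) \<theta> w" using arc_ex[OF A' B'] .
  show "free_arc D \<rho> (\<gamma> (- \<xi>)) (\<gamma> (- \<eta>)) \<theta> w \<Longrightarrow> free_arc D \<rho> (\<gamma> (- \<xi>)) (\<gamma> (- \<eta>)) \<theta>' w' \<Longrightarrow> \<theta> = \<theta>'"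
    for \<theta> w \<theta>' w' using arc_uniq[OF A' B'] .
qed

lemma rho_pos: "a < \<xi> \<Longrightarrow> \<xi> < b \<Longrightarrow> \<rho> > 0"
  using bounded[of \<xi>] zero_le_power2[of "norm (\<gamma> \<xi>)"] by linarith

text \<open>The wedge of the curve with \<open>z\<close> changes sign between the two parameters, so
  some curve point lies on the line through \<open>z\<close>; the orientation excludes the opposite
  ray.\<close>

lemma ray_between:
  assumes "a < \<xi>" "\<xi> < \<eta>" "\<eta> < b" "s * wedge (\<gamma> \<xi>) z > 0" "s * wedge z (\<gamma> \<eta>) > 0"
  obtains \<zeta> r where "\<xi> < \<zeta>" "\<zeta> < \<eta>" "r > 0" "z = r *\<^sub>R \<gamma> \<zeta>"
proof -
  define h where "h \<zeta> = s * wedge (\<gamma> \<zeta>) z" for \<zeta>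
  have c: "continuous_on {\<xi>..\<eta>} h" unfolding h_def
    by (intro continuous_intros continuous_on_subset[OF cont]) (use assms in auto)
  have e: "h \<eta> < 0" using assms(5) wedge_commute[of z "\<gamma> \<eta>"] by (simp add: h_def)
  have "\<exists>\<zeta>\<ge>\<xi>. \<zeta> \<le> \<eta> \<and> h \<zeta> = 0"
    using IVT2'[of h \<eta> 0 \<xi>] c e assms by (auto simp: h_def)
  then obtain \<zeta> where z: "\<xi> \<le> \<zeta>" "\<zeta> \<le> \<eta>" "h \<zeta> = 0" by blast
  then have "\<zeta> \<noteq> \<xi>" "\<zeta> \<noteq> \<eta>" using e assms by (auto simp: h_def)
  then have z': "\<xi> < \<zeta>" "\<zeta> < \<eta>" using z by auto
  have "s \<noteq> 0" using s by auto
  then have "wedge (\<gamma> \<zeta>) z = 0" using z by (simp add: h_def)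
  then obtain r where r: "z = r *\<^sub>R \<gamma> \<zeta>" using nz[of \<zeta>] z' assms wedge_zeroE by (metis less_trans)
  have "s * wedge (\<gamma> \<xi>) (\<gamma> \<zeta>) > 0" using orient[of \<xi> \<zeta>] z' assms by auto
  moreover have "r * (s * wedge (\<gamma> \<xi>) (\<gamma> \<zeta>)) > 0" using assms(4) unfolding r by (simp add: mult.left_commute)
  ultimately have "r > 0" by (rule zero_less_mult_pos2[rotated])
  then show ?thesis using that z' r by blast
qed

text \<open>The condition that the arc avoids \<open>D\<close>, rewritten for the slope alone: on
  every intermediate ray the ellipse passes at or above the boundary point. Arc and travel angle
  disappear from the comparisons that follow.\<close>

definition valid_slope :: "real \<Rightarrow> real \<Rightarrow> real \<Rightarrow> bool" where
  "valid_slope k \<xi> \<eta> \<longleftrightarrow> slope_form \<rho> s (\<gamma> \<xi>) k (\<gamma> \<eta>) = 0 \<and>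
     (\<forall>\<zeta>\<in>{\<xi><..<\<eta>}. slope_form \<rho> s (\<gamma> \<xi>) k (\<gamma> \<zeta>) \<le> 0)"

text \<open>Curve and arc both meet every intermediate ray. On a ray, membership in \<open>D\<close>
  is a comparison of radii by \<open>radial\<close>, and \<open>slope_form_scale\<close> turns this
  comparison into the sign of the form at the boundary point; this is \<open>key\<close>.\<close>

lemma valid_slope_iff_free:
  assumes \<xi>: "a < \<xi>" "\<xi> < \<eta>" "\<eta> < b"
    and th: "0 < \<theta>" "\<theta> < pi" and w: "(norm w)\<^sup>2 = \<rho> - (norm (\<gamma> \<xi>))\<^sup>2"
    and q: "cos \<theta> *\<^sub>R \<gamma> \<xi> + sin \<theta> *\<^sub>R w = \<gamma> \<eta>"
  shows "s * wedge (\<gamma> \<xi>) w > 0"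
    and "valid_slope (inner (\<gamma> \<xi>) w / (s * wedge (\<gamma> \<xi>) w)) \<xi> \<eta> \<longleftrightarrow> free_arc D \<rho> (\<gamma> \<xi>) (\<gamma> \<eta>) \<theta> w"
proof -
  define p where "p = \<gamma> \<xi>"
  define z where "z \<phi> = cos \<phi> *\<^sub>R p + sin \<phi> *\<^sub>R w" for \<phi>
  define k where "k = inner p w / (s * wedge p w)"
  have sin: "sin \<theta> > 0" using th by (simp add: sin_gt_zero)
  have q': "z \<theta> = \<gamma> \<eta>" using q by (simp add: z_def p_def)
  have wz: "wedge p (z \<phi>) = sin \<phi> * wedge p w" for \<phi> by (simp add: z_def wedge_add)
  have wzs: "s * wedge (\<gamma> \<xi>) (z \<phi>) = sin \<phi> * (s * wedge (\<gamma> \<xi>) w)" for \<phi>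
    using wz[of \<phi>] by (simp add: p_def)
  have "sin \<theta> * (s * wedge p w) > 0"
    using orient[OF \<xi>] wz[of \<theta>] q' by (simp add: p_def mult.left_commute)
  then show W: "s * wedge (\<gamma> \<xi>) w > 0" using sin zero_less_mult_pos unfolding p_def by blast
  have M0: "slope_form \<rho> s p k (z \<phi>) = 0" for \<phi>
    unfolding z_def by (rule slope_form_on_arc) (use s w W in \<open>auto simp: p_def k_def\<close>)
  have P: "((norm p)\<^sup>2)\<^sup>2 * (\<rho> - (norm p)\<^sup>2) > 0"
    using nz[of \<xi>] bounded[of \<xi>] \<xi> by (auto simp: p_def)
  have key: "z \<phi> \<in> D \<longleftrightarrow> slope_form \<rho> s p k (\<gamma> \<zeta>) > 0"
    if "r > 0" "z \<phi> = r *\<^sub>R \<gamma> \<zeta>" "\<xi> < \<zeta>" "\<zeta> < \<eta>" for r \<phi> \<zeta>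
  proof -
    define A where "A = ((norm p)\<^sup>2)\<^sup>2 * (\<rho> - (norm p)\<^sup>2)"
    define B where "B = slope_form \<rho> s p k (\<gamma> \<zeta>)"
    have e: "A = r\<^sup>2 * (B + A)"
      using slope_form_scale[of \<rho> s p k r "\<gamma> \<zeta>"] M0[of \<phi>] that(2) by (simp add: A_def B_def)
    have A: "A > 0" using P by (simp add: A_def)
    have "r < 1 \<longleftrightarrow> B > 0"
    proof
      assume "r < 1"
      then have "r\<^sup>2 < 1" using that(1) by (simp add: abs_square_less_1)
      have "r\<^sup>2 * (B + A) > 0" using e A by simp
      then have "B + A > 0" by (rule zero_less_mult_pos) (use that(1) in simp)
      then have "r\<^sup>2 * (B + A) < B + A" using \<open>r\<^sup>2 < 1\<close> by simp
      then show "B > 0" using e by linarith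
    next
      assume "B > 0"
      show "r < 1"
      proof (rule ccontr)
        assume "\<not> r < 1"
        then have "1 \<le> r\<^sup>2" by simp
        then have "B + A \<le> r\<^sup>2 * (B + A)" using \<open>B > 0\<close> A by simp
        then show False using e \<open>B > 0\<close> by linarith
      qed
    qed
    then show ?thesis using radial[of \<zeta> r] that \<xi> by (simp add: B_def)
  qed
  have wq: "s * wedge (z \<phi>) (\<gamma> \<eta>) = sin (\<theta> - \<phi>) * (s * wedge p w)" for \<phi>
    unfolding q'[symmetric] z_def
    by (simp add: wedge_add wedge_commute[of w p] sin_diff algebra_simps)
  show "valid_slope (inner (\<gamma> \<xi>) w / (s * wedge (\<gamma> \<xi>) w)) \<xi> \<eta> \<longleftrightarrow> free_arc D \<rho> (\<gamma> \<xi>) (\<gamma> \<eta>) \<theta> w"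
  proof
    assume v: "valid_slope (inner (\<gamma> \<xi>) w / (s * wedge (\<gamma> \<xi>) w)) \<xi> \<eta>"
    have "z \<phi> \<notin> D" if \<phi>: "\<phi> \<in> {0<..<\<theta>}" for \<phi>
    proof -
      have "sin \<phi> > 0" "sin (\<theta> - \<phi>) > 0" using \<phi> th by (auto intro!: sin_gt_zero)
      then have "s * wedge (\<gamma> \<xi>) (z \<phi>) > 0" "s * wedge (z \<phi>) (\<gamma> \<eta>) > 0"
        unfolding wzs wq p_def using W by (auto intro: mult_pos_pos)
      then obtain \<zeta> r where "\<xi> < \<zeta>" "\<zeta> < \<eta>" "r > 0" "z \<phi> = r *\<^sub>R \<gamma> \<zeta>"
        using ray_between[OF \<xi>] by blast
      then show ?thesis using key[of r \<phi> \<zeta>] v by (auto simp: valid_slope_def k_def p_def not_less)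
    qed
    then show "free_arc D \<rho> (\<gamma> \<xi>) (\<gamma> \<eta>) \<theta> w"
      using th w q by (auto simp: free_arc_def z_def p_def)
  next
    assume f: "free_arc D \<rho> (\<gamma> \<xi>) (\<gamma> \<eta>) \<theta> w"
    have "slope_form \<rho> s p k (\<gamma> \<zeta>) \<le> 0" if \<zeta>: "\<zeta> \<in> {\<xi><..<\<eta>}" for \<zeta>
    proof -
      \<comment> \<open>Conversely, each boundary point has to be matched with a time at which the
        arc crosses its ray; this time is a zero of \<open>h\<close>.\<close>
      define h where "h \<phi> = s * wedge (z \<phi>) (\<gamma> \<zeta>)" for \<phi>
      have o1: "s * wedge (\<gamma> \<xi>) (\<gamma> \<zeta>) > 0" and o2: "s * wedge (\<gamma> \<zeta>) (\<gamma> \<eta>) > 0"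
        using orient[of \<xi> \<zeta>] orient[of \<zeta> \<eta>] \<zeta> \<xi> by auto
      have c: "continuous_on {0..\<theta>} h" unfolding h_def z_def by (intro continuous_intros)
      have h0: "h 0 > 0" using o1 by (simp add: h_def z_def p_def)
      have h1: "h \<theta> < 0" using o2 q' wedge_commute[of "\<gamma> \<zeta>" "\<gamma> \<eta>"] by (simp add: h_def)
      obtain \<phi> where \<phi>: "0 \<le> \<phi>" "\<phi> \<le> \<theta>" "h \<phi> = 0"
        using IVT2'[of h \<theta> 0 0] c h0 h1 th by auto
      then have "\<phi> \<noteq> 0" "\<phi> \<noteq> \<theta>" using h0 h1 by auto
      then have \<phi>': "\<phi> \<in> {0<..<\<theta>}" using \<phi> by auto
      have "s \<noteq> 0" using s by auto
      then have "wedge (\<gamma> \<zeta>) (z \<phi>) = 0" using \<phi> wedge_commute[of "\<gamma> \<zeta>" "z \<phi>"] by (simp add: h_def)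
      then obtain r where r: "z \<phi> = r *\<^sub>R \<gamma> \<zeta>"
        using nz[of \<zeta>] \<zeta> \<xi> wedge_zeroE by (metis greaterThanLessThan_iff less_trans)
      have "sin \<phi> > 0" using \<phi>' th by (auto intro!: sin_gt_zero)
      then have "s * wedge (\<gamma> \<xi>) (z \<phi>) > 0" unfolding wzs using W by (rule mult_pos_pos)
      then have "r * (s * wedge (\<gamma> \<xi>) (\<gamma> \<zeta>)) > 0" unfolding r by (simp add: mult.left_commute)
      then have "r > 0" using o1 by (rule zero_less_mult_pos2)
      moreover have "z \<phi> \<notin> D" using f \<phi>' by (simp add: free_arc_def z_def p_def)
      ultimately show ?thesis using key[of r \<phi> \<zeta>] r \<zeta> by auto
    qed
    then show "valid_slope (inner (\<gamma> \<xi>) w / (s * wedge (\<gamma> \<xi>) w)) \<xi> \<eta>"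
      using M0[of \<theta>] q' by (auto simp: valid_slope_def p_def k_def)
  qed
qed

lemma free_arc_of_valid_slope:
  assumes \<xi>: "a < \<xi>" "\<xi> < \<eta>" "\<eta> < b" and v: "valid_slope k \<xi> \<eta>"
  obtains \<theta> w where "free_arc D \<rho> (\<gamma> \<xi>) (\<gamma> \<eta>) \<theta> w" "k = inner (\<gamma> \<xi>) w / (s * wedge (\<gamma> \<xi>) w)"
    "s * wedge (\<gamma> \<xi>) w > 0"
proof -
  obtain \<theta> w where tw: "0 < \<theta>" "\<theta> < pi" "(norm w)\<^sup>2 = \<rho> - (norm (\<gamma> \<xi>))\<^sup>2"
      "cos \<theta> *\<^sub>R \<gamma> \<xi> + sin \<theta> *\<^sub>R w = \<gamma> \<eta>" "s * wedge (\<gamma> \<xi>) w > 0"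
      "k = inner (\<gamma> \<xi>) w / (s * wedge (\<gamma> \<xi>) w)"
  proof (rule arc_of_slope[of s "\<gamma> \<xi>" \<rho> "\<gamma> \<eta>" k])
    show "s * s = 1" "\<gamma> \<xi> \<noteq> 0" "(norm (\<gamma> \<xi>))\<^sup>2 < \<rho>" "0 < s * wedge (\<gamma> \<xi>) (\<gamma> \<eta>)"
      using s nz[of \<xi>] bounded[of \<xi>] orient[OF \<xi>] \<xi> by auto
    show "slope_form \<rho> s (\<gamma> \<xi>) k (\<gamma> \<eta>) = 0" using v by (simp add: valid_slope_def)
  qed (use that in blast)
  then show ?thesis using that valid_slope_iff_free(2)[OF \<xi> tw(1-4)] v by auto
qed

lemma slope_cos:
  assumes "a < \<xi>" "\<xi> < b" "k = inner (\<gamma> \<xi>) w / (s * wedge (\<gamma> \<xi>) w)" "s * wedge (\<gamma> \<xi>) w > 0"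
    "cos \<theta> *\<^sub>R \<gamma> \<xi> + sin \<theta> *\<^sub>R w = q"
  shows "(norm (\<gamma> \<xi>))\<^sup>2 * cos \<theta> = inner (\<gamma> \<xi>) q - k * (s * wedge (\<gamma> \<xi>) q)"
proof -
  have X: "inner (\<gamma> \<xi>) q = cos \<theta> * (norm (\<gamma> \<xi>))\<^sup>2 + sin \<theta> * inner (\<gamma> \<xi>) w"
    using assms(5) by (auto simp: inner_add_right power2_norm_eq_inner)
  have "wedge (\<gamma> \<xi>) q = sin \<theta> * wedge (\<gamma> \<xi>) w"
    using assms(5) by (auto simp: wedge_add)
  moreover have "s \<noteq> 0" "wedge (\<gamma> \<xi>) w \<noteq> 0" using assms(4) by auto
  ultimately have "k * (s * wedge (\<gamma> \<xi>) q) = sin \<theta> * inner (\<gamma> \<xi>) w"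
    using assms(3) by simp
  then show ?thesis using X by simp
qed

lemma valid_slope_ex1:
  assumes \<xi>: "a < \<xi>" "\<xi> < \<eta>" "\<eta> < b"
  shows "\<exists>!k. valid_slope k \<xi> \<eta>"
proof -
  obtain \<theta> w where f: "free_arc D \<rho> (\<gamma> \<xi>) (\<gamma> \<eta>) \<theta> w"
    using arc_ex[of \<xi> \<eta>] \<xi> by auto
  then have "valid_slope (inner (\<gamma> \<xi>) w / (s * wedge (\<gamma> \<xi>) w)) \<xi> \<eta>"
    using valid_slope_iff_free(2)[OF \<xi>, of \<theta> w] by (simp add: free_arc_def)
  moreover have "k = k'" if k: "valid_slope k \<xi> \<eta>" and k': "valid_slope k' \<xi> \<eta>" for k k'
  proof -
    obtain \<theta> w where 1: "free_arc D \<rho> (\<gamma> \<xi>) (\<gamma> \<eta>) \<theta> w" "k = inner (\<gamma> \<xi>) w / (s * wedge (\<gamma> \<xi>) w)"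
      "s * wedge (\<gamma> \<xi>) w > 0" using free_arc_of_valid_slope[OF \<xi> k] by blast
    obtain \<theta>' w' where 2: "free_arc D \<rho> (\<gamma> \<xi>) (\<gamma> \<eta>) \<theta>' w'" "k' = inner (\<gamma> \<xi>) w' / (s * wedge (\<gamma> \<xi>) w')"
      "s * wedge (\<gamma> \<xi>) w' > 0" using free_arc_of_valid_slope[OF \<xi> k'] by blast
    have "\<theta> = \<theta>'" using arc_uniq[of \<xi> \<eta> \<theta> w \<theta>' w'] 1 2 \<xi> by auto
    then have "k * (s * wedge (\<gamma> \<xi>) (\<gamma> \<eta>)) = k' * (s * wedge (\<gamma> \<xi>) (\<gamma> \<eta>))"
      using slope_cos[of \<xi> k w \<theta> "\<gamma> \<eta>"] slope_cos[of \<xi> k' w' \<theta>' "\<gamma> \<eta>"] 1 2 \<xi>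
      by (auto simp: free_arc_def)
    then show ?thesis using orient[OF \<xi>] by auto
  qed
  ultimately show ?thesis by blast
qed

end

text \<open>The cosine of the travel angle of the outer arc from \<open>p\<close> to \<open>q\<close>, the smaller root of
  \<open>\<rho> c\<^sup>2 - 2 \<langle>p, q\<rangle> c + |p|\<^sup>2 + |q|\<^sup>2 - \<rho> = 0\<close>.\<close>
definition lob_cos :: "real \<Rightarrow> complex \<Rightarrow> complex \<Rightarrow> real" where
  "lob_cos \<rho> p q = (inner p q - sqrt (arc_disc \<rho> p q)) / \<rho>"

section \<open>The larger root gives the arc\<close>

context arc_sector
begin

lemma isCont_curve: "a < \<xi> \<Longrightarrow> \<xi> < b \<Longrightarrow> isCont \<gamma> \<xi>"
  using cont continuous_on_eq_continuous_at[of "{a<..<b}" \<gamma>] by auto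

text \<open>The inequality says that the mean of the two roots in \<open>k\<close> exceeds
  \<open>K\<close>. When the target approaches the start, the wedge tends to 0 while the inner
  product tends to a positive number.\<close>

lemma steep_near:
  assumes "a < \<xi>" "\<xi> < b"
  shows "\<forall>\<^sub>F \<zeta> in at_right \<xi>. \<rho> * (K * (s * wedge (\<gamma> \<xi>) (\<gamma> \<zeta>))) < (\<rho> - (norm (\<gamma> \<xi>))\<^sup>2) * inner (\<gamma> \<xi>) (\<gamma> \<zeta>)"
proof -
  define g where "g \<zeta> = (\<rho> - (norm (\<gamma> \<xi>))\<^sup>2) * inner (\<gamma> \<xi>) (\<gamma> \<zeta>) - \<rho> * (K * (s * wedge (\<gamma> \<xi>) (\<gamma> \<zeta>)))" for \<zeta>
  have "(\<gamma> \<longlongrightarrow> \<gamma> \<xi>) (at_right \<xi>)"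
    using isCont_curve[OF assms] by (simp add: isCont_def filterlim_at_split)
  then have "(g \<longlongrightarrow> g \<xi>) (at_right \<xi>)" unfolding g_def by (intro tendsto_intros)
  moreover have "g \<xi> > 0"
    using nz[OF assms] bounded[OF assms] by (simp add: g_def power2_norm_eq_inner[symmetric])
  ultimately have "\<forall>\<^sub>F \<zeta> in at_right \<xi>. g \<zeta> > 0" by (rule order_tendstoD(1))
  then show ?thesis by eventually_elim (simp add: g_def)
qed

text \<open>If the boundary followed an ellipse over a whole interval, an arc started there could
  run along the boundary, while the other root of the same quadratic would give a second admissible
  arc to a nearby target, against uniqueness.\<close>

lemma no_coincidence:
  assumes \<xi>: "a < \<xi>" "\<xi> < \<eta>\<^sub>1" "\<eta>\<^sub>1 < \<eta>\<^sub>2" "\<eta>\<^sub>2 < b"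
  shows "\<exists>\<zeta>\<in>{\<eta>\<^sub>1..\<eta>\<^sub>2}. slope_form \<rho> s (\<gamma> \<xi>) k (\<gamma> \<zeta>) \<noteq> 0"
proof (rule ccontr)
  assume "\<not> ?thesis"
  then have M: "slope_form \<rho> s (\<gamma> \<xi>) k (\<gamma> \<zeta>) = 0" if "\<eta>\<^sub>1 \<le> \<zeta>" "\<zeta> \<le> \<eta>\<^sub>2" for \<zeta> using that by auto
  define p where "p = \<gamma> \<xi>"
  define w where "w = sqrt ((\<rho> - (norm p)\<^sup>2) / ((norm p)\<^sup>2 * (1 + k\<^sup>2))) *\<^sub>R (Complex k s * p)"
  have \<rho>: "\<rho> > 0" using rho_pos[of \<xi>] \<xi> by auto
  have arc: "\<exists>\<theta>. \<gamma> \<zeta> = cos \<theta> *\<^sub>R p + sin \<theta> *\<^sub>R w \<and> (norm w)\<^sup>2 = \<rho> - (norm p)\<^sup>2 \<and> s * wedge p w > 0"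
    if "\<eta>\<^sub>1 \<le> \<zeta>" "\<zeta> \<le> \<eta>\<^sub>2" for \<zeta>
  proof (rule arc_of_slope[of s "\<gamma> \<xi>" \<rho> "\<gamma> \<zeta>" k])
    show "s * s = 1" "\<gamma> \<xi> \<noteq> 0" "(norm (\<gamma> \<xi>))\<^sup>2 < \<rho>" "0 < s * wedge (\<gamma> \<xi>) (\<gamma> \<zeta>)"
      using s nz[of \<xi>] bounded[of \<xi>] orient[of \<xi> \<zeta>] \<xi> that by auto
    show "slope_form \<rho> s (\<gamma> \<xi>) k (\<gamma> \<zeta>) = 0" using M that by simp
    fix \<theta> v
    assume "v = sqrt ((\<rho> - (norm (\<gamma> \<xi>))\<^sup>2) / ((norm (\<gamma> \<xi>))\<^sup>2 * (1 + k\<^sup>2))) *\<^sub>R (Complex k s * \<gamma> \<xi>)"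
    then have v: "v = w" by (simp add: w_def p_def)
    assume "(norm v)\<^sup>2 = \<rho> - (norm (\<gamma> \<xi>))\<^sup>2" "cos \<theta> *\<^sub>R \<gamma> \<xi> + sin \<theta> *\<^sub>R v = \<gamma> \<zeta>" "s * wedge (\<gamma> \<xi>) v > 0"
    then show ?thesis unfolding v p_def by metis
  qed
  obtain \<theta>\<^sub>1 where t1: "\<gamma> \<eta>\<^sub>1 = cos \<theta>\<^sub>1 *\<^sub>R p + sin \<theta>\<^sub>1 *\<^sub>R w" and nw: "(norm w)\<^sup>2 = \<rho> - (norm p)\<^sup>2"
    and W: "s * wedge p w > 0"
    using arc[of \<eta>\<^sub>1] \<xi> by auto
  \<comment> \<open>The same ellipse based at another of its points: \<open>p'\<close> and
    \<open>w'\<close> are position and scaled velocity at the angle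
    \<open>\<theta>\<^sub>1\<close>.\<close>
  define p' where "p' = \<gamma> \<eta>\<^sub>1"
  define w' where "w' = cos \<theta>\<^sub>1 *\<^sub>R w - sin \<theta>\<^sub>1 *\<^sub>R p"
  have p': "p' = cos \<theta>\<^sub>1 *\<^sub>R p + sin \<theta>\<^sub>1 *\<^sub>R w" using t1 by (simp add: p'_def)
  have sc: "sin \<theta>\<^sub>1 * sin \<theta>\<^sub>1 = 1 - cos \<theta>\<^sub>1 * cos \<theta>\<^sub>1"
    using sin_cos_squared_add[of \<theta>\<^sub>1] by (simp add: power2_eq_square)
  have "(norm p')\<^sup>2 + (norm w')\<^sup>2 = (norm p)\<^sup>2 + (norm w)\<^sup>2"
  proof -
    have "(norm (c *\<^sub>R p + d *\<^sub>R w))\<^sup>2 + (norm (c *\<^sub>R w - d *\<^sub>R p))\<^sup>2 = (c\<^sup>2 + d\<^sup>2) * ((norm p)\<^sup>2 + (norm w)\<^sup>2)"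
      for c d unfolding cmod_power2 by (simp add: algebra_simps power2_eq_square)
    then have "(norm p')\<^sup>2 + (norm w')\<^sup>2 = ((cos \<theta>\<^sub>1)\<^sup>2 + (sin \<theta>\<^sub>1)\<^sup>2) * ((norm p)\<^sup>2 + (norm w)\<^sup>2)"
      unfolding p' w'_def by blast
    then show ?thesis by simp
  qed
  then have nw': "(norm w')\<^sup>2 = \<rho> - (norm p')\<^sup>2" using nw by simp
  have ww': "wedge p' w' = wedge p w"
  proof -
    have "wedge (c *\<^sub>R p + d *\<^sub>R w) (c *\<^sub>R w - d *\<^sub>R p) = (c\<^sup>2 + d\<^sup>2) * wedge p w" for c d
      by (simp add: wedge_add wedge_commute[of w p] algebra_simps power2_eq_square)
    then have "wedge p' w' = ((cos \<theta>\<^sub>1)\<^sup>2 + (sin \<theta>\<^sub>1)\<^sup>2) * wedge p w"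
      unfolding p' w'_def by blast
    then show ?thesis by simp
  qed
  define \<kappa> where "\<kappa> = inner p' w' / (s * wedge p' w')"
  have M': "slope_form \<rho> s p' \<kappa> (\<gamma> \<zeta>) = 0" if \<zeta>: "\<eta>\<^sub>1 < \<zeta>" "\<zeta> \<le> \<eta>\<^sub>2" for \<zeta>
  proof -
    obtain \<theta> where th: "\<gamma> \<zeta> = cos \<theta> *\<^sub>R p + sin \<theta> *\<^sub>R w" using arc[of \<zeta>] \<zeta> by auto
    have "\<gamma> \<zeta> = cos (\<theta> - \<theta>\<^sub>1) *\<^sub>R p' + sin (\<theta> - \<theta>\<^sub>1) *\<^sub>R w'"
    proof -
      have "cos (\<theta> - \<theta>\<^sub>1) * cos \<theta>\<^sub>1 - sin (\<theta> - \<theta>\<^sub>1) * sin \<theta>\<^sub>1 = cos \<theta>"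
           "cos (\<theta> - \<theta>\<^sub>1) * sin \<theta>\<^sub>1 + sin (\<theta> - \<theta>\<^sub>1) * cos \<theta>\<^sub>1 = sin \<theta>"
        using cos_add[of "\<theta> - \<theta>\<^sub>1" \<theta>\<^sub>1] sin_add[of "\<theta> - \<theta>\<^sub>1" \<theta>\<^sub>1] by auto
      moreover have "cos (\<theta> - \<theta>\<^sub>1) *\<^sub>R p' + sin (\<theta> - \<theta>\<^sub>1) *\<^sub>R w' =
         (cos (\<theta> - \<theta>\<^sub>1) * cos \<theta>\<^sub>1 - sin (\<theta> - \<theta>\<^sub>1) * sin \<theta>\<^sub>1) *\<^sub>R p +
         (cos (\<theta> - \<theta>\<^sub>1) * sin \<theta>\<^sub>1 + sin (\<theta> - \<theta>\<^sub>1) * cos \<theta>\<^sub>1) *\<^sub>R w"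
        unfolding p' w'_def by (simp add: algebra_simps)
      ultimately show ?thesis using th by simp
    qed
    then show ?thesis
      by (simp only:) (rule slope_form_on_arc[OF s nw' _ _ \<kappa>_def], use W ww' in auto)
  qed
  have Y: "s * wedge p' (\<gamma> \<zeta>) > 0" if "\<eta>\<^sub>1 < \<zeta>" "\<zeta> \<le> \<eta>\<^sub>2" for \<zeta>
    using orient[of \<eta>\<^sub>1 \<zeta>] \<xi> that by (simp add: p'_def)
  \<comment> \<open>The root complementary to \<open>\<kappa>\<close>. It decreases as the target
    moves away, because the quotient of inner product and oriented wedge is a cotangent.\<close>
  define k2 where "k2 \<zeta> = 2 * (\<rho> - (norm p')\<^sup>2) * inner p' (\<gamma> \<zeta>) / (\<rho> * (s * wedge p' (\<gamma> \<zeta>))) - \<kappa>" for \<zeta>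
  have fac: "slope_form \<rho> s p' x (\<gamma> \<zeta>) = \<rho> * (s * wedge p' (\<gamma> \<zeta>))\<^sup>2 * (x - \<kappa>) * (x - k2 \<zeta>)"
    if "\<eta>\<^sub>1 < \<zeta>" "\<zeta> \<le> \<eta>\<^sub>2" for x \<zeta>
    unfolding k2_def by (rule slope_form_factor[OF s]) (use \<rho> Y[OF that] M'[OF that] in auto)
  have k2mono: "k2 \<zeta> \<le> k2 \<zeta>'" if "\<eta>\<^sub>1 < \<zeta>'" "\<zeta>' < \<zeta>" "\<zeta> \<le> \<eta>\<^sub>2" for \<zeta> \<zeta>'
  proof -
    have "inner p' x * (s * wedge p' y) - inner p' y * (s * wedge p' x) = (norm p')\<^sup>2 * (s * wedge x y)" for x y
      unfolding inner_complex_def wedge_def cmod_power2 by (simp add: algebra_simps power2_eq_square)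
    then have "inner p' (\<gamma> \<zeta>') * (s * wedge p' (\<gamma> \<zeta>)) - inner p' (\<gamma> \<zeta>) * (s * wedge p' (\<gamma> \<zeta>'))
       = (norm p')\<^sup>2 * (s * wedge (\<gamma> \<zeta>') (\<gamma> \<zeta>))"
      by blast
    also have "\<dots> \<ge> 0" using orient[of \<zeta>' \<zeta>] that \<xi> by auto
    finally have le: "inner p' (\<gamma> \<zeta>) * (s * wedge p' (\<gamma> \<zeta>')) \<le> inner p' (\<gamma> \<zeta>') * (s * wedge p' (\<gamma> \<zeta>))" by simp
    have "inner p' (\<gamma> \<zeta>) / (s * wedge p' (\<gamma> \<zeta>)) \<le> inner p' (\<gamma> \<zeta>') / (s * wedge p' (\<gamma> \<zeta>'))"
    proof -
      have "x / u \<le> y / v" if "x * v \<le> y * u" "u > 0" "v > 0" for x y u v :: real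
        using that by (simp add: field_simps)
      from this[OF le Y Y] show ?thesis using that by auto
    qed
    moreover have "2 * (\<rho> - (norm p')\<^sup>2) / \<rho> \<ge> 0" using \<rho> bounded[of \<eta>\<^sub>1] \<xi> by (simp add: p'_def)
    ultimately have "2 * (\<rho> - (norm p')\<^sup>2) / \<rho> * (inner p' (\<gamma> \<zeta>) / (s * wedge p' (\<gamma> \<zeta>)))
        \<le> 2 * (\<rho> - (norm p')\<^sup>2) / \<rho> * (inner p' (\<gamma> \<zeta>') / (s * wedge p' (\<gamma> \<zeta>')))"
      by (rule mult_left_mono)
    then show ?thesis by (simp add: k2_def)
  qed
  have "\<forall>\<^sub>F \<zeta> in at_right \<eta>\<^sub>1. \<rho> * (\<kappa> * (s * wedge p' (\<gamma> \<zeta>))) < (\<rho> - (norm p')\<^sup>2) * inner p' (\<gamma> \<zeta>)"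
    unfolding p'_def by (rule steep_near) (use \<xi> in auto)
  moreover have "\<forall>\<^sub>F \<zeta> in at_right \<eta>\<^sub>1. \<zeta> < \<eta>\<^sub>2" "\<forall>\<^sub>F \<zeta> in at_right \<eta>\<^sub>1. \<eta>\<^sub>1 < \<zeta>"
    using \<xi> by (auto simp: eventually_at_right_field eventually_at_right_less)
  ultimately have "\<forall>\<^sub>F \<zeta> in at_right \<eta>\<^sub>1. \<eta>\<^sub>1 < \<zeta> \<and> \<zeta> < \<eta>\<^sub>2 \<and>
      \<rho> * (\<kappa> * (s * wedge p' (\<gamma> \<zeta>))) < (\<rho> - (norm p')\<^sup>2) * inner p' (\<gamma> \<zeta>)"
    by eventually_elim auto
  then obtain \<zeta> where \<zeta>: "\<eta>\<^sub>1 < \<zeta>" "\<zeta> < \<eta>\<^sub>2"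
     "\<rho> * (\<kappa> * (s * wedge p' (\<gamma> \<zeta>))) < (\<rho> - (norm p')\<^sup>2) * inner p' (\<gamma> \<zeta>)"
    using eventually_happens'[OF trivial_limit_at_right_real] by blast
  \<comment> \<open>For this \<open>\<zeta>\<close> the mean of the two roots exceeds
    \<open>\<kappa>\<close>, so the other root is strictly larger.\<close>
  have "k2 \<zeta> > \<kappa>"
  proof -
    have "\<rho> * (s * wedge p' (\<gamma> \<zeta>)) > 0" using \<rho> Y[of \<zeta>] \<zeta> by simp
    moreover have "\<kappa> * (\<rho> * (s * wedge p' (\<gamma> \<zeta>))) < (\<rho> - (norm p')\<^sup>2) * inner p' (\<gamma> \<zeta>)"
      using \<zeta>(3) by (simp only: mult.left_commute)
    ultimately have "\<kappa> < (\<rho> - (norm p')\<^sup>2) * inner p' (\<gamma> \<zeta>) / (\<rho> * (s * wedge p' (\<gamma> \<zeta>)))"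
      by (simp only: pos_less_divide_eq)
    moreover have "k2 \<zeta> = 2 * ((\<rho> - (norm p')\<^sup>2) * inner p' (\<gamma> \<zeta>) / (\<rho> * (s * wedge p' (\<gamma> \<zeta>)))) - \<kappa>"
      by (simp only: k2_def times_divide_eq_right mult.assoc)
    ultimately show ?thesis by linarith
  qed
  moreover have "valid_slope \<kappa> \<eta>\<^sub>1 \<zeta>"
    using M' \<zeta> by (auto simp: valid_slope_def p'_def)
  moreover have "valid_slope (k2 \<zeta>) \<eta>\<^sub>1 \<zeta>"
  proof -
    have "slope_form \<rho> s p' (k2 \<zeta>) (\<gamma> \<zeta>') \<le> 0" if z: "\<eta>\<^sub>1 < \<zeta>'" "\<zeta>' < \<zeta>" for \<zeta>'
    proof -
      have "0 \<le> \<rho> * (s * wedge p' (\<gamma> \<zeta>'))\<^sup>2 * (k2 \<zeta> - \<kappa>)"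
        using \<rho> \<open>k2 \<zeta> > \<kappa>\<close> by simp
      moreover have "k2 \<zeta> - k2 \<zeta>' \<le> 0" using k2mono[of \<zeta>' \<zeta>] z \<zeta> by simp
      ultimately show ?thesis using fac[of \<zeta>' "k2 \<zeta>"] z \<zeta> by (simp add: mult_nonneg_nonpos)
    qed
    moreover have "slope_form \<rho> s p' (k2 \<zeta>) (\<gamma> \<zeta>) = 0" using fac[of \<zeta> "k2 \<zeta>"] \<zeta> by simp
    ultimately show ?thesis by (auto simp: valid_slope_def p'_def)
  qed
  ultimately show False using valid_slope_ex1[of \<eta>\<^sub>1 \<zeta>] \<xi> \<zeta> by (metis less_irrefl less_trans)
qed

abbreviation "kp \<xi> \<eta> \<equiv> slope_plus \<rho> s (\<gamma> \<xi>) (\<gamma> \<eta>)"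
abbreviation "km \<xi> \<eta> \<equiv> slope_minus \<rho> s (\<gamma> \<xi>) (\<gamma> \<eta>)"

lemma slope_form_iff:
  assumes "a < \<xi>" "\<xi> < \<eta>" "\<eta> < b"
  shows "slope_form \<rho> s (\<gamma> \<xi>) k (\<gamma> \<eta>) \<le> 0 \<longleftrightarrow> 0 \<le> arc_disc \<rho> (\<gamma> \<xi>) (\<gamma> \<eta>) \<and> km \<xi> \<eta> \<le> k \<and> k \<le> kp \<xi> \<eta>"
    and "slope_form \<rho> s (\<gamma> \<xi>) k (\<gamma> \<eta>) = 0 \<longleftrightarrow> 0 \<le> arc_disc \<rho> (\<gamma> \<xi>) (\<gamma> \<eta>) \<and> (k = km \<xi> \<eta> \<or> k = kp \<xi> \<eta>)"
    and "slope_form \<rho> s (\<gamma> \<xi>) k (\<gamma> \<eta>) < 0 \<longleftrightarrow> 0 \<le> arc_disc \<rho> (\<gamma> \<xi>) (\<gamma> \<eta>) \<and> km \<xi> \<eta> < k \<and> k < kp \<xi> \<eta>"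
  using slope_form_nonpos_iff[of s \<rho> "\<gamma> \<xi>" "\<gamma> \<eta>" k] s rho_pos[of \<xi>] orient[OF assms] nz[of \<xi>] assms by auto

text \<open>At a vanishing discriminant the two roots coincide, so every arc to a farther target
  must use this one slope in order to clear the point. The boundary beyond it would then follow an
  ellipse, against \<open>no_coincidence\<close>.\<close>

lemma disc_pos:
  assumes \<xi>: "a < \<xi>" "\<xi> < \<eta>" "\<eta> < b"
  shows "arc_disc \<rho> (\<gamma> \<xi>) (\<gamma> \<eta>) > 0"
proof (rule ccontr)
  assume n: "\<not> ?thesis"
  have n0: "0 \<le> arc_disc \<rho> (\<gamma> \<xi>) (\<gamma> \<eta>)"
    using valid_slope_ex1[OF \<xi>] slope_form_iff(2)[OF \<xi>] by (auto simp: valid_slope_def)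
  then have "arc_disc \<rho> (\<gamma> \<xi>) (\<gamma> \<eta>) = 0" using n by simp
  then have e: "km \<xi> \<eta> = kp \<xi> \<eta>" by (simp add: slope_minus_def slope_plus_def)
  have "slope_form \<rho> s (\<gamma> \<xi>) (kp \<xi> \<eta>) (\<gamma> \<zeta>) = 0" if z: "\<eta> \<le> \<zeta>" "\<zeta> < b" for \<zeta>
  proof (cases "\<zeta> = \<eta>")
    case True then show ?thesis using slope_form_iff(2)[OF \<xi>] n0 by simp
  next
    case False
    then obtain k where k: "valid_slope k \<xi> \<zeta>" using ex1_implies_ex[OF valid_slope_ex1[of \<xi> \<zeta>]] \<xi> z by auto
    then have "slope_form \<rho> s (\<gamma> \<xi>) k (\<gamma> \<eta>) \<le> 0" using \<xi> z False by (auto simp: valid_slope_def)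
    then have "k = kp \<xi> \<eta>" using slope_form_iff(1)[OF \<xi>] e by auto
    then show ?thesis using k by (simp add: valid_slope_def)
  qed
  then show False using no_coincidence[of \<xi> \<eta> "(\<eta> + b) / 2" "kp \<xi> \<eta>"] \<xi> by auto
qed

lemma km_less_kp: "a < \<xi> \<Longrightarrow> \<xi> < \<eta> \<Longrightarrow> \<eta> < b \<Longrightarrow> km \<xi> \<eta> < kp \<xi> \<eta>"
  unfolding slope_minus_def slope_plus_def
proof (rule divide_strict_right_mono)
  assume \<xi>: "a < \<xi>" "\<xi> < \<eta>" "\<eta> < b"
  have "(norm (\<gamma> \<xi>))\<^sup>2 * sqrt (arc_disc \<rho> (\<gamma> \<xi>) (\<gamma> \<eta>)) > 0" using disc_pos[OF \<xi>] nz[of \<xi>] \<xi> by simp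
  then show "(\<rho> - (norm (\<gamma> \<xi>))\<^sup>2) * inner (\<gamma> \<xi>) (\<gamma> \<eta>) - (norm (\<gamma> \<xi>))\<^sup>2 * sqrt (arc_disc \<rho> (\<gamma> \<xi>) (\<gamma> \<eta>))
      < (\<rho> - (norm (\<gamma> \<xi>))\<^sup>2) * inner (\<gamma> \<xi>) (\<gamma> \<eta>) + (norm (\<gamma> \<xi>))\<^sup>2 * sqrt (arc_disc \<rho> (\<gamma> \<xi>) (\<gamma> \<eta>))"
    by linarith
  show "0 < \<rho> * (s * wedge (\<gamma> \<xi>) (\<gamma> \<eta>))"
    by (rule mult_pos_pos) (use orient[OF \<xi>] rho_pos[of \<xi>] \<xi> in auto)
qed

lemma continuous_on_slopes:
  assumes "a < \<xi>"
  shows "continuous_on {\<xi><..<b} (kp \<xi>)" "continuous_on {\<xi><..<b} (km \<xi>)"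
proof -
  have g: "continuous_on {\<xi><..<b} \<gamma>" using cont assms by (auto intro: continuous_on_subset)
  have "\<rho> * (s * wedge (\<gamma> \<xi>) (\<gamma> \<eta>)) \<noteq> 0" if "\<eta> \<in> {\<xi><..<b}" for \<eta>
    using that orient[of \<xi> \<eta>] rho_pos[of \<xi>] assms by auto
  then show "continuous_on {\<xi><..<b} (kp \<xi>)" "continuous_on {\<xi><..<b} (km \<xi>)"
    unfolding slope_plus_def slope_minus_def arc_disc_def by (intro continuous_intros g; blast)+
qed

lemma kp_large:
  assumes "a < \<xi>" "\<xi> < b"
  shows "\<forall>\<^sub>F \<zeta> in at_right \<xi>. \<xi> < \<zeta> \<and> \<zeta> < b \<and> K < kp \<xi> \<zeta>"
proof -
  have "\<forall>\<^sub>F \<zeta> in at_right \<xi>. \<zeta> < b" "\<forall>\<^sub>F \<zeta> in at_right \<xi>. \<xi> < \<zeta>"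
    using assms by (auto simp: eventually_at_right_field eventually_at_right_less)
  then have "\<forall>\<^sub>F \<zeta> in at_right \<xi>. \<zeta> < b \<and> \<xi> < \<zeta> \<and>
      \<rho> * (K * (s * wedge (\<gamma> \<xi>) (\<gamma> \<zeta>))) < (\<rho> - (norm (\<gamma> \<xi>))\<^sup>2) * inner (\<gamma> \<xi>) (\<gamma> \<zeta>)"
    using steep_near[OF assms, of K] by (intro eventually_conj)
  then show ?thesis
  proof (rule eventually_mono)
    fix \<zeta> assume elim: "\<zeta> < b \<and> \<xi> < \<zeta> \<and>
      \<rho> * (K * (s * wedge (\<gamma> \<xi>) (\<gamma> \<zeta>))) < (\<rho> - (norm (\<gamma> \<xi>))\<^sup>2) * inner (\<gamma> \<xi>) (\<gamma> \<zeta>)"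
    have Y: "\<rho> * (s * wedge (\<gamma> \<xi>) (\<gamma> \<zeta>)) > 0"
      by (rule mult_pos_pos) (use orient[of \<xi> \<zeta>] rho_pos[of \<xi>] assms elim in auto)
    have "K * (\<rho> * (s * wedge (\<gamma> \<xi>) (\<gamma> \<zeta>))) < (\<rho> - (norm (\<gamma> \<xi>))\<^sup>2) * inner (\<gamma> \<xi>) (\<gamma> \<zeta>)"
      using elim by (simp only: mult.left_commute)
    also have "\<dots> \<le> (\<rho> - (norm (\<gamma> \<xi>))\<^sup>2) * inner (\<gamma> \<xi>) (\<gamma> \<zeta>) + (norm (\<gamma> \<xi>))\<^sup>2 * sqrt (arc_disc \<rho> (\<gamma> \<xi>) (\<gamma> \<zeta>))"
      using disc_pos[of \<xi> \<zeta>] elim assms by simp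
    finally have "K < kp \<xi> \<zeta>" unfolding slope_plus_def pos_less_divide_eq[OF Y] .
    then show "\<xi> < \<zeta> \<and> \<zeta> < b \<and> K < kp \<xi> \<zeta>" using elim by blast
  qed
qed

end

context arc_sector
begin

lemma valid_slope_bounds:
  assumes "valid_slope k \<xi> \<eta>" "a < \<xi>" "\<xi> < \<zeta>" "\<zeta> < \<eta>" "\<eta> < b"
  shows "km \<xi> \<zeta> \<le> k \<and> k \<le> kp \<xi> \<zeta>"
proof -
  have "slope_form \<rho> s (\<gamma> \<xi>) k (\<gamma> \<zeta>) \<le> 0" using assms by (auto simp: valid_slope_def)
  then show ?thesis using slope_form_iff(1)[of \<xi> \<zeta> k] assms by auto
qed

text \<open>Each target is reached with exactly one of the two roots. If \<open>\<eta>\<close> were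
  reached with the smaller one, the targets reached with either root would split an interval ending
  at \<open>\<eta>\<close> into two nonempty disjoint closed sets.\<close>

lemma valid_kp:
  assumes \<xi>: "a < \<xi>" "\<xi> < \<eta>" "\<eta> < b"
  shows "valid_slope (kp \<xi> \<eta>) \<xi> \<eta>"
proof (rule ccontr)
  assume n: "\<not> ?thesis"
  obtain k where k: "valid_slope k \<xi> \<eta>" using ex1_implies_ex[OF valid_slope_ex1[OF \<xi>]] by blast
  then have "k = km \<xi> \<eta>" using n slope_form_iff(2)[OF \<xi>] by (auto simp: valid_slope_def)
  then have km: "valid_slope (km \<xi> \<eta>) \<xi> \<eta>" using k by simp
  have b1: "km \<xi> \<zeta> \<le> km \<xi> \<eta> \<and> km \<xi> \<eta> \<le> kp \<xi> \<zeta>" if "\<xi> < \<zeta>" "\<zeta> \<le> \<eta>" for \<zeta>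
  proof (cases "\<zeta> = \<eta>")
    case True then show ?thesis using km_less_kp[OF \<xi>] by simp
  next
    case False
    then show ?thesis using valid_slope_bounds[OF km \<xi>(1), of \<zeta>] that \<xi> by auto
  qed
  have Cp: "valid_slope (kp \<xi> \<zeta>) \<xi> \<zeta>"
    if z: "\<xi> < \<zeta>" "\<zeta> \<le> \<eta>" and le: "\<And>\<zeta>'. \<xi> < \<zeta>' \<Longrightarrow> \<zeta>' < \<zeta> \<Longrightarrow> kp \<xi> \<zeta> \<le> kp \<xi> \<zeta>'" for \<zeta>
    unfolding valid_slope_def
  proof (intro conjI ballI)
    have d: "a < \<xi>" "\<xi> < \<zeta>" "\<zeta> < b" using z \<xi> by auto
    show "slope_form \<rho> s (\<gamma> \<xi>) (kp \<xi> \<zeta>) (\<gamma> \<zeta>) = 0"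
      using slope_form_iff(2)[OF d] disc_pos[OF d] by simp
    fix \<zeta>' assume z': "\<zeta>' \<in> {\<xi><..<\<zeta>}"
    then have d': "a < \<xi>" "\<xi> < \<zeta>'" "\<zeta>' < b" using d by auto
    have "km \<xi> \<zeta>' \<le> kp \<xi> \<zeta>" using b1[of \<zeta>'] b1[of \<zeta>] z z' by auto
    then show "slope_form \<rho> s (\<gamma> \<xi>) (kp \<xi> \<zeta>) (\<gamma> \<zeta>') \<le> 0"
      using slope_form_iff(1)[OF d'] disc_pos[OF d'] le[of \<zeta>'] z' by simp
  qed
  have Cm: "valid_slope (km \<xi> \<zeta>) \<xi> \<zeta>"
    if z: "\<xi> < \<zeta>" "\<zeta> \<le> \<eta>" and le: "\<And>\<zeta>'. \<xi> < \<zeta>' \<Longrightarrow> \<zeta>' < \<zeta> \<Longrightarrow> km \<xi> \<zeta>' \<le> km \<xi> \<zeta>" for \<zeta>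
    unfolding valid_slope_def
  proof (intro conjI ballI)
    have d: "a < \<xi>" "\<xi> < \<zeta>" "\<zeta> < b" using z \<xi> by auto
    show "slope_form \<rho> s (\<gamma> \<xi>) (km \<xi> \<zeta>) (\<gamma> \<zeta>) = 0"
      using slope_form_iff(2)[OF d] disc_pos[OF d] by simp
    fix \<zeta>' assume z': "\<zeta>' \<in> {\<xi><..<\<zeta>}"
    then have d': "a < \<xi>" "\<xi> < \<zeta>'" "\<zeta>' < b" using d by auto
    have "km \<xi> \<zeta> \<le> kp \<xi> \<zeta>'" using b1[of \<zeta>'] b1[of \<zeta>] z z' by auto
    then show "slope_form \<rho> s (\<gamma> \<xi>) (km \<xi> \<zeta>) (\<gamma> \<zeta>') \<le> 0"
      using slope_form_iff(1)[OF d'] disc_pos[OF d'] le[of \<zeta>'] z' by simp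
  qed
  have cont_kp: "continuous_on {\<zeta>..\<eta>} (kp \<xi>)" and cont_km: "continuous_on {\<zeta>..\<eta>} (km \<xi>)" if "\<xi> < \<zeta>" for \<zeta>
    using continuous_on_slopes[OF \<xi>(1)] that \<xi> by (auto elim!: continuous_on_subset)
  obtain \<zeta>\<^sub>0 where z0: "\<xi> < \<zeta>\<^sub>0" "\<zeta>\<^sub>0 < \<eta>" "\<And>\<zeta>. \<xi> < \<zeta> \<Longrightarrow> \<zeta> \<le> \<zeta>\<^sub>0 \<Longrightarrow> kp \<xi> \<eta> < kp \<xi> \<zeta>"
  proof -
    have "\<forall>\<^sub>F \<zeta> in at_right \<xi>. kp \<xi> \<eta> < kp \<xi> \<zeta>"
      using kp_large[of \<xi> "kp \<xi> \<eta>"] \<xi> by (auto elim: eventually_mono)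
    then obtain c where c: "c > \<xi>" "\<And>y. \<xi> < y \<Longrightarrow> y < c \<Longrightarrow> kp \<xi> \<eta> < kp \<xi> y"
      by (auto simp: eventually_at_right_field)
    show ?thesis
    proof (rule that[of "(\<xi> + min c \<eta>) / 2"])
      show "kp \<xi> \<eta> < kp \<xi> \<zeta>" if "\<xi> < \<zeta>" "\<zeta> \<le> (\<xi> + min c \<eta>) / 2" for \<zeta>
        using c(1) that \<xi> by (intro c(2)) (auto simp: min_def split: if_splits)
    qed (use c(1) \<xi> in \<open>auto simp: min_def field_simps\<close>)
  qed
  \<comment> \<open>Left of \<open>\<zeta>\<^sub>0\<close> the larger root exceeds its value at
    \<open>\<eta>\<close>, so the minimum over this compact part is the minimum over all parameters
    between \<xi> and \<eta>. The minimum point shows that \<open>A\<close> is nonempty.\<close>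
  obtain \<zeta>m where zm: "\<zeta>m \<in> {\<zeta>\<^sub>0..\<eta>}" "\<And>y. y \<in> {\<zeta>\<^sub>0..\<eta>} \<Longrightarrow> kp \<xi> \<zeta>m \<le> kp \<xi> y"
    using continuous_attains_inf[of "{\<zeta>\<^sub>0..\<eta>}" "kp \<xi>"] cont_kp[OF z0(1)] z0 by auto
  have zm': "kp \<xi> \<zeta>m \<le> kp \<xi> \<zeta>" if "\<xi> < \<zeta>" "\<zeta> \<le> \<eta>" for \<zeta>
  proof (cases "\<zeta> \<le> \<zeta>\<^sub>0")
    case True
    then have "kp \<xi> \<eta> < kp \<xi> \<zeta>" using z0(3) that by blast
    moreover have "kp \<xi> \<zeta>m \<le> kp \<xi> \<eta>" using zm(2)[of \<eta>] z0 by auto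
    ultimately show ?thesis by linarith
  qed (use zm(2)[of \<zeta>] that in auto)
  define S where "S = {\<zeta>m..\<eta>}"
  have S: "\<xi> < \<zeta>" "\<zeta> \<le> \<eta>" if "\<zeta> \<in> S" for \<zeta> using that zm z0 by (auto simp: S_def)
  \<comment> \<open>\<open>A\<close> collects the running minima of the larger root,
    \<open>B\<close> the running maxima of the smaller one. By \<open>Cp\<close> and
    \<open>Cm\<close> these are targets for which the respective root is valid; stated with
    nonstrict inequalities, both sets are closed.\<close>
  define A where "A = {\<zeta>\<in>S. \<forall>\<zeta>'. \<xi> < \<zeta>' \<and> \<zeta>' < \<zeta> \<longrightarrow> kp \<xi> \<zeta> \<le> kp \<xi> \<zeta>'}"
  define B where "B = {\<zeta>\<in>S. \<forall>\<zeta>'. \<xi> < \<zeta>' \<and> \<zeta>' < \<zeta> \<longrightarrow> km \<xi> \<zeta>' \<le> km \<xi> \<zeta>}"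
  have contS: "continuous_on S (kp \<xi>)" "continuous_on S (km \<xi>)"
    using cont_kp[of \<zeta>m] cont_km[of \<zeta>m] zm z0 by (auto simp: S_def)
  have cl: "closed {\<zeta> \<in> S. \<zeta> \<le> c \<or> f \<zeta> \<le> g \<zeta>}" if "continuous_on S f" "continuous_on S g"
    for c and f g :: "real \<Rightarrow> real"
  proof -
    have cS: "closed S" by (simp add: S_def)
    have "closed {\<zeta> \<in> S. f \<zeta> \<le> g \<zeta>}" by (rule continuous_on_closed_Collect_le) (use that cS in auto)
    moreover have "{\<zeta> \<in> S. \<zeta> \<le> c \<or> f \<zeta> \<le> g \<zeta>} = (S \<inter> {..c}) \<union> {\<zeta> \<in> S. f \<zeta> \<le> g \<zeta>}" by auto
    ultimately show ?thesis using cS by auto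
  qed
  have "A = S \<inter> (\<Inter>\<zeta>'\<in>{\<xi><..}. {\<zeta> \<in> S. \<zeta> \<le> \<zeta>' \<or> kp \<xi> \<zeta> \<le> kp \<xi> \<zeta>'})"
    unfolding A_def by (auto simp: not_less) (meson greaterThan_iff leD)
  moreover have "closed S" by (simp add: S_def)
  ultimately have clA: "closed A" by (auto intro!: cl contS continuous_on_const)
  have "B = S \<inter> (\<Inter>\<zeta>'\<in>{\<xi><..}. {\<zeta> \<in> S. \<zeta> \<le> \<zeta>' \<or> km \<xi> \<zeta>' \<le> km \<xi> \<zeta>})"
    unfolding B_def by (auto simp: not_less) (meson greaterThan_iff leD)
  moreover have "closed S" by (simp add: S_def)
  ultimately have clB: "closed B" by (auto intro!: cl contS continuous_on_const)
  have "S \<subseteq> A \<union> B"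
  proof
    fix \<zeta> assume z: "\<zeta> \<in> S"
    then have d: "a < \<xi>" "\<xi> < \<zeta>" "\<zeta> < b" using S[OF z] \<xi> by auto
    obtain k where k: "valid_slope k \<xi> \<zeta>" using ex1_implies_ex[OF valid_slope_ex1[OF d]] by blast
    have le: "km \<xi> \<zeta>' \<le> k \<and> k \<le> kp \<xi> \<zeta>'" if "\<xi> < \<zeta>'" "\<zeta>' < \<zeta>" for \<zeta>'
      using valid_slope_bounds[OF k d(1) that d(3)] .
    have "k = km \<xi> \<zeta> \<or> k = kp \<xi> \<zeta>" using k slope_form_iff(2)[OF d] by (auto simp: valid_slope_def)
    then show "\<zeta> \<in> A \<union> B" using le z by (auto simp: A_def B_def)
  qed
  moreover have "A \<inter> B \<inter> S = {}"
  proof -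
    have False if z: "\<zeta> \<in> A" "\<zeta> \<in> B" for \<zeta>
    proof -
      have d: "a < \<xi>" "\<xi> < \<zeta>" "\<zeta> < b" "\<zeta> \<le> \<eta>" using S[of \<zeta>] z \<xi> by (auto simp: A_def)
      have "valid_slope (kp \<xi> \<zeta>) \<xi> \<zeta>" "valid_slope (km \<xi> \<zeta>) \<xi> \<zeta>"
        using Cp[of \<zeta>] Cm[of \<zeta>] d z by (auto simp: A_def B_def)
      then show False using valid_slope_ex1[OF d(1-3)] km_less_kp[OF d(1-3)] by (metis less_irrefl)
    qed
    then show ?thesis by auto
  qed
  moreover have "A \<inter> S \<noteq> {}"
    using zm zm' z0 by (auto simp: A_def S_def intro!: exI[of _ \<zeta>m])
  moreover have "B \<inter> S \<noteq> {}"
    using zm b1 \<xi> by (auto simp: B_def S_def intro!: exI[of _ \<eta>])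
  moreover have "connected S" by (simp add: S_def)
  ultimately show False using clA clB unfolding connected_closed by blast
qed

text \<open>The slope to a farther target has to clear the points on the way, so it is at most the
  larger root there. Equality would persist between the two targets and make the boundary an
  elliptic arc.\<close>

lemma kp_antitone:
  assumes \<xi>: "a < \<xi>" "\<xi> < \<eta>\<^sub>1" "\<eta>\<^sub>1 < \<eta>\<^sub>2" "\<eta>\<^sub>2 < b"
  shows "kp \<xi> \<eta>\<^sub>2 < kp \<xi> \<eta>\<^sub>1"
proof -
  have le: "kp \<xi> \<zeta>\<^sub>2 \<le> kp \<xi> \<zeta>\<^sub>1" if "\<xi> < \<zeta>\<^sub>1" "\<zeta>\<^sub>1 \<le> \<zeta>\<^sub>2" "\<zeta>\<^sub>2 < b" for \<zeta>\<^sub>1 \<zeta>\<^sub>2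
  proof (cases "\<zeta>\<^sub>1 = \<zeta>\<^sub>2")
    case False
    then show ?thesis using valid_slope_bounds[OF valid_kp[of \<xi> \<zeta>\<^sub>2], of \<zeta>\<^sub>1] that \<xi> by auto
  qed simp
  show ?thesis
  proof (rule ccontr)
    assume "\<not> ?thesis"
    then have e: "kp \<xi> \<eta>\<^sub>2 = kp \<xi> \<eta>\<^sub>1" using le[of \<eta>\<^sub>1 \<eta>\<^sub>2] \<xi> by auto
    have "slope_form \<rho> s (\<gamma> \<xi>) (kp \<xi> \<eta>\<^sub>1) (\<gamma> \<zeta>) = 0" if z: "\<zeta> \<in> {\<eta>\<^sub>1..\<eta>\<^sub>2}" for \<zeta>
    proof -
      have "kp \<xi> \<zeta> = kp \<xi> \<eta>\<^sub>1" using le[of \<eta>\<^sub>1 \<zeta>] le[of \<zeta> \<eta>\<^sub>2] e z \<xi> by auto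
      moreover have "valid_slope (kp \<xi> \<zeta>) \<xi> \<zeta>" using valid_kp[of \<xi> \<zeta>] z \<xi> by auto
      ultimately show ?thesis by (simp add: valid_slope_def)
    qed
    then show False using no_coincidence[OF \<xi>] by blast
  qed
qed

text \<open>A target beyond \<open>\<eta>\<close> leaves room: its slope is strictly smaller than
  \<open>kp \<xi> \<eta>\<close>, yet still at least \<open>km \<xi> \<zeta>\<close>.\<close>

lemma below_strict:
  assumes \<xi>: "a < \<xi>" "\<xi> < \<zeta>" "\<zeta> < \<eta>" "\<eta> < b"
  shows "slope_form \<rho> s (\<gamma> \<xi>) (kp \<xi> \<eta>) (\<gamma> \<zeta>) < 0"
proof -
  define \<eta>' where "\<eta>' = (\<eta> + b) / 2"
  have \<eta>': "\<eta> < \<eta>'" "\<eta>' < b" using \<xi> by (auto simp: \<eta>'_def)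
  have d: "a < \<xi>" "\<xi> < \<zeta>" "\<zeta> < b" using \<xi> by auto
  have "km \<xi> \<zeta> \<le> kp \<xi> \<eta>'"
    using valid_slope_bounds[OF valid_kp[of \<xi> \<eta>'], of \<zeta>] \<eta>' \<xi> by auto
  also have "\<dots> < kp \<xi> \<eta>" using kp_antitone[of \<xi> \<eta> \<eta>'] \<eta>' \<xi> by auto
  finally show ?thesis
    using slope_form_iff(3)[OF d] disc_pos[OF d] kp_antitone[OF \<xi>] by auto
qed

text \<open>For points close to the start \<open>k\<close> lies between the two roots, so the form
  is nonpositive there; it vanishes at the start itself. The claim is the sign of its derivative at
  the start.\<close>

lemma tangent_slope_le:
  assumes \<xi>: "a < \<xi>" "\<xi> < \<eta>" "\<eta> < b" and t: "(\<gamma> has_vector_derivative t) (at \<xi>)" and k: "kp \<xi> \<eta> < k"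
  shows "inner (\<gamma> \<xi>) t \<le> k * (s * wedge (\<gamma> \<xi>) t)"
proof (rule ccontr)
  assume n: "\<not> ?thesis"
  define p where "p = \<gamma> \<xi>"
  define P where "P = (norm p)\<^sup>2"
  define S where "S = \<rho> - P"
  have P: "P > 0" and S: "S > 0" using nz[of \<xi>] bounded[of \<xi>] \<xi> by (auto simp: P_def S_def p_def)
  define f where "f \<zeta> = \<rho> * (k * (s * wedge p (\<gamma> \<zeta>)))\<^sup>2
     - 2 * S * inner p (\<gamma> \<zeta>) * (k * (s * wedge p (\<gamma> \<zeta>)))
     + P * (wedge p (\<gamma> \<zeta>))\<^sup>2 + S * (inner p (\<gamma> \<zeta>))\<^sup>2 - P\<^sup>2 * S" for \<zeta>
  have f: "f \<zeta> = slope_form \<rho> s p k (\<gamma> \<zeta>)" for \<zeta>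
    by (simp add: f_def slope_form_def S_def P_def)
  have dR: "((\<lambda>\<zeta>. Re (\<gamma> \<zeta>)) has_real_derivative Re t) (at \<xi>)" "((\<lambda>\<zeta>. Im (\<gamma> \<zeta>)) has_real_derivative Im t) (at \<xi>)"
    using t unfolding has_real_derivative_iff_has_vector_derivative
    by (auto intro: bounded_linear.has_vector_derivative[OF bounded_linear_Re]
        bounded_linear.has_vector_derivative[OF bounded_linear_Im])
  have dX: "((\<lambda>\<zeta>. inner p (\<gamma> \<zeta>)) has_real_derivative inner p t) (at \<xi>)"
    and dY: "((\<lambda>\<zeta>. wedge p (\<gamma> \<zeta>)) has_real_derivative wedge p t) (at \<xi>)"
    unfolding inner_complex_def wedge_def by (intro DERIV_add DERIV_diff DERIV_cmult dR)+
  have X0: "inner p (\<gamma> \<xi>) = P" and Y0: "wedge p (\<gamma> \<xi>) = 0"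
    by (auto simp: p_def P_def power2_norm_eq_inner)
  have "(f has_real_derivative 2 * S * P * (inner p t - k * (s * wedge p t))) (at \<xi>)"
    unfolding f_def
    by (rule derivative_eq_intros dX dY refl | simp add: X0 Y0 algebra_simps)+
  moreover have "2 * S * P * (inner p t - k * (s * wedge p t)) > 0"
    using n P S by (simp add: p_def)
  ultimately obtain d where d: "d > 0" "\<And>h. 0 < h \<Longrightarrow> h < d \<Longrightarrow> f \<xi> < f (\<xi> + h)"
    using DERIV_pos_inc_right by blast
  have f0: "f \<xi> = 0" unfolding f_def X0 Y0 by (simp add: power2_eq_square)
  have "\<forall>\<^sub>F \<zeta> in at_right \<xi>. \<xi> < \<zeta> \<and> \<zeta> < b \<and> k < kp \<xi> \<zeta>" using kp_large[of \<xi> k] \<xi> by auto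
  moreover have "\<forall>\<^sub>F \<zeta> in at_right \<xi>. \<zeta> < min \<eta> (\<xi> + d)"
    using \<xi> d by (auto simp: eventually_at_right_field intro!: exI[of _ "min \<eta> (\<xi> + d)"])
  ultimately have "\<forall>\<^sub>F \<zeta> in at_right \<xi>. (\<xi> < \<zeta> \<and> \<zeta> < b \<and> k < kp \<xi> \<zeta>) \<and> \<zeta> < min \<eta> (\<xi> + d)"
    by (rule eventually_conj)
  then have "\<exists>\<zeta>. (\<xi> < \<zeta> \<and> \<zeta> < b \<and> k < kp \<xi> \<zeta>) \<and> \<zeta> < min \<eta> (\<xi> + d)"
    by (rule eventually_happens'[OF trivial_limit_at_right_real])
  then obtain \<zeta> where \<zeta>: "\<xi> < \<zeta>" "\<zeta> < b" "k < kp \<xi> \<zeta>" "\<zeta> < \<eta>" "\<zeta> < \<xi> + d"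
    by auto
  have "f \<zeta> > 0" using d(2)[of "\<zeta> - \<xi>"] \<zeta> f0 by simp
  moreover have "km \<xi> \<zeta> < k" using below_strict[of \<xi> \<zeta> \<eta>] slope_form_iff(3)[of \<xi> \<zeta> "kp \<xi> \<eta>"] \<zeta> \<xi> k by auto
  then have "f \<zeta> \<le> 0"
    using slope_form_iff(1)[of \<xi> \<zeta> k] \<zeta> \<xi> disc_pos[of \<xi> \<zeta>] by (auto simp: f p_def)
  ultimately show False by simp
qed

text \<open>\<open>tangent_slope_le\<close> holds for all large \<open>k\<close>, which is possible
  only if the coefficient of \<open>k\<close> is nonnegative.\<close>

lemma tangent_wedge_nonneg:
  assumes \<xi>: "a < \<xi>" "\<xi> < b" and t: "(\<gamma> has_vector_derivative t) (at \<xi>)"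
  shows "s * wedge (\<gamma> \<xi>) t \<ge> 0" "s * wedge (\<gamma> \<xi>) t = 0 \<Longrightarrow> inner (\<gamma> \<xi>) t \<le> 0"
proof -
  define \<eta> where "\<eta> = (\<xi> + b) / 2"
  have \<eta>: "a < \<xi>" "\<xi> < \<eta>" "\<eta> < b" using \<xi> by (auto simp: \<eta>_def)
  note le = tangent_slope_le[OF \<eta> t]
  define Y where "Y = s * wedge (\<gamma> \<xi>) t"
  show "s * wedge (\<gamma> \<xi>) t = 0 \<Longrightarrow> inner (\<gamma> \<xi>) t \<le> 0"
    using le[of "kp \<xi> \<eta> + 1"] by (metis less_add_one mult_zero_right)
  show "s * wedge (\<gamma> \<xi>) t \<ge> 0"
  proof (rule ccontr)
    assume "\<not> ?thesis"
    then have Y: "Y < 0" by (simp add: Y_def)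
    define k where "k = max (kp \<xi> \<eta> + 1) ((inner (\<gamma> \<xi>) t - 1) / Y)"
    have "k \<ge> (inner (\<gamma> \<xi>) t - 1) / Y" by (simp add: k_def)
    then have "k * Y \<le> inner (\<gamma> \<xi>) t - 1" using Y by (simp add: neg_divide_le_eq)
    moreover have "k > kp \<xi> \<eta>" by (simp add: k_def)
    ultimately show False using le[of k] by (simp add: Y_def)
  qed
qed

text \<open>If the tangent were radial, the sector and its mirror image would bound its radial
  component from both sides by 0, and the tangent would vanish.\<close>

lemma tangent_transversal:
  assumes \<xi>: "a < \<xi>" "\<xi> < b" and t: "(\<gamma> has_vector_derivative t) (at \<xi>)" "t \<noteq> 0"
  shows "s * wedge (\<gamma> \<xi>) t > 0"
proof -
  interpret m: arc_sector \<rho> "- s" "- b" "- a" "\<lambda>x. \<gamma> (- x)" D by (rule mirror)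
  have "((\<lambda>x. \<gamma> (- x)) has_vector_derivative - t) (at (- \<xi>))"
  proof -
    have "((\<gamma> \<circ> uminus) has_vector_derivative (- 1) *\<^sub>R t) (at (- \<xi>))"
      by (rule vector_diff_chain_at) (auto intro!: derivative_eq_intros t(1))
    then show ?thesis by (simp add: o_def)
  qed
  then have "s * wedge (\<gamma> \<xi>) t = 0 \<Longrightarrow> - inner (\<gamma> \<xi>) t \<le> 0"
    using m.tangent_wedge_nonneg(2)[of "- \<xi>" "- t"] \<xi> by simp
  moreover have "(inner (\<gamma> \<xi>) t)\<^sup>2 + (wedge (\<gamma> \<xi>) t)\<^sup>2 \<noteq> 0"
    unfolding inner_wedge_sq using nz[OF \<xi>] t(2) by simp
  moreover have "s * wedge (\<gamma> \<xi>) t = 0 \<longleftrightarrow> wedge (\<gamma> \<xi>) t = 0" using s by auto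
  ultimately show ?thesis using tangent_wedge_nonneg[OF \<xi> t(1)] by force
qed

lemma forward_arc:
  assumes \<xi>: "a < \<xi>" "\<xi> < \<eta>" "\<eta> < b" and f: "free_arc D \<rho> (\<gamma> \<xi>) (\<gamma> \<eta>) \<theta> w"
  shows "cos \<theta> = lob_cos \<rho> (\<gamma> \<xi>) (\<gamma> \<eta>)"
    and "0 < \<phi> \<Longrightarrow> \<phi> < \<theta> \<Longrightarrow> \<exists>\<zeta>\<in>{a<..<b}. \<exists>r>1. cos \<phi> *\<^sub>R \<gamma> \<xi> + sin \<phi> *\<^sub>R w = r *\<^sub>R \<gamma> \<zeta>"
    and "(\<gamma> has_vector_derivative t) (at \<xi>) \<Longrightarrow> t \<noteq> 0 \<Longrightarrow> s * wedge w t > 0"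
proof -
  define p where "p = \<gamma> \<xi>"
  have F: "0 < \<theta>" "\<theta> < pi" "(norm w)\<^sup>2 = \<rho> - (norm (\<gamma> \<xi>))\<^sup>2" "cos \<theta> *\<^sub>R \<gamma> \<xi> + sin \<theta> *\<^sub>R w = \<gamma> \<eta>"
    "\<And>\<phi>. 0 < \<phi> \<Longrightarrow> \<phi> < \<theta> \<Longrightarrow> cos \<phi> *\<^sub>R \<gamma> \<xi> + sin \<phi> *\<^sub>R w \<notin> D"
    using f by (auto simp: free_arc_def)
  define k where "k = inner (\<gamma> \<xi>) w / (s * wedge (\<gamma> \<xi>) w)"
  have W: "s * wedge (\<gamma> \<xi>) w > 0" using valid_slope_iff_free(1)[OF \<xi> F(1-4)] .
  have "valid_slope k \<xi> \<eta>" using valid_slope_iff_free(2)[OF \<xi> F(1-4)] f by (simp add: k_def)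
  then have k: "k = kp \<xi> \<eta>" using valid_slope_ex1[OF \<xi>] valid_kp[OF \<xi>] by blast
  have P: "(norm (\<gamma> \<xi>))\<^sup>2 > 0" using nz[of \<xi>] \<xi> by simp
  have \<rho>: "\<rho> > 0" using rho_pos[of \<xi>] \<xi> by auto
  have "\<rho> * (kp \<xi> \<eta> * (s * wedge (\<gamma> \<xi>) (\<gamma> \<eta>))) = (\<rho> - (norm (\<gamma> \<xi>))\<^sup>2) * inner (\<gamma> \<xi>) (\<gamma> \<eta>) +
      (norm (\<gamma> \<xi>))\<^sup>2 * sqrt (arc_disc \<rho> (\<gamma> \<xi>) (\<gamma> \<eta>))"
  proof -
    have "\<rho> * (N / (\<rho> * Y) * Y) = N" if "Y > 0" for N Y :: real using that \<rho> by simp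
    then show ?thesis unfolding slope_plus_def using orient[OF \<xi>] by blast
  qed
  moreover have "(norm (\<gamma> \<xi>))\<^sup>2 * cos \<theta> = inner (\<gamma> \<xi>) (\<gamma> \<eta>) - kp \<xi> \<eta> * (s * wedge (\<gamma> \<xi>) (\<gamma> \<eta>))"
    unfolding k[symmetric] by (rule slope_cos[OF _ _ k_def W F(4)]) (use \<xi> in auto)
  ultimately have "\<rho> * ((norm (\<gamma> \<xi>))\<^sup>2 * cos \<theta>) = (norm (\<gamma> \<xi>))\<^sup>2 * (inner (\<gamma> \<xi>) (\<gamma> \<eta>) - sqrt (arc_disc \<rho> (\<gamma> \<xi>) (\<gamma> \<eta>)))"
    by (simp only: right_diff_distrib left_diff_distrib)
  then have "(norm (\<gamma> \<xi>))\<^sup>2 * (\<rho> * cos \<theta>) = (norm (\<gamma> \<xi>))\<^sup>2 * (inner (\<gamma> \<xi>) (\<gamma> \<eta>) - sqrt (arc_disc \<rho> (\<gamma> \<xi>) (\<gamma> \<eta>)))"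
    by (simp only: mult.left_commute)
  then have "\<rho> * cos \<theta> = inner (\<gamma> \<xi>) (\<gamma> \<eta>) - sqrt (arc_disc \<rho> (\<gamma> \<xi>) (\<gamma> \<eta>))"
    using P by (simp only: mult_left_cancel)
  then show "cos \<theta> = lob_cos \<rho> (\<gamma> \<xi>) (\<gamma> \<eta>)" using \<rho> by (simp add: lob_cos_def field_simps)
  {
    assume \<phi>: "0 < \<phi>" "\<phi> < \<theta>"
    define z where "z = cos \<phi> *\<^sub>R \<gamma> \<xi> + sin \<phi> *\<^sub>R w"
    have "s * wedge (\<gamma> \<xi>) z = sin \<phi> * (s * wedge (\<gamma> \<xi>) w)" by (simp add: z_def wedge_add)
    moreover have "s * wedge z (\<gamma> \<eta>) = sin (\<theta> - \<phi>) * (s * wedge (\<gamma> \<xi>) w)"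
      unfolding F(4)[symmetric] z_def
      by (simp add: wedge_add wedge_commute[of w "\<gamma> \<xi>"] sin_diff algebra_simps)
    moreover have "sin \<phi> > 0" "sin (\<theta> - \<phi>) > 0" using \<phi> F by (auto intro!: sin_gt_zero)
    ultimately have "s * wedge (\<gamma> \<xi>) z > 0" "s * wedge z (\<gamma> \<eta>) > 0" using W by (metis mult_pos_pos)+
    then obtain \<zeta> r where \<zeta>: "\<xi> < \<zeta>" "\<zeta> < \<eta>" "r > 0" "z = r *\<^sub>R \<gamma> \<zeta>" using ray_between[OF \<xi>] by metis
    have "z \<notin> D" using F(5)[OF \<phi>] by (simp add: z_def)
    then have r1: "r \<ge> 1" using radial[of \<zeta> r] \<zeta> \<xi> by auto
    have "slope_form \<rho> s (\<gamma> \<xi>) k z = 0"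
      unfolding z_def by (rule slope_form_on_arc) (use s F(3) W in \<open>auto simp: k_def\<close>)
    moreover have "slope_form \<rho> s (\<gamma> \<xi>) k (\<gamma> \<zeta>) < 0" using below_strict[of \<xi> \<zeta> \<eta>] \<zeta> \<xi> k by auto
    ultimately have "r \<noteq> 1" using \<zeta>(4) by auto
    then show "\<exists>\<zeta>\<in>{a<..<b}. \<exists>r>1. cos \<phi> *\<^sub>R \<gamma> \<xi> + sin \<phi> *\<^sub>R w = r *\<^sub>R \<gamma> \<zeta>"
      using r1 \<zeta> \<xi> by (intro bexI[of _ \<zeta>] exI[of _ r]) (auto simp: z_def)
  }
  {
    assume t: "(\<gamma> has_vector_derivative t) (at \<xi>)" "t \<noteq> 0"
    have Yt: "s * wedge (\<gamma> \<xi>) t > 0" using tangent_transversal[of \<xi> t] t \<xi> by auto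
    \<comment> \<open>A farther target provides a slope \<open>k'\<close> below \<open>k\<close>
      that still dominates the tangent; the gap between \<open>k'\<close> and \<open>k\<close> makes
      the inequality strict.\<close>
    define \<eta>' where "\<eta>' = (\<eta> + b) / 2"
    have \<eta>': "\<eta> < \<eta>'" "\<eta>' < b" using \<xi> by (auto simp: \<eta>'_def)
    define k' where "k' = (kp \<xi> \<eta>' + k) / 2"
    have k': "kp \<xi> \<eta>' < k'" "k' < k" using kp_antitone[of \<xi> \<eta> \<eta>'] \<eta>' \<xi> k by (auto simp: k'_def)
    have "inner (\<gamma> \<xi>) t \<le> k' * (s * wedge (\<gamma> \<xi>) t)"
      using tangent_slope_le[of \<xi> \<eta>' t k'] t k' \<eta>' \<xi> by auto
    also have "\<dots> < k * (s * wedge (\<gamma> \<xi>) t)" using k'(2) Yt by (rule mult_strict_right_mono)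
    finally have "inner (\<gamma> \<xi>) t * (s * wedge (\<gamma> \<xi>) w) < k * (s * wedge (\<gamma> \<xi>) t) * (s * wedge (\<gamma> \<xi>) w)"
      using W by (rule mult_strict_right_mono)
    also have "\<dots> = inner (\<gamma> \<xi>) w * (s * wedge (\<gamma> \<xi>) t)" using W unfolding k_def by auto
    finally have "0 < inner (\<gamma> \<xi>) w * (s * wedge (\<gamma> \<xi>) t) - inner (\<gamma> \<xi>) t * (s * wedge (\<gamma> \<xi>) w)" by simp
    also have "\<dots> = (norm (\<gamma> \<xi>))\<^sup>2 * (s * wedge w t)"
      unfolding inner_complex_def wedge_def cmod_power2 by (simp add: algebra_simps power2_eq_square)
    finally show "s * wedge w t > 0" using P by (rule zero_less_mult_pos)
  }
qed

end

section \<open>Outer arcs\<close>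

lemma newton_solution_harmonic:
  assumes "newton_solution (\<lambda>z. - (\<omega>\<^sup>2 *\<^sub>R z)) T z v" "\<omega> > 0" "s \<in> {0..T}"
  shows "z s = cos (\<omega> * s) *\<^sub>R z 0 + sin (\<omega> * s) *\<^sub>R (v 0 /\<^sub>R \<omega>)"
    and "v s = \<omega> *\<^sub>R (cos (\<omega> * s) *\<^sub>R (v 0 /\<^sub>R \<omega>) - sin (\<omega> * s) *\<^sub>R z 0)"
proof -
  have dz: "(z has_vector_derivative v x) (at x within {0..T})"
    and dv: "(v has_vector_derivative - (\<omega>\<^sup>2 *\<^sub>R z x)) (at x within {0..T})" if "x \<in> {0..T}" for x
    using assms that by (auto simp: newton_solution_def)
  \<comment> \<open>\<open>A\<close> and \<open>B\<close> are position and scaled velocity rotated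
    back by the angle \<omega> x in phase space, hence constants of the motion.\<close>
  define A where "A x = cos (\<omega> * x) *\<^sub>R z x - (sin (\<omega> * x) / \<omega>) *\<^sub>R v x" for x
  define B where "B x = sin (\<omega> * x) *\<^sub>R z x + (cos (\<omega> * x) / \<omega>) *\<^sub>R v x" for x
  have "(A has_vector_derivative 0) (at x within {0..T})" if "x \<in> {0..T}" for x
    unfolding A_def using assms(2)
    by (auto intro!: derivative_eq_intros dz[OF that] dv[OF that] simp: algebra_simps power2_eq_square)
  then obtain c where c: "\<And>x. x \<in> {0..T} \<Longrightarrow> A x = c"
    using has_vector_derivative_zero_constant[of "{0..T}" A] by auto
  have "(B has_vector_derivative 0) (at x within {0..T})" if "x \<in> {0..T}" for x
    unfolding B_def using assms(2)
    by (auto intro!: derivative_eq_intros dz[OF that] dv[OF that] simp: algebra_simps power2_eq_square)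
  then obtain d where d: "\<And>x. x \<in> {0..T} \<Longrightarrow> B x = d"
    using has_vector_derivative_zero_constant[of "{0..T}" B] by auto
  have "0 \<in> {0..T}" using assms(3) by auto
  then have A0: "A s = z 0" and B0: "B s = v 0 /\<^sub>R \<omega>"
    using c[of 0] d[of 0] c[of s] d[of s] assms by (auto simp: A_def B_def divide_inverse_commute)
  have rot: "c *\<^sub>R (c *\<^sub>R x - (d / \<omega>) *\<^sub>R y) + d *\<^sub>R (d *\<^sub>R x + (c / \<omega>) *\<^sub>R y) = (c\<^sup>2 + d\<^sup>2) *\<^sub>R x"
     "c *\<^sub>R (d *\<^sub>R x + (c / \<omega>) *\<^sub>R y) - d *\<^sub>R (c *\<^sub>R x - (d / \<omega>) *\<^sub>R y) = ((c\<^sup>2 + d\<^sup>2) / \<omega>) *\<^sub>R y"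
    for c d and x y :: complex
    by (simp_all add: algebra_simps power2_eq_square add_divide_distrib)
  have "cos (\<omega> * s) *\<^sub>R A s + sin (\<omega> * s) *\<^sub>R B s =
      ((cos (\<omega> * s))\<^sup>2 + (sin (\<omega> * s))\<^sup>2) *\<^sub>R z s"
    unfolding A_def B_def by (rule rot)
  then show "z s = cos (\<omega> * s) *\<^sub>R z 0 + sin (\<omega> * s) *\<^sub>R (v 0 /\<^sub>R \<omega>)"
    by (simp add: A0 B0)
  have "cos (\<omega> * s) *\<^sub>R B s - sin (\<omega> * s) *\<^sub>R A s =
      (((cos (\<omega> * s))\<^sup>2 + (sin (\<omega> * s))\<^sup>2) / \<omega>) *\<^sub>R v s"
    unfolding A_def B_def by (rule rot)
  then have "\<omega> *\<^sub>R (cos (\<omega> * s) *\<^sub>R B s - sin (\<omega> * s) *\<^sub>R A s) = v s"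
    using assms(2) by simp
  then show "v s = \<omega> *\<^sub>R (cos (\<omega> * s) *\<^sub>R (v 0 /\<^sub>R \<omega>) - sin (\<omega> * s) *\<^sub>R z 0)"
    by (simp add: A0 B0)
qed

lemma harmonic_newton_solution:
  "newton_solution (\<lambda>z. - (\<omega>\<^sup>2 *\<^sub>R z)) T (\<lambda>s. cos (\<omega> * s) *\<^sub>R p + sin (\<omega> * s) *\<^sub>R w)
     (\<lambda>s. \<omega> *\<^sub>R (cos (\<omega> * s) *\<^sub>R w - sin (\<omega> * s) *\<^sub>R p))"
  unfolding newton_solution_def
  by (auto intro!: derivative_eq_intros simp: algebra_simps power2_eq_square)

text \<open>A \<open>free_arc\<close> without a bound on the angle, since the outer-arc property
  does not say how far an arc turns. The bound \<open>pi\<close> is recovered in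
  \<open>hooke_less_pi\<close>.\<close>

definition hooke_arc :: "complex set \<Rightarrow> real \<Rightarrow> complex \<Rightarrow> complex \<Rightarrow> real \<Rightarrow> complex \<Rightarrow> bool" where
  "hooke_arc D \<rho> p q \<theta> w \<longleftrightarrow> 0 < \<theta> \<and> (norm w)\<^sup>2 = \<rho> - (norm p)\<^sup>2 \<and>
     cos \<theta> *\<^sub>R p + sin \<theta> *\<^sub>R w = q \<and> (\<forall>\<phi>\<in>{0<..<\<theta>}. cos \<phi> *\<^sub>R p + sin \<phi> *\<^sub>R w \<notin> D)"

lemma free_arc_hooke: "free_arc D \<rho> p q \<theta> w \<longleftrightarrow> hooke_arc D \<rho> p q \<theta> w \<and> \<theta> < pi"
  by (auto simp: free_arc_def hooke_arc_def)

lemma hooke_arc_norm: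
  assumes "hooke_arc D \<rho> p q \<theta> w"
  shows "(norm (cos \<phi> *\<^sub>R p + sin \<phi> *\<^sub>R w))\<^sup>2 + (norm (cos \<phi> *\<^sub>R w - sin \<phi> *\<^sub>R p))\<^sup>2 = \<rho>"
proof -
  have "(norm (c *\<^sub>R p + d *\<^sub>R w))\<^sup>2 + (norm (c *\<^sub>R w - d *\<^sub>R p))\<^sup>2 = (c\<^sup>2 + d\<^sup>2) * ((norm p)\<^sup>2 + (norm w)\<^sup>2)"
    for c d unfolding cmod_power2 by (simp add: algebra_simps power2_eq_square)
  from this[of "cos \<phi>" "sin \<phi>"] show ?thesis using assms by (simp add: hooke_arc_def)
qed

lemma hooke_arc_reverse:
  assumes "hooke_arc D \<rho> p q \<theta> w"
  shows "hooke_arc D \<rho> q p \<theta> (sin \<theta> *\<^sub>R p - cos \<theta> *\<^sub>R w)"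
proof -
  have q: "q = cos \<theta> *\<^sub>R p + sin \<theta> *\<^sub>R w" using assms by (simp add: hooke_arc_def)
  have e: "cos \<phi> *\<^sub>R q + sin \<phi> *\<^sub>R (sin \<theta> *\<^sub>R p - cos \<theta> *\<^sub>R w) = cos (\<theta> - \<phi>) *\<^sub>R p + sin (\<theta> - \<phi>) *\<^sub>R w" for \<phi>
    unfolding q by (simp add: cos_diff sin_diff algebra_simps)
  have n: "norm (sin \<theta> *\<^sub>R p - cos \<theta> *\<^sub>R w) = norm (cos \<theta> *\<^sub>R w - sin \<theta> *\<^sub>R p)"
    by (simp add: norm_minus_commute)
  show ?thesis
    unfolding hooke_arc_def e n
    using assms hooke_arc_norm[OF assms, of \<theta>] q by (auto simp: hooke_arc_def)
qed

section \<open>Outer arcs in angular time\<close>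

context refraction_domain
begin

definition \<rho> :: real where "\<rho> = 2 * \<E> / \<omega>\<^sup>2"

lemma rho_pos: "\<rho> > 0"
  using \<omega>_pos \<E>_pos by (simp add: \<rho>_def)

lemma V\<^sub>E_rho: "V\<^sub>E z = \<omega>\<^sup>2 / 2 * (\<rho> - (norm z)\<^sup>2)"
  using \<omega>_pos by (simp add: V\<^sub>E_def \<rho>_def field_simps)

lemma closure_norm: "z \<in> closure D \<Longrightarrow> (norm z)\<^sup>2 < \<rho>"
proof -
  assume "z \<in> closure D"
  then have "norm z < sqrt (2 * \<E>) / \<omega>" using D_in_Hill by auto
  then have "(norm z)\<^sup>2 < (sqrt (2 * \<E>) / \<omega>)\<^sup>2" by (intro power_strict_mono) auto
  also have "\<dots> = \<rho>" using \<E>_pos by (simp add: \<rho>_def power_divide)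
  finally show ?thesis .
qed

lemma curve_frontier: "\<xi> \<in> {0..L} \<Longrightarrow> \<gamma> \<xi> \<in> frontier D"
  using boundary by auto

lemma curve_notin: "\<xi> \<in> {0..L} \<Longrightarrow> \<gamma> \<xi> \<notin> D"
  using curve_frontier[of \<xi>] D_open by (auto simp: frontier_def interior_open)

lemma curve_closure: "\<xi> \<in> {0..L} \<Longrightarrow> \<gamma> \<xi> \<in> closure D"
  using curve_frontier[of \<xi>] by (auto simp: frontier_def)

lemma curve_nonzero: "\<xi> \<in> {0..L} \<Longrightarrow> \<gamma> \<xi> \<noteq> 0"
  using curve_notin[of \<xi>] zero_in_D by auto

lemma continuous_on_curve: "continuous_on {0..L} \<gamma>"
  using curve_diff by (auto intro: differentiable_imp_continuous_on simp: differentiable_on_def)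

lemma curve_vector_derivative:
  assumes "\<xi> \<in> {0<..<L}"
  shows "(\<gamma> has_vector_derivative tangent \<xi>) (at \<xi>)"
proof -
  have "(\<gamma> has_vector_derivative tangent \<xi>) (at \<xi> within {0..L})"
    unfolding tangent_def using curve_diff[of \<xi>] assms
    by (auto simp: vector_derivative_works[symmetric])
  then show ?thesis using assms by (simp add: at_within_Icc_at)
qed

lemma norm_tangent: "\<xi> \<in> {0..L} \<Longrightarrow> norm (tangent \<xi>) = 1"
  using arc_length by (simp add: tangent_def)

lemma curve_inj: "\<xi> \<in> {0<..<L} \<Longrightarrow> \<eta> \<in> {0<..<L} \<Longrightarrow> \<gamma> \<xi> = \<gamma> \<eta> \<longleftrightarrow> \<xi> = \<eta>"
  using simple_curve by (auto simp: inj_on_def)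

lemma outer_arc_hooke:
  assumes "outer_arc p q T z"
  obtains w where "hooke_arc D \<rho> p q (\<omega> * T) w"
    "\<And>s. s \<in> {0..T} \<Longrightarrow> z s = cos (\<omega> * s) *\<^sub>R p + sin (\<omega> * s) *\<^sub>R w"
proof -
  obtain v where v: "newton_solution harmonic_force T z v" "\<And>s. s \<in> {0..T} \<Longrightarrow> (norm (v s))\<^sup>2 / 2 = V\<^sub>E (z s)"
    and T: "T > 0" and nD: "\<And>s. s \<in> {0<..<T} \<Longrightarrow> z s \<notin> D" and z: "z 0 = p" "z T = q"
    using assms by (auto simp: outer_arc_def)
  define w where "w = v 0 /\<^sub>R \<omega>"
  have zs: "z s = cos (\<omega> * s) *\<^sub>R p + sin (\<omega> * s) *\<^sub>R w" if "s \<in> {0..T}" for s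
    using newton_solution_harmonic(1)[OF _ \<omega>_pos that, of z v] v(1) z
    by (simp add: harmonic_force_def[abs_def] w_def)
  have "(norm (v 0))\<^sup>2 / 2 = V\<^sub>E p" using v(2)[of 0] T z by simp
  then have "(norm w)\<^sup>2 = \<rho> - (norm p)\<^sup>2"
    using \<omega>_pos by (simp add: w_def V\<^sub>E_rho power_mult_distrib field_simps)
  moreover have "cos \<phi> *\<^sub>R p + sin \<phi> *\<^sub>R w \<notin> D" if "\<phi> \<in> {0<..<\<omega> * T}" for \<phi>
    using nD[of "\<phi> / \<omega>"] zs[of "\<phi> / \<omega>"] that \<omega>_pos by (simp add: field_simps)
  ultimately have "hooke_arc D \<rho> p q (\<omega> * T) w"
    using zs[of T] T z \<omega>_pos by (auto simp: hooke_arc_def)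
  then show ?thesis using that zs by blast
qed

lemma hooke_outer_arc:
  assumes "hooke_arc D \<rho> p q \<theta> w"
  shows "outer_arc p q (\<theta> / \<omega>) (\<lambda>s. cos (\<omega> * s) *\<^sub>R p + sin (\<omega> * s) *\<^sub>R w)"
  unfolding outer_arc_def
proof (intro conjI exI ballI)
  show "newton_solution harmonic_force (\<theta> / \<omega>) (\<lambda>s. cos (\<omega> * s) *\<^sub>R p + sin (\<omega> * s) *\<^sub>R w)
     (\<lambda>s. \<omega> *\<^sub>R (cos (\<omega> * s) *\<^sub>R w - sin (\<omega> * s) *\<^sub>R p))"
    unfolding harmonic_force_def[abs_def] by (rule harmonic_newton_solution)
  show "(norm (\<omega> *\<^sub>R (cos (\<omega> * s) *\<^sub>R w - sin (\<omega> * s) *\<^sub>R p)))\<^sup>2 / 2 =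
      V\<^sub>E (cos (\<omega> * s) *\<^sub>R p + sin (\<omega> * s) *\<^sub>R w)" for s
    using hooke_arc_norm[OF assms, of "\<omega> * s"] \<omega>_pos by (simp add: V\<^sub>E_rho power_mult_distrib)
  show "cos (\<omega> * s) *\<^sub>R p + sin (\<omega> * s) *\<^sub>R w \<notin> D" if "s \<in> {0<..<\<theta> / \<omega>}" for s
    using assms that \<omega>_pos by (auto simp: hooke_arc_def field_simps)
qed (use assms \<omega>_pos in \<open>auto simp: hooke_arc_def\<close>)

lemma unique_hooke_arc:
  assumes "unique_arc (outer_arc p q)"
  shows "\<exists>\<theta> w. hooke_arc D \<rho> p q \<theta> w"
    and "hooke_arc D \<rho> p q \<theta> w \<Longrightarrow> hooke_arc D \<rho> p q \<theta>' w' \<Longrightarrow>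
      \<theta> = \<theta>' \<and> (\<forall>\<phi>\<in>{0..\<theta>}. cos \<phi> *\<^sub>R p + sin \<phi> *\<^sub>R w = cos \<phi> *\<^sub>R p + sin \<phi> *\<^sub>R w')"
proof -
  obtain T z where T: "outer_arc p q T z"
    and u: "\<And>T' z'. outer_arc p q T' z' \<Longrightarrow> T' = T \<and> (\<forall>s\<in>{0..T}. z' s = z s)"
    using assms by (auto simp: unique_arc_def)
  show "\<exists>\<theta> w. hooke_arc D \<rho> p q \<theta> w" using outer_arc_hooke[OF T] by blast
  assume h: "hooke_arc D \<rho> p q \<theta> w" "hooke_arc D \<rho> p q \<theta>' w'"
  note u1 = u[OF hooke_outer_arc[OF h(1)]] and u2 = u[OF hooke_outer_arc[OF h(2)]]
  have "\<theta> = \<omega> * T" "\<theta>' = \<omega> * T" using u1 u2 \<omega>_pos by (auto simp: field_simps)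
  then have "\<theta> = \<theta>'" by simp
  moreover have "cos \<phi> *\<^sub>R p + sin \<phi> *\<^sub>R w = cos \<phi> *\<^sub>R p + sin \<phi> *\<^sub>R w'" if "\<phi> \<in> {0..\<theta>}" for \<phi>
  proof -
    have "\<phi> / \<omega> \<in> {0..T}" using that u1 \<omega>_pos by (auto simp: field_simps)
    then have "cos (\<omega> * (\<phi> / \<omega>)) *\<^sub>R p + sin (\<omega> * (\<phi> / \<omega>)) *\<^sub>R w = cos (\<omega> * (\<phi> / \<omega>)) *\<^sub>R p + sin (\<omega> * (\<phi> / \<omega>)) *\<^sub>R w'"
      using u1 u2 by metis
    then show ?thesis using \<omega>_pos by simp
  qed
  ultimately show "\<theta> = \<theta>' \<and> (\<forall>\<phi>\<in>{0..\<theta>}. cos \<phi> *\<^sub>R p + sin \<phi> *\<^sub>R w = cos \<phi> *\<^sub>R p + sin \<phi> *\<^sub>R w')"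
    by blast
qed

end

lemma closedin_sequentiallyI:
  fixes S T :: "'a::metric_space set"
  assumes "T \<subseteq> S" "\<And>x l. \<forall>n. x n \<in> T \<Longrightarrow> x \<longlonglongrightarrow> l \<Longrightarrow> l \<in> S \<Longrightarrow> l \<in> T"
  shows "closedin (top_of_set S) T"
  unfolding closedin_limpt islimpt_sequential using assms by blast

text \<open>The data of a single parameter interval. \<open>inner_radius\<close> is what the
  collision-ejection arcs provide: they run along the whole radius inside \<open>D\<close>.\<close>

locale arc_interval = refraction_domain +
  fixes a b :: real
  assumes interval: "0 \<le> a" "a < b" "b \<le> L"
    and outer_unique: "outer_arc_property a b"
    and not_antipodal: "\<And>\<xi> \<eta>. \<xi> \<in> {a<..<b} \<Longrightarrow> \<eta> \<in> {a<..<b} \<Longrightarrow> 0 \<notin> closed_segment (\<gamma> \<xi>) (\<gamma> \<eta>)"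
    and inner_radius: "\<And>\<xi> r. \<xi> \<in> {a<..<b} \<Longrightarrow> 0 \<le> r \<Longrightarrow> r < 1 \<Longrightarrow> r *\<^sub>R \<gamma> \<xi> \<in> D"
begin

lemma subset_L: "\<xi> \<in> {a<..<b} \<Longrightarrow> \<xi> \<in> {0<..<L}" "\<xi> \<in> {a<..<b} \<Longrightarrow> \<xi> \<in> {0..L}"
  using interval by auto

lemma norm_curve_less: "\<xi> \<in> {a<..<b} \<Longrightarrow> (norm (\<gamma> \<xi>))\<^sup>2 < \<rho>"
  using closure_norm[OF curve_closure] subset_L by blast

lemma hooke_ex: "\<xi> \<in> {a<..<b} \<Longrightarrow> \<eta> \<in> {a<..<b} \<Longrightarrow> \<exists>\<theta> w. hooke_arc D \<rho> (\<gamma> \<xi>) (\<gamma> \<eta>) \<theta> w"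
  and hooke_unique: "\<xi> \<in> {a<..<b} \<Longrightarrow> \<eta> \<in> {a<..<b} \<Longrightarrow>
      hooke_arc D \<rho> (\<gamma> \<xi>) (\<gamma> \<eta>) \<theta> w \<Longrightarrow> hooke_arc D \<rho> (\<gamma> \<xi>) (\<gamma> \<eta>) \<theta>' w' \<Longrightarrow>
      \<theta> = \<theta>' \<and> (\<forall>\<phi>\<in>{0..\<theta>}. cos \<phi> *\<^sub>R \<gamma> \<xi> + sin \<phi> *\<^sub>R w = cos \<phi> *\<^sub>R \<gamma> \<xi> + sin \<phi> *\<^sub>R w')"
  using outer_unique unique_hooke_arc unfolding outer_arc_property_def by blast+

text \<open>Beyond a full turn, dropping one period gives a second arc. An exact full turn can be
  run in both senses; uniqueness identifies the two, so the velocity is zero, which the Hill bound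
  excludes.\<close>

lemma hooke_less_2pi:
  assumes \<xi>: "\<xi> \<in> {a<..<b}" "\<eta> \<in> {a<..<b}" and h: "hooke_arc D \<rho> (\<gamma> \<xi>) (\<gamma> \<eta>) \<theta> w"
  shows "\<theta> < 2 * pi"
proof (rule ccontr)
  assume n: "\<not> ?thesis"
  show False
  proof (cases "\<theta> = 2 * pi")
    case True
    have e: "\<gamma> \<xi> = \<gamma> \<eta>" using h True by (simp add: hooke_arc_def)
    have "hooke_arc D \<rho> (\<gamma> \<xi>) (\<gamma> \<eta>) \<theta> (- w)"
      using hooke_arc_reverse[OF h] unfolding True e by simp
    moreover have "pi / 2 \<in> {0..\<theta>}" using True by simp
    ultimately have "cos (pi / 2) *\<^sub>R \<gamma> \<xi> + sin (pi / 2) *\<^sub>R w = cos (pi / 2) *\<^sub>R \<gamma> \<xi> + sin (pi / 2) *\<^sub>R (- w)"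
      using hooke_unique[OF \<xi> h, of \<theta> "- w"] by blast
    then have "w = - w" by simp
    then have "w = 0" by simp
    then show False using h norm_curve_less[OF \<xi>(1)] by (auto simp: hooke_arc_def)
  next
    case False
    then have g: "\<theta> - 2 * pi > 0" using n by simp
    have "\<phi> \<in> {0<..<\<theta>}" if "0 < \<phi>" "\<phi> < \<theta> - 2 * pi" for \<phi>
    proof -
      have "\<phi> < \<theta>" using that pi_gt_zero by linarith
      then show ?thesis using that by simp
    qed
    then have "hooke_arc D \<rho> (\<gamma> \<xi>) (\<gamma> \<eta>) (\<theta> - 2 * pi) w"
      using h g by (auto simp: hooke_arc_def cos_diff sin_diff)
    then show False using hooke_unique[OF \<xi> h] by fastforce
  qed
qed

lemma hooke_not_pi:
  assumes \<xi>: "\<xi> \<in> {a<..<b}" "\<eta> \<in> {a<..<b}" and h: "hooke_arc D \<rho> (\<gamma> \<xi>) (\<gamma> \<eta>) \<theta> w"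
  shows "\<theta> \<noteq> pi"
proof
  assume "\<theta> = pi"
  then have "\<gamma> \<eta> = - \<gamma> \<xi>" using h by (simp add: hooke_arc_def)
  then have "0 = (1 - 1 / 2) *\<^sub>R \<gamma> \<xi> + (1 / 2) *\<^sub>R \<gamma> \<eta>" by simp
  then have "0 \<in> closed_segment (\<gamma> \<xi>) (\<gamma> \<eta>)" unfolding in_segment by (intro exI[of _ "1 / 2"]) auto
  then show False using not_antipodal[OF \<xi>] by simp
qed

text \<open>A loop has radial velocity and moves along a line through the origin, turning back at
  half of its time. With an angle above \<open>pi\<close> it would have passed through the origin, a
  point of \<open>D\<close>, before.\<close>

lemma hooke_loop:
  assumes \<xi>: "\<xi> \<in> {a<..<b}" and h: "hooke_arc D \<rho> (\<gamma> \<xi>) (\<gamma> \<xi>) \<theta> w"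
  shows "\<theta> < pi" "w = tan (\<theta> / 2) *\<^sub>R \<gamma> \<xi>" "\<rho> = (norm (\<gamma> \<xi>))\<^sup>2 / (cos (\<theta> / 2))\<^sup>2" "cos (\<theta> / 2) > 0"
proof -
  have t: "0 < \<theta>" "\<theta> < 2 * pi" "\<theta> \<noteq> pi"
    using hooke_less_2pi[OF \<xi> \<xi> h] hooke_not_pi[OF \<xi> \<xi> h] h by (auto simp: hooke_arc_def)
  define x where "x = \<theta> / 2"
  have x: "0 < x" "x < pi" "x \<noteq> pi / 2" using t by (auto simp: x_def)
  have sx: "sin x > 0" using x by (simp add: sin_gt_zero)
  have cx: "cos x \<noteq> 0"
  proof (cases "x < pi / 2")
    case True then show ?thesis using cos_gt_zero[of x] x by auto
  next
    case False
    then have "cos (pi - x) > 0" using x by (intro cos_gt_zero) auto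
    then show ?thesis by (simp add: cos_diff)
  qed
  have th: "\<theta> = 2 * x" by (simp add: x_def)
  have "cos \<theta> *\<^sub>R \<gamma> \<xi> + sin \<theta> *\<^sub>R w = \<gamma> \<xi>" using h by (simp add: hooke_arc_def)
  then have "sin \<theta> *\<^sub>R w = (1 - cos \<theta>) *\<^sub>R \<gamma> \<xi>" by (simp add: algebra_simps)
  then have "(2 * sin x * cos x) *\<^sub>R w = (2 * (sin x)\<^sup>2) *\<^sub>R \<gamma> \<xi>"
    unfolding th by (simp add: sin_double cos_double_sin)
  then have "(2 * sin x) *\<^sub>R (cos x *\<^sub>R w) = (2 * sin x) *\<^sub>R (sin x *\<^sub>R \<gamma> \<xi>)"
    by (simp add: power2_eq_square)
  then have cw: "cos x *\<^sub>R w = sin x *\<^sub>R \<gamma> \<xi>" using sx by (simp only: scaleR_cancel_left) auto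
  then have w: "w = tan x *\<^sub>R \<gamma> \<xi>"
    using cx by (metis (no_types, opaque_lifting) divideR_right scaleR_scaleR tan_def divide_inverse_commute)
  then show "w = tan (\<theta> / 2) *\<^sub>R \<gamma> \<xi>" by (simp add: x_def)
  have "cos (x - pi / 2) *\<^sub>R \<gamma> \<xi> + sin (x - pi / 2) *\<^sub>R w = 0"
  proof -
    have "cos (x - pi / 2) = sin x" "sin (x - pi / 2) = - cos x"
      by (auto simp: cos_diff sin_diff)
    then show ?thesis using cw by simp
  qed
  moreover have "x - pi / 2 \<in> {0<..<2 * x}" if "x > pi / 2" using that x pi_gt_zero by auto
  ultimately have "\<not> x > pi / 2" using h zero_in_D unfolding hooke_arc_def th by metis
  then have x2: "x < pi / 2" using x by auto
  then show "\<theta> < pi" by (simp add: th)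
  have cp: "cos x > 0" using x x2 by (intro cos_gt_zero) auto
  then show "cos (\<theta> / 2) > 0" by (simp add: x_def)
  have "\<rho> = (norm (\<gamma> \<xi>))\<^sup>2 * (1 + (tan x)\<^sup>2)"
    using h unfolding w by (simp add: hooke_arc_def power_mult_distrib algebra_simps)
  also have "1 + (tan x)\<^sup>2 = 1 / (cos x)\<^sup>2"
    using tan_sec[OF cx] by (simp add: power_inverse divide_inverse)
  finally show "\<rho> = (norm (\<gamma> \<xi>))\<^sup>2 / (cos (\<theta> / 2))\<^sup>2" by (simp add: x_def)
qed

text \<open>The loop at \<xi> sweeps its ray from the boundary point up to the norm sqrt \<rho>
  without entering \<open>D\<close>; farther out, the Hill bound on the closure of \<open>D\<close>
  applies.\<close>

lemma outer_radius:
  assumes \<xi>: "\<xi> \<in> {a<..<b}" and r: "1 \<le> r"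
  shows "r *\<^sub>R \<gamma> \<xi> \<notin> D"
proof -
  obtain \<theta> w where h: "hooke_arc D \<rho> (\<gamma> \<xi>) (\<gamma> \<xi>) \<theta> w" using hooke_ex[OF \<xi> \<xi>] by blast
  note l = hooke_loop[OF \<xi> h]
  define x where "x = \<theta> / 2"
  have x: "0 < x" "x < pi / 2" using h l by (auto simp: x_def hooke_arc_def)
  have cp: "cos x > 0" using l by (simp add: x_def)
  show ?thesis
  proof (cases "r * cos x \<le> 1")
    case True
    show ?thesis
    proof (cases "r = 1")
      case True
      then show ?thesis using curve_notin subset_L \<xi> by auto
    next
      case False
      then have r1: "r > 1" using r by simp
      \<comment> \<open>At the angle \<open>x - y\<close> the loop is at
        \<open>cos y / cos x\<close> times its starting point, the turning point being at
        \<open>x\<close>.\<close>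
      define y where "y = arccos (r * cos x)"
      have rc: "0 < r * cos x" using cp r1 by simp
      have cy: "cos y = r * cos x" using True rc by (simp add: y_def)
      have y0: "0 \<le> y" using True rc by (simp add: y_def arccos_lbound)
      have "y < x"
      proof (rule ccontr)
        assume "\<not> y < x"
        moreover have "y \<le> pi" using True rc by (simp add: y_def arccos_ubound)
        ultimately have "cos y \<le> cos x" using x by (intro cos_monotone_0_pi_le) auto
        then show False using cy cp r1 by simp
      qed
      have "x - y \<in> {0<..<\<theta>}" using \<open>y < x\<close> y0 x by (auto simp: x_def)
      then have "cos (x - y) *\<^sub>R \<gamma> \<xi> + sin (x - y) *\<^sub>R w \<notin> D" using h by (simp add: hooke_arc_def)
      moreover have "cos (x - y) + sin (x - y) * tan x = r"
      proof -
        have "cos x * (cos (x - y) + sin (x - y) * tan x) = cos x * cos (x - y) + sin x * sin (x - y)"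
          using cp by (simp add: tan_def algebra_simps)
        also have "\<dots> = cos y" using cos_diff[of x "x - y"] by simp
        finally show ?thesis using cy cp by simp
      qed
      ultimately show ?thesis unfolding l(2) x_def[symmetric]
        by (simp add: scaleR_add_left[symmetric])
    qed
  next
    case False
    then have "1 < (r * cos x)\<^sup>2" using cp r by simp
    then have "(norm (\<gamma> \<xi>))\<^sup>2 * 1 < (norm (\<gamma> \<xi>))\<^sup>2 * (r * cos x)\<^sup>2"
      using curve_nonzero[OF subset_L(2)[OF \<xi>]] by (intro mult_strict_left_mono) auto
    then have "\<rho> \<le> (norm (r *\<^sub>R \<gamma> \<xi>))\<^sup>2"
      using cp unfolding l(3) x_def[symmetric] by (simp add: field_simps)
    then show ?thesis using closure_norm[of "r *\<^sub>R \<gamma> \<xi>"] closure_subset[of D] by force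
  qed
qed

text \<open>The angles are bounded and the energy fixes the norm of \<open>w\<close>, so a
  subsequence converges; avoiding an open set survives the limit. The limit angle 0 is kept apart
  because an arc has positive duration.\<close>

lemma hooke_limit:
  assumes x: "\<And>n. hooke_arc D \<rho> p (q n) (\<theta> n) (w n)" "\<And>n. \<theta> n \<le> M" and q: "q \<longlonglongrightarrow> q'" and M: "\<And>n. m \<le> \<theta> n"
  obtains \<theta>' w' where "m \<le> \<theta>'" "\<theta>' \<le> M" "\<theta>' > 0 \<Longrightarrow> hooke_arc D \<rho> p q' \<theta>' w'" "\<theta>' = 0 \<Longrightarrow> q' = p" "0 \<le> \<theta>'"
proof -
  have nw: "(norm (w n))\<^sup>2 = \<rho> - (norm p)\<^sup>2" and t0: "0 < \<theta> n" for n using x(1)[of n] by (auto simp: hooke_arc_def)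
  have "norm (w n) = sqrt (\<rho> - (norm p)\<^sup>2)" for n using nw[of n] by (metis norm_ge_zero real_sqrt_unique)
  then have "\<theta> n \<in> {0..M} \<and> w n \<in> cball 0 (sqrt (\<rho> - (norm p)\<^sup>2))" for n using t0[of n] x(2)[of n] by simp
  then have inK: "\<forall>n. (\<theta> n, w n) \<in> {0..M} \<times> cball 0 (sqrt (\<rho> - (norm p)\<^sup>2))" by simp
  have "compact ({0..M} \<times> cball (0::complex) (sqrt (\<rho> - (norm p)\<^sup>2)))" by (intro compact_Times) auto
  then obtain l r where l: "strict_mono r" "((\<lambda>n. (\<theta> n, w n)) \<circ> r) \<longlonglongrightarrow> l"
    using seq_compactE[OF compact_imp_seq_compact inK] by blast
  define \<theta>' w' where "\<theta>' = fst l" and "w' = snd l"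
  have lt: "(\<lambda>n. \<theta> (r n)) \<longlonglongrightarrow> \<theta>'" and lw: "(\<lambda>n. w (r n)) \<longlonglongrightarrow> w'"
    using tendsto_fst[OF l(2)] tendsto_snd[OF l(2)] by (auto simp: o_def \<theta>'_def w'_def)
  have lq: "(\<lambda>n. q (r n)) \<longlonglongrightarrow> q'" using LIMSEQ_subseq_LIMSEQ[OF q l(1)] by (simp add: o_def)
  have e: "cos \<theta>' *\<^sub>R p + sin \<theta>' *\<^sub>R w' = q'"
  proof (rule LIMSEQ_unique)
    show "(\<lambda>n. cos (\<theta> (r n)) *\<^sub>R p + sin (\<theta> (r n)) *\<^sub>R w (r n)) \<longlonglongrightarrow> cos \<theta>' *\<^sub>R p + sin \<theta>' *\<^sub>R w'"
      by (intro tendsto_intros lt lw)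
    show "(\<lambda>n. cos (\<theta> (r n)) *\<^sub>R p + sin (\<theta> (r n)) *\<^sub>R w (r n)) \<longlonglongrightarrow> q'"
      using lq x(1) by (simp add: hooke_arc_def)
  qed
  have n': "(norm w')\<^sup>2 = \<rho> - (norm p)\<^sup>2"
  proof (rule LIMSEQ_unique)
    show "(\<lambda>n. (norm (w (r n)))\<^sup>2) \<longlonglongrightarrow> (norm w')\<^sup>2" by (intro tendsto_intros lw)
  qed (simp add: nw)
  have nD: "cos \<phi> *\<^sub>R p + sin \<phi> *\<^sub>R w' \<notin> D" if "0 < \<phi>" "\<phi> < \<theta>'" for \<phi>
  proof -
    have A: "closed (- D)" using D_open by auto
    have B: "\<forall>\<^sub>F n in sequentially. cos \<phi> *\<^sub>R p + sin \<phi> *\<^sub>R w (r n) \<in> - D"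
      using order_tendstoD(1)[OF lt that(2)]
    proof eventually_elim
      case (elim n) then show ?case using x(1)[of "r n"] that by (auto simp: hooke_arc_def)
    qed
    have C: "(\<lambda>n. cos \<phi> *\<^sub>R p + sin \<phi> *\<^sub>R w (r n)) \<longlonglongrightarrow> cos \<phi> *\<^sub>R p + sin \<phi> *\<^sub>R w'"
      by (intro tendsto_intros lw)
    have "cos \<phi> *\<^sub>R p + sin \<phi> *\<^sub>R w' \<in> - D"
      by (rule Lim_in_closed_set[OF A B trivial_limit_sequentially C])
    then show ?thesis by simp
  qed
  have b: "m \<le> \<theta>'" "\<theta>' \<le> M" "0 \<le> \<theta>'"
    using LIMSEQ_le_const[OF lt, of m] LIMSEQ_le_const2[OF lt, of M] LIMSEQ_le_const[OF lt, of 0] M x(2)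
      less_imp_le[OF t0] by auto
  show ?thesis
    by (rule that[of \<theta>' w']) (use b e n' nD in \<open>auto simp: hooke_arc_def\<close>)
qed

text \<open>As the end point varies, the angle never equals \<open>pi\<close>, and it cannot jump
  across, because the end points with angle at most \<open>pi\<close> and those with angle at least
  \<open>pi\<close> form closed sets. For the loop at \<open>\<xi>\<close> it is below
  \<open>pi\<close>.\<close>

lemma hooke_less_pi:
  assumes \<xi>: "\<xi> \<in> {a<..<b}" and \<eta>: "\<eta> \<in> {a<..<b}" and h: "hooke_arc D \<rho> (\<gamma> \<xi>) (\<gamma> \<eta>) \<theta> w"
  shows "\<theta> < pi"
proof (rule ccontr)
  assume n: "\<not> ?thesis"
  define A where "A = {\<zeta>\<in>{a<..<b}. \<exists>\<theta> w. hooke_arc D \<rho> (\<gamma> \<xi>) (\<gamma> \<zeta>) \<theta> w \<and> \<theta> \<le> pi}"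
  define B where "B = {\<zeta>\<in>{a<..<b}. \<exists>\<theta> w. hooke_arc D \<rho> (\<gamma> \<xi>) (\<gamma> \<zeta>) \<theta> w \<and> pi \<le> \<theta>}"
  have c: "isCont \<gamma> \<zeta>" if "\<zeta> \<in> {a<..<b}" for \<zeta>
    using continuous_on_interior[OF continuous_on_curve, of \<zeta>] subset_L(1)[OF that]
    by (simp add: interior_atLeastAtMost_real)
  have "\<zeta> \<in> A" if z: "\<forall>n. x n \<in> A" "x \<longlonglongrightarrow> \<zeta>" "\<zeta> \<in> {a<..<b}" for x \<zeta>
  proof -
    have "\<forall>n. \<exists>\<theta> w. hooke_arc D \<rho> (\<gamma> \<xi>) (\<gamma> (x n)) \<theta> w \<and> \<theta> \<le> pi" using z(1) by (auto simp: A_def)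
    then obtain \<theta> w where tw: "\<And>n. hooke_arc D \<rho> (\<gamma> \<xi>) (\<gamma> (x n)) (\<theta> n) (w n)" "\<And>n. \<theta> n \<le> pi" by metis
    have q: "(\<lambda>n. \<gamma> (x n)) \<longlonglongrightarrow> \<gamma> \<zeta>" using c[OF z(3)] z(2) by (rule isCont_tendsto_compose)
    have t0: "0 \<le> \<theta> n" for n using tw(1)[of n] by (auto simp: hooke_arc_def)
    obtain \<theta>' w' where 1: "\<theta>' \<le> pi" "\<theta>' > 0 \<Longrightarrow> hooke_arc D \<rho> (\<gamma> \<xi>) (\<gamma> \<zeta>) \<theta>' w'" "\<theta>' = 0 \<Longrightarrow> \<gamma> \<zeta> = \<gamma> \<xi>" "0 \<le> \<theta>'"
      using hooke_limit[OF tw q t0] by metis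
    show ?thesis
    \<comment> \<open>A limit angle 0 occurs only at \<open>\<zeta> = \<xi>\<close>, where the loop
      takes the place of the collapsed arc.\<close>
    proof (cases "\<theta>' = 0")
      case True
      then have "\<zeta> = \<xi>" using 1(3) curve_inj subset_L \<xi> z(3) by blast
      moreover obtain \<theta> w where "hooke_arc D \<rho> (\<gamma> \<xi>) (\<gamma> \<xi>) \<theta> w" using hooke_ex[OF \<xi> \<xi>] by blast
      ultimately show ?thesis using hooke_loop(1)[OF \<xi>] \<xi> by (force simp: A_def)
    next
      case False
      then show ?thesis using 1 z(3) by (auto simp: A_def)
    qed
  qed
  then have clA: "closedin (top_of_set {a<..<b}) A"
    by (intro closedin_sequentiallyI) (auto simp: A_def)
  have "\<zeta> \<in> B" if z: "\<forall>n. x n \<in> B" "x \<longlonglongrightarrow> \<zeta>" "\<zeta> \<in> {a<..<b}" for x \<zeta>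
  proof -
    have "\<forall>n. \<exists>\<theta> w. hooke_arc D \<rho> (\<gamma> \<xi>) (\<gamma> (x n)) \<theta> w \<and> pi \<le> \<theta>" using z(1) by (auto simp: B_def)
    then obtain \<theta> w where tw: "\<And>n. hooke_arc D \<rho> (\<gamma> \<xi>) (\<gamma> (x n)) (\<theta> n) (w n)" "\<And>n. pi \<le> \<theta> n" by metis
    have q: "(\<lambda>n. \<gamma> (x n)) \<longlonglongrightarrow> \<gamma> \<zeta>" using c[OF z(3)] z(2) by (rule isCont_tendsto_compose)
    have t1: "\<theta> n \<le> 2 * pi" for n
    proof -
      have "x n \<in> {a<..<b}" using z(1) by (auto simp: B_def)
      then show ?thesis using hooke_less_2pi[OF \<xi> _ tw(1)[of n]] by simp
    qed
    obtain \<theta>' w' where 1: "pi \<le> \<theta>'" "\<theta>' > 0 \<Longrightarrow> hooke_arc D \<rho> (\<gamma> \<xi>) (\<gamma> \<zeta>) \<theta>' w'"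
      using hooke_limit[OF tw(1) t1 q tw(2)] by metis
    then have "\<theta>' > 0" using pi_gt_zero by linarith
    then show ?thesis using 1 z(3) by (auto simp: B_def)
  qed
  then have clB: "closedin (top_of_set {a<..<b}) B"
    by (intro closedin_sequentiallyI) (auto simp: B_def)
  have cov: "{a<..<b} \<subseteq> A \<union> B"
  proof
    fix \<zeta> assume z: "\<zeta> \<in> {a<..<b}"
    obtain \<theta> w where "hooke_arc D \<rho> (\<gamma> \<xi>) (\<gamma> \<zeta>) \<theta> w" using hooke_ex[OF \<xi> z] by blast
    then show "\<zeta> \<in> A \<union> B" using z by (cases "\<theta> \<le> pi") (auto simp: A_def B_def)
  qed
  have disj: "A \<inter> B = {}"
  proof -
    have False if zz: "\<zeta> \<in> A" "\<zeta> \<in> B" for \<zeta>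
    proof -
      obtain \<theta> w where 1: "\<zeta> \<in> {a<..<b}" "hooke_arc D \<rho> (\<gamma> \<xi>) (\<gamma> \<zeta>) \<theta> w" "\<theta> \<le> pi" using zz by (auto simp: A_def)
      obtain \<theta>' w' where 2: "hooke_arc D \<rho> (\<gamma> \<xi>) (\<gamma> \<zeta>) \<theta>' w'" "pi \<le> \<theta>'" using zz by (auto simp: B_def)
      have "\<theta> = pi" using hooke_unique[OF \<xi> 1(1,2) 2(1)] 1 2 by auto
      then show False using hooke_not_pi[OF \<xi> 1(1,2)] by simp
    qed
    then show ?thesis by auto
  qed
  have "\<eta> \<in> B" using n h \<eta> by (auto simp: B_def)
  moreover have "\<xi> \<in> A"
    using hooke_ex[OF \<xi> \<xi>] hooke_loop(1)[OF \<xi>] \<xi> by (force simp: A_def)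
  moreover have "connected {a<..<b}" by simp
  ultimately show False using clA clB cov disj unfolding connected_closedin by blast
qed

end

text \<open>The initial velocity of that arc, divided by \<open>\<omega>\<close>.\<close>
definition lob_vec :: "real \<Rightarrow> complex \<Rightarrow> complex \<Rightarrow> complex" where
  "lob_vec \<rho> p q = (q - lob_cos \<rho> p q *\<^sub>R p) /\<^sub>R sqrt (1 - (lob_cos \<rho> p q)\<^sup>2)"

section \<open>Admissible intervals are arc sectors\<close>

context arc_interval
begin

text \<open>Two boundary points on one line through the origin are antipodal, equal, or one of them
  lies on the open radius of the other, which is inside \<open>D\<close>.\<close>

lemma curve_wedge_nonzero:
  assumes \<xi>: "\<xi> \<in> {a<..<b}" "\<eta> \<in> {a<..<b}" "\<xi> \<noteq> \<eta>"
  shows "wedge (\<gamma> \<xi>) (\<gamma> \<eta>) \<noteq> 0"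
proof
  assume "wedge (\<gamma> \<xi>) (\<gamma> \<eta>) = 0"
  then obtain r where r: "\<gamma> \<eta> = r *\<^sub>R \<gamma> \<xi>" using wedge_zeroE curve_nonzero[of \<xi>] subset_L \<xi> by metis
  consider "r < 0" | "0 \<le> r" "r < 1" | "r = 1" | "r > 1" by linarith
  then show False
  proof cases
    case 1
    define u where "u = 1 / (1 - r)"
    have "(1 - u) + u * r = 0" using 1 by (simp add: u_def field_simps)
    then have "0 = (1 - u) *\<^sub>R \<gamma> \<xi> + u *\<^sub>R \<gamma> \<eta>" unfolding r by (simp add: scaleR_add_left[symmetric])
    moreover have "0 \<le> u" "u \<le> 1" using 1 by (auto simp: u_def)
    ultimately have "0 \<in> closed_segment (\<gamma> \<xi>) (\<gamma> \<eta>)" unfolding in_segment by blast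
    then show False using not_antipodal \<xi> by blast
  next
    case 2 then show False using inner_radius[of \<xi> r] \<xi> r curve_notin[of \<eta>] subset_L by auto
  next
    case 3 then show False using r curve_inj[of \<xi> \<eta>] subset_L \<xi> by auto
  next
    case 4
    then have "\<gamma> \<xi> = (1 / r) *\<^sub>R \<gamma> \<eta>" using r by simp
    then show False using inner_radius[of \<eta> "1 / r"] 4 \<xi> curve_notin[of \<xi>] subset_L by auto
  qed
qed

lemma isCont_curve: "\<xi> \<in> {a<..<b} \<Longrightarrow> isCont \<gamma> \<xi>"
  using curve_vector_derivative[OF subset_L(1)] by (rule has_vector_derivative_continuous)

text \<open>The pairs of increasing parameters form a convex set on which the wedge does not vanish,
  so its sign is constant.\<close>

lemma orientation_ex: "\<exists>s. s * s = 1 \<and> (\<forall>\<xi> \<eta>. a < \<xi> \<longrightarrow> \<xi> < \<eta> \<longrightarrow> \<eta> < b \<longrightarrow> s * wedge (\<gamma> \<xi>) (\<gamma> \<eta>) > 0)"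
proof -
  define x y where "x = (2 * a + b) / 3" and "y = (a + 2 * b) / 3"
  have xy: "a < x" "x < y" "y < b" using interval by (auto simp: x_def y_def)
  have same: "wedge (\<gamma> \<xi>) (\<gamma> \<eta>) * wedge (\<gamma> x) (\<gamma> y) > 0" if \<xi>: "a < \<xi>" "\<xi> < \<eta>" "\<eta> < b" for \<xi> \<eta>
  proof -
    define u v where "u t = (1 - t) * \<xi> + t * x" and "v t = (1 - t) * \<eta> + t * y" for t
    define g where "g t = wedge (\<gamma> (u t)) (\<gamma> (v t))" for t
    have uv: "a < u t \<and> u t < v t \<and> v t < b" if "0 \<le> t" "t \<le> 1" for t
    proof -
      have conv: "(1 - t) * x' + t * p' < (1 - t) * y' + t * q'" if "x' < y'" "p' < q'" for x' y' p' q'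
      proof (cases "t = 0")
        case False
        then have "t * p' < t * q'" using \<open>0 \<le> t\<close> that by simp
        moreover have "(1 - t) * x' \<le> (1 - t) * y'" using \<open>t \<le> 1\<close> that by (intro mult_left_mono) auto
        ultimately show ?thesis by linarith
      qed (use that in simp)
      have id: "(1 - t) * c + t * c = c" for c by (simp add: algebra_simps)
      show ?thesis unfolding u_def v_def
        using conv[of a \<xi> a x] conv[of \<xi> \<eta> x y] conv[of \<eta> b y b] \<xi> xy unfolding id by blast
    qed
    have uvc: "continuous_on {0..1} u" "continuous_on {0..1} v"
      unfolding u_def v_def by (intro continuous_intros)+
    have im: "u ` {0..1} \<subseteq> {0..L}" "v ` {0..1} \<subseteq> {0..L}"
    proof -
      have "0 \<le> u t \<and> u t \<le> L \<and> 0 \<le> v t \<and> v t \<le> L" if "t \<in> {0..1}" for t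
        using uv[of t] interval that by auto
      then show "u ` {0..1} \<subseteq> {0..L}" "v ` {0..1} \<subseteq> {0..L}" by auto
    qed
    note cont = continuous_on_compose2[OF continuous_on_curve uvc(1) im(1)]
      continuous_on_compose2[OF continuous_on_curve uvc(2) im(2)]
    have c: "continuous_on {0..1} g" unfolding g_def by (intro continuous_intros cont)
    have nz: "g t \<noteq> 0" if "0 \<le> t" "t \<le> 1" for t
      unfolding g_def using uv[OF that] by (intro curve_wedge_nonzero) auto
    have "connected (g ` {0..1})" using c by (intro connected_continuous_image) auto
    then have "\<not> (g 0 < 0 \<and> g 1 > 0)" "\<not> (g 1 < 0 \<and> g 0 > 0)"
      using nz connectedD_interval[of "g ` {0..1}" "g 0" "g 1" 0] connectedD_interval[of "g ` {0..1}" "g 1" "g 0" 0] by force+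
    then have "g 0 * g 1 > 0" using nz[of 0] nz[of 1] by (auto simp: zero_less_mult_iff not_less)
    then show ?thesis by (simp add: g_def u_def v_def)
  qed
  define s where "s = sgn (wedge (\<gamma> x) (\<gamma> y))"
  have "wedge (\<gamma> x) (\<gamma> y) \<noteq> 0" using same[OF xy] by auto
  then have "s * s = 1" by (simp add: s_def sgn_if)
  moreover have "s * wedge (\<gamma> \<xi>) (\<gamma> \<eta>) > 0" if "a < \<xi>" "\<xi> < \<eta>" "\<eta> < b" for \<xi> \<eta>
    using same[OF that] by (auto simp: s_def sgn_if zero_less_mult_iff)
  ultimately show ?thesis by blast
qed

lemma arc_sector_ex: "\<exists>s. arc_sector \<rho> s a b \<gamma> D"
proof -
  obtain s where s: "s * s = 1" "\<And>\<xi> \<eta>. a < \<xi> \<Longrightarrow> \<xi> < \<eta> \<Longrightarrow> \<eta> < b \<Longrightarrow> s * wedge (\<gamma> \<xi>) (\<gamma> \<eta>) > 0"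
    using orientation_ex by metis
  have "arc_sector \<rho> s a b \<gamma> D"
  proof
    show "continuous_on {a<..<b} \<gamma>"
      by (rule continuous_on_subset[OF continuous_on_curve]) (use subset_L in blast)
    fix \<xi> assume \<xi>: "a < \<xi>" "\<xi> < b"
    then have \<xi>': "\<xi> \<in> {a<..<b}" by simp
    show "\<gamma> \<xi> \<noteq> 0" "(norm (\<gamma> \<xi>))\<^sup>2 < \<rho>"
      using curve_nonzero[OF subset_L(2)[OF \<xi>']] norm_curve_less[OF \<xi>'] by auto
    show "r *\<^sub>R \<gamma> \<xi> \<in> D \<longleftrightarrow> r < 1" if "0 \<le> r" for r
      using inner_radius[OF \<xi>' that] outer_radius[OF \<xi>', of r] by (cases "r < 1") auto
    fix \<eta> assume \<eta>: "a < \<eta>" "\<eta> < b"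
    then have \<eta>': "\<eta> \<in> {a<..<b}" by simp
    show "\<exists>\<theta> w. free_arc D \<rho> (\<gamma> \<xi>) (\<gamma> \<eta>) \<theta> w"
      using hooke_ex[OF \<xi>' \<eta>'] hooke_less_pi[OF \<xi>' \<eta>'] by (auto simp: free_arc_hooke)
    show "free_arc D \<rho> (\<gamma> \<xi>) (\<gamma> \<eta>) \<theta> w \<Longrightarrow> free_arc D \<rho> (\<gamma> \<xi>) (\<gamma> \<eta>) \<theta>' w' \<Longrightarrow> \<theta> = \<theta>'" for \<theta> w \<theta>' w'
      using hooke_unique[OF \<xi>' \<eta>'] by (auto simp: free_arc_hooke)
  qed (use s in auto)
  then show ?thesis by blast
qed

definition sg :: real where "sg = (SOME s. arc_sector \<rho> s a b \<gamma> D)"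

sublocale sec: arc_sector \<rho> sg a b \<gamma> D
  unfolding sg_def using arc_sector_ex by (rule someI_ex)

lemma vec_eq_lob:
  assumes "cos \<theta> = lob_cos \<rho> p q" "cos \<theta> *\<^sub>R p + sin \<theta> *\<^sub>R w = q" "0 < \<theta>" "\<theta> < pi"
  shows "w = lob_vec \<rho> p q" "\<theta> = arccos (lob_cos \<rho> p q)" "sin \<theta> = sqrt (1 - (lob_cos \<rho> p q)\<^sup>2)"
    "- 1 < lob_cos \<rho> p q" "lob_cos \<rho> p q < 1"
proof -
  have s: "sin \<theta> > 0" using assms by (simp add: sin_gt_zero)
  then show sn: "sin \<theta> = sqrt (1 - (lob_cos \<rho> p q)\<^sup>2)"
    unfolding assms(1)[symmetric] by (metis abs_of_pos real_sqrt_abs sin_squared_eq)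
  have "sin \<theta> *\<^sub>R w = q - lob_cos \<rho> p q *\<^sub>R p" using assms(1,2) by (metis add_diff_cancel_left')
  then show "w = lob_vec \<rho> p q"
    unfolding lob_vec_def sn[symmetric] using s by (metis less_irrefl scaleR_left.zero real_vector.scale_one divideR_right scaleR_scaleR left_inverse)
  show "\<theta> = arccos (lob_cos \<rho> p q)" by (metis assms(1,3,4) arccos_cos less_imp_le)
  show "- 1 < lob_cos \<rho> p q" "lob_cos \<rho> p q < 1"
    unfolding assms(1)[symmetric] using assms cos_monotone_0_pi[of \<theta> pi] cos_monotone_0_pi[of 0 \<theta>] by auto
qed

text \<open>The sector treats increasing parameters and its mirror image decreasing ones; the loop,
  which the sector leaves out, is computed from \<open>hooke_loop\<close>.\<close>

lemma lob_arc_aux: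
  assumes \<xi>: "\<xi> \<in> {a<..<b}" "\<eta> \<in> {a<..<b}" and h: "hooke_arc D \<rho> (\<gamma> \<xi>) (\<gamma> \<eta>) \<theta> w"
  shows "cos \<theta> = lob_cos \<rho> (\<gamma> \<xi>) (\<gamma> \<eta>)" (is ?A)
    and "0 < \<phi> \<Longrightarrow> \<phi> < \<theta> \<Longrightarrow> \<exists>\<zeta>\<in>{a<..<b}. \<exists>r>1. cos \<phi> *\<^sub>R \<gamma> \<xi> + sin \<phi> *\<^sub>R w = r *\<^sub>R \<gamma> \<zeta>" (is "_ \<Longrightarrow> _ \<Longrightarrow> ?B")
    and "sg * wedge w (tangent \<xi>) > 0" (is ?C)
    and "arc_disc \<rho> (\<gamma> \<xi>) (\<gamma> \<eta>) > 0" (is ?D)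
proof -
  have f: "free_arc D \<rho> (\<gamma> \<xi>) (\<gamma> \<eta>) \<theta> w" using h hooke_less_pi[OF \<xi> h] by (simp add: free_arc_hooke)
  have dt: "(\<gamma> has_vector_derivative tangent \<xi>) (at \<xi>)" by (rule curve_vector_derivative[OF subset_L(1)[OF \<xi>(1)]])
  have t0: "tangent \<xi> \<noteq> 0" using norm_tangent[OF subset_L(2)[OF \<xi>(1)]] by auto
  have Yt: "sg * wedge (\<gamma> \<xi>) (tangent \<xi>) > 0" using sec.tangent_transversal[OF _ _ dt t0] \<xi> by auto
  consider "\<xi> < \<eta>" | "\<eta> < \<xi>" | "\<xi> = \<eta>" by linarith
  then have "?A \<and> (0 < \<phi> \<longrightarrow> \<phi> < \<theta> \<longrightarrow> ?B) \<and> ?C \<and> ?D"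
  proof cases
    case 1
    then have o: "a < \<xi>" "\<xi> < \<eta>" "\<eta> < b" using \<xi> by auto
    show ?thesis using sec.forward_arc[OF o f] dt t0 sec.disc_pos[OF o] by blast
  next
    case 2
    then have o: "- b < - \<xi>" "- \<xi> < - \<eta>" "- \<eta> < - a" using \<xi> by auto
    interpret m: arc_sector \<rho> "- sg" "- b" "- a" "\<lambda>x. \<gamma> (- x)" D by (rule sec.mirror)
    have f': "free_arc D \<rho> (\<gamma> (- (- \<xi>))) (\<gamma> (- (- \<eta>))) \<theta> w" using f by simp
    have "((\<gamma> \<circ> uminus) has_vector_derivative (- 1) *\<^sub>R tangent \<xi>) (at (- \<xi>))"
      by (rule vector_diff_chain_at) (auto intro!: derivative_eq_intros dt)
    then have dt': "((\<lambda>x. \<gamma> (- x)) has_vector_derivative - tangent \<xi>) (at (- \<xi>))" by (simp add: o_def)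
    have t0': "- tangent \<xi> \<noteq> 0" using t0 by simp
    have A: ?A using m.forward_arc(1)[OF o f'] by simp
    have C: ?C using m.forward_arc(3)[OF o f' dt' t0'] by simp
    have D: ?D using m.disc_pos[OF o] by simp
    have B: ?B if \<phi>: "0 < \<phi>" "\<phi> < \<theta>"
    proof -
      obtain \<zeta> r where "\<zeta> \<in> {- b<..<- a}" "r > 1" "cos \<phi> *\<^sub>R \<gamma> \<xi> + sin \<phi> *\<^sub>R w = r *\<^sub>R \<gamma> (- \<zeta>)"
        using m.forward_arc(2)[OF o f' \<phi>] by auto
      then show ?thesis by (intro bexI[of _ "- \<zeta>"]) auto
    qed
    show ?thesis using A B C D by blast
  next
    case 3
    then have h': "hooke_arc D \<rho> (\<gamma> \<xi>) (\<gamma> \<xi>) \<theta> w" using h by simp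
    note l = hooke_loop[OF \<xi>(1) h']
    define x where "x = \<theta> / 2"
    define P where "P = (norm (\<gamma> \<xi>))\<^sup>2"
    have P: "P > 0" "P < \<rho>" using curve_nonzero[OF subset_L(2)[OF \<xi>(1)]] norm_curve_less[OF \<xi>(1)] by (auto simp: P_def)
    have x: "0 < x" "x < pi / 2" using h l by (auto simp: x_def hooke_arc_def)
    have cp: "cos x > 0" using l by (simp add: x_def)
    have sp: "sin x > 0" using x by (intro sin_gt_zero) auto
    have tp: "tan x > 0" using cp sp by (simp add: tan_def)
    have d: "arc_disc \<rho> (\<gamma> \<xi>) (\<gamma> \<xi>) = (\<rho> - P)\<^sup>2"
    proof -
      have "inner (\<gamma> \<xi>) (\<gamma> \<xi>) = P" by (simp add: P_def power2_norm_eq_inner)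
      then show ?thesis unfolding arc_disc_def P_def[symmetric] by (simp add: algebra_simps power2_eq_square)
    qed
    have D: ?D unfolding 3[symmetric] d using P by simp
    have C: ?C unfolding l(2) x_def[symmetric] using tp Yt by (simp add: mult.left_commute)
    have "cos \<theta> = 2 * (cos x)\<^sup>2 - 1" using cos_double_cos[of x] by (simp add: x_def)
    also have "(cos x)\<^sup>2 = P / \<rho>"
    proof -
      have "\<rho> = P / (cos x)\<^sup>2" using l(3) by (simp add: x_def P_def)
      then show ?thesis using cp P by (simp add: field_simps)
    qed
    also have "2 * (P / \<rho>) - 1 = (P - (\<rho> - P)) / \<rho>" using P by (simp add: field_simps)
    finally have A: ?A unfolding 3[symmetric] lob_cos_def d using P
      by (simp add: P_def power2_norm_eq_inner[symmetric])
    have B: ?B if \<phi>: "0 < \<phi>" "\<phi> < \<theta>"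
    proof -
      have "cos x * (cos \<phi> + sin \<phi> * tan x) = cos (\<phi> - x)"
        using cp by (simp add: tan_def cos_diff algebra_simps)
      moreover have "cos (\<phi> - x) > cos x"
      proof -
        have "\<bar>\<phi> - x\<bar> < x" using \<phi> unfolding abs_less_iff x_def by linarith
        then have "cos x < cos \<bar>\<phi> - x\<bar>" using x by (intro cos_monotone_0_pi) auto
        then show ?thesis by simp
      qed
      ultimately have "cos x * 1 < cos x * (cos \<phi> + sin \<phi> * tan x)" by simp
      then have "1 < cos \<phi> + sin \<phi> * tan x" using cp by (simp only: mult_less_cancel_left_pos)
      moreover have "cos \<phi> *\<^sub>R \<gamma> \<xi> + sin \<phi> *\<^sub>R w = (cos \<phi> + sin \<phi> * tan x) *\<^sub>R \<gamma> \<xi>"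
        unfolding l(2) x_def[symmetric] by (simp add: scaleR_add_left)
      ultimately show ?thesis using \<xi>(1) by blast
    qed
    show ?thesis using A B C D by blast
  qed
  then show ?A "0 < \<phi> \<Longrightarrow> \<phi> < \<theta> \<Longrightarrow> ?B" ?C ?D by auto
qed

lemma lob_hooke:
  assumes \<xi>: "\<xi> \<in> {a<..<b}" "\<eta> \<in> {a<..<b}" and h: "hooke_arc D \<rho> (\<gamma> \<xi>) (\<gamma> \<eta>) \<theta> w"
  shows "w = lob_vec \<rho> (\<gamma> \<xi>) (\<gamma> \<eta>)" "\<theta> = arccos (lob_cos \<rho> (\<gamma> \<xi>) (\<gamma> \<eta>))"
    "sin \<theta> = sqrt (1 - (lob_cos \<rho> (\<gamma> \<xi>) (\<gamma> \<eta>))\<^sup>2)"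
  by (rule vec_eq_lob[of \<theta> _ _ w]; use lob_arc_aux(1)[OF assms] hooke_less_pi[OF assms] h in \<open>simp add: hooke_arc_def\<close>)+

lemma lob_arc:
  assumes \<xi>: "\<xi> \<in> {a<..<b}" "\<eta> \<in> {a<..<b}"
  shows "hooke_arc D \<rho> (\<gamma> \<xi>) (\<gamma> \<eta>) (arccos (lob_cos \<rho> (\<gamma> \<xi>) (\<gamma> \<eta>))) (lob_vec \<rho> (\<gamma> \<xi>) (\<gamma> \<eta>))"
    and "- 1 < lob_cos \<rho> (\<gamma> \<xi>) (\<gamma> \<eta>)" "lob_cos \<rho> (\<gamma> \<xi>) (\<gamma> \<eta>) < 1"
    and "arc_disc \<rho> (\<gamma> \<xi>) (\<gamma> \<eta>) > 0"
    and "sg * wedge (lob_vec \<rho> (\<gamma> \<xi>) (\<gamma> \<eta>)) (tangent \<xi>) > 0"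
    and "0 < \<phi> \<Longrightarrow> \<phi> < arccos (lob_cos \<rho> (\<gamma> \<xi>) (\<gamma> \<eta>)) \<Longrightarrow>
       \<exists>\<zeta>\<in>{a<..<b}. \<exists>r>1. cos \<phi> *\<^sub>R \<gamma> \<xi> + sin \<phi> *\<^sub>R lob_vec \<rho> (\<gamma> \<xi>) (\<gamma> \<eta>) = r *\<^sub>R \<gamma> \<zeta>"
proof -
  obtain \<theta> w where h: "hooke_arc D \<rho> (\<gamma> \<xi>) (\<gamma> \<eta>) \<theta> w" using hooke_ex[OF \<xi>] by blast
  note e = lob_hooke[OF \<xi> h]
  show "hooke_arc D \<rho> (\<gamma> \<xi>) (\<gamma> \<eta>) (arccos (lob_cos \<rho> (\<gamma> \<xi>) (\<gamma> \<eta>))) (lob_vec \<rho> (\<gamma> \<xi>) (\<gamma> \<eta>))"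
    using h unfolding e(1,2)[symmetric] .
  show "- 1 < lob_cos \<rho> (\<gamma> \<xi>) (\<gamma> \<eta>)" "lob_cos \<rho> (\<gamma> \<xi>) (\<gamma> \<eta>) < 1"
    by (rule vec_eq_lob[of \<theta> _ _ w]; use lob_arc_aux(1)[OF \<xi> h] hooke_less_pi[OF \<xi> h] h in \<open>simp add: hooke_arc_def\<close>)+
  show "arc_disc \<rho> (\<gamma> \<xi>) (\<gamma> \<eta>) > 0" by (rule lob_arc_aux(4)[OF \<xi> h])
  show "sg * wedge (lob_vec \<rho> (\<gamma> \<xi>) (\<gamma> \<eta>)) (tangent \<xi>) > 0"
    using lob_arc_aux(3)[OF \<xi> h] unfolding e(1) .
  show "0 < \<phi> \<Longrightarrow> \<phi> < arccos (lob_cos \<rho> (\<gamma> \<xi>) (\<gamma> \<eta>)) \<Longrightarrow>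
       \<exists>\<zeta>\<in>{a<..<b}. \<exists>r>1. cos \<phi> *\<^sub>R \<gamma> \<xi> + sin \<phi> *\<^sub>R lob_vec \<rho> (\<gamma> \<xi>) (\<gamma> \<eta>) = r *\<^sub>R \<gamma> \<zeta>"
    using lob_arc_aux(2)[OF \<xi> h] unfolding e(1,2)[symmetric] .
qed

lemma tangent_wedge_pos: "\<xi> \<in> {a<..<b} \<Longrightarrow> sg * wedge (\<gamma> \<xi>) (tangent \<xi>) > 0"
  using sec.tangent_transversal[OF _ _ curve_vector_derivative[OF subset_L(1)]] norm_tangent[OF subset_L(2)]
  by (metis greaterThanLessThan_iff norm_zero zero_neq_one)

end

section \<open>Crossing the boundary\<close>

context arc_interval
begin

text \<open>The real part is the radius relative to the boundary, the imaginary part is the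
  parameter of the ray. Packing both into one complex number makes invariance of domain applicable
  to a map between planes.\<close>

definition polar :: "complex \<Rightarrow> complex" where "polar z = Re z *\<^sub>R \<gamma> (Im z)"

definition strip :: "complex set" where "strip = {z. 0 < Re z \<and> a < Im z \<and> Im z < b}"

lemma open_strip: "open strip"
  unfolding strip_def
  by (intro open_Collect_conj open_Collect_less continuous_intros)

lemma continuous_on_polar: "continuous_on strip polar"
proof -
  have "continuous_on strip (\<lambda>z. \<gamma> (Im z))"
    by (rule continuous_on_compose2[OF sec.cont]) (auto simp: strip_def intro!: continuous_intros)
  then show ?thesis unfolding polar_def by (intro continuous_intros)
qed

lemma inj_on_polar: "inj_on polar strip"
proof (rule inj_onI)
  fix x y assume xy: "x \<in> strip" "y \<in> strip" "polar x = polar y"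
  have r: "Re x > 0" "Re y > 0" and i: "Im x \<in> {a<..<b}" "Im y \<in> {a<..<b}" using xy by (auto simp: strip_def)
  have "wedge (polar x) (\<gamma> (Im y)) = wedge (polar y) (\<gamma> (Im y))" using xy by simp
  then have "Re x * wedge (\<gamma> (Im x)) (\<gamma> (Im y)) = 0" by (simp add: polar_def)
  then have e: "Im x = Im y" using curve_wedge_nonzero[OF i] r by auto
  then have "Re x *\<^sub>R \<gamma> (Im y) = Re y *\<^sub>R \<gamma> (Im y)" using xy(3) by (simp add: polar_def)
  then have "Re x = Re y" using curve_nonzero[OF subset_L(2)[OF i(2)]] by simp
  then show "x = y" using e by (simp add: complex_eq_iff)
qed

lemma open_polar_image: "U \<subseteq> strip \<Longrightarrow> open U \<Longrightarrow> open (polar ` U)"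
  by (rule invariance_of_domain)
     (use continuous_on_polar inj_on_polar in \<open>auto intro: continuous_on_subset inj_on_subset\<close>)

text \<open>The return map needs arcs off the closure of \<open>D\<close>. The points beyond the
  boundary over the interval form an open set by invariance of domain; missing \<open>D\<close>, it
  misses the closure.\<close>

lemma beyond_notin_closure:
  assumes "\<xi> \<in> {a<..<b}" "r > 1"
  shows "r *\<^sub>R \<gamma> \<xi> \<notin> closure D"
proof -
  define U where "U = strip \<inter> {z. Re z > 1}"
  have "open U" unfolding U_def by (intro open_Int open_strip open_Collect_less continuous_intros)
  then have "open (polar ` U)" by (intro open_polar_image) (auto simp: U_def)
  moreover have "polar ` U \<inter> D = {}"
    using outer_radius by (auto simp: polar_def U_def strip_def)
  ultimately have "polar ` U \<inter> closure D = {}" by (simp add: open_Int_closure_eq_empty)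
  moreover have "r *\<^sub>R \<gamma> \<xi> \<in> polar ` U"
    by (rule image_eqI[of _ _ "Complex r \<xi>"]) (use assms in \<open>auto simp: polar_def U_def strip_def\<close>)
  ultimately show ?thesis by blast
qed

text \<open>\<open>polar\<close> is a homeomorphism onto an open set, and at the boundary point its
  derivative is invertible because the tangent is transversal to the ray. Hence the inverse is
  differentiable there, with the inverse derivative by Cramer's rule.\<close>

lemma height_derivative:
  assumes \<xi>: "\<xi> \<in> {a<..<b}"
  obtains g where "\<And>z. z \<in> polar ` strip \<Longrightarrow> g z \<in> strip \<and> polar (g z) = z"
    "g (\<gamma> \<xi>) = Complex 1 \<xi>"
    "(g has_derivative (\<lambda>v. Complex (wedge v (tangent \<xi>) / wedge (\<gamma> \<xi>) (tangent \<xi>))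
         (wedge (\<gamma> \<xi>) v / wedge (\<gamma> \<xi>) (tangent \<xi>)))) (at (\<gamma> \<xi>))"
proof -
  define t where "t = tangent \<xi>"
  define W where "W = wedge (\<gamma> \<xi>) t"
  have W: "W \<noteq> 0" using tangent_wedge_pos[OF \<xi>] by (auto simp: W_def t_def)
  obtain g where g: "homeomorphism strip (polar ` strip) polar g"
    using invariance_of_domain_homeomorphism[OF open_strip continuous_on_polar _ inj_on_polar] by auto
  define z0 where "z0 = Complex 1 \<xi>"
  have z0: "z0 \<in> strip" "polar z0 = \<gamma> \<xi>" using \<xi> by (auto simp: z0_def strip_def polar_def)
  have gz0: "g (\<gamma> \<xi>) = z0" using homeomorphism_apply1[OF g z0(1)] z0(2) by simp
  have gp: "g z \<in> strip \<and> polar (g z) = z" if "z \<in> polar ` strip" for z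
    using homeomorphism_apply2[OF g that] homeomorphism_image2[OF g] that by blast
  have dt: "(\<gamma> has_derivative (\<lambda>h. h *\<^sub>R t)) (at \<xi>)"
    using curve_vector_derivative[OF subset_L(1)[OF \<xi>]] by (simp add: has_vector_derivative_def t_def)
  have dI: "(Im has_derivative Im) (at z0)" and dR: "(Re has_derivative Re) (at z0)"
    using bounded_linear_imp_has_derivative bounded_linear_Im bounded_linear_Re by blast+
  have dc: "((\<lambda>z. \<gamma> (Im z)) has_derivative (\<lambda>h. Im h *\<^sub>R t)) (at z0)"
    using has_derivative_compose[OF dI, of \<gamma> "\<lambda>h. h *\<^sub>R t"] dt by (simp add: z0_def)
  have dp: "(polar has_derivative (\<lambda>h. Re h *\<^sub>R \<gamma> \<xi> + Im h *\<^sub>R t)) (at z0)"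
    using has_derivative_scaleR[OF dR dc] by (simp add: polar_def[abs_def] z0_def add.commute)
  define g' where "g' v = Complex (wedge v t / W) (wedge (\<gamma> \<xi>) v / W)" for v
  have lin: "linear g'"
    by (rule linearI) (auto simp: g'_def wedge_add complex_eq_iff add_divide_distrib)
  then have bl: "bounded_linear g'" by (simp add: linear_conv_bounded_linear)
  have zi: "\<gamma> \<xi> \<in> polar ` strip" using imageI[OF z0(1), of polar] z0(2) by simp
  have op: "open (polar ` strip)" by (intro open_polar_image open_strip) auto
  have "(g has_derivative g') (at (\<gamma> \<xi>))"
  proof (rule has_derivative_inverse_basic)
    show "(polar has_derivative (\<lambda>h. Re h *\<^sub>R \<gamma> \<xi> + Im h *\<^sub>R t)) (at (g (\<gamma> \<xi>)))" using dp gz0 by simp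
    show "bounded_linear g'" by (rule bl)
    show "g' \<circ> (\<lambda>h. Re h *\<^sub>R \<gamma> \<xi> + Im h *\<^sub>R t) = id"
      using W by (auto simp: fun_eq_iff g'_def complex_eq_iff wedge_add W_def[symmetric])
    show "open (polar ` strip)" "\<gamma> \<xi> \<in> polar ` strip" by (rule op, rule zi)
    show "continuous (at (\<gamma> \<xi>)) g"
      using homeomorphism_cont2[OF g] zi unfolding continuous_on_eq_continuous_at[OF op] by blast
    show "\<And>z. z \<in> polar ` strip \<Longrightarrow> polar (g z) = z" using gp by blast
  qed
  then show ?thesis using that[of g] gp gz0 unfolding z0_def g'_def[abs_def] W_def t_def by blast
qed

text \<open>The relative radius of \<open>u s\<close> equals 1 at time 0, and its derivative has the
  sign of \<open>sg * wedge v (tangent \<xi>)\<close>; so it moves at once to one side of 1.\<close>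

lemma crossing:
  assumes \<xi>: "\<xi> \<in> {a<..<b}" and u: "(u has_vector_derivative v) (at_right 0)" "u 0 = \<gamma> \<xi>"
  shows "sg * wedge v (tangent \<xi>) > 0 \<Longrightarrow> \<forall>\<^sub>F s in at_right 0. u s \<notin> closure D"
    and "sg * wedge v (tangent \<xi>) < 0 \<Longrightarrow> \<forall>\<^sub>F s in at_right 0. u s \<in> D"
proof -
  obtain g where g: "\<And>z. z \<in> polar ` strip \<Longrightarrow> g z \<in> strip \<and> polar (g z) = z" "g (\<gamma> \<xi>) = Complex 1 \<xi>"
    "(g has_derivative (\<lambda>v. Complex (wedge v (tangent \<xi>) / wedge (\<gamma> \<xi>) (tangent \<xi>))
         (wedge (\<gamma> \<xi>) v / wedge (\<gamma> \<xi>) (tangent \<xi>)))) (at (\<gamma> \<xi>))"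
    using height_derivative[OF \<xi>] by blast
  define c where "c = wedge v (tangent \<xi>) / wedge (\<gamma> \<xi>) (tangent \<xi>)"
  define r where "r s = Re (g (u s))" for s
  have du: "(u has_derivative (\<lambda>h. h *\<^sub>R v)) (at_right 0)" using u(1) by (simp add: has_vector_derivative_def)
  have "((\<lambda>s. g (u s)) has_derivative (\<lambda>h. Complex (h * c) (h * (wedge (\<gamma> \<xi>) v / wedge (\<gamma> \<xi>) (tangent \<xi>))))) (at_right 0)"
  proof -
    have "(g has_derivative (\<lambda>v. Complex (wedge v (tangent \<xi>) / wedge (\<gamma> \<xi>) (tangent \<xi>))
         (wedge (\<gamma> \<xi>) v / wedge (\<gamma> \<xi>) (tangent \<xi>)))) (at (u 0))"
      using g(3) u(2) by simp
    from has_derivative_compose[OF du this] show ?thesis by (simp add: c_def)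
  qed
  then have "(r has_derivative (\<lambda>h. h * c)) (at_right 0)"
    unfolding r_def using bounded_linear.has_derivative[OF bounded_linear_Re] by fastforce
  then have "(r has_real_derivative c) (at 0 within {0<..})"
    unfolding has_field_derivative_def by (simp add: mult.commute[of _ c])
  then have lim: "((\<lambda>s. (r s - r 0) / s) \<longlongrightarrow> c) (at_right 0)" by (simp add: has_field_derivative_iff)
  have r0: "r 0 = 1" by (simp add: r_def u g)
  have z0: "\<gamma> \<xi> \<in> polar ` strip"
    by (rule image_eqI[of _ _ "Complex 1 \<xi>"]) (use \<xi> in \<open>auto simp: polar_def strip_def\<close>)
  have "(u \<longlongrightarrow> \<gamma> \<xi>) (at_right 0)"
    using has_vector_derivative_continuous[OF u(1)] u(2) by (simp add: continuous_within)
  then have ev: "\<forall>\<^sub>F s in at_right 0. u s \<in> polar ` strip"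
    using open_polar_image[OF order_refl open_strip] z0 by (rule topological_tendstoD)
  have pos: "\<forall>\<^sub>F s in at_right 0. 0 < (s::real)" by (rule eventually_at_right_less)
  have sc: "sg * wedge v (tangent \<xi>) = c * (sg * wedge (\<gamma> \<xi>) (tangent \<xi>))"
    using tangent_wedge_pos[OF \<xi>] by (auto simp: c_def)
  have us: "u s = r s *\<^sub>R \<gamma> (Im (g (u s)))" "r s > 0" "Im (g (u s)) \<in> {a<..<b}" if "u s \<in> polar ` strip" for s
    using g(1)[OF that] by (auto simp: polar_def r_def strip_def)
  show "\<forall>\<^sub>F s in at_right 0. u s \<notin> closure D" if "sg * wedge v (tangent \<xi>) > 0"
  proof -
    have "c > 0" using that tangent_wedge_pos[OF \<xi>] unfolding sc by (rule zero_less_mult_pos2)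
    then have "\<forall>\<^sub>F s in at_right 0. (r s - r 0) / s > 0" by (rule order_tendstoD(1)[OF lim])
    then show ?thesis using ev pos
    proof eventually_elim
      case (elim s)
      then have "r s > 1" by (simp add: r0 zero_less_divide_iff)
      then show ?case using us[OF elim(2)] beyond_notin_closure[of "Im (g (u s))" "r s"] by simp
    qed
  qed
  show "\<forall>\<^sub>F s in at_right 0. u s \<in> D" if "sg * wedge v (tangent \<xi>) < 0"
  proof -
    have "(- c) * (sg * wedge (\<gamma> \<xi>) (tangent \<xi>)) > 0" using that unfolding sc by simp
    then have "- c > 0" using tangent_wedge_pos[OF \<xi>] by (rule zero_less_mult_pos2)
    then have "c < 0" by simp
    then have "\<forall>\<^sub>F s in at_right 0. (r s - r 0) / s < 0" by (rule order_tendstoD(2)[OF lim])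
    then show ?thesis using ev pos
    proof eventually_elim
      case (elim s)
      then have "r s < 1" by (simp add: r0 divide_less_0_iff)
      then show ?case using us[OF elim(2)] inner_radius[of "Im (g (u s))" "r s"] by simp
    qed
  qed
qed

definition nrm :: "real \<Rightarrow> complex" where "nrm \<xi> = - (sg *\<^sub>R (\<i> * tangent \<xi>))"

lemma inner_nrm: "inner (nrm \<xi>) v = sg * wedge v (tangent \<xi>)"
  by (simp add: nrm_def inner_complex_def wedge_def algebra_simps)

lemma sg_sq: "sg * sg = 1" by (rule sec.s)

lemma sg_cases: "sg = 1 \<or> sg = - 1"
  using sg_sq by (metis mult_cancel_left1 power2_eq_1_iff power2_eq_square)

lemma norm_nrm: "\<xi> \<in> {a<..<b} \<Longrightarrow> norm (nrm \<xi>) = 1"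
  using sg_cases norm_tangent[OF subset_L(2)] by (auto simp: nrm_def norm_mult)

lemma inner_nrm_tangent: "inner (nrm \<xi>) (tangent \<xi>) = 0"
  by (simp add: inner_nrm)

lemma orth_decomp:
  assumes "\<xi> \<in> {a<..<b}"
  shows "v = inner v (tangent \<xi>) *\<^sub>R tangent \<xi> + inner v (nrm \<xi>) *\<^sub>R nrm \<xi>"
proof -
  define t where "t = tangent \<xi>"
  have t1: "Re t * Re t + Im t * Im t = 1"
    using norm_tangent[OF subset_L(2)[OF assms]] cmod_power2[of t] by (simp add: t_def power2_eq_square)
  have "inner v t *\<^sub>R t + inner v (nrm \<xi>) *\<^sub>R nrm \<xi> = inner v t *\<^sub>R t + (sg * sg) *\<^sub>R (wedge v t *\<^sub>R (- (\<i> * t)))"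
    by (simp add: inner_commute[of v "nrm \<xi>"] inner_nrm) (simp add: nrm_def t_def mult.commute mult.left_commute)
  also have "\<dots> = (Re t * Re t + Im t * Im t) *\<^sub>R v"
    unfolding sg_sq by (simp add: complex_eq_iff inner_complex_def wedge_def algebra_simps)
  finally show ?thesis unfolding t1 by (simp add: t_def)
qed

text \<open>There are two unit normals, and by \<open>crossing\<close> the opposite one points into
  \<open>D\<close>, so the defining description is met exactly once.\<close>

lemma outward_normal_eq:
  assumes \<xi>: "\<xi> \<in> {a<..<b}"
  shows "outward_normal \<xi> = nrm \<xi>"
  unfolding outward_normal_def
proof (rule the_equality)
  have d: "((\<lambda>s. \<gamma> \<xi> + s *\<^sub>R v) has_vector_derivative v) (at_right 0)" for v
    by (auto intro!: derivative_eq_intros)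
  have "sg * wedge (nrm \<xi>) (tangent \<xi>) = 1"
    using norm_nrm[OF \<xi>] by (simp add: inner_nrm[symmetric] power2_norm_eq_inner[symmetric])
  then have 1: "\<forall>\<^sub>F s in at_right 0. \<gamma> \<xi> + s *\<^sub>R nrm \<xi> \<notin> closure D"
    and 2: "\<forall>\<^sub>F s in at_right 0. \<gamma> \<xi> + s *\<^sub>R (- nrm \<xi>) \<in> D"
    using crossing(1)[OF \<xi> d[of "nrm \<xi>"]] crossing(2)[OF \<xi> d[of "- nrm \<xi>"]] by simp_all
  show "norm (nrm \<xi>) = 1 \<and> inner (nrm \<xi>) (tangent \<xi>) = 0 \<and> (\<forall>\<^sub>F s in at_right 0. \<gamma> \<xi> + s *\<^sub>R nrm \<xi> \<notin> closure D)"
    using norm_nrm[OF \<xi>] inner_nrm_tangent 1 by blast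
  fix n assume n: "norm n = 1 \<and> inner n (tangent \<xi>) = 0 \<and> (\<forall>\<^sub>F s in at_right 0. \<gamma> \<xi> + s *\<^sub>R n \<notin> closure D)"
  define c where "c = inner n (nrm \<xi>)"
  have nc: "n = c *\<^sub>R nrm \<xi>" using orth_decomp[OF \<xi>, of n] n by (simp add: c_def)
  then have "\<bar>c\<bar> = 1" using n norm_nrm[OF \<xi>] by simp
  moreover have "c \<noteq> - 1"
  proof
    assume "c = - 1"
    then have "\<forall>\<^sub>F s in at_right 0. \<gamma> \<xi> + s *\<^sub>R (- nrm \<xi>) \<notin> closure D" using n nc by simp
    then have "\<forall>\<^sub>F s in at_right (0::real). False" using 2
    proof eventually_elim
      case (elim s) then show ?case using closure_subset[of D] by blast
    qed
    then show False by simp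
  qed
  ultimately have "c = 1" by linarith
  then show "n = nrm \<xi>" using nc by simp
qed

lemma normal_curve_pos: "\<xi> \<in> {a<..<b} \<Longrightarrow> inner (nrm \<xi>) (\<gamma> \<xi>) > 0"
  using tangent_wedge_pos by (simp add: inner_nrm)

lemma lob_vec_out: "\<xi> \<in> {a<..<b} \<Longrightarrow> \<eta> \<in> {a<..<b} \<Longrightarrow> inner (nrm \<xi>) (lob_vec \<rho> (\<gamma> \<xi>) (\<gamma> \<eta>)) > 0"
  using lob_arc(5) by (simp add: inner_nrm)

end

section \<open>Length of an outer arc and its derivative\<close>

lemma lob_cos_commute: "lob_cos \<rho> q p = lob_cos \<rho> p q"
  by (simp add: lob_cos_def arc_disc_def inner_commute add.commute)

lemma lob_cos_quadratic:
  assumes "\<rho> > 0" "arc_disc \<rho> p q \<ge> 0"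
  shows "\<rho> * (lob_cos \<rho> p q)\<^sup>2 - 2 * inner p q * lob_cos \<rho> p q + (norm p)\<^sup>2 + (norm q)\<^sup>2 - \<rho> = 0"
proof -
  define c where "c = lob_cos \<rho> p q"
  have "\<rho> * c - inner p q = - sqrt (arc_disc \<rho> p q)" using assms by (simp add: c_def lob_cos_def)
  then have "(\<rho> * c - inner p q)\<^sup>2 = arc_disc \<rho> p q" using assms by simp
  then have "\<rho> * (\<rho> * c\<^sup>2 - 2 * inner p q * c + (norm p)\<^sup>2 + (norm q)\<^sup>2 - \<rho>) = 0"
    unfolding arc_disc_def by (simp add: algebra_simps power2_eq_square)
  then show ?thesis using assms by (simp add: c_def)
qed

text \<open>The coefficient of \<open>c\<^sub>1\<close> vanishes because the length is stationary with respect to the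
  travel time among arcs joining the given end points.\<close>
lemma outer_length_derivative:
  fixes c Q X :: "real \<Rightarrow> real"
  assumes d: "(c has_real_derivative c\<^sub>1) (at x)" "(Q has_real_derivative Q\<^sub>1) (at x)" "(X has_real_derivative X\<^sub>1) (at x)"
    and c: "- 1 < c x" "c x < 1" and q: "\<rho> * (c x)\<^sup>2 - 2 * X x * c x + P + Q x - \<rho> = 0"
    and \<omega>: "\<omega> > 0" and E: "E = \<rho> * \<omega>\<^sup>2 / 2"
  shows "((\<lambda>x. \<omega> * ((P + Q x) * c x - 2 * X x) / (2 * sqrt (1 - (c x)\<^sup>2)) + E * arccos (c x) / \<omega>)
     has_real_derivative \<omega> * (c x * Q\<^sub>1 - 2 * X\<^sub>1) / (2 * sqrt (1 - (c x)\<^sup>2))) (at x)"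
proof -
  have c2: "1 - (c x)\<^sup>2 > 0" using c by (simp add: abs_square_less_1)
  define S where "S = sqrt (1 - (c x)\<^sup>2)"
  have S: "S > 0" "S * S = 1 - (c x)\<^sup>2" using c2 by (auto simp: S_def)
  have dS: "((\<lambda>x. sqrt (1 - (c x)\<^sup>2)) has_real_derivative - (c x * c\<^sub>1 / S)) (at x)"
    using c2 by (auto intro!: derivative_eq_intros d simp: S_def divide_simps)
  have dA: "((\<lambda>x. arccos (c x)) has_real_derivative - c\<^sub>1 / S) (at x)"
    using DERIV_chain2[OF DERIV_arccos[OF c] d(1)] by (simp add: S_def divide_inverse mult.commute)
  have dN: "((\<lambda>x. \<omega> * ((P + Q x) * c x - 2 * X x)) has_real_derivative
       \<omega> * ((P + Q x) * c\<^sub>1 + Q\<^sub>1 * c x - 2 * X\<^sub>1)) (at x)"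
    by (auto intro!: derivative_eq_intros d simp: algebra_simps)
  have "((\<lambda>x. \<omega> * ((P + Q x) * c x - 2 * X x) / (2 * sqrt (1 - (c x)\<^sup>2))) has_real_derivative
     (\<omega> * ((P + Q x) * c\<^sub>1 + Q\<^sub>1 * c x - 2 * X\<^sub>1) * (2 * S) - \<omega> * ((P + Q x) * c x - 2 * X x) * (2 * (- (c x * c\<^sub>1 / S))))
      / ((2 * S) * (2 * S))) (at x)"
    using DERIV_divide[OF dN DERIV_cmult[OF dS, of 2]] S(1) by (simp add: S_def)
  moreover have "((\<lambda>x. E * arccos (c x) / \<omega>) has_real_derivative E * (- c\<^sub>1 / S) / \<omega>) (at x)"
    by (intro DERIV_cdivide DERIV_cmult dA)
  ultimately have "((\<lambda>x. \<omega> * ((P + Q x) * c x - 2 * X x) / (2 * sqrt (1 - (c x)\<^sup>2)) + E * arccos (c x) / \<omega>)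
     has_real_derivative (\<omega> * ((P + Q x) * c\<^sub>1 + Q\<^sub>1 * c x - 2 * X\<^sub>1) * (2 * S) - \<omega> * ((P + Q x) * c x - 2 * X x) * (2 * (- (c x * c\<^sub>1 / S))))
      / ((2 * S) * (2 * S)) + E * (- c\<^sub>1 / S) / \<omega>) (at x)"
    by (rule DERIV_add)
  moreover have "(\<omega> * ((P + Q x) * c\<^sub>1 + Q\<^sub>1 * c x - 2 * X\<^sub>1) * (2 * S) - \<omega> * ((P + Q x) * c x - 2 * X x) * (2 * (- (c x * c\<^sub>1 / S))))
      / ((2 * S) * (2 * S)) + E * (- c\<^sub>1 / S) / \<omega> = \<omega> * (c x * Q\<^sub>1 - 2 * X\<^sub>1) / (2 * S)"
  proof -
    have "(\<omega> * ((P + Q x) * c\<^sub>1 + Q\<^sub>1 * c x - 2 * X\<^sub>1) * (2 * S) - \<omega> * ((P + Q x) * c x - 2 * X x) * (2 * (- (c x * c\<^sub>1 / S))))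
      / ((2 * S) * (2 * S)) + E * (- c\<^sub>1 / S) / \<omega> - \<omega> * (c x * Q\<^sub>1 - 2 * X\<^sub>1) / (2 * S) =
      \<omega> * c\<^sub>1 / (2 * S * S * S) * ((P + Q x) * (S * S) + ((P + Q x) * c x - 2 * X x) * c x - \<rho> * (S * S))"
      using S(1) \<omega> unfolding E by (simp add: field_simps power2_eq_square)
    also have "(P + Q x) * (S * S) + ((P + Q x) * c x - 2 * X x) * c x - \<rho> * (S * S) = 0"
      using q unfolding S(2) by (simp add: algebra_simps power2_eq_square)
    finally show ?thesis by simp
  qed
  ultimately show ?thesis by (simp add: S_def)
qed

context refraction_domain
begin

text \<open>The value from \<open>jacobi_length_outer\<close> with the end velocities eliminated:
  the sine of the travel angle times \<open>w\<close> is
  \<open>q - lob_cos \<rho> p q *\<^sub>R p\<close>.\<close>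

definition outer_length :: "complex \<Rightarrow> complex \<Rightarrow> real" where
  "outer_length p q = (\<omega> * (((norm p)\<^sup>2 + (norm q)\<^sup>2) * lob_cos \<rho> p q - 2 * inner p q)
       / (2 * sqrt (1 - (lob_cos \<rho> p q)\<^sup>2)) + \<E> * arccos (lob_cos \<rho> p q) / \<omega>) / sqrt 2"

text \<open>At this energy the integrand is |v|^2 / sqrt 2, and the derivative of <z, v> is |v|^2 -
  \<omega>^2 |z|^2 = 2 |v|^2 - 2 \<E>. This virial identity provides the primitive
  \<open>G\<close>.\<close>

lemma jacobi_length_outer:
  assumes v: "newton_solution harmonic_force T z v" "\<And>s. s \<in> {0..T} \<Longrightarrow> (norm (v s))\<^sup>2 / 2 = V\<^sub>E (z s)" and T: "T > 0"
  shows "jacobi_length V\<^sub>E T z = ((inner (z T) (v T) - inner (z 0) (v 0)) / 2 + \<E> * T) / sqrt 2"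
proof -
  define G where "G s = (inner (z s) (v s) / 2 + \<E> * s) / sqrt 2" for s
  define f where "f s = norm (vector_derivative z (at s within {0..T})) * sqrt (V\<^sub>E (z s))" for s
  have dz: "(z has_vector_derivative v s) (at s within {0..T})"
    and dv: "(v has_vector_derivative - (\<omega>\<^sup>2 *\<^sub>R z s)) (at s within {0..T})" if "s \<in> {0..T}" for s
    using v(1) that by (auto simp: newton_solution_def harmonic_force_def)
  have fs: "f s = (norm (v s))\<^sup>2 / sqrt 2" if s: "s \<in> {0..T}" for s
  proof -
    have "vector_derivative z (at s within {0..T}) = v s"
      using vector_derivative_within_cbox[of 0 T s z "v s"] dz[OF s] s T by simp
    moreover have "sqrt (V\<^sub>E (z s)) = norm (v s) / sqrt 2"
      unfolding v(2)[OF s, symmetric] by (simp add: real_sqrt_divide)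
    ultimately show ?thesis by (simp add: f_def power2_eq_square)
  qed
  have "(G has_vector_derivative f s) (at s within {0..T})" if s: "s \<in> {0..T}" for s
  proof -
    have "((\<lambda>s. inner (z s) (v s)) has_derivative (\<lambda>h. inner (z s) (h *\<^sub>R - (\<omega>\<^sup>2 *\<^sub>R z s)) + inner (h *\<^sub>R v s) (v s))) (at s within {0..T})"
      using has_derivative_inner[OF dz[OF s, unfolded has_vector_derivative_def] dv[OF s, unfolded has_vector_derivative_def]] .
    then have di: "((\<lambda>s. inner (z s) (v s)) has_real_derivative (norm (v s))\<^sup>2 - \<omega>\<^sup>2 * (norm (z s))\<^sup>2) (at s within {0..T})"
      unfolding has_field_derivative_def power2_norm_eq_inner
      by (rule has_derivative_eq_rhs) (auto simp: fun_eq_iff algebra_simps)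
    have "(G has_real_derivative (((norm (v s))\<^sup>2 - \<omega>\<^sup>2 * (norm (z s))\<^sup>2) / 2 + \<E>) / sqrt 2) (at s within {0..T})"
      unfolding G_def by (intro DERIV_cdivide DERIV_add di DERIV_cmult_Id)
    moreover have "((norm (v s))\<^sup>2 - \<omega>\<^sup>2 * (norm (z s))\<^sup>2) / 2 + \<E> = (norm (v s))\<^sup>2"
      using v(2)[OF s] by (simp add: V\<^sub>E_def field_simps)
    ultimately show ?thesis using fs[OF s] by (simp add: has_real_derivative_iff_has_vector_derivative)
  qed
  then have "(f has_integral (G T - G 0)) {0..T}" using T by (intro fundamental_theorem_of_calculus) auto
  then have "jacobi_length V\<^sub>E T z = G T - G 0" unfolding jacobi_length_def f_def by (rule integral_unique)
  also have "\<dots> = ((inner (z T) (v T) - inner (z 0) (v 0)) / 2 + \<E> * T) / sqrt 2"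
    by (simp add: G_def diff_divide_distrib add_divide_distrib)
  finally show ?thesis .
qed

end

context arc_interval
begin

lemma S\<^sub>E_eq:
  assumes \<xi>: "\<xi> \<in> {a<..<b}" "\<eta> \<in> {a<..<b}"
  shows "S\<^sub>E \<xi> \<eta> = outer_length (\<gamma> \<xi>) (\<gamma> \<eta>)"
proof -
  define p q where "p = \<gamma> \<xi>" and "q = \<gamma> \<eta>"
  define c where "c = lob_cos \<rho> p q"
  define w where "w = lob_vec \<rho> p q"
  define \<theta> where "\<theta> = arccos c"
  note l = lob_arc[OF \<xi>, folded p_def q_def, folded c_def w_def]
  have cs: "cos \<theta> = c" using l by (simp add: \<theta>_def)
  have sn: "sin \<theta> = sqrt (1 - c\<^sup>2)" using l by (simp add: \<theta>_def sin_arccos)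
  have S: "sin \<theta> > 0" unfolding sn using l(2,3) by (simp add: abs_square_less_1)
  have all: "jacobi_length V\<^sub>E T z = outer_length p q" if o: "outer_arc p q T z" for T z
  proof -
    obtain v where v: "newton_solution harmonic_force T z v" "\<And>s. s \<in> {0..T} \<Longrightarrow> (norm (v s))\<^sup>2 / 2 = V\<^sub>E (z s)"
      and T: "T > 0" and z: "z 0 = p" "z T = q"
      using o by (auto simp: outer_arc_def)
    obtain w' where w': "hooke_arc D \<rho> p q (\<omega> * T) w'"
      "\<And>s. s \<in> {0..T} \<Longrightarrow> z s = cos (\<omega> * s) *\<^sub>R p + sin (\<omega> * s) *\<^sub>R w'"
      using outer_arc_hooke[OF o] by blast
    have wT: "\<omega> * T = \<theta>" "w' = w"
      using lob_hooke[OF \<xi>] w'(1) by (auto simp: \<theta>_def c_def w_def p_def q_def)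
    have v': "newton_solution (\<lambda>z. - (\<omega>\<^sup>2 *\<^sub>R z)) T z v" using v(1) by (simp add: harmonic_force_def[abs_def])
    have zT: "z T = cos \<theta> *\<^sub>R p + sin \<theta> *\<^sub>R (v 0 /\<^sub>R \<omega>)" and vT: "v T = \<omega> *\<^sub>R (cos \<theta> *\<^sub>R (v 0 /\<^sub>R \<omega>) - sin \<theta> *\<^sub>R p)"
      using newton_solution_harmonic[OF v' \<omega>_pos, of T] T z wT by auto
    have "sin \<theta> *\<^sub>R (v 0 /\<^sub>R \<omega>) = sin \<theta> *\<^sub>R w"
      using zT w'(2)[of T] T wT by simp
    then have v0: "v 0 /\<^sub>R \<omega> = w" using S by (simp only: scaleR_cancel_left) auto
    then have vT': "v T = \<omega> *\<^sub>R (cos \<theta> *\<^sub>R w - sin \<theta> *\<^sub>R p)" using vT by simp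
    have v00: "v 0 = \<omega> *\<^sub>R w" using v0 \<omega>_pos by (metis divideR_right less_irrefl)
    have q: "q = cos \<theta> *\<^sub>R p + sin \<theta> *\<^sub>R w" using zT z v0 by simp
    define X where "X = inner p q"
    have 1: "sin \<theta> * inner p w = X - c * (norm p)\<^sup>2"
      unfolding X_def q by (simp add: inner_add_right cs power2_norm_eq_inner)
    have "inner q q = cos \<theta> * inner p q + sin \<theta> * inner q w"
      by (subst (2) q) (simp add: inner_add_right inner_commute)
    then have 2: "sin \<theta> * inner q w = (norm q)\<^sup>2 - c * X" by (simp add: X_def cs power2_norm_eq_inner)
    have e: "inner (z T) (v T) - inner (z 0) (v 0) = \<omega> * (c * inner q w - sin \<theta> * X - inner p w)"
      unfolding z vT' v00 cs by (simp add: X_def inner_diff_right inner_commute algebra_simps)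
    have "sin \<theta> * (inner (z T) (v T) - inner (z 0) (v 0)) =
       \<omega> * (c * (sin \<theta> * inner q w) - (sin \<theta>)\<^sup>2 * X - sin \<theta> * inner p w)"
      unfolding e by (simp add: algebra_simps power2_eq_square)
    also have "\<dots> = \<omega> * (((norm p)\<^sup>2 + (norm q)\<^sup>2) * c - 2 * X)"
      unfolding 1 2 sin_squared_eq cs by (simp add: algebra_simps power2_eq_square)
    finally have "inner (z T) (v T) - inner (z 0) (v 0) = \<omega> * (((norm p)\<^sup>2 + (norm q)\<^sup>2) * c - 2 * X) / sin \<theta>"
      using S by (simp add: field_simps)
    moreover have "\<E> * T = \<E> * \<theta> / \<omega>" using wT(1) \<omega>_pos by (simp add: field_simps)
    moreover have "jacobi_length V\<^sub>E T z = ((inner (z T) (v T) - inner (z 0) (v 0)) / 2 + \<E> * T) / sqrt 2"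
      by (rule jacobi_length_outer[OF v(1) _ T]) (rule v(2))
    ultimately show ?thesis unfolding outer_length_def
      by (simp only: c_def[symmetric] sn X_def \<theta>_def[symmetric] divide_divide_eq_left mult.commute[of _ "2::real"])
  qed
  obtain T z where o: "outer_arc p q T z" using hooke_outer_arc[OF l(1)] by blast
  show ?thesis unfolding S\<^sub>E_def p_def[symmetric] q_def[symmetric]
    by (rule the_equality) (use o all in metis)+
qed

text \<open>The arrival velocity at \<open>\<eta>\<close> is minus the initial velocity of the
  reversed arc, which is \<omega> times \<open>lob_vec\<close> from \<open>\<eta>\<close> to
  \<open>\<xi>\<close>; this explains the sign and the order of the arguments.\<close>

lemma S\<^sub>E_derivative:
  assumes \<xi>: "\<xi> \<in> {a<..<b}" "\<eta> \<in> {a<..<b}"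
  shows "((\<lambda>x. S\<^sub>E \<xi> x) has_real_derivative - (\<omega> * inner (lob_vec \<rho> (\<gamma> \<eta>) (\<gamma> \<xi>)) (tangent \<eta>)) / sqrt 2) (at \<eta>)"
proof -
  define p where "p = \<gamma> \<xi>"
  define t where "t = tangent \<eta>"
  note l = lob_arc[OF \<xi>, folded p_def]
  have dt: "(\<gamma> has_derivative (\<lambda>h. h *\<^sub>R t)) (at \<eta>)"
    using curve_vector_derivative[OF subset_L(1)[OF \<xi>(2)]] by (simp add: has_vector_derivative_def t_def)
  have dX: "((\<lambda>x. inner p (\<gamma> x)) has_real_derivative inner p t) (at \<eta>)"
    unfolding has_field_derivative_def
    by (rule has_derivative_eq_rhs[OF has_derivative_inner_right[OF dt]]) (auto simp: fun_eq_iff)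
  have dQ: "((\<lambda>x. (norm (\<gamma> x))\<^sup>2) has_real_derivative 2 * inner (\<gamma> \<eta>) t) (at \<eta>)"
    unfolding has_field_derivative_def power2_norm_eq_inner
    by (rule has_derivative_eq_rhs[OF has_derivative_inner[OF dt dt]]) (auto simp: fun_eq_iff inner_commute)
  obtain c\<^sub>1 where dc: "((\<lambda>x. lob_cos \<rho> p (\<gamma> x)) has_real_derivative c\<^sub>1) (at \<eta>)"
  proof -
    have "((\<lambda>x. arc_disc \<rho> p (\<gamma> x)) has_real_derivative (2 * inner p (\<gamma> \<eta>) * inner p t - \<rho> * (2 * inner (\<gamma> \<eta>) t))) (at \<eta>)"
      unfolding arc_disc_def by (rule dX dQ derivative_eq_intros refl | simp)+
    from DERIV_chain2[OF DERIV_real_sqrt[OF l(4)] this]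
    have ds: "((\<lambda>x. sqrt (arc_disc \<rho> p (\<gamma> x))) has_real_derivative inverse (sqrt (arc_disc \<rho> p (\<gamma> \<eta>))) / 2 * (2 * inner p (\<gamma> \<eta>) * inner p t - \<rho> * (2 * inner (\<gamma> \<eta>) t))) (at \<eta>)" .
    show ?thesis by (rule that) (unfold lob_cos_def, rule DERIV_cdivide[OF DERIV_diff[OF dX ds]])
  qed
  have "((\<lambda>x. outer_length p (\<gamma> x)) has_real_derivative
     \<omega> * (lob_cos \<rho> p (\<gamma> \<eta>) * (2 * inner (\<gamma> \<eta>) t) - 2 * inner p t) / (2 * sqrt (1 - (lob_cos \<rho> p (\<gamma> \<eta>))\<^sup>2)) / sqrt 2) (at \<eta>)"
    unfolding outer_length_def
    by (intro DERIV_cdivide outer_length_derivative[OF dc dQ dX l(2,3) _ \<omega>_pos, where \<rho> = \<rho>])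
       (use lob_cos_quadratic[OF rho_pos less_imp_le[OF l(4)]] \<omega>_pos in \<open>auto simp: \<rho>_def\<close>)
  moreover have "\<omega> * (lob_cos \<rho> p (\<gamma> \<eta>) * (2 * inner (\<gamma> \<eta>) t) - 2 * inner p t) / (2 * sqrt (1 - (lob_cos \<rho> p (\<gamma> \<eta>))\<^sup>2)) / sqrt 2
      = - (\<omega> * inner (lob_vec \<rho> (\<gamma> \<eta>) p) t) / sqrt 2"
  proof -
    define c S where "c = lob_cos \<rho> p (\<gamma> \<eta>)" and "S = sqrt (1 - c\<^sup>2)"
    have S: "S > 0" using l(2,3) by (simp add: S_def c_def abs_square_less_1)
    have lv: "inner (lob_vec \<rho> (\<gamma> \<eta>) p) t = (inner p t - c * inner (\<gamma> \<eta>) t) / S"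
      unfolding lob_vec_def lob_cos_commute[of \<rho> "\<gamma> \<eta>" p] c_def[symmetric] S_def[symmetric]
      by (simp add: inner_diff_left divide_inverse_commute)
    have "\<omega> * (c * (2 * y) - 2 * x) / (2 * S) = - (\<omega> * ((x - c * y) / S))" for x y
      using S by (simp add: field_simps)
    then show ?thesis unfolding lv c_def[symmetric] S_def[symmetric] by simp
  qed
  ultimately have "((\<lambda>x. outer_length p (\<gamma> x)) has_real_derivative - (\<omega> * inner (lob_vec \<rho> (\<gamma> \<eta>) p) t) / sqrt 2) (at \<eta>)"
    by simp
  moreover have "\<forall>\<^sub>F x in nhds \<eta>. S\<^sub>E \<xi> x = outer_length p (\<gamma> x)"
    using eventually_nhds_in_open[of "{a<..<b}" \<eta>] \<xi>
    by (auto elim!: eventually_mono simp: p_def S\<^sub>E_eq)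
  ultimately show ?thesis using DERIV_cong_ev[of \<eta> \<eta>] by (simp add: p_def t_def)
qed

end

section \<open>Kepler arcs in Levi-Civita coordinates\<close>

text \<open>Linear hyperbolic motion run with a changed time \<open>\<tau>\<close>. With the
  identity as \<open>\<tau>\<close> it solves the regularized equation; with the Levi-Civita time it
  recognizes a physical Kepler arc as a regularized one.\<close>

lemma hyperbolic_flow:
  fixes f g :: "real \<Rightarrow> complex" and \<tau> \<tau>' :: "real \<Rightarrow> real"
  assumes \<kappa>: "\<kappa> \<noteq> 0" and \<tau>0: "\<tau> 0 = 0"
    and d\<tau>: "\<And>x. x \<in> {0..T} \<Longrightarrow> (\<tau> has_real_derivative \<tau>' x) (at x within {0..T})"
    and df: "\<And>x. x \<in> {0..T} \<Longrightarrow> (f has_vector_derivative \<tau>' x *\<^sub>R g x) (at x within {0..T})"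
    and dg: "\<And>x. x \<in> {0..T} \<Longrightarrow> (g has_vector_derivative (\<tau>' x * (\<kappa> * \<kappa>)) *\<^sub>R f x) (at x within {0..T})"
    and s: "s \<in> {0..T}"
  shows "f s = cosh (\<kappa> * \<tau> s) *\<^sub>R f 0 + sinh (\<kappa> * \<tau> s) *\<^sub>R (g 0 /\<^sub>R \<kappa>)"
    and "g s = \<kappa> *\<^sub>R (sinh (\<kappa> * \<tau> s) *\<^sub>R f 0 + cosh (\<kappa> * \<tau> s) *\<^sub>R (g 0 /\<^sub>R \<kappa>))"
proof -
  define A where "A x = cosh (\<kappa> * \<tau> x) *\<^sub>R f x - (sinh (\<kappa> * \<tau> x) / \<kappa>) *\<^sub>R g x" for x
  define B where "B x = (cosh (\<kappa> * \<tau> x) / \<kappa>) *\<^sub>R g x - sinh (\<kappa> * \<tau> x) *\<^sub>R f x" for x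
  have "(A has_vector_derivative 0) (at x within {0..T})" if "x \<in> {0..T}" for x
    unfolding A_def using \<kappa>
    by (auto intro!: derivative_eq_intros df[OF that] dg[OF that] d\<tau>[OF that] simp: algebra_simps)
  then obtain c where c: "\<And>x. x \<in> {0..T} \<Longrightarrow> A x = c"
    using has_vector_derivative_zero_constant[of "{0..T}" A] by auto
  have "(B has_vector_derivative 0) (at x within {0..T})" if "x \<in> {0..T}" for x
    unfolding B_def using \<kappa>
    by (auto intro!: derivative_eq_intros df[OF that] dg[OF that] d\<tau>[OF that] simp: algebra_simps)
  then obtain d where d: "\<And>x. x \<in> {0..T} \<Longrightarrow> B x = d"
    using has_vector_derivative_zero_constant[of "{0..T}" B] by auto
  have "0 \<in> {0..T}" using s by auto
  then have A0: "A s = f 0" and B0: "B s = g 0 /\<^sub>R \<kappa>"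
    using c[of 0] d[of 0] c[OF s] d[OF s] by (auto simp: A_def B_def \<tau>0 divide_inverse_commute)
  have rot: "c *\<^sub>R (c *\<^sub>R x - (d / \<kappa>) *\<^sub>R y) + d *\<^sub>R ((c / \<kappa>) *\<^sub>R y - d *\<^sub>R x) = (c\<^sup>2 - d\<^sup>2) *\<^sub>R x"
     "d *\<^sub>R (c *\<^sub>R x - (d / \<kappa>) *\<^sub>R y) + c *\<^sub>R ((c / \<kappa>) *\<^sub>R y - d *\<^sub>R x) = ((c\<^sup>2 - d\<^sup>2) / \<kappa>) *\<^sub>R y"
    for c d and x y :: complex
    by (simp_all add: algebra_simps power2_eq_square diff_divide_distrib)
  have hyp: "(cosh x)\<^sup>2 - (sinh x)\<^sup>2 = 1" for x :: real by (simp add: cosh_square_eq)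
  show "f s = cosh (\<kappa> * \<tau> s) *\<^sub>R f 0 + sinh (\<kappa> * \<tau> s) *\<^sub>R (g 0 /\<^sub>R \<kappa>)"
    unfolding A0[symmetric] B0[symmetric] A_def B_def rot hyp by simp
  show "g s = \<kappa> *\<^sub>R (sinh (\<kappa> * \<tau> s) *\<^sub>R f 0 + cosh (\<kappa> * \<tau> s) *\<^sub>R (g 0 /\<^sub>R \<kappa>))"
    unfolding A0[symmetric] B0[symmetric] A_def B_def rot hyp using \<kappa> by simp
qed

lemma lc_explicit:
  fixes w w' :: "real \<Rightarrow> complex"
  assumes n: "newton_solution (\<lambda>u. (H / 2) *\<^sub>R u) S w w'" and H: "H > 0" and t: "\<tau> \<in> {0..S}"
    and \<kappa>: "\<kappa> = sqrt (H / 2)"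
  shows "w \<tau> = cosh (\<kappa> * \<tau>) *\<^sub>R w 0 + sinh (\<kappa> * \<tau>) *\<^sub>R (w' 0 /\<^sub>R \<kappa>)"
    and "w' \<tau> = \<kappa> *\<^sub>R (sinh (\<kappa> * \<tau>) *\<^sub>R w 0 + cosh (\<kappa> * \<tau>) *\<^sub>R (w' 0 /\<^sub>R \<kappa>))"
proof -
  have k: "\<kappa> \<noteq> 0" "\<kappa> * \<kappa> = H / 2" using H by (auto simp: \<kappa>)
  show "w \<tau> = cosh (\<kappa> * \<tau>) *\<^sub>R w 0 + sinh (\<kappa> * \<tau>) *\<^sub>R (w' 0 /\<^sub>R \<kappa>)"
    "w' \<tau> = \<kappa> *\<^sub>R (sinh (\<kappa> * \<tau>) *\<^sub>R w 0 + cosh (\<kappa> * \<tau>) *\<^sub>R (w' 0 /\<^sub>R \<kappa>))"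
    by (rule hyperbolic_flow[OF k(1), where \<tau> = "\<lambda>x. x" and \<tau>' = "\<lambda>_. 1" and T = S];
        use n t k(2) in \<open>auto simp: newton_solution_def\<close>)+
qed

lemma lc_newton_solution:
  assumes "H > 0" "\<kappa> = sqrt (H / 2)"
  shows "newton_solution (\<lambda>u. (H / 2) *\<^sub>R u) S (\<lambda>\<tau>. cosh (\<kappa> * \<tau>) *\<^sub>R w0 + sinh (\<kappa> * \<tau>) *\<^sub>R W)
     (\<lambda>\<tau>. \<kappa> *\<^sub>R (sinh (\<kappa> * \<tau>) *\<^sub>R w0 + cosh (\<kappa> * \<tau>) *\<^sub>R W))"
proof -
  have k: "H / 2 = \<kappa> * \<kappa>" using assms by auto
  show ?thesis unfolding newton_solution_def k
    by (auto intro!: derivative_eq_intros simp: algebra_simps)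
qed

text \<open>If \<open>p = w\<^sub>0\<^sup>2\<close>, \<open>q = w\<^sub>1\<^sup>2\<close> with an obtuse angle between \<open>w\<^sub>0\<close> and \<open>w\<^sub>1\<close>, then \<open>kep_d p q\<close> is
  \<open>- \<langle>w\<^sub>0, w\<^sub>1\<rangle>\<close>, and \<open>kep_C\<close> is the hyperbolic cosine of the rescaled regularized travel time.\<close>
definition kep_d :: "complex \<Rightarrow> complex \<Rightarrow> real" where
  "kep_d p q = sqrt ((norm p * norm q + inner p q) / 2)"

definition kep_C :: "real \<Rightarrow> complex \<Rightarrow> complex \<Rightarrow> real" where
  "kep_C \<epsilon> p q = (kep_d p q + sqrt ((kep_d p q)\<^sup>2 + \<epsilon> * (norm p + norm q + \<epsilon>))) / \<epsilon>"

text \<open>Initial velocity of the topologically nontrivial Kepler arc from \<open>p\<close> to \<open>q\<close> at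
  energy \<open>H\<close>; in Levi-Civita coordinates this arc runs from a square root of \<open>p\<close> to the
  square root of \<open>q\<close> that makes an obtuse angle with it.\<close>
definition kep_vel :: "real \<Rightarrow> real \<Rightarrow> complex \<Rightarrow> complex \<Rightarrow> complex" where
  "kep_vel \<mu> H p q = - (2 * sqrt (H / 2) / sqrt ((kep_C (\<mu> / H) p q)\<^sup>2 - 1)) *\<^sub>R
     ((kep_C (\<mu> / H) p q / norm p) *\<^sub>R p + ((norm q / norm p) *\<^sub>R p + q) /\<^sub>R (2 * kep_d p q))"

text \<open>The Jacobi length of that arc. In regularized time the integrand has the primitive sqrt
  2 (<w, w'> + \<mu> \<tau> / 2), and \<open>arcosh (kep_C (\<mu> / H) p q)\<close> is
  \<open>sqrt (H / 2)\<close> times the regularized duration.\<close>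

definition kep_length :: "real \<Rightarrow> real \<Rightarrow> complex \<Rightarrow> complex \<Rightarrow> real" where
  "kep_length \<mu> H p q = sqrt 2 * (sqrt (H / 2) * ((norm p + norm q) * kep_C (\<mu> / H) p q + 2 * kep_d p q)
      / sqrt ((kep_C (\<mu> / H) p q)\<^sup>2 - 1) + \<mu> * arcosh (kep_C (\<mu> / H) p q) / (2 * sqrt (H / 2)))"

lemma kep_d_commute: "kep_d q p = kep_d p q"
  by (simp add: kep_d_def inner_commute mult.commute)

lemma kep_C_commute: "kep_C \<epsilon> q p = kep_C \<epsilon> p q"
  by (simp add: kep_C_def kep_d_commute add.commute)

text \<open>\<open>kep_C\<close> is the positive root. The last bound grows linearly in 1 /
  \<epsilon>, that is in the energy; it is the source of the transversality of inner arcs.\<close>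

lemma kep_C_quadratic:
  assumes "\<epsilon> > 0" "kep_d p q > 0"
  shows "\<epsilon> * (kep_C \<epsilon> p q)\<^sup>2 - 2 * kep_d p q * kep_C \<epsilon> p q - (norm p + norm q + \<epsilon>) = 0" "kep_C \<epsilon> p q > 1"
    "kep_C \<epsilon> p q \<ge> 2 * kep_d p q / \<epsilon>"
proof -
  define d P where "d = kep_d p q" and "P = norm p + norm q + \<epsilon>"
  define R where "R = sqrt (d\<^sup>2 + \<epsilon> * P)"
  have P: "P \<ge> \<epsilon>" "\<epsilon> * P > 0" using assms by (auto simp: P_def intro!: mult_pos_pos add_nonneg_pos)
  have R: "R\<^sup>2 = d\<^sup>2 + \<epsilon> * P" using P by (simp add: R_def)
  have C: "kep_C \<epsilon> p q = (d + R) / \<epsilon>" by (simp add: kep_C_def d_def R_def P_def)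
  have "\<epsilon> * (\<epsilon> * ((d + R) / \<epsilon>)\<^sup>2 - 2 * d * ((d + R) / \<epsilon>) - P) = R\<^sup>2 - d\<^sup>2 - \<epsilon> * P"
    using assms by (simp add: field_simps power2_eq_square)
  then have "\<epsilon> * ((d + R) / \<epsilon>)\<^sup>2 - 2 * d * ((d + R) / \<epsilon>) - P = 0" using R assms by simp
  then show "\<epsilon> * (kep_C \<epsilon> p q)\<^sup>2 - 2 * kep_d p q * kep_C \<epsilon> p q - (norm p + norm q + \<epsilon>) = 0"
    by (simp only: C d_def P_def)
  have Rd: "R \<ge> d" unfolding R_def using P by (intro real_le_rsqrt) simp
  then show "kep_C \<epsilon> p q \<ge> 2 * kep_d p q / \<epsilon>" unfolding C using assms by (simp add: d_def[symmetric] divide_right_mono)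
  have "\<epsilon>\<^sup>2 \<le> \<epsilon> * P" using P(1) assms by (simp add: power2_eq_square)
  then have Re: "R \<ge> \<epsilon>" unfolding R_def by (intro real_le_rsqrt) (simp add: add_increasing)
  have "d + R > \<epsilon>" using Re assms(2) by (simp add: d_def)
  then show "kep_C \<epsilon> p q > 1" unfolding C using assms by simp
qed

text \<open>By the equality case of Cauchy-Schwarz the radicand vanishes only for opposite
  directions, and then the segment passes through the origin.\<close>

lemma kep_d_pos:
  assumes "0 \<notin> closed_segment p q"
  shows "kep_d p q > 0"
proof -
  have p: "p \<noteq> 0" "q \<noteq> 0" using assms by auto
  have "norm p * norm q + inner p q > 0"
  proof (rule ccontr)
    assume "\<not> ?thesis"
    then have e: "inner p q = - (norm p * norm q)" using norm_cauchy_schwarz[of p "- q"] by simp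
    define x where "x = norm q *\<^sub>R p + norm p *\<^sub>R q"
    have "inner x x = (norm q)\<^sup>2 * inner p p + (norm p)\<^sup>2 * inner q q + 2 * (norm p * norm q * inner p q)"
      by (simp add: x_def inner_add_left inner_add_right inner_commute[of q p] power2_eq_square algebra_simps)
    then have "inner x x = 0" unfolding e power2_norm_eq_inner[symmetric] by (simp add: power2_eq_square)
    then have x0: "norm q *\<^sub>R p + norm p *\<^sub>R q = 0" by (simp add: x_def)
    define u where "u = norm p / (norm p + norm q)"
    have s: "norm p + norm q > 0" using p by (simp add: add_pos_pos)
    have u: "1 - u = norm q / (norm p + norm q)" "0 \<le> u" "u \<le> 1" using s by (auto simp: u_def field_simps)
    have "(1 - u) *\<^sub>R p + u *\<^sub>R q = (1 / (norm p + norm q)) *\<^sub>R (norm q *\<^sub>R p + norm p *\<^sub>R q)"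
      unfolding u(1) by (simp add: u_def scaleR_add_right)
    then have "(1 - u) *\<^sub>R p + u *\<^sub>R q = 0" unfolding x0 by simp
    then have "0 \<in> closed_segment p q" unfolding in_segment using u by metis
    then show False using assms by simp
  qed
  then show ?thesis by (simp add: kep_d_def)
qed

lemma inner_sqrt_sq:
  "(inner w v)\<^sup>2 = (norm (w\<^sup>2) * norm (v\<^sup>2) + inner (w\<^sup>2) (v\<^sup>2)) / 2" for w v :: complex
proof -
  have "norm (w\<^sup>2) * norm (v\<^sup>2) = ((Re w)\<^sup>2 + (Im w)\<^sup>2) * ((Re v)\<^sup>2 + (Im v)\<^sup>2)"
    by (simp add: norm_power cmod_power2)
  then show ?thesis
    by (simp add: inner_complex_def power2_eq_square algebra_simps)
qed

text \<open>Recovers the product of two square roots from the squares and the scalar product, so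
  that the arc can be described by its end points without choosing branches.\<close>

lemma product_of_square_roots:
  "(2 * inner w v) *\<^sub>R (w * v) = norm (v\<^sup>2) *\<^sub>R w\<^sup>2 + norm (w\<^sup>2) *\<^sub>R v\<^sup>2" for w v :: complex
proof -
  have n: "norm (z\<^sup>2) = (Re z)\<^sup>2 + (Im z)\<^sup>2" for z :: complex by (simp add: norm_power cmod_power2)
  show ?thesis unfolding n
    by (simp add: complex_eq_iff inner_complex_def power2_eq_square algebra_simps)
qed

text \<open>Solving for \<open>W\<close> and inserting it into the energy relation gives a quadratic
  equation for \<open>cosh \<sigma>\<close>, whose positive root is \<open>kep_C\<close>; the obtuse
  angle is what makes \<open>kep_d\<close> equal to \<open>- inner w0 v\<close>. The velocities then
  follow from \<open>product_of_square_roots\<close>.\<close>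

lemma kep_endpoints:
  fixes w0 W :: complex
  assumes H: "H > 0" and \<mu>: "\<mu> > 0" and \<sigma>: "\<sigma> > 0" and W: "(norm W)\<^sup>2 = (norm w0)\<^sup>2 + \<mu> / H"
    and v: "v = cosh \<sigma> *\<^sub>R w0 + sinh \<sigma> *\<^sub>R W" and neg: "inner w0 v < 0"
  shows "kep_d (w0\<^sup>2) (v\<^sup>2) = - inner w0 v" "cosh \<sigma> = kep_C (\<mu> / H) (w0\<^sup>2) (v\<^sup>2)"
    "sinh \<sigma> = sqrt ((kep_C (\<mu> / H) (w0\<^sup>2) (v\<^sup>2))\<^sup>2 - 1)"
    "2 * (sqrt (H / 2) *\<^sub>R W) / cnj w0 = kep_vel \<mu> H (w0\<^sup>2) (v\<^sup>2)"
    "2 * (sqrt (H / 2) *\<^sub>R (sinh \<sigma> *\<^sub>R w0 + cosh \<sigma> *\<^sub>R W)) / cnj v = - kep_vel \<mu> H (v\<^sup>2) (w0\<^sup>2)"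
    "inner v (sinh \<sigma> *\<^sub>R w0 + cosh \<sigma> *\<^sub>R W) - inner w0 W =
       ((norm (w0\<^sup>2) + norm (v\<^sup>2)) * cosh \<sigma> + 2 * kep_d (w0\<^sup>2) (v\<^sup>2)) / sinh \<sigma>"
proof -
  define p q where "p = w0\<^sup>2" and "q = v\<^sup>2"
  define d where "d = - inner w0 v"
  define C where "C = cosh \<sigma>"
  define Z where "Z = sinh \<sigma>"
  define \<epsilon> where "\<epsilon> = \<mu> / H"
  have \<epsilon>: "\<epsilon> > 0" using \<mu> H by (simp add: \<epsilon>_def)
  have Z: "Z > 0" "Z\<^sup>2 = C\<^sup>2 - 1" using \<sigma> by (auto simp: Z_def C_def cosh_square_eq)
  have C0: "C > 0" by (simp add: C_def)
  have d: "d > 0" using neg by (simp add: d_def)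
  have np: "norm p = (norm w0)\<^sup>2" and nq: "norm q = (norm v)\<^sup>2" by (auto simp: p_def q_def norm_power)
  have w0n: "w0 \<noteq> 0" and vn: "v \<noteq> 0" using neg by auto
  have p0: "norm p > 0" "norm q > 0" using w0n vn by (auto simp: p_def q_def)
  have kd: "kep_d p q = d"
    unfolding kep_d_def p_def q_def inner_sqrt_sq[symmetric] d_def using neg by simp
  then show "kep_d (w0\<^sup>2) (v\<^sup>2) = - inner w0 v" by (simp add: p_def q_def d_def)
  have ZW: "Z *\<^sub>R W = v - C *\<^sub>R w0" using v by (simp add: Z_def C_def)
  have quad: "\<epsilon> * C\<^sup>2 - 2 * d * C - (norm p + norm q + \<epsilon>) = 0"
  proof -
    have "(norm (Z *\<^sub>R W))\<^sup>2 = (C\<^sup>2 - 1) * (norm p + \<epsilon>)" by (simp add: power_mult_distrib Z W np \<epsilon>_def)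
    moreover have "(norm (v - C *\<^sub>R w0))\<^sup>2 = norm q + 2 * d * C + C\<^sup>2 * norm p"
      unfolding np nq d_def power2_norm_eq_inner
      by (simp add: inner_diff_left inner_diff_right inner_commute[of v w0] power2_eq_square algebra_simps)
    ultimately show ?thesis unfolding ZW by (simp add: algebra_simps)
  qed
  have kq: "\<epsilon> * (kep_C \<epsilon> p q)\<^sup>2 - 2 * d * kep_C \<epsilon> p q - (norm p + norm q + \<epsilon>) = 0" "kep_C \<epsilon> p q > 1"
    using kep_C_quadratic[OF \<epsilon>, of p q] d kd by auto
  have CC: "C = kep_C \<epsilon> p q"
  proof -
    define K where "K = kep_C \<epsilon> p q"
    have "(C - K) * (\<epsilon> * (C + K) - 2 * d) = 0"
      using quad kq(1) unfolding K_def[symmetric] by (simp add: algebra_simps power2_eq_square)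
    moreover have "\<epsilon> * (C + K) - 2 * d > 0"
    proof -
      have "K * (\<epsilon> * K - 2 * d) = norm p + norm q + \<epsilon>" using kq(1) by (simp add: K_def algebra_simps power2_eq_square)
      moreover have "norm p + norm q + \<epsilon> > 0" using p0 \<epsilon> by linarith
      ultimately have "K * (\<epsilon> * K - 2 * d) > 0" by linarith
      then have "\<epsilon> * K - 2 * d > 0" using kq(2) by (simp add: K_def zero_less_mult_iff)
      moreover have "\<epsilon> * C > 0" using \<epsilon> C0 by simp
      ultimately show ?thesis by (simp add: algebra_simps)
    qed
    ultimately show ?thesis by (simp add: K_def)
  qed
  show "cosh \<sigma> = kep_C (\<mu> / H) (w0\<^sup>2) (v\<^sup>2)" using CC by (simp add: C_def \<epsilon>_def p_def q_def)
  have ZZ: "Z = sqrt ((kep_C \<epsilon> p q)\<^sup>2 - 1)"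
    unfolding CC[symmetric] Z(2)[symmetric] using Z(1) by simp
  then show "sinh \<sigma> = sqrt ((kep_C (\<mu> / H) (w0\<^sup>2) (v\<^sup>2))\<^sup>2 - 1)" by (simp add: Z_def \<epsilon>_def p_def q_def)
  have prod: "w0 * v = - ((norm q *\<^sub>R p + norm p *\<^sub>R q) /\<^sub>R (2 * d))"
  proof -
    have "(2 * inner w0 v) *\<^sub>R (w0 * v) = norm q *\<^sub>R p + norm p *\<^sub>R q"
      unfolding p_def q_def by (rule product_of_square_roots)
    then have "norm q *\<^sub>R p + norm p *\<^sub>R q = - ((2 * d) *\<^sub>R (w0 * v))" by (simp add: d_def)
    then show ?thesis using d by simp
  qed
  have cdiv: "x / cnj y = (x * y) /\<^sub>R (norm y)\<^sup>2" if "y \<noteq> 0" for x y :: complex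
  proof -
    have "x / cnj y = (x * y) / (y * cnj y)" using that by (simp add: field_simps)
    then show ?thesis unfolding complex_norm_square[symmetric]
      by (simp add: scaleR_conv_of_real divide_inverse mult.commute of_real_inverse)
  qed
  define \<kappa> where "\<kappa> = sqrt (H / 2)"
  have W': "W = (v - C *\<^sub>R w0) /\<^sub>R Z" unfolding ZW[symmetric] using Z by simp
  have vel: "- (2 * \<kappa> / Z) *\<^sub>R ((C / norm x) *\<^sub>R x + ((norm y / norm x) *\<^sub>R x + y) /\<^sub>R (2 * d)) =
      (2 * \<kappa> / (Z * norm x)) *\<^sub>R (- ((norm y *\<^sub>R x + norm x *\<^sub>R y) /\<^sub>R (2 * d)) - C *\<^sub>R x)"
    if "norm x > 0" for x y :: complex
    using that Z d by (simp add: complex_eq_iff field_simps)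
  have gen: "(2 * (\<kappa> *\<^sub>R (x /\<^sub>R Z)) * y) /\<^sub>R N = (2 * \<kappa> / (Z * N)) *\<^sub>R (x * y)" for x y :: complex and N
    by (simp add: complex_eq_iff divide_inverse inverse_mult_distrib algebra_simps)
  have "2 * (\<kappa> *\<^sub>R W) / cnj w0 = (2 * \<kappa> / (Z * norm p)) *\<^sub>R (w0 * v - C *\<^sub>R p)"
    unfolding cdiv[OF w0n] W' np gen unfolding p_def
    by (simp add: algebra_simps power2_eq_square)
  also have "\<dots> = kep_vel \<mu> H p q"
    unfolding prod kep_vel_def \<epsilon>_def[symmetric] \<kappa>_def[symmetric] ZZ[symmetric]
    unfolding CC[symmetric] kd vel[OF p0(1)] ..
  finally show "2 * (sqrt (H / 2) *\<^sub>R W) / cnj w0 = kep_vel \<mu> H (w0\<^sup>2) (v\<^sup>2)" by (simp add: \<kappa>_def p_def q_def)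
  have fin: "Z *\<^sub>R w0 + C *\<^sub>R W = (C *\<^sub>R v - w0) /\<^sub>R Z"
  proof -
    have "Z *\<^sub>R (Z *\<^sub>R w0 + C *\<^sub>R W) = Z\<^sup>2 *\<^sub>R w0 + C *\<^sub>R (Z *\<^sub>R W)" by (simp add: scaleR_add_right power2_eq_square mult.commute)
    also have "\<dots> = C *\<^sub>R v - w0" unfolding ZW Z(2) by (simp add: algebra_simps power2_eq_square)
    finally show ?thesis using Z(1) by (metis divideR_right less_irrefl)
  qed
  have "2 * (\<kappa> *\<^sub>R (Z *\<^sub>R w0 + C *\<^sub>R W)) / cnj v = - ((2 * \<kappa> / (Z * norm q)) *\<^sub>R (w0 * v - C *\<^sub>R q))"
    unfolding cdiv[OF vn] fin nq gen unfolding q_def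
    by (simp add: algebra_simps power2_eq_square)
  also have "\<dots> = - kep_vel \<mu> H q p"
    unfolding prod kep_vel_def \<epsilon>_def[symmetric] \<kappa>_def[symmetric] kep_C_commute[of \<epsilon> q p] kep_d_commute[of q p]
      ZZ[symmetric]
    unfolding CC[symmetric] kd vel[OF p0(2)] by (simp add: add.commute)
  finally show "2 * (sqrt (H / 2) *\<^sub>R (sinh \<sigma> *\<^sub>R w0 + cosh \<sigma> *\<^sub>R W)) / cnj v = - kep_vel \<mu> H (v\<^sup>2) (w0\<^sup>2)"
    by (simp add: \<kappa>_def p_def q_def Z_def C_def)
  have "inner v (Z *\<^sub>R w0 + C *\<^sub>R W) - inner w0 W = ((norm p + norm q) * C + 2 * d) / Z"
    unfolding fin unfolding W' np nq d_def power2_norm_eq_inner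
    using Z(1) by (simp add: inner_diff_right inner_commute[of v w0] field_simps)
  then show "inner v (sinh \<sigma> *\<^sub>R w0 + cosh \<sigma> *\<^sub>R W) - inner w0 W =
       ((norm (w0\<^sup>2) + norm (v\<^sup>2)) * cosh \<sigma> + 2 * kep_d (w0\<^sup>2) (v\<^sup>2)) / sinh \<sigma>"
    using kd by (simp add: p_def q_def Z_def C_def)
qed

section \<open>Regularized arcs and physical time\<close>

locale lc_arc =
  fixes \<mu> H S :: real and w w' :: "real \<Rightarrow> complex"
  assumes \<mu>: "\<mu> > 0" and H: "H > 0" and S: "S > 0"
    and sol: "newton_solution (\<lambda>u. (H / 2) *\<^sub>R u) S w w'"
    and energy: "\<And>\<tau>. \<tau> \<in> {0..S} \<Longrightarrow> 2 * (norm (w' \<tau>))\<^sup>2 - H * (norm (w \<tau>))\<^sup>2 = \<mu>"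
begin

definition sf :: "real \<Rightarrow> real" where "sf \<tau> = integral {0..\<tau>} (\<lambda>u. (norm (w u))\<^sup>2)"

lemma dw: "\<tau> \<in> {0..S} \<Longrightarrow> (w has_vector_derivative w' \<tau>) (at \<tau> within {0..S})"
  and dw': "\<tau> \<in> {0..S} \<Longrightarrow> (w' has_vector_derivative (H / 2) *\<^sub>R w \<tau>) (at \<tau> within {0..S})"
  using sol by (auto simp: newton_solution_def)

lemma cont_w: "continuous_on {0..S} w" "continuous_on {0..S} w'"
  by (auto simp: continuous_on_eq_continuous_within intro: has_vector_derivative_continuous[OF dw]
      has_vector_derivative_continuous[OF dw'])

lemma sf0: "sf 0 = 0" by (simp add: sf_def)

lemma dsf: "\<tau> \<in> {0..S} \<Longrightarrow> (sf has_real_derivative (norm (w \<tau>))\<^sup>2) (at \<tau> within {0..S})"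
  unfolding has_real_derivative_iff_has_vector_derivative sf_def
  by (intro integral_has_vector_derivative continuous_intros cont_w)

lemma dsf_at: "0 < \<tau> \<Longrightarrow> \<tau> < S \<Longrightarrow> (sf has_real_derivative (norm (w \<tau>))\<^sup>2) (at \<tau>)"
  using dsf[of \<tau>] by (simp add: at_within_Icc_at)

lemma cont_sf: "continuous_on {0..S} sf"
  using dsf by (rule DERIV_continuous_on)

lemma inner_derivative:
  assumes "\<tau> \<in> {0..S}"
  shows "((\<lambda>\<tau>. inner (w \<tau>) (w' \<tau>)) has_real_derivative H * (norm (w \<tau>))\<^sup>2 + \<mu> / 2) (at \<tau> within {0..S})"
proof -
  have "((\<lambda>\<tau>. inner (w \<tau>) (w' \<tau>)) has_derivative
      (\<lambda>h. inner (w \<tau>) (h *\<^sub>R ((H / 2) *\<^sub>R w \<tau>)) + inner (h *\<^sub>R w' \<tau>) (w' \<tau>))) (at \<tau> within {0..S})"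
    using has_derivative_inner[OF dw[OF assms, unfolded has_vector_derivative_def] dw'[OF assms, unfolded has_vector_derivative_def]] .
  moreover have w'2: "(norm (w' \<tau>))\<^sup>2 = (\<mu> + H * (norm (w \<tau>))\<^sup>2) / 2"
    using energy[OF assms] by simp
  have "inner (w \<tau>) (h *\<^sub>R ((H / 2) *\<^sub>R w \<tau>)) + inner (h *\<^sub>R w' \<tau>) (w' \<tau>) = (H * (norm (w \<tau>))\<^sup>2 + \<mu> / 2) * h" for h
    by (simp add: power2_norm_eq_inner[symmetric] w'2 field_simps)
  ultimately show ?thesis unfolding has_field_derivative_def by simp
qed

text \<open>\<open>inner (w \<tau>) (w' \<tau>)\<close> vanishes at a collision and has derivative
  at least \<mu> / 2, so there is at most one collision.\<close>

lemma zero_unique: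
  assumes "\<tau>\<^sub>1 \<in> {0..S}" "\<tau>\<^sub>2 \<in> {0..S}" "w \<tau>\<^sub>1 = 0" "w \<tau>\<^sub>2 = 0"
  shows "\<tau>\<^sub>1 = \<tau>\<^sub>2"
proof -
  have "False" if t: "\<tau>\<^sub>1 \<in> {0..S}" "\<tau>\<^sub>2 \<in> {0..S}" "w \<tau>\<^sub>1 = 0" "w \<tau>\<^sub>2 = 0" "\<tau>\<^sub>1 < \<tau>\<^sub>2" for \<tau>\<^sub>1 \<tau>\<^sub>2
  proof -
    have "inner (w \<tau>\<^sub>1) (w' \<tau>\<^sub>1) < inner (w \<tau>\<^sub>2) (w' \<tau>\<^sub>2)"
    proof (rule DERIV_pos_imp_increasing_open[OF t(5)])
      fix x assume x: "\<tau>\<^sub>1 < x" "x < \<tau>\<^sub>2"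
      then have "((\<lambda>\<tau>. inner (w \<tau>) (w' \<tau>)) has_real_derivative H * (norm (w x))\<^sup>2 + \<mu> / 2) (at x)"
        using inner_derivative[of x] t by (simp add: at_within_Icc_at)
      moreover have "H * (norm (w x))\<^sup>2 + \<mu> / 2 > 0" using H \<mu> by (intro add_nonneg_pos) auto
      ultimately show "\<exists>y. ((\<lambda>\<tau>. inner (w \<tau>) (w' \<tau>)) has_real_derivative y) (at x) \<and> 0 < y" by blast
    next
      show "continuous_on {\<tau>\<^sub>1..\<tau>\<^sub>2} (\<lambda>\<tau>. inner (w \<tau>) (w' \<tau>))"
        using t by (intro continuous_intros continuous_on_subset[OF cont_w(1)] continuous_on_subset[OF cont_w(2)]) auto
    qed
    then show False using t by simp
  qed
  from this[of \<tau>\<^sub>1 \<tau>\<^sub>2] this[of \<tau>\<^sub>2 \<tau>\<^sub>1] show ?thesis using assms by force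
qed

text \<open>Physical time is stationary in regularized time only at a collision. As there is at most
  one, strict monotonicity holds on both sides of it.\<close>

lemma sf_strict:
  assumes "0 \<le> \<tau>\<^sub>1" "\<tau>\<^sub>1 < \<tau>\<^sub>2" "\<tau>\<^sub>2 \<le> S"
  shows "sf \<tau>\<^sub>1 < sf \<tau>\<^sub>2"
proof -
  have nz: "sf x < sf y" if "0 \<le> x" "x < y" "y \<le> S" "\<And>\<tau>. x < \<tau> \<Longrightarrow> \<tau> < y \<Longrightarrow> w \<tau> \<noteq> 0" for x y
  proof (rule DERIV_pos_imp_increasing_open[OF that(2)])
    fix \<tau> assume "x < \<tau>" "\<tau> < y"
    then show "\<exists>d. (sf has_real_derivative d) (at \<tau>) \<and> 0 < d"
      using dsf_at[of \<tau>] that by (intro exI[of _ "(norm (w \<tau>))\<^sup>2"]) auto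
  qed (use that in \<open>auto intro: continuous_on_subset[OF cont_sf]\<close>)
  show ?thesis
  proof (cases "\<exists>\<tau>. \<tau>\<^sub>1 < \<tau> \<and> \<tau> < \<tau>\<^sub>2 \<and> w \<tau> = 0")
    case True
    then obtain \<tau> where t: "\<tau>\<^sub>1 < \<tau>" "\<tau> < \<tau>\<^sub>2" "w \<tau> = 0" by blast
    have u: "w x \<noteq> 0" if "0 \<le> x" "x \<le> S" "x \<noteq> \<tau>" for x
      using zero_unique[of x \<tau>] that t assms by auto
    have "sf \<tau>\<^sub>1 < sf \<tau>" using t assms by (intro nz u) auto
    also have "\<dots> < sf \<tau>\<^sub>2" using t assms by (intro nz u) auto
    finally show ?thesis .
  qed (use assms nz in blast)
qed

lemma sf_inj: "inj_on sf {0..S}"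
proof (rule inj_onI)
  fix x y assume "x \<in> {0..S}" "y \<in> {0..S}" "sf x = sf y"
  then show "x = y" using sf_strict[of x y] sf_strict[of y x] by (cases x y rule: linorder_cases) auto
qed

lemma sf_image: "sf ` {0..S} = {0..sf S}"
proof (intro equalityI subsetI)
  fix y assume "y \<in> sf ` {0..S}"
  then obtain x where x: "x \<in> {0..S}" "y = sf x" by blast
  show "y \<in> {0..sf S}" using sf_strict[of 0 x] sf_strict[of x S] x sf0
    by (cases "x = 0"; cases "x = S") auto
next
  fix y assume "y \<in> {0..sf S}"
  then show "y \<in> sf ` {0..S}"
    using IVT'[of sf 0 y S] cont_sf sf0 S by auto
qed

lemma sf_open: "\<tau> \<in> {0<..<S} \<Longrightarrow> sf \<tau> \<in> {0<..<sf S}"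
  using sf_strict[of 0 \<tau>] sf_strict[of \<tau> S] sf0 by auto

lemma sf_pos: "sf S > 0" using sf_strict[of 0 S] S sf0 by simp

definition tau :: "real \<Rightarrow> real" where "tau = the_inv_into {0..S} sf"

lemma sf_tau: "s \<in> {0..sf S} \<Longrightarrow> sf (tau s) = s" "s \<in> {0..sf S} \<Longrightarrow> tau s \<in> {0..S}"
  unfolding tau_def using f_the_inv_into_f[OF sf_inj] the_inv_into_into[OF sf_inj _ order_refl]
  by (auto simp: sf_image)

lemma tau_sf: "\<tau> \<in> {0..S} \<Longrightarrow> tau (sf \<tau>) = \<tau>"
  unfolding tau_def by (simp add: the_inv_into_f_f sf_inj)

lemma cont_tau: "continuous_on {0..sf S} tau"
  using continuous_on_inv_into[OF cont_sf compact_Icc sf_inj] by (simp add: sf_image tau_def)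

lemma tau_open: "s \<in> {0<..<sf S} \<Longrightarrow> tau s \<in> {0<..<S}"
  using sf_tau[of s] sf0 by (cases "tau s = 0"; cases "tau s = S") auto

lemma dtau:
  assumes s: "s \<in> {0<..<sf S}" and nz: "w (tau s) \<noteq> 0"
  shows "(tau has_real_derivative inverse ((norm (w (tau s)))\<^sup>2)) (at s)"
proof (rule DERIV_inverse_function[where f = sf and a = 0 and b = "sf S"])
  show "(sf has_real_derivative (norm (w (tau s)))\<^sup>2) (at (tau s))"
    using dsf_at tau_open[OF s] by auto
  show "isCont tau s"
    using continuous_on_interior[OF cont_tau, of s] s by (simp add: interior_atLeastAtMost_real)
qed (use s nz sf_tau(1) in auto)

text \<open>In regularized time the integrand is sqrt 2 (H |w|^2 + \<mu>), the derivative of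
  \<open>\<Phi>\<close>. At the collision instant collected in \<open>N\<close> the inverse time
  change is only continuous, so the fundamental theorem is used with a finite exceptional
  set.\<close>

lemma jacobi_length_lc:
  assumes z: "\<And>\<tau>. \<tau> \<in> {0..S} \<Longrightarrow> z (sf \<tau>) = (w \<tau>)\<^sup>2"
    and V: "\<And>z. V z = H + \<mu> / norm z"
  shows "jacobi_length V (sf S) z = sqrt 2 * (inner (w S) (w' S) - inner (w 0) (w' 0) + \<mu> * S / 2)"
proof -
  define \<Phi> where "\<Phi> \<tau> = sqrt 2 * (inner (w \<tau>) (w' \<tau>) + \<mu> * \<tau> / 2)" for \<tau>
  define f where "f s = norm (vector_derivative z (at s within {0..sf S})) * sqrt (V (z s))" for s
  define N where "N = {s \<in> {0..sf S}. w (tau s) = 0}"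
  have zt: "z s = (w (tau s))\<^sup>2" if "s \<in> {0..sf S}" for s using z[of "tau s"] sf_tau[OF that] by simp
  have fN: "finite N"
  proof -
    have sub: "N \<subseteq> {s}" if "s \<in> N" for s
    proof
      fix x assume x: "x \<in> N"
      then have "tau x = tau s" using zero_unique[of "tau x" "tau s"] sf_tau(2) that by (auto simp: N_def)
      moreover have "sf (tau x) = x" "sf (tau s) = s" using sf_tau(1) x that by (auto simp: N_def)
      ultimately have "x = s" by metis
      then show "x \<in> {s}" by simp
    qed
    show ?thesis
    proof (cases "N = {}")
      case False
      then obtain s where "s \<in> N" by blast
      from sub[OF this] show ?thesis by (rule finite_subset) simp
    qed simp
  qed
  have d\<Phi>: "(\<Phi> has_real_derivative sqrt 2 * (H * (norm (w \<tau>))\<^sup>2 + \<mu>)) (at \<tau>)" if "\<tau> \<in> {0<..<S}" for \<tau>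
  proof -
    have "((\<lambda>\<tau>. inner (w \<tau>) (w' \<tau>)) has_real_derivative H * (norm (w \<tau>))\<^sup>2 + \<mu> / 2) (at \<tau>)"
      using inner_derivative[of \<tau>] that by (simp add: at_within_Icc_at)
    from DERIV_cmult[OF DERIV_add[OF this DERIV_cdivide[OF DERIV_cmult_Id[of \<mu>], of 2]], of "sqrt 2"]
    show ?thesis unfolding \<Phi>_def by (simp add: add.commute)
  qed
  have "((\<lambda>s. \<Phi> (tau s)) has_vector_derivative f s) (at s)" if s: "s \<in> {0<..<sf S} - N" for s
  proof -
    have s': "s \<in> {0<..<sf S}" "s \<in> {0..sf S}" using s by auto
    define t where "t = tau s"
    have nz: "w t \<noteq> 0" using s by (auto simp: N_def t_def)
    have ts: "t \<in> {0<..<S}" using tau_open[OF s'(1)] by (simp add: t_def)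
    have d1: "((\<lambda>s. \<Phi> (tau s)) has_real_derivative sqrt 2 * (H * (norm (w t))\<^sup>2 + \<mu>) * inverse ((norm (w t))\<^sup>2)) (at s)"
      using DERIV_chain2[OF d\<Phi>[OF tau_open[OF s'(1)]] dtau[OF s'(1)]] nz by (simp add: t_def)
    have dwt: "(w has_vector_derivative w' t) (at t)"
      using dw[of t] ts by (simp add: at_within_Icc_at)
    have dc: "((w \<circ> tau) has_vector_derivative inverse ((norm (w t))\<^sup>2) *\<^sub>R w' t) (at s)"
      by (rule vector_diff_chain_at)
         (use dtau[OF s'(1)] nz dwt in \<open>auto simp: t_def has_real_derivative_iff_has_vector_derivative\<close>)
    have "((\<lambda>s. (w (tau s)) * (w (tau s))) has_vector_derivative
        w t * (inverse ((norm (w t))\<^sup>2) *\<^sub>R w' t) + inverse ((norm (w t))\<^sup>2) *\<^sub>R w' t * w t) (at s)"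
      using has_vector_derivative_mult[OF dc dc] by (simp add: t_def o_def)
    then have "(z has_vector_derivative w t * (inverse ((norm (w t))\<^sup>2) *\<^sub>R w' t) + inverse ((norm (w t))\<^sup>2) *\<^sub>R w' t * w t) (at s)"
    proof (rule has_vector_derivative_transform_within_open)
      show "open {0<..<sf S}" "s \<in> {0<..<sf S}" using s' by auto
      show "w (tau x) * w (tau x) = z x" if "x \<in> {0<..<sf S}" for x
        using zt[of x] that by (simp add: power2_eq_square)
    qed
    then have "vector_derivative z (at s within {0..sf S}) =
        w t * (inverse ((norm (w t))\<^sup>2) *\<^sub>R w' t) + inverse ((norm (w t))\<^sup>2) *\<^sub>R w' t * w t"
      using s' by (simp add: at_within_Icc_at vector_derivative_at)
    also have "\<dots> = (2 * inverse ((norm (w t))\<^sup>2)) *\<^sub>R (w t * w' t)" by (simp add: complex_eq_iff algebra_simps)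
    finally have n: "norm (vector_derivative z (at s within {0..sf S})) = 2 * norm (w' t) / norm (w t)"
      using nz by (simp add: norm_mult power2_eq_square field_simps)
    have en: "H * (norm (w t))\<^sup>2 + \<mu> = 2 * (norm (w' t))\<^sup>2" using energy[of t] ts by simp
    have "V (z s) = 2 * (norm (w' t))\<^sup>2 / (norm (w t))\<^sup>2"
      unfolding V zt[OF s'(2)] t_def[symmetric] en[symmetric] using nz by (simp add: norm_power field_simps)
    then have "sqrt (V (z s)) = sqrt 2 * norm (w' t) / norm (w t)"
      by (simp add: real_sqrt_divide real_sqrt_mult)
    then have "f s = 2 * sqrt 2 * (norm (w' t))\<^sup>2 / (norm (w t))\<^sup>2"
      unfolding f_def n by (simp add: power2_eq_square)
    also have "\<dots> = sqrt 2 * (H * (norm (w t))\<^sup>2 + \<mu>) * inverse ((norm (w t))\<^sup>2)"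
      unfolding en by (simp add: divide_inverse)
    finally show ?thesis using d1 by (simp add: has_real_derivative_iff_has_vector_derivative)
  qed
  moreover have "continuous_on {0..sf S} (\<lambda>s. \<Phi> (tau s))"
  proof -
    have "continuous_on {0..S} \<Phi>" unfolding \<Phi>_def by (intro continuous_intros cont_w) simp
    then show ?thesis by (rule continuous_on_compose2[OF _ cont_tau]) (use sf_tau(2) in auto)
  qed
  ultimately have "(f has_integral (\<Phi> (tau (sf S)) - \<Phi> (tau 0))) {0..sf S}"
    using sf_pos by (intro fundamental_theorem_of_calculus_interior_strong[OF fN]) auto
  then have "jacobi_length V (sf S) z = \<Phi> (tau (sf S)) - \<Phi> (tau 0)"
    unfolding jacobi_length_def f_def by (rule integral_unique)
  also have "\<dots> = \<Phi> S - \<Phi> 0" using tau_sf[of S] tau_sf[of 0] S sf0 by simp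
  finally show ?thesis by (simp add: \<Phi>_def algebra_simps)
qed

lemma lc_endpoints:
  assumes neg: "inner (w 0) (w S) < 0"
  shows "2 * w' 0 / cnj (w 0) = kep_vel \<mu> H ((w 0)\<^sup>2) ((w S)\<^sup>2)"
    and "2 * w' S / cnj (w S) = - kep_vel \<mu> H ((w S)\<^sup>2) ((w 0)\<^sup>2)"
    and "sqrt 2 * (inner (w S) (w' S) - inner (w 0) (w' 0) + \<mu> * S / 2) = kep_length \<mu> H ((w 0)\<^sup>2) ((w S)\<^sup>2)"
proof -
  define \<kappa> where "\<kappa> = sqrt (H / 2)"
  have k: "\<kappa> > 0" "\<kappa>\<^sup>2 = H / 2" using H by (auto simp: \<kappa>_def)
  define W where "W = w' 0 /\<^sub>R \<kappa>"
  have w'0: "w' 0 = \<kappa> *\<^sub>R W" using k by (simp add: W_def)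
  have e: "w S = cosh (\<kappa> * S) *\<^sub>R w 0 + sinh (\<kappa> * S) *\<^sub>R W"
     "w' S = \<kappa> *\<^sub>R (sinh (\<kappa> * S) *\<^sub>R w 0 + cosh (\<kappa> * S) *\<^sub>R W)"
    using lc_explicit[OF sol H _ \<kappa>_def, of S] S by (auto simp: W_def)
  have nW: "(norm W)\<^sup>2 = (norm (w 0))\<^sup>2 + \<mu> / H"
  proof -
    have "2 * (\<kappa>\<^sup>2 * (norm W)\<^sup>2) - H * (norm (w 0))\<^sup>2 = \<mu>" using energy[of 0] S by (simp add: w'0 power_mult_distrib)
    then show ?thesis unfolding k(2) using H by (simp add: field_simps)
  qed
  have ks: "\<kappa> * S > 0" using k S by simp
  note kp = kep_endpoints[OF H \<mu> ks nW e(1) neg]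
  show "2 * w' 0 / cnj (w 0) = kep_vel \<mu> H ((w 0)\<^sup>2) ((w S)\<^sup>2)"
    using kp(4) unfolding w'0 \<kappa>_def[symmetric] .
  show "2 * w' S / cnj (w S) = - kep_vel \<mu> H ((w S)\<^sup>2) ((w 0)\<^sup>2)"
    using kp(5) unfolding e(2) \<kappa>_def[symmetric] .
  have "inner (w S) (w' S) - inner (w 0) (w' 0) =
     \<kappa> * (inner (w S) (sinh (\<kappa> * S) *\<^sub>R w 0 + cosh (\<kappa> * S) *\<^sub>R W) - inner (w 0) W)"
    unfolding w'0 e(2) by (simp add: algebra_simps)
  then have a: "inner (w S) (w' S) - inner (w 0) (w' 0) =
    \<kappa> * (((norm ((w 0)\<^sup>2) + norm ((w S)\<^sup>2)) * cosh (\<kappa> * S) + 2 * kep_d ((w 0)\<^sup>2) ((w S)\<^sup>2)) / sinh (\<kappa> * S))"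
    unfolding kp(6) .
  have b: "arcosh (kep_C (\<mu> / H) ((w 0)\<^sup>2) ((w S)\<^sup>2)) = \<kappa> * S"
    unfolding kp(2)[symmetric] using ks by (intro arcosh_cosh_real) simp
  have c: "\<mu> * S / 2 = \<mu> * (\<kappa> * S) / (2 * \<kappa>)" using k by simp
  show "sqrt 2 * (inner (w S) (w' S) - inner (w 0) (w' 0) + \<mu> * S / 2) = kep_length \<mu> H ((w 0)\<^sup>2) ((w S)\<^sup>2)"
    unfolding a c kep_length_def \<kappa>_def[symmetric] b kp(3)[symmetric] unfolding kp(2)[symmetric]
    by (simp only: times_divide_eq_right)
qed

end

lemma levi_civita_iff:
  assumes "\<mu> > 0" "H > 0"
  shows "levi_civita_solution \<mu> H T z v \<longleftrightarrow>
    (\<exists>S w w'. lc_arc \<mu> H S w w' \<and> T = lc_arc.sf w S \<and>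
       (\<forall>\<tau>\<in>{0..S}. z (lc_arc.sf w \<tau>) = (w \<tau>)\<^sup>2 \<and> (w \<tau> \<noteq> 0 \<longrightarrow> v (lc_arc.sf w \<tau>) = 2 * w' \<tau> / cnj (w \<tau>))))"
proof -
  have sf: "lc_arc \<mu> H S w w' \<Longrightarrow> lc_arc.sf w = (\<lambda>\<tau>. integral {0..\<tau>} (\<lambda>u. (norm (w u))\<^sup>2))" for S w w'
    using lc_arc.sf_def by blast
  show ?thesis
    unfolding levi_civita_solution_def Let_def
    apply (intro iffI; elim exE conjE)
    subgoal for S w w'
    proof -
      assume a: "0 < S" "newton_solution (\<lambda>u. (H / 2) *\<^sub>R u) S w w'"
        "\<forall>\<tau>\<in>{0..S}. 2 * (norm (w' \<tau>))\<^sup>2 - H * (norm (w \<tau>))\<^sup>2 = \<mu>"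
      then have l: "lc_arc \<mu> H S w w'" using assms by unfold_locales auto
      assume "integral {0..S} (\<lambda>u. (norm (w u))\<^sup>2) = T"
        "\<forall>\<tau>\<in>{0..S}. z (integral {0..\<tau>} (\<lambda>u. (norm (w u))\<^sup>2)) = (w \<tau>)\<^sup>2 \<and>
            (w \<tau> \<noteq> 0 \<longrightarrow> v (integral {0..\<tau>} (\<lambda>u. (norm (w u))\<^sup>2)) = 2 * w' \<tau> / cnj (w \<tau>))"
      then show ?thesis using l unfolding sf[OF l, symmetric] by (metis sf)
    qed
    subgoal for S w w'
    proof -
      assume l: "lc_arc \<mu> H S w w'" and b: "T = lc_arc.sf w S"
       "\<forall>\<tau>\<in>{0..S}. z (lc_arc.sf w \<tau>) = (w \<tau>)\<^sup>2 \<and> (w \<tau> \<noteq> 0 \<longrightarrow> v (lc_arc.sf w \<tau>) = 2 * w' \<tau> / cnj (w \<tau>))"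
      interpret lc_arc \<mu> H S w w' by (rule l)
      show ?thesis
        by (intro exI[of _ S] exI[of _ w] exI[of _ w'] conjI)
           (use S sol energy b in \<open>auto simp: sf_def\<close>)
    qed
    done
qed

text \<open>A continuous square root of \<open>z\<close> along the arc is obtained without branch
  cuts as a constant times the exponential of a primitive of v / (2 z). In the time with ds = |z|
  d\<tau> it satisfies the linear equation.\<close>

lemma newton_to_levi_civita:
  fixes z v :: "real \<Rightarrow> complex"
  assumes \<mu>: "\<mu> > 0" and H: "H > 0" and T: "T > 0"
    and sol: "newton_solution (\<lambda>z. - ((\<mu> / norm z ^ 3) *\<^sub>R z)) T z v"
    and nz: "\<And>s. s \<in> {0..T} \<Longrightarrow> z s \<noteq> 0"
    and en: "\<And>s. s \<in> {0..T} \<Longrightarrow> (norm (v s))\<^sup>2 / 2 = H + \<mu> / norm (z s)"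
  shows "levi_civita_solution \<mu> H T z v"
proof -
  define \<kappa> where "\<kappa> = sqrt (H / 2)"
  have k: "\<kappa> > 0" "\<kappa> * \<kappa> = H / 2" using H by (auto simp: \<kappa>_def)
  have dz: "(z has_vector_derivative v s) (at s within {0..T})"
    and dv: "(v has_vector_derivative - ((\<mu> / norm (z s) ^ 3) *\<^sub>R z s)) (at s within {0..T})" if "s \<in> {0..T}" for s
    using sol that by (auto simp: newton_solution_def)
  have cont: "continuous_on {0..T} z" "continuous_on {0..T} v"
    by (auto simp: continuous_on_eq_continuous_within intro: has_vector_derivative_continuous[OF dz]
        has_vector_derivative_continuous[OF dv])
  define J where "J s = integral {0..s} (\<lambda>x. v x / (2 * z x))" for s
  have dJ: "(J has_vector_derivative v s / (2 * z s)) (at s within {0..T})" if "s \<in> {0..T}" for s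
    unfolding J_def using that nz by (intro integral_has_vector_derivative continuous_intros cont) auto
  define w0 where "w0 = csqrt (z 0)"
  define \<omega> where "\<omega> s = w0 * exp (J s)" for s
  have dexp: "((\<lambda>s. exp (c * J s)) has_vector_derivative c * (v s / (2 * z s)) * exp (c * J s)) (at s within {0..T})"
    if "s \<in> {0..T}" for s c
  proof -
    have "((\<lambda>s. c * J s) has_vector_derivative c * (v s / (2 * z s))) (at s within {0..T})"
      by (rule has_vector_derivative_mult_right[OF dJ[OF that]])
    from field_vector_diff_chain_within[OF this, of exp "exp (c * J s)"]
    show ?thesis by (simp add: o_def DERIV_exp has_field_derivative_at_within)
  qed
  have "((\<lambda>s. exp (- 2 * J s) * z s) has_vector_derivative 0) (at s within {0..T})" if "s \<in> {0..T}" for s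
    using has_vector_derivative_mult[OF dexp[OF that, of "- 2"] dz[OF that]] nz[OF that]
    by (simp add: field_simps)
  then obtain c where c: "\<And>s. s \<in> {0..T} \<Longrightarrow> exp (- 2 * J s) * z s = c"
    using has_vector_derivative_zero_constant[of "{0..T}" "\<lambda>s. exp (- 2 * J s) * z s"] by auto
  have zw: "z s = (\<omega> s)\<^sup>2" if s: "s \<in> {0..T}" for s
  proof -
    have "exp (- 2 * J s) * z s = z 0" using c[OF s] c[of 0] T by (simp add: J_def)
    then have "exp (2 * J s) * (exp (- 2 * J s) * z s) = exp (2 * J s) * z 0" by simp
    then have "z s = exp (2 * J s) * z 0" by (simp add: mult.assoc[symmetric] exp_add[symmetric])
    then show ?thesis by (simp add: \<omega>_def w0_def power_mult_distrib exp_double[symmetric] mult.commute)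
  qed
  define n where "n s = (norm (\<omega> s))\<^sup>2" for s
  have nn: "norm (z s) = n s" if "s \<in> {0..T}" for s using zw[OF that] by (simp add: n_def norm_power)
  have n0: "n s > 0" if "s \<in> {0..T}" for s using nn[OF that] nz[OF that] by (metis zero_less_norm_iff)
  have \<omega>0: "\<omega> s \<noteq> 0" if "s \<in> {0..T}" for s using n0[OF that] by (auto simp: n_def)
  have cc: "\<omega> s * cnj (\<omega> s) = of_real (n s)" for s unfolding n_def complex_norm_square ..
  define \<tau> where "\<tau> s = integral {0..s} (\<lambda>x. 1 / norm (z x))" for s
  have d\<tau>: "(\<tau> has_real_derivative 1 / n s) (at s within {0..T})" if "s \<in> {0..T}" for s
    unfolding \<tau>_def has_real_derivative_iff_has_vector_derivative nn[OF that, symmetric]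
    using that nz by (intro integral_has_vector_derivative continuous_intros cont) auto
  \<comment> \<open>The derivative of the square root in regularized time.\<close>
  define \<pi> where "\<pi> s = v s * cnj (\<omega> s) / 2" for s
  have d\<omega>: "(\<omega> has_vector_derivative (1 / n s) *\<^sub>R \<pi> s) (at s within {0..T})" if s: "s \<in> {0..T}" for s
  proof -
    have "(\<omega> has_vector_derivative w0 * (v s / (2 * z s) * exp (J s))) (at s within {0..T})"
      unfolding \<omega>_def using has_vector_derivative_mult_right[OF dexp[OF s, of 1], of w0] by simp
    also have "w0 * (v s / (2 * z s) * exp (J s)) = \<omega> s * v s / (2 * (\<omega> s)\<^sup>2)"
      unfolding zw[OF s] by (simp add: \<omega>_def)
    also have "\<dots> = v s * cnj (\<omega> s) / (2 * (\<omega> s * cnj (\<omega> s)))"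
      using \<omega>0[OF s] by (simp add: power2_eq_square field_simps)
    also have "\<dots> = (1 / n s) *\<^sub>R \<pi> s" unfolding cc by (simp add: \<pi>_def scaleR_conv_of_real field_simps)
    finally show ?thesis .
  qed
  have d\<pi>: "(\<pi> has_vector_derivative (1 / n s * (\<kappa> * \<kappa>)) *\<^sub>R \<omega> s) (at s within {0..T})" if s: "s \<in> {0..T}" for s
  proof -
    define N where "N = (of_real (n s) :: complex)"
    have N: "N \<noteq> 0" "\<omega> s * cnj (\<omega> s) = N" using n0[OF s] cc by (auto simp: N_def)
    have "(\<pi> has_vector_derivative (v s * cnj ((1 / n s) *\<^sub>R \<pi> s) + - ((\<mu> / norm (z s) ^ 3) *\<^sub>R z s) * cnj (\<omega> s)) / 2) (at s within {0..T})"
      unfolding \<pi>_def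
      by (intro has_vector_derivative_divide has_vector_derivative_mult dv[OF s] has_vector_derivative_cnj d\<omega>[OF s, unfolded \<pi>_def])
    also have "v s * cnj ((1 / n s) *\<^sub>R \<pi> s) = of_real ((norm (v s))\<^sup>2) * \<omega> s / (2 * N)"
      unfolding \<pi>_def complex_norm_square N_def by (simp add: scaleR_conv_of_real field_simps)
    also have "(norm (v s))\<^sup>2 = 2 * (H + \<mu> / n s)" using en[OF s] nn[OF s] by simp
    also have "- ((\<mu> / norm (z s) ^ 3) *\<^sub>R z s) * cnj (\<omega> s) = - (of_real \<mu> / N ^ 3) * (\<omega> s * (\<omega> s * cnj (\<omega> s)))"
      unfolding nn[OF s] unfolding zw[OF s] N_def by (simp add: scaleR_conv_of_real power2_eq_square mult.assoc)
    also have "(of_real (2 * (H + \<mu> / n s)) * \<omega> s / (2 * N) + - (of_real \<mu> / N ^ 3) * (\<omega> s * (\<omega> s * cnj (\<omega> s)))) / 2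
       = (of_real H / 2) * \<omega> s / N"
    proof -
      have ofN: "of_real (2 * (H + \<mu> / n s)) = 2 * (of_real H + of_real \<mu> / N)" by (simp add: N_def)
      show ?thesis unfolding ofN N(2) using N(1) by (simp add: field_simps power3_eq_cube)
    qed
    also have "\<dots> = (1 / n s * (\<kappa> * \<kappa>)) *\<^sub>R \<omega> s" unfolding k(2) N_def by (simp add: scaleR_conv_of_real)
    finally show ?thesis .
  qed
  have \<tau>0: "\<tau> 0 = 0" by (simp add: \<tau>_def)
  define w where "w x = cosh (\<kappa> * x) *\<^sub>R \<omega> 0 + sinh (\<kappa> * x) *\<^sub>R (\<pi> 0 /\<^sub>R \<kappa>)" for x
  define w' where "w' x = \<kappa> *\<^sub>R (sinh (\<kappa> * x) *\<^sub>R \<omega> 0 + cosh (\<kappa> * x) *\<^sub>R (\<pi> 0 /\<^sub>R \<kappa>))" for x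
  have kn: "\<kappa> \<noteq> 0" using k by simp
  have e: "\<omega> s = w (\<tau> s)" "\<pi> s = w' (\<tau> s)" if "s \<in> {0..T}" for s
    unfolding w_def w'_def using hyperbolic_flow[OF kn \<tau>0 d\<tau> d\<omega> d\<pi> that] by auto
  define S where "S = \<tau> T"
  have mono: "\<tau> x < \<tau> y" if "0 \<le> x" "x < y" "y \<le> T" for x y
  proof (rule DERIV_pos_imp_increasing_open[OF that(2)])
    fix s assume "x < s" "s < y"
    then show "\<exists>d. (\<tau> has_real_derivative d) (at s) \<and> 0 < d"
      using d\<tau>[of s] n0[of s] that by (intro exI[of _ "1 / n s"]) (auto simp: at_within_Icc_at)
  next
    have "continuous_on {0..T} \<tau>" using d\<tau> by (rule DERIV_continuous_on)
    then show "continuous_on {x..y} \<tau>" by (rule continuous_on_subset) (use that in auto)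
  qed
  have S: "S > 0" using mono[of 0 T] T by (simp add: S_def \<tau>0)
  have im: "\<tau> ` {0..T} \<subseteq> {0..S}"
  proof
    fix y assume "y \<in> \<tau> ` {0..T}"
    then obtain x where x: "x \<in> {0..T}" "y = \<tau> x" by blast
    show "y \<in> {0..S}" using mono[of 0 x] mono[of x T] x \<tau>0 by (cases "x = 0"; cases "x = T") (auto simp: S_def)
  qed
  have surj: "\<exists>s\<in>{0..T}. x = \<tau> s" if "x \<in> {0..S}" for x
    using IVT'[of \<tau> 0 x T] DERIV_continuous_on[OF d\<tau>] \<tau>0 T that by (auto simp: S_def)
  have lc: "lc_arc \<mu> H S w w'"
  proof
    show "newton_solution (\<lambda>u. (H / 2) *\<^sub>R u) S w w'"
      unfolding w_def w'_def by (rule lc_newton_solution[OF H \<kappa>_def])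
    fix x assume "x \<in> {0..S}"
    then obtain s where s: "s \<in> {0..T}" "x = \<tau> s" using surj by blast
    have "(norm (\<pi> s))\<^sup>2 = (norm (v s))\<^sup>2 / 2 * n s / 2" by (simp add: \<pi>_def norm_mult norm_divide power_mult_distrib power_divide n_def)
    also have "\<dots> = (H + \<mu> / n s) * n s / 2" using en[OF s(1)] nn[OF s(1)] by simp
    also have "(H + \<mu> / n s) * n s = H * n s + \<mu>" using n0[OF s(1)] by (simp add: field_simps)
    finally have "2 * (norm (\<pi> s))\<^sup>2 - H * n s = \<mu>" by simp
    then show "2 * (norm (w' x))\<^sup>2 - H * (norm (w x))\<^sup>2 = \<mu>" using e[OF s(1)] by (simp add: s(2) n_def)
  qed (use \<mu> H S in auto)
  interpret lc_arc \<mu> H S w w' by (rule lc)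
  \<comment> \<open>The two time changes are inverse to each other: the derivative of
    \<open>sf (\<tau> s)\<close> is |w|^2 / |z| = 1.\<close>
  have sft: "sf (\<tau> s) = s" if s: "s \<in> {0..T}" for s
  proof -
    have "((\<lambda>s. sf (\<tau> s) - s) has_vector_derivative 0) (at s within {0..T})" if s: "s \<in> {0..T}" for s
    proof -
      have "(sf has_vector_derivative n s) (at (\<tau> s) within {0..S})"
      proof -
        have "\<tau> s \<in> {0..S}" using im s by blast
        then show ?thesis using dsf[of "\<tau> s"] e(1)[OF s] by (simp add: has_real_derivative_iff_has_vector_derivative n_def)
      qed
      then have "(sf has_vector_derivative n s) (at (\<tau> s) within \<tau> ` {0..T})"
        using im by (rule has_vector_derivative_within_subset)
      from vector_diff_chain_within[OF d\<tau>[OF s, unfolded has_real_derivative_iff_has_vector_derivative] this]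
      have "((\<lambda>s. sf (\<tau> s)) has_vector_derivative 1) (at s within {0..T})" using n0[OF s] by (simp add: o_def)
      from has_vector_derivative_diff[OF this has_vector_derivative_id] show ?thesis by simp
    qed
    then obtain c where c: "\<And>s. s \<in> {0..T} \<Longrightarrow> sf (\<tau> s) - s = c"
      using has_vector_derivative_zero_constant[of "{0..T}" "\<lambda>s. sf (\<tau> s) - s"] by auto
    show ?thesis using c[OF s] c[of 0] T \<tau>0 sf0 by simp
  qed
  show ?thesis unfolding levi_civita_iff[OF \<mu> H]
  proof (intro exI conjI ballI)
    show "lc_arc \<mu> H S w w'" by (rule lc)
    show "T = sf S" using sft[of T] T by (simp add: S_def)
    fix x assume "x \<in> {0..S}"
    then obtain s where s: "s \<in> {0..T}" "x = \<tau> s" using surj by blast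
    show "z (sf x) = (w x)\<^sup>2" using sft[OF s(1)] s zw[OF s(1)] e(1)[OF s(1)] by simp
    have "v s = 2 * \<pi> s / cnj (\<omega> s)" using \<omega>0[OF s(1)] by (simp add: \<pi>_def)
    then show "w x \<noteq> 0 \<longrightarrow> v (sf x) = 2 * w' x / cnj (w x)" using sft[OF s(1)] s e[OF s(1)] by simp
  qed
qed

section \<open>Homotopy class of an inner arc and the angle of the square roots\<close>

context lc_arc
begin

text \<open>The boundary value problem for the linear equation: the weights are sinh of the
  remaining and of the elapsed time, divided by sinh of the total.\<close>

lemma w_convex_combination:
  assumes "\<tau> \<in> {0..S}"
  obtains A B where "0 \<le> A" "0 \<le> B" "A + B > 0" "w \<tau> = A *\<^sub>R w 0 + B *\<^sub>R w S"
proof -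
  define \<kappa> where "\<kappa> = sqrt (H / 2)"
  have k: "\<kappa> > 0" using H by (simp add: \<kappa>_def)
  define W where "W = w' 0 /\<^sub>R \<kappa>"
  have e: "w t = cosh (\<kappa> * t) *\<^sub>R w 0 + sinh (\<kappa> * t) *\<^sub>R W" if "t \<in> {0..S}" for t
    using lc_explicit(1)[OF sol H that \<kappa>_def] by (simp add: W_def)
  have sp: "sinh (\<kappa> * S) > 0" using k S by simp
  define A B where "A = sinh (\<kappa> * S - \<kappa> * \<tau>) / sinh (\<kappa> * S)" and "B = sinh (\<kappa> * \<tau>) / sinh (\<kappa> * S)"
  have n: "\<kappa> * \<tau> \<le> \<kappa> * S" "0 \<le> \<kappa> * \<tau>" using assms k by auto
  have "A \<ge> 0" "B \<ge> 0" using sp n by (auto simp: A_def B_def)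
  moreover have "A + B > 0"
  proof (cases "\<tau> = 0")
    case True then show ?thesis using k S by (simp add: A_def B_def)
  next
    case False
    then have "B > 0" using sp assms k by (simp add: B_def)
    then show ?thesis using \<open>A \<ge> 0\<close> by simp
  qed
  moreover have "w \<tau> = A *\<^sub>R w 0 + B *\<^sub>R w S"
  proof -
    have "A + B * cosh (\<kappa> * S) = cosh (\<kappa> * \<tau>)" "B * sinh (\<kappa> * S) = sinh (\<kappa> * \<tau>)"
    proof -
      have sum: "sinh (\<kappa> * S - \<kappa> * \<tau>) + sinh (\<kappa> * \<tau>) * cosh (\<kappa> * S) = sinh (\<kappa> * S) * cosh (\<kappa> * \<tau>)"
        by (simp add: sinh_diff)
      show "A + B * cosh (\<kappa> * S) = cosh (\<kappa> * \<tau>)"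
        unfolding A_def B_def times_divide_eq_left add_divide_distrib[symmetric] sum using k S by simp
      show "B * sinh (\<kappa> * S) = sinh (\<kappa> * \<tau>)" using k S by (simp add: B_def)
    qed
    moreover have "A *\<^sub>R w 0 + B *\<^sub>R w S = (A + B * cosh (\<kappa> * S)) *\<^sub>R w 0 + (B * sinh (\<kappa> * S)) *\<^sub>R W"
      using S by (subst e[of S]) (auto simp: algebra_simps)
    ultimately show ?thesis using e[OF assms] by simp
  qed
  ultimately show ?thesis using that by blast
qed

text \<open>Squaring the combination of end values produces the mixed term \<open>w 0 * w S\<close>.
  For an acute angle this is itself a nonnegative combination of the two squares, by
  \<open>product_of_square_roots\<close>.\<close>

lemma square_in_cone:
  assumes "\<tau> \<in> {0..S}" "inner (w 0) (w S) > 0"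
  obtains \<alpha> \<beta> where "0 \<le> \<alpha>" "0 \<le> \<beta>" "\<alpha> + \<beta> > 0" "(w \<tau>)\<^sup>2 = \<alpha> *\<^sub>R (w 0)\<^sup>2 + \<beta> *\<^sub>R (w S)\<^sup>2"
proof -
  obtain A B where AB: "0 \<le> A" "0 \<le> B" "A + B > 0" "w \<tau> = A *\<^sub>R w 0 + B *\<^sub>R w S"
    using w_convex_combination[OF assms(1)] by blast
  define i where "i = inner (w 0) (w S)"
  have i: "i > 0" using assms by (simp add: i_def)
  have "(2 * i) *\<^sub>R (w 0 * w S) = norm ((w S)\<^sup>2) *\<^sub>R (w 0)\<^sup>2 + norm ((w 0)\<^sup>2) *\<^sub>R (w S)\<^sup>2"
    unfolding i_def by (rule product_of_square_roots)
  then have pr: "w 0 * w S = (norm ((w S)\<^sup>2) / (2 * i)) *\<^sub>R (w 0)\<^sup>2 + (norm ((w 0)\<^sup>2) / (2 * i)) *\<^sub>R (w S)\<^sup>2"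
  proof -
    assume eq: "(2 * i) *\<^sub>R (w 0 * w S) = norm ((w S)\<^sup>2) *\<^sub>R (w 0)\<^sup>2 + norm ((w 0)\<^sup>2) *\<^sub>R (w S)\<^sup>2"
    have "w 0 * w S = (1 / (2 * i)) *\<^sub>R ((2 * i) *\<^sub>R (w 0 * w S))" using i by simp
    then show ?thesis unfolding eq by (simp add: scaleR_add_right)
  qed
  define \<alpha> \<beta> where "\<alpha> = A\<^sup>2 + 2 * A * B * (norm ((w S)\<^sup>2) / (2 * i))" and "\<beta> = B\<^sup>2 + 2 * A * B * (norm ((w 0)\<^sup>2) / (2 * i))"
  have "(w \<tau>)\<^sup>2 = A\<^sup>2 *\<^sub>R (w 0)\<^sup>2 + B\<^sup>2 *\<^sub>R (w S)\<^sup>2 + (2 * A * B) *\<^sub>R (w 0 * w S)"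
    unfolding AB(4) by (simp add: scaleR_conv_of_real power2_eq_square algebra_simps)
  also have "\<dots> = \<alpha> *\<^sub>R (w 0)\<^sup>2 + \<beta> *\<^sub>R (w S)\<^sup>2"
    unfolding pr \<alpha>_def \<beta>_def by (simp add: scaleR_add_left scaleR_add_right)
  finally have e: "(w \<tau>)\<^sup>2 = \<alpha> *\<^sub>R (w 0)\<^sup>2 + \<beta> *\<^sub>R (w S)\<^sup>2" .
  have x: "0 \<le> 2 * A * B * (norm ((w S)\<^sup>2) / (2 * i))" "0 \<le> 2 * A * B * (norm ((w 0)\<^sup>2) / (2 * i))"
    using AB i by auto
  have "A\<^sup>2 + B\<^sup>2 > 0" using AB by (auto simp: sum_power2_gt_zero_iff)
  then have "\<alpha> + \<beta> > 0" using x by (simp add: \<alpha>_def \<beta>_def)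
  moreover have "\<alpha> \<ge> 0" "\<beta> \<ge> 0" unfolding \<alpha>_def \<beta>_def using x by (auto intro: add_nonneg_nonneg)
  ultimately show ?thesis using that e by blast
qed

end

lemma cone_nonzero:
  assumes "0 \<notin> closed_segment p q" "0 \<le> \<alpha>" "0 \<le> \<beta>" "\<alpha> + \<beta> > 0"
  shows "\<alpha> *\<^sub>R p + \<beta> *\<^sub>R q \<noteq> (0 :: complex)"
proof
  assume e: "\<alpha> *\<^sub>R p + \<beta> *\<^sub>R q = 0"
  define u where "u = \<beta> / (\<alpha> + \<beta>)"
  have u: "1 - u = \<alpha> / (\<alpha> + \<beta>)" "0 \<le> u" "u \<le> 1" using assms by (auto simp: u_def field_simps)
  have "(1 - u) *\<^sub>R p + u *\<^sub>R q = (1 / (\<alpha> + \<beta>)) *\<^sub>R (\<alpha> *\<^sub>R p + \<beta> *\<^sub>R q)"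
    unfolding u(1) by (simp add: u_def scaleR_add_right)
  then have "0 = (1 - u) *\<^sub>R p + u *\<^sub>R q" unfolding e by simp
  then have "0 \<in> closed_segment p q" unfolding in_segment using u(2,3) by blast
  then show False using assms by simp
qed

context refraction_domain
begin

text \<open>The angle between \<open>w 0\<close> and \<open>w S\<close> is not right, as the end
  points are not antipodal. If it were acute, the arc would stay in the cone spanned by
  \<open>p\<close> and \<open>q\<close> and contract linearly to the segment. For
  \<open>p = q\<close> an acute angle would mean \<open>w S = w 0\<close>, excluded because the
  energy makes |W| larger than |w 0|.\<close>

lemma inner_arc_levi_civita:
  assumes h: "h > 0" and i: "inner_arc h p q T z" and pq: "0 \<notin> closed_segment p q"
  obtains v S w w' where "levi_civita_solution \<mu> (\<E> + h) T z v" "lc_arc \<mu> (\<E> + h) S w w'" "T = lc_arc.sf w S"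
    "\<And>\<tau>. \<tau> \<in> {0..S} \<Longrightarrow> z (lc_arc.sf w \<tau>) = (w \<tau>)\<^sup>2 \<and> (w \<tau> \<noteq> 0 \<longrightarrow> v (lc_arc.sf w \<tau>) = 2 * w' \<tau> / cnj (w \<tau>))"
    "inner (w 0) (w S) < 0" "(w 0)\<^sup>2 = p" "(w S)\<^sup>2 = q"
proof -
  have H: "\<E> + h > 0" using h \<E>_pos by simp
  have T: "T > 0" "z 0 = p" "z T = q" using i by (auto simp: inner_arc_def)
  have "\<exists>v. levi_civita_solution \<mu> (\<E> + h) T z v"
  proof (cases "p = q")
    case True then show ?thesis using i by (auto simp: inner_arc_def)
  next
    case False
    then obtain v where v: "newton_solution kepler_force T z v"
      "\<And>s. s \<in> {0..T} \<Longrightarrow> z s \<noteq> 0 \<and> (norm (v s))\<^sup>2 / 2 = V\<^sub>I h (z s)"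
      using i by (auto simp: inner_arc_def)
    have "levi_civita_solution \<mu> (\<E> + h) T z v"
      by (rule newton_to_levi_civita[OF \<mu>_pos H T(1)])
         (use v in \<open>auto simp: kepler_force_def[abs_def] V\<^sub>I_def\<close>)
    then show ?thesis by blast
  qed
  then obtain v where v: "levi_civita_solution \<mu> (\<E> + h) T z v" by blast
  then obtain S w w' where l: "lc_arc \<mu> (\<E> + h) S w w'" "T = lc_arc.sf w S"
    and zv: "\<And>\<tau>. \<tau> \<in> {0..S} \<Longrightarrow> z (lc_arc.sf w \<tau>) = (w \<tau>)\<^sup>2 \<and> (w \<tau> \<noteq> 0 \<longrightarrow> v (lc_arc.sf w \<tau>) = 2 * w' \<tau> / cnj (w \<tau>))"
    unfolding levi_civita_iff[OF \<mu>_pos H] by blast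
  interpret lc_arc \<mu> "\<E> + h" S w w' by (rule l)
  have p: "(w 0)\<^sup>2 = p" and q: "(w S)\<^sup>2 = q" using zv[of 0] zv[of S] S sf0 l(2) T by auto
  have pqn: "p \<noteq> 0" "q \<noteq> 0" using pq by auto
  then have wn: "w 0 \<noteq> 0" "w S \<noteq> 0" using p q by auto
  have "(inner (w 0) (w S))\<^sup>2 = (kep_d p q)\<^sup>2"
    using inner_sqrt_sq[of "w 0" "w S"] kep_d_pos[OF pq] by (simp add: p q kep_d_def)
  then have ne: "inner (w 0) (w S) \<noteq> 0" using kep_d_pos[OF pq] by auto
  have "\<not> inner (w 0) (w S) > 0"
  proof
    assume pos: "inner (w 0) (w S) > 0"
    show False
    proof (cases "p = q")
      case True
      then have "(w 0)\<^sup>2 = (w S)\<^sup>2" using p q by simp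
      then have "w S = w 0 \<or> w S = - w 0" by (simp add: power2_eq_iff) (metis minus_minus)
      moreover have "w S \<noteq> - w 0"
      proof
        assume "w S = - w 0"
        then have "inner (w 0) (w S) = - (norm (w 0))\<^sup>2" by (simp add: power2_norm_eq_inner)
        then show False using pos zero_le_power2[of "norm (w 0)"] by linarith
      qed
      ultimately have eq: "w S = w 0" by blast
      define \<kappa> where "\<kappa> = sqrt ((\<E> + h) / 2)"
      have k: "\<kappa> > 0" "\<kappa>\<^sup>2 = (\<E> + h) / 2" using H by (auto simp: \<kappa>_def)
      define W where "W = w' 0 /\<^sub>R \<kappa>"
      define C where "C = cosh (\<kappa> * S)"
      define Z where "Z = sinh (\<kappa> * S)"
      have w'0: "w' 0 = \<kappa> *\<^sub>R W" using k by (simp add: W_def)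
      have "w S = C *\<^sub>R w 0 + Z *\<^sub>R W"
        using lc_explicit(1)[OF sol H _ \<kappa>_def, of S] S by (auto simp: W_def C_def Z_def)
      then have "Z *\<^sub>R W = (1 - C) *\<^sub>R w 0" using eq by (simp add: algebra_simps)
      then have "norm (Z *\<^sub>R W) = norm ((1 - C) *\<^sub>R w 0)" by simp
      then have eq1: "Z\<^sup>2 * (norm W)\<^sup>2 = (1 - C)\<^sup>2 * (norm (w 0))\<^sup>2"
        by (metis norm_scaleR power_mult_distrib power2_abs)
      have Z2: "Z\<^sup>2 = (C - 1) * (C + 1)" unfolding Z_def C_def sinh_square_eq by (simp add: algebra_simps power2_eq_square)
      have C1: "C > 1" using k S cosh_real_strict_mono[of 0 "\<kappa> * S"] by (simp add: C_def)
      have "(C - 1) * ((C + 1) * (norm W)\<^sup>2) = (C - 1) * ((C - 1) * (norm (w 0))\<^sup>2)"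
        using eq1 unfolding Z2 by (simp add: power2_eq_square algebra_simps)
      then have a: "(C + 1) * (norm W)\<^sup>2 = (C - 1) * (norm (w 0))\<^sup>2" using C1 by simp
      have "2 * (\<kappa>\<^sup>2 * (norm W)\<^sup>2) - (\<E> + h) * (norm (w 0))\<^sup>2 = \<mu>" using energy[of 0] S by (simp add: w'0 power_mult_distrib)
      then have "(\<E> + h) * ((norm W)\<^sup>2 - (norm (w 0))\<^sup>2) = \<mu>" unfolding k(2) by (simp add: algebra_simps)
      then have "(norm W)\<^sup>2 > (norm (w 0))\<^sup>2" using H \<mu>_pos by (metis diff_gt_0_iff_gt zero_less_mult_pos)
      then have "(C - 1) * (norm (w 0))\<^sup>2 \<le> (C - 1) * (norm W)\<^sup>2"
        using C1 by (intro mult_left_mono less_imp_le[OF \<open>(norm W)\<^sup>2 > (norm (w 0))\<^sup>2\<close>]) simp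
      also have "\<dots> < (C + 1) * (norm W)\<^sup>2"
        using \<open>(norm W)\<^sup>2 > (norm (w 0))\<^sup>2\<close> by (intro mult_strict_right_mono) (auto intro: le_less_trans[OF zero_le_power2])
      finally show False using a by simp
    next
      case False
      then have tn: "topologically_nontrivial T z p q" using i by (auto simp: inner_arc_def)
      define g where "g u = z (T * u)" for u
      have cone: "\<exists>\<alpha> \<beta>. 0 \<le> \<alpha> \<and> 0 \<le> \<beta> \<and> \<alpha> + \<beta> > 0 \<and> g u = \<alpha> *\<^sub>R p + \<beta> *\<^sub>R q" if "u \<in> {0..1}" for u
      proof -
        have "T * u \<in> {0..sf S}" using that T l(2) by (auto intro: mult_left_le)
        then have t: "tau (T * u) \<in> {0..S}" "sf (tau (T * u)) = T * u" using sf_tau by auto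
        then have "g u = (w (tau (T * u)))\<^sup>2" using zv[OF t(1)] by (simp add: g_def)
        then show ?thesis using square_in_cone[OF t(1) pos] p q by metis
      qed
      have "homotopic_paths (- {0}) g (linepath p q)"
      proof (rule homotopic_paths_linear)
        have cz: "continuous_on {0..T} z" using tn by (simp add: topologically_nontrivial_def)
        have im: "(\<lambda>u. T * u) ` {0..1} \<subseteq> {0..T}" using T(1) by (auto intro: mult_left_le)
        have "continuous_on {0..1} (\<lambda>u. z (T * u))"
          by (rule continuous_on_compose2[OF cz _ im]) (intro continuous_intros)
        then show "path g" unfolding path_def g_def .
        show "pathstart (linepath p q) = pathstart g" "pathfinish (linepath p q) = pathfinish g"
          unfolding pathstart_linepath pathfinish_linepath unfolding pathstart_def pathfinish_def g_def using T(2,3) by simp_all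
        fix u :: real assume u: "u \<in> {0..1}"
        obtain \<alpha> \<beta> where ab: "0 \<le> \<alpha>" "0 \<le> \<beta>" "\<alpha> + \<beta> > 0" "g u = \<alpha> *\<^sub>R p + \<beta> *\<^sub>R q" using cone[OF u] by blast
        show "closed_segment (g u) (linepath p q u) \<subseteq> - {0}"
        proof
          fix x assume "x \<in> closed_segment (g u) (linepath p q u)"
          then obtain t where t: "0 \<le> t" "t \<le> 1" "x = (1 - t) *\<^sub>R g u + t *\<^sub>R linepath p q u" unfolding in_segment by blast
          have x: "x = ((1 - t) * \<alpha> + t * (1 - u)) *\<^sub>R p + ((1 - t) * \<beta> + t * u) *\<^sub>R q"
            unfolding t(3) ab(4) linepath_def by (simp add: algebra_simps)
          have "(1 - t) * \<alpha> + t * (1 - u) \<ge> 0" "(1 - t) * \<beta> + t * u \<ge> 0" using t ab u by auto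
          moreover have "((1 - t) * \<alpha> + t * (1 - u)) + ((1 - t) * \<beta> + t * u) = (1 - t) * (\<alpha> + \<beta>) + t" by (simp add: algebra_simps)
          moreover have "(1 - t) * (\<alpha> + \<beta>) + t > 0"
          proof (cases "t = 0")
            case False
            have "(1 - t) * (\<alpha> + \<beta>) \<ge> 0" using t ab by auto
            then show ?thesis using False t by linarith
          qed (use ab in simp)
          ultimately have "x \<noteq> 0" unfolding x by (intro cone_nonzero[OF pq]) auto
          then show "x \<in> - {0}" by simp
        qed
      qed (auto simp: path_linepath)
      then show False using tn by (simp add: topologically_nontrivial_def g_def[abs_def])
    qed
  qed
  then have "inner (w 0) (w S) < 0" using ne by simp
  then show ?thesis using that[OF v l zv _ p q] by blast
qed

lemma inner_arc_explicit:
  assumes h: "h > 0" and i: "inner_arc h p q T z" and pq: "0 \<notin> closed_segment p q"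
  shows "\<exists>v. levi_civita_solution \<mu> (\<E> + h) T z v \<and> v 0 = kep_vel \<mu> (\<E> + h) p q \<and> v T = - kep_vel \<mu> (\<E> + h) q p"
    and "jacobi_length (V\<^sub>I h) T z = kep_length \<mu> (\<E> + h) p q"
proof -
  obtain v S w w' where v: "levi_civita_solution \<mu> (\<E> + h) T z v" and l: "lc_arc \<mu> (\<E> + h) S w w'" "T = lc_arc.sf w S"
    and zv: "\<And>\<tau>. \<tau> \<in> {0..S} \<Longrightarrow> z (lc_arc.sf w \<tau>) = (w \<tau>)\<^sup>2 \<and> (w \<tau> \<noteq> 0 \<longrightarrow> v (lc_arc.sf w \<tau>) = 2 * w' \<tau> / cnj (w \<tau>))"
    and neg: "inner (w 0) (w S) < 0" and p: "(w 0)\<^sup>2 = p" "(w S)\<^sup>2 = q"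
    using inner_arc_levi_civita[OF assms] by blast
  interpret lc_arc \<mu> "\<E> + h" S w w' by (rule l)
  note e = lc_endpoints[OF neg, unfolded p]
  have "w 0 \<noteq> 0" "w S \<noteq> 0" using neg by auto
  then have "v 0 = kep_vel \<mu> (\<E> + h) p q" "v T = - kep_vel \<mu> (\<E> + h) q p"
    using zv[of 0] zv[of S] S sf0 l(2) e(1,2) by auto
  then show "\<exists>v. levi_civita_solution \<mu> (\<E> + h) T z v \<and> v 0 = kep_vel \<mu> (\<E> + h) p q \<and> v T = - kep_vel \<mu> (\<E> + h) q p"
    using v by blast
  have "jacobi_length (V\<^sub>I h) (sf S) z = sqrt 2 * (inner (w S) (w' S) - inner (w 0) (w' 0) + \<mu> * S / 2)"
    by (rule jacobi_length_lc) (use zv in \<open>auto simp: V\<^sub>I_def\<close>)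
  then show "jacobi_length (V\<^sub>I h) T z = kep_length \<mu> (\<E> + h) p q" unfolding e(3) l(2)[symmetric] .
qed

lemma S\<^sub>I_eq:
  assumes h: "h > 0" and u: "unique_arc (inner_arc h (\<gamma> \<xi>) (\<gamma> \<eta>))" and pq: "0 \<notin> closed_segment (\<gamma> \<xi>) (\<gamma> \<eta>)"
  shows "S\<^sub>I h \<xi> \<eta> = kep_length \<mu> (\<E> + h) (\<gamma> \<xi>) (\<gamma> \<eta>)"
proof -
  obtain T z where "inner_arc h (\<gamma> \<xi>) (\<gamma> \<eta>) T z" using u by (auto simp: unique_arc_def)
  then show ?thesis unfolding S\<^sub>I_def
    by (intro the_equality) (use inner_arc_explicit(2)[OF h _ pq] in metis)+
qed

end

section \<open>The derivative of the inner length\<close>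

text \<open>As for outer arcs the coefficient of \<open>C'\<close> is a multiple of the quadratic
  relation and drops out: the length is stationary in the travel time.\<close>

lemma kep_length_derivative:
  fixes P d C :: "real \<Rightarrow> real"
  assumes dC: "(C has_real_derivative C') (at x)" and dP: "(P has_real_derivative P') (at x)"
    and dd: "(d has_real_derivative d') (at x)" and C: "C x > 1" and \<kappa>: "\<kappa> > 0" and \<mu>: "\<mu> = 2 * \<kappa>\<^sup>2 * \<epsilon>"
    and quad: "\<epsilon> * (C x)\<^sup>2 - 2 * d x * C x - (P x + \<epsilon>) = 0"
  shows "((\<lambda>x. \<kappa> * (P x * C x + 2 * d x) / sqrt ((C x)\<^sup>2 - 1) + \<mu> * arcosh (C x) / (2 * \<kappa>))
      has_real_derivative \<kappa> * (C x * P' + 2 * d') / sqrt ((C x)\<^sup>2 - 1)) (at x)"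
proof -
  define s where "s = sqrt ((C x)\<^sup>2 - 1)"
  have C2: "(C x)\<^sup>2 - 1 > 0" using C by (simp add: one_less_power)
  then have s: "s > 0" "s\<^sup>2 = (C x)\<^sup>2 - 1" by (auto simp: s_def)
  have "((\<lambda>x. (C x)\<^sup>2 - 1) has_real_derivative 2 * C x * C') (at x)"
    by (rule dC derivative_eq_intros refl | simp)+
  from DERIV_chain2[OF DERIV_real_sqrt[OF C2] this]
  have ds: "((\<lambda>x. sqrt ((C x)\<^sup>2 - 1)) has_real_derivative C x * C' / s) (at x)"
    by (rule DERIV_cong) (simp add: s_def[symmetric] field_simps)
  have dn: "((\<lambda>x. \<kappa> * (P x * C x + 2 * d x)) has_real_derivative \<kappa> * (P' * C x + P x * C' + 2 * d')) (at x)"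
    by (rule dC dP dd derivative_eq_intros refl | simp)+
  have da: "((\<lambda>x. arcosh (C x)) has_real_derivative C' / s) (at x)"
    using DERIV_chain2[OF arcosh_real_has_field_derivative[OF C] dC] by (simp add: s_def)
  have "((\<lambda>x. \<kappa> * (P x * C x + 2 * d x) / sqrt ((C x)\<^sup>2 - 1) + \<mu> * arcosh (C x) / (2 * \<kappa>))
      has_real_derivative (\<kappa> * (P' * C x + P x * C' + 2 * d') * s - \<kappa> * (P x * C x + 2 * d x) * (C x * C' / s)) / (s * s)
        + \<mu> * (C' / s) / (2 * \<kappa>)) (at x)"
    using DERIV_add[OF DERIV_divide[OF dn ds] DERIV_cdivide[OF DERIV_cmult[OF da]]] s by (simp add: s_def)
  moreover have "(\<kappa> * (P' * C x + P x * C' + 2 * d') * s - \<kappa> * (P x * C x + 2 * d x) * (C x * C' / s)) / (s * s)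
        + \<mu> * (C' / s) / (2 * \<kappa>) = \<kappa> * (C x * P' + 2 * d') / s"
  proof -
    define X where "X = (\<kappa> * (P' * C x + P x * C' + 2 * d') * s - \<kappa> * (P x * C x + 2 * d x) * (C x * C' / s)) / (s * s)
        + \<mu> * (C' / s) / (2 * \<kappa>)"
    have "\<mu> * (C' / s) / (2 * \<kappa>) = \<kappa> * \<epsilon> * C' / s" using \<kappa> unfolding \<mu> by (simp add: field_simps power2_eq_square)
    then have "X = (\<kappa> * (P' * C x + P x * C' + 2 * d') * s - \<kappa> * (P x * C x + 2 * d x) * (C x * C' / s)) / (s * s) + \<kappa> * \<epsilon> * C' / s"
      unfolding X_def by simp
    then have "X * (s * s\<^sup>2) = \<kappa> * (P' * C x + P x * C' + 2 * d') * s\<^sup>2 - \<kappa> * (P x * C x + 2 * d x) * (C x * C') + \<kappa> * \<epsilon> * C' * s\<^sup>2"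
      using s(1) by (simp add: field_simps power2_eq_square)
    also have "\<dots> = \<kappa> * (C x * P' + 2 * d') * s\<^sup>2 + \<kappa> * C' * (\<epsilon> * (C x)\<^sup>2 - 2 * d x * C x - (P x + \<epsilon>))"
      unfolding s(2) by (simp add: algebra_simps power2_eq_square)
    also have "\<dots> = \<kappa> * (C x * P' + 2 * d') * s\<^sup>2" unfolding quad by simp
    finally have "X * s * s\<^sup>2 = \<kappa> * (C x * P' + 2 * d') * s\<^sup>2" by (simp add: mult.assoc)
    then have "X * s = \<kappa> * (C x * P' + 2 * d')" using s(1) by simp
    then show ?thesis using s(1) unfolding X_def[symmetric] by (simp add: field_simps)
  qed
  ultimately show ?thesis by (simp add: s_def)
qed

lemma inner_kep_vel:
  "inner (kep_vel \<mu> H p q) t = - (2 * sqrt (H / 2) / sqrt ((kep_C (\<mu> / H) p q)\<^sup>2 - 1)) *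
     (kep_C (\<mu> / H) p q * (inner p t / norm p) + (norm q * (inner p t / norm p) + inner q t) / (2 * kep_d p q))"
  unfolding kep_vel_def inner_scaleR_left inner_add_left by (simp only: divide_inverse mult_ac)

context refraction_domain
begin

lemma S\<^sub>I_derivative:
  assumes \<xi>: "\<xi> \<in> {a<..<b}" and ab: "0 \<le> a" "b \<le> L" and h: "h > 0"
    and u: "\<And>x. x \<in> {a<..<b} \<Longrightarrow> unique_arc (inner_arc h (\<gamma> x) (\<gamma> \<eta>))"
    and na: "\<And>x. x \<in> {a<..<b} \<Longrightarrow> 0 \<notin> closed_segment (\<gamma> x) (\<gamma> \<eta>)"
  shows "((\<lambda>x. S\<^sub>I h x \<eta>) has_real_derivative - inner (kep_vel \<mu> (\<E> + h) (\<gamma> \<xi>) (\<gamma> \<eta>)) (tangent \<xi>) / sqrt 2) (at \<xi>)"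
proof -
  define H where "H = \<E> + h"
  define p q t \<kappa> \<epsilon> where "p = \<gamma> \<xi>" and "q = \<gamma> \<eta>" and "t = tangent \<xi>" and "\<kappa> = sqrt (H / 2)" and "\<epsilon> = \<mu> / H"
  have H: "H > 0" using h \<E>_pos by (simp add: H_def)
  have k: "\<kappa> > 0" "\<epsilon> > 0" using H \<mu>_pos by (auto simp: \<kappa>_def \<epsilon>_def)
  have m: "\<mu> = 2 * \<kappa>\<^sup>2 * \<epsilon>" using H by (simp add: \<kappa>_def \<epsilon>_def)
  have dpos: "kep_d p q > 0" using kep_d_pos[OF na[OF \<xi>]] by (simp add: p_def q_def)
  have p0: "p \<noteq> 0" using na[OF \<xi>] by (auto simp: p_def)
  have dt: "(\<gamma> has_derivative (\<lambda>h. h *\<^sub>R t)) (at \<xi>)"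
    using curve_vector_derivative[of \<xi>] \<xi> ab by (simp add: has_vector_derivative_def t_def)
  have dX: "((\<lambda>x. inner (\<gamma> x) q) has_real_derivative inner q t) (at \<xi>)"
    unfolding has_field_derivative_def
    by (rule has_derivative_eq_rhs[OF has_derivative_inner_left[OF dt]]) (auto simp: fun_eq_iff inner_commute)
  have dN: "((\<lambda>x. norm (\<gamma> x)) has_real_derivative inner p t / norm p) (at \<xi>)"
    unfolding has_field_derivative_def
    by (rule has_derivative_eq_rhs[OF has_derivative_compose[OF dt has_derivative_norm]])
       (use p0 in \<open>auto simp: fun_eq_iff sgn_div_norm p_def inner_commute divide_inverse mult_ac\<close>)
  have dP: "((\<lambda>x. norm (\<gamma> x) + norm q) has_real_derivative inner p t / norm p) (at \<xi>)"
    by (rule DERIV_cong[OF DERIV_add[OF dN DERIV_const]]) simp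
  define d' where "d' = (norm q * (inner p t / norm p) + inner q t) / (4 * kep_d p q)"
  have dd: "((\<lambda>x. kep_d (\<gamma> x) q) has_real_derivative d') (at \<xi>)"
  proof -
    have d1: "((\<lambda>x. (norm (\<gamma> x) * norm q + inner (\<gamma> x) q) / 2) has_real_derivative (norm q * (inner p t / norm p) + inner q t) / 2) (at \<xi>)"
      by (rule DERIV_cong[OF DERIV_cdivide[OF DERIV_add[OF DERIV_cmult_right[OF dN] dX]]]) (simp add: mult.commute)
    have pos: "(norm (\<gamma> \<xi>) * norm q + inner (\<gamma> \<xi>) q) / 2 > 0" using dpos by (simp add: kep_d_def p_def)
    have "((\<lambda>x. kep_d (\<gamma> x) q) has_real_derivative inverse (kep_d p q) / 2 * ((norm q * (inner p t / norm p) + inner q t) / 2)) (at \<xi>)"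
      using DERIV_chain2[OF DERIV_real_sqrt[OF pos] d1] by (simp add: kep_d_def p_def)
    then show ?thesis by (rule DERIV_cong) (use dpos in \<open>simp add: d'_def field_simps\<close>)
  qed
  obtain C' where dC: "((\<lambda>x. kep_C \<epsilon> (\<gamma> x) q) has_real_derivative C') (at \<xi>)"
  proof -
    have d1: "((\<lambda>x. (kep_d (\<gamma> x) q)\<^sup>2 + \<epsilon> * (norm (\<gamma> x) + norm q + \<epsilon>)) has_real_derivative 2 * kep_d p q * d' + \<epsilon> * (inner p t / norm p)) (at \<xi>)"
      by (rule DERIV_cong[OF DERIV_add[OF DERIV_power[OF dd, of 2] DERIV_cmult[OF DERIV_add[OF dP DERIV_const]]]])
         (simp add: p_def)
    have "\<epsilon> * (norm p + norm q + \<epsilon>) > 0" using k by (intro mult_pos_pos add_nonneg_pos add_nonneg_nonneg) simp_all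
    then have pos: "(kep_d (\<gamma> \<xi>) q)\<^sup>2 + \<epsilon> * (norm (\<gamma> \<xi>) + norm q + \<epsilon>) > 0"
      unfolding p_def by (rule add_nonneg_pos[OF zero_le_power2])
    show ?thesis
      by (rule that) (unfold kep_C_def, rule DERIV_cdivide[OF DERIV_add[OF dd DERIV_chain2[OF DERIV_real_sqrt[OF pos] d1]]])
  qed
  note quad = kep_C_quadratic(1,2)[OF k(2) dpos]
  have "((\<lambda>x. \<kappa> * ((norm (\<gamma> x) + norm q) * kep_C \<epsilon> (\<gamma> x) q + 2 * kep_d (\<gamma> x) q) / sqrt ((kep_C \<epsilon> (\<gamma> x) q)\<^sup>2 - 1)
        + \<mu> * arcosh (kep_C \<epsilon> (\<gamma> x) q) / (2 * \<kappa>))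
      has_real_derivative \<kappa> * (kep_C \<epsilon> p q * (inner p t / norm p) + 2 * d') / sqrt ((kep_C \<epsilon> p q)\<^sup>2 - 1)) (at \<xi>)"
    using kep_length_derivative[OF dC dP dd _ k(1) m] quad by (simp add: p_def)
  from DERIV_cmult[OF this, of "sqrt 2"]
  have "((\<lambda>x. kep_length \<mu> H (\<gamma> x) q) has_real_derivative
      sqrt 2 * (\<kappa> * (kep_C \<epsilon> p q * (inner p t / norm p) + 2 * d') / sqrt ((kep_C \<epsilon> p q)\<^sup>2 - 1))) (at \<xi>)"
    by (simp only: kep_length_def \<kappa>_def \<epsilon>_def)
  moreover have "sqrt 2 * (\<kappa> * (kep_C \<epsilon> p q * (inner p t / norm p) + 2 * d') / sqrt ((kep_C \<epsilon> p q)\<^sup>2 - 1))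
      = - inner (kep_vel \<mu> H p q) t / sqrt 2"
  proof -
    have i: "inner (kep_vel \<mu> H p q) t = - (2 * \<kappa> / sqrt ((kep_C \<epsilon> p q)\<^sup>2 - 1)) *
        (kep_C \<epsilon> p q * (inner p t / norm p) + 2 * d')"
    proof -
      have "2 * (x / (4 * y)) = x / (2 * y)" for x y :: real by simp
      then have "2 * d' = (norm q * (inner p t / norm p) + inner q t) / (2 * kep_d p q)" unfolding d'_def .
      then show ?thesis by (simp only: inner_kep_vel \<kappa>_def \<epsilon>_def)
    qed
    have s2: "sqrt 2 * x = - (- (2 * x)) / sqrt 2" for x :: real
      by (simp add: field_simps)
    show ?thesis unfolding i by (subst s2) (simp add: mult.assoc)
  qed
  ultimately have "((\<lambda>x. kep_length \<mu> H (\<gamma> x) q) has_real_derivative - inner (kep_vel \<mu> H p q) t / sqrt 2) (at \<xi>)" by simp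
  moreover have "\<forall>\<^sub>F x in nhds \<xi>. S\<^sub>I h x \<eta> = kep_length \<mu> H (\<gamma> x) q"
    using eventually_nhds_in_open[of "{a<..<b}" \<xi>] \<xi> S\<^sub>I_eq[OF h u na]
    by (auto elim!: eventually_mono simp: q_def H_def)
  ultimately show ?thesis using DERIV_cong_ev[of \<xi> \<xi>] by (simp add: p_def q_def t_def H_def)
qed

text \<open>The arc from \<open>p\<close> to itself covers the radial segment, and a point of it
  other than \<open>p\<close> is passed at an interior time, when the arc is inside
  \<open>D\<close>.\<close>

lemma inner_arc_radius:
  assumes "inner_arc h p p T z" "p \<noteq> 0" "0 \<le> r" "r < 1"
  shows "r *\<^sub>R p \<in> D"
proof -
  have "r *\<^sub>R p \<in> closed_segment 0 p" using assms(3,4) by (auto simp: in_segment)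
  moreover have "z ` {0..T} = closed_segment 0 p" using assms(1) by (simp add: inner_arc_def)
  ultimately have "r *\<^sub>R p \<in> z ` {0..T}" by simp
  then obtain s where s: "s \<in> {0..T}" "z s = r *\<^sub>R p" by (metis imageE)
  have "r *\<^sub>R p \<noteq> p"
  proof
    assume "r *\<^sub>R p = p"
    then have "(r - 1) *\<^sub>R p = 0" by (simp add: algebra_simps)
    then show False using assms(2,4) by simp
  qed
  then have "s \<noteq> 0" "s \<noteq> T" using s(2) assms(1) by (auto simp: inner_arc_def)
  then have "s \<in> {0<..<T}" using s(1) by auto
  moreover have "\<forall>s\<in>{0<..<T}. z s \<in> D" using assms(1) by (simp add: inner_arc_def)
  ultimately show ?thesis using s(2) by metis
qed

lemma NA_commute: "i \<in> {1..m} \<Longrightarrow> j \<in> NA m a b i \<Longrightarrow> i \<in> NA m a b j"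
  unfolding NA_def not_antipodal_sets_def antipodal_def using closed_segment_commute by blast

lemma NA_nonzero:
  "j \<in> NA m a b i \<Longrightarrow> \<xi> \<in> {a i<..<b i} \<Longrightarrow> \<eta> \<in> {a j<..<b j} \<Longrightarrow> 0 \<notin> closed_segment (\<gamma> \<xi>) (\<gamma> \<eta>)"
  by (auto simp: NA_def not_antipodal_sets_def antipodal_def)

lemma admissible_arc_interval:
  assumes "outer_arc_property (a i) (b i)" "inner_arc_property m a b h\<^sub>0" and im: "i \<in> {1..m}"
  shows "arc_interval \<omega> \<mu> \<E> D \<gamma> L (a i) (b i)"
proof unfold_locales
  have i: "i \<in> NA m a b i" "0 \<le> a i" "a i < b i" "b i \<le> L" using assms(2) im by (auto simp: inner_arc_property_def)
  then show "0 \<le> a i" "a i < b i" "b i \<le> L" "outer_arc_property (a i) (b i)" using assms(1) by auto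
  show na: "0 \<notin> closed_segment (\<gamma> \<xi>) (\<gamma> \<eta>)" if "\<xi> \<in> {a i<..<b i}" "\<eta> \<in> {a i<..<b i}" for \<xi> \<eta>
    using NA_nonzero[OF i(1) that] .
  show "r *\<^sub>R \<gamma> \<xi> \<in> D" if x: "\<xi> \<in> {a i<..<b i}" and r: "0 \<le> r" "r < 1" for \<xi> r
  proof -
    have "\<forall>h>h\<^sub>0. unique_arc (inner_arc h (\<gamma> \<xi>) (\<gamma> \<xi>))"
      using assms(2) im i(1) x unfolding inner_arc_property_def by blast
    \<comment> \<open>Any energy above the threshold serves, as the conclusion about the radius does
      not involve the energy.\<close>
    then have "unique_arc (inner_arc (h\<^sub>0 + 1) (\<gamma> \<xi>) (\<gamma> \<xi>))" by simp
    then obtain T z where "inner_arc (h\<^sub>0 + 1) (\<gamma> \<xi>) (\<gamma> \<xi>) T z" by (auto simp: unique_arc_def)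
    then show ?thesis by (rule inner_arc_radius) (use na[OF x x] r in auto)
  qed
qed

text \<open>In \<open>kep_vel\<close> the radial term carries the factor \<open>kep_C\<close>, at
  least 2 d H / \<mu>, whereas the remaining terms do not grow with this factor. The hypothesis
  \<open>big\<close> makes the radial term, which points to the origin, dominate.\<close>

lemma kep_vel_transversal:
  assumes H: "H > 0" and pq: "0 \<notin> closed_segment p q" and n: "norm n = 1" "inner n p > 0"
    and big: "\<mu> * (norm p * norm q) < 2 * H * (kep_d p q)\<^sup>2 * inner n p"
  shows "inner n (kep_vel \<mu> H p q) < 0"
proof -
  define d C where "d = kep_d p q" and "C = kep_C (\<mu> / H) p q"
  have e: "\<mu> / H > 0" using H \<mu>_pos by simp
  have d: "d > 0" using kep_d_pos[OF pq] by (simp add: d_def)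
  have C: "C > 1" "C \<ge> 2 * d * H / \<mu>" using kep_C_quadratic(2,3)[OF e] d by (auto simp: d_def C_def)
  have p: "norm p > 0" "norm q > 0" using pq by auto
  have sq: "sqrt (C\<^sup>2 - 1) > 0" using C(1) by (simp add: one_less_power)
  define k where "k = 2 * sqrt (H / 2) / sqrt (C\<^sup>2 - 1)"
  have k: "k > 0" using H sq by (simp add: k_def)
  have "inner n (kep_vel \<mu> H p q) = - (k * (C * (inner n p / norm p) + (norm q / norm p * inner n p + inner n q) / (2 * d)))"
    unfolding inner_commute[of n "kep_vel \<mu> H p q"] inner_kep_vel d_def[symmetric] C_def[symmetric] k_def[symmetric]
    by (simp add: inner_commute)
  moreover have "C * (inner n p / norm p) + (norm q / norm p * inner n p + inner n q) / (2 * d) > 0"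
  proof -
    have nq: "inner n q \<ge> - norm q" using Cauchy_Schwarz_ineq2[of n q] n(1) by simp
    have "\<mu> * (norm p * norm q) < (2 * d * H * inner n p) * d" using big by (simp add: d_def power2_eq_square mult_ac)
    then have "norm q < (2 * d * H * inner n p) * d / (\<mu> * norm p)"
      by (subst pos_less_divide_eq) (use p \<mu>_pos in \<open>simp_all add: mult_ac\<close>)
    then have "norm q / d < (2 * d * H * inner n p) * d / (\<mu> * norm p) / d"
      using d by (rule divide_strict_right_mono)
    also have "\<dots> = (2 * d * H / \<mu>) * (inner n p / norm p)" using d by simp
    also have "\<dots> \<le> C * (inner n p / norm p)"
      using C(2) p(1) n(2) by (intro mult_right_mono) simp_all
    finally have "norm q / d < C * (inner n p / norm p)" .
    moreover have "norm q / (2 * d) \<le> norm q / d" using d p by (intro divide_left_mono) auto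
    moreover have "(norm q / norm p * inner n p + inner n q) / (2 * d) \<ge> - norm q / (2 * d)"
    proof (rule divide_right_mono)
      have "norm q / norm p * inner n p \<ge> 0" using n(2) p by simp
      then show "- norm q \<le> norm q / norm p * inner n p + inner n q" using nq by simp
    qed (use d in simp)
    ultimately show ?thesis by simp
  qed
  ultimately show ?thesis using k by (simp add: mult_pos_pos)
qed

end

section \<open>Products of intervals and spaces of words\<close>

text \<open>Poincare--Miranda on an infinite product of intervals: Kuhn's lemma on the first \<open>n\<close>
  coordinates with mesh \<open>1/n\<close>, and compactness as \<open>n\<close> tends to infinity.\<close>
lemma poincare_miranda_product:
  fixes lo hi :: "nat \<Rightarrow> real" and G :: "nat \<Rightarrow> (nat \<Rightarrow> real) \<Rightarrow> real"
  defines "B \<equiv> {x. \<forall>i. lo i \<le> x i \<and> x i \<le> hi i}"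
  assumes le: "\<And>i. lo i \<le> hi i" and cont: "\<And>i. continuous_on B (G i)"
    and neg: "\<And>i x. x \<in> B \<Longrightarrow> x i = lo i \<Longrightarrow> G i x \<le> 0" and pos: "\<And>i x. x \<in> B \<Longrightarrow> x i = hi i \<Longrightarrow> G i x \<ge> 0"
  shows "\<exists>x\<in>B. \<forall>i. G i x = 0"
proof -
  \<comment> \<open>Grid points with \<open>Suc n\<close> steps in each of the first
    \<open>n\<close> coordinates; all later coordinates are frozen at their lower ends.\<close>
  define pt where "pt n x = (\<lambda>i. if i < n then lo i + (hi i - lo i) * (real (x i) / real (Suc n)) else lo i)" for n and x :: "nat \<Rightarrow> nat"
  have ptB: "pt n x \<in> B" if "\<forall>i<n. x i \<le> Suc n" for n x
  proof -
    have "lo i + (hi i - lo i) * (real (x i) / real (Suc n)) \<le> hi i" if "i < n" for i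
    proof -
      have "x i \<le> Suc n" using \<open>\<forall>i<n. x i \<le> Suc n\<close> \<open>i < n\<close> by blast
      then have "real (x i) \<le> real (Suc n)" by (rule of_nat_mono)
      then have "real (x i) / real (Suc n) \<le> 1" by (simp add: divide_le_eq_1)
      then have "(hi i - lo i) * (real (x i) / real (Suc n)) \<le> (hi i - lo i) * 1" using le[of i] by (intro mult_left_mono) auto
      then show ?thesis by simp
    qed
    moreover have "0 \<le> (hi i - lo i) * (real (x i) / real (Suc n))" for i using le[of i] by simp
    ultimately show ?thesis using le by (auto simp: B_def pt_def)
  qed
  have "\<exists>x. x \<in> B \<and> (\<forall>i<n. \<exists>y z. y \<in> B \<and> z \<in> B \<and> G i y \<le> 0 \<and> 0 \<le> G i z \<and>
      (\<forall>j. \<bar>y j - x j\<bar> \<le> (hi j - lo j) / Suc n \<and> \<bar>z j - x j\<bar> \<le> (hi j - lo j) / Suc n))" for n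
  proof -
    \<comment> \<open>The label is 0 on the lower face and 1 on the upper one, as Kuhn's lemma
      demands. The sign hypotheses on the faces keep its meaning, recorded in \<open>lab0\<close>
      and \<open>lab1\<close>, correct there.\<close>
    define label where "label x i = (if x i = 0 \<or> (x i \<noteq> Suc n \<and> G i (pt n x) \<le> 0) then 0 else (1::nat))" for x i
    have lab0: "G i (pt n x) \<le> 0" if "label x i = 0" "\<forall>i<n. x i \<le> Suc n" "i < n" for x i
    proof (cases "x i = 0")
      case True
      then have "pt n x i = lo i" using that by (simp add: pt_def)
      then show ?thesis using neg ptB that by blast
    next
      case False then show ?thesis using that by (auto simp: label_def split: if_splits)
    qed
    have lab1: "G i (pt n x) \<ge> 0" if "label x i \<noteq> 0" "\<forall>i<n. x i \<le> Suc n" "i < n" for x i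
    proof (cases "x i = Suc n")
      case True
      then have "pt n x i = hi i" using that by (simp add: pt_def)
      then show ?thesis using pos ptB that by blast
    next
      case False then show ?thesis using that by (auto simp: label_def split: if_splits)
    qed
    obtain q where q: "\<forall>i<n. q i < Suc n"
      and rs: "\<forall>i<n. \<exists>r s. (\<forall>j<n. q j \<le> r j \<and> r j \<le> q j + 1) \<and> (\<forall>j<n. q j \<le> s j \<and> s j \<le> q j + 1) \<and> label r i \<noteq> label s i"
      by (rule kuhn_lemma[of "Suc n" n label]) (auto simp: label_def)
    have near: "\<bar>pt n r j - pt n q j\<bar> \<le> (hi j - lo j) / Suc n" if "\<forall>j<n. q j \<le> r j \<and> r j \<le> q j + 1" for r j
    proof (cases "j < n")
      case True
      then have "q j \<le> r j" "r j \<le> q j + 1" using that by auto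
      then have "0 \<le> real (r j) - real (q j)" "real (r j) - real (q j) \<le> 1" by linarith+
      moreover have "pt n r j - pt n q j = (hi j - lo j) * ((real (r j) - real (q j)) / real (Suc n))"
        using True by (simp add: pt_def diff_divide_distrib right_diff_distrib)
      moreover have "(hi j - lo j) * ((real (r j) - real (q j)) / real (Suc n)) \<le> (hi j - lo j) * (1 / real (Suc n))"
        using calculation le[of j] by (intro mult_left_mono divide_right_mono) auto
      moreover have "0 \<le> (hi j - lo j) * ((real (r j) - real (q j)) / real (Suc n))"
        using calculation(1) le[of j] by (intro mult_nonneg_nonneg divide_nonneg_nonneg) auto
      ultimately show ?thesis by simp
    next
      case False
      then show ?thesis using le[of j] by (simp add: pt_def)
    qed
    have bd: "\<forall>j<n. r j \<le> Suc n" if "\<forall>j<n. q j \<le> r j \<and> r j \<le> q j + 1" for r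
      using that q by (metis Suc_eq_plus1 Suc_le_eq le_trans Suc_leI)
    have "\<exists>y z. y \<in> B \<and> z \<in> B \<and> G i y \<le> 0 \<and> 0 \<le> G i z \<and>
      (\<forall>j. \<bar>y j - pt n q j\<bar> \<le> (hi j - lo j) / Suc n \<and> \<bar>z j - pt n q j\<bar> \<le> (hi j - lo j) / Suc n)" if i: "i < n" for i
    proof -
      obtain r s where r: "\<forall>j<n. q j \<le> r j \<and> r j \<le> q j + 1" and s: "\<forall>j<n. q j \<le> s j \<and> s j \<le> q j + 1"
        and lb: "label r i \<noteq> label s i" using rs i by blast
      consider "label r i = 0" "label s i \<noteq> 0" | "label s i = 0" "label r i \<noteq> 0" using lb by (auto simp: label_def split: if_splits)
      then show ?thesis
      proof cases
        case 1
        then show ?thesis using lab0[OF 1(1) bd[OF r] i] lab1[OF 1(2) bd[OF s] i] ptB[OF bd[OF r]] ptB[OF bd[OF s]] near[OF r] near[OF s] by blast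
      next
        case 2
        then show ?thesis using lab0[OF 2(1) bd[OF s] i] lab1[OF 2(2) bd[OF r] i] ptB[OF bd[OF r]] ptB[OF bd[OF s]] near[OF r] near[OF s] by blast
      qed
    qed
    moreover have "pt n q \<in> B" using ptB[of n q] q by (auto intro: less_imp_le)
    ultimately show ?thesis by blast
  qed
  then obtain X where XB: "\<And>n. X n \<in> B" and X: "\<And>n i. i < n \<Longrightarrow> \<exists>y z. y \<in> B \<and> z \<in> B \<and> G i y \<le> 0 \<and> 0 \<le> G i z \<and>
      (\<forall>j. \<bar>y j - X n j\<bar> \<le> (hi j - lo j) / Suc n \<and> \<bar>z j - X n j\<bar> \<le> (hi j - lo j) / Suc n)" by metis
  have "compact B"
  proof -
    have "B = PiE UNIV (\<lambda>i. {lo i..hi i})" by (auto simp: B_def PiE_def)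
    then have "compactin (product_topology (\<lambda>i. euclidean) UNIV) B" by (simp add: compactin_PiE)
    then show ?thesis by (simp add: euclidean_product_topology)
  qed
  then obtain x r where x: "x \<in> B" and r: "strict_mono (r :: nat \<Rightarrow> nat)" and lim: "(X \<circ> r) \<longlonglongrightarrow> x"
    using seq_compactE[OF compact_imp_seq_compact] XB by metis
  have coord: "(\<lambda>n. X (r n) j) \<longlonglongrightarrow> x j" for j
  proof -
    have "isCont (\<lambda>x. x j) x"
      using continuous_on_product_coordinates continuous_on_eq_continuous_at[OF open_UNIV, of "\<lambda>x :: nat \<Rightarrow> real. x j"] by simp
    from isCont_tendsto_compose[OF this lim] show ?thesis by (simp add: o_def)
  qed
  have conv: "Y \<longlonglongrightarrow> x" if Y: "\<And>n. i < r n \<Longrightarrow> \<forall>j. \<bar>Y n j - X (r n) j\<bar> \<le> (hi j - lo j) / Suc (r n)" for Y :: "nat \<Rightarrow> nat \<Rightarrow> real" and i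
  proof -
    have "(\<lambda>n. Y n j) \<longlonglongrightarrow> x j" for j
    proof -
      have "(\<lambda>n. (hi j - lo j) * inverse (real (Suc n))) \<longlonglongrightarrow> (hi j - lo j) * 0"
        by (intro tendsto_intros LIMSEQ_inverse_real_of_nat)
      then have "(\<lambda>n. (hi j - lo j) / Suc n) \<longlonglongrightarrow> 0" by (simp add: divide_inverse)
      from LIMSEQ_subseq_LIMSEQ[OF this r] have e: "(\<lambda>n. (hi j - lo j) / Suc (r n)) \<longlonglongrightarrow> 0" by (simp add: o_def)
      have "\<forall>\<^sub>F n in sequentially. i < r n"
        by (rule eventually_compose_filterlim[OF eventually_gt_at_top filterlim_subseq[OF r]])
      then have "\<forall>\<^sub>F n in sequentially. norm (Y n j - X (r n) j) \<le> (hi j - lo j) / Suc (r n)"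
        by eventually_elim (use Y in auto)
      from Lim_null_comparison[OF this e] have "(\<lambda>n. Y n j - X (r n) j) \<longlonglongrightarrow> 0" .
      from tendsto_add[OF this coord[of j]] show ?thesis by simp
    qed
    then have "limitin (product_topology (\<lambda>i. euclidean) UNIV) Y x sequentially"
      by (simp add: limitin_componentwise)
    then show ?thesis by (simp add: euclidean_product_topology)
  qed
  have "G i x = 0" for i
  proof -
    define P where "P n y z \<longleftrightarrow> y \<in> B \<and> z \<in> B \<and> G i y \<le> 0 \<and> 0 \<le> G i z \<and>
      (\<forall>j. \<bar>y j - X n j\<bar> \<le> (hi j - lo j) / Suc n \<and> \<bar>z j - X n j\<bar> \<le> (hi j - lo j) / Suc n)" for n y z
    \<comment> \<open>For the finitely many \<open>n\<close> with \<open>r n \<le> i\<close> the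
      grid says nothing about coordinate \<open>i\<close>; the limit \<open>x\<close> fills these
      places so that the sequences stay in \<open>B\<close>.\<close>
    have "\<exists>y z. y \<in> B \<and> z \<in> B \<and> (i < r n \<longrightarrow> P (r n) y z)" for n
      using X[of i "r n"] x unfolding P_def by (cases "i < r n") blast+
    then obtain Y Z where YB: "\<And>n. Y n \<in> B" "\<And>n. Z n \<in> B" and YZ: "\<And>n. i < r n \<Longrightarrow> P (r n) (Y n) (Z n)" by metis
    have "Y \<longlonglongrightarrow> x" "Z \<longlonglongrightarrow> x" by (rule conv[of i]; use YZ in \<open>simp add: P_def\<close>)+
    then have GY: "(\<lambda>n. G i (Y n)) \<longlonglongrightarrow> G i x" "(\<lambda>n. G i (Z n)) \<longlonglongrightarrow> G i x"
      using cont[of i] YB x unfolding continuous_on_sequentially by (auto simp: o_def)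
    have ev: "\<forall>\<^sub>F n in sequentially. i < r n"
      by (rule eventually_compose_filterlim[OF eventually_gt_at_top filterlim_subseq[OF r]])
    have "G i x \<le> 0"
      by (rule tendsto_upperbound[OF GY(1)]) (use ev YZ in \<open>auto elim!: eventually_mono simp: P_def\<close>)
    moreover have "0 \<le> G i x"
      by (rule tendsto_lowerbound[OF GY(2)]) (use ev YZ in \<open>auto elim!: eventually_mono simp: P_def\<close>)
    ultimately show ?thesis by simp
  qed
  then show ?thesis using x by (intro bexI[of _ x] allI)
qed

section \<open>The metric on bi-infinite words\<close>

lemma geometric_int_summable: "(\<lambda>k::int. 1 / 4 ^ nat \<bar>k\<bar> :: real) summable_on UNIV"
proof -
  have g: "(\<lambda>n::nat. 1 / 4 ^ n :: real) summable_on UNIV"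
  proof -
    have "summable (\<lambda>n. norm ((1 / 4 :: real) ^ n))"
      using summable_geometric[of "norm (1 / 4 :: real)"] by (simp only: norm_power) simp
    then have "(\<lambda>n. (1 / 4 :: real) ^ n) summable_on UNIV" by (rule norm_summable_imp_summable_on)
    then show ?thesis by (simp only: power_one_over)
  qed
  have "(\<lambda>k::int. 1 / 4 ^ nat \<bar>k\<bar> :: real) summable_on range int"
    using g by (subst summable_on_reindex) (auto simp: o_def)
  moreover have "(\<lambda>k::int. 1 / 4 ^ nat \<bar>k\<bar> :: real) summable_on range (\<lambda>n. - int n)"
    using g by (subst summable_on_reindex) (auto simp: o_def inj_def)
  then have "(\<lambda>k::int. 1 / 4 ^ nat \<bar>k\<bar> :: real) summable_on (range (\<lambda>n. - int n) - range int)"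
    by (rule summable_on_subset_banach) auto
  ultimately have "(\<lambda>k::int. 1 / 4 ^ nat \<bar>k\<bar> :: real) summable_on (range int \<union> (range (\<lambda>n. - int n) - range int))"
    by (intro summable_on_Un_disjoint) auto
  moreover have "range int \<union> (range (\<lambda>n. - int n) - range int) = UNIV"
  proof -
    have "k \<in> range int \<union> range (\<lambda>n. - int n)" for k :: int
      by (cases k rule: int_cases2) auto
    then show ?thesis by auto
  qed
  ultimately show ?thesis by simp
qed

lemma word_dist_summable: "(\<lambda>k. (if l k = l' k then 0 else 1) / 4 ^ nat \<bar>k\<bar> :: real) summable_on (UNIV :: int set)"
  by (rule summable_on_comparison_test[OF geometric_int_summable]) (auto simp: divide_right_mono)

lemma word_dist_metric: "Metric_space W word_dist"
proof
  show "0 \<le> word_dist l l'" for l l' unfolding word_dist_def by (rule infsum_nonneg) auto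
  show "word_dist l l' = word_dist l' l" for l l' unfolding word_dist_def by (simp add: eq_commute)
  show "word_dist l l' = 0 \<longleftrightarrow> l = l'" for l l'
  proof
    assume z: "word_dist l l' = 0"
    show "l = l'"
    proof (rule ccontr)
      assume "l \<noteq> l'"
      then obtain k where k: "l k \<noteq> l' k" by blast
      have "sum (\<lambda>k. (if l k = l' k then 0 else 1) / 4 ^ nat \<bar>k\<bar> :: real) {k} \<le> word_dist l l'"
        unfolding word_dist_def by (rule finite_sum_le_infsum[OF word_dist_summable]) auto
      moreover have "sum (\<lambda>k. (if l k = l' k then 0 else 1) / 4 ^ nat \<bar>k\<bar> :: real) {k} = 1 / 4 ^ nat \<bar>k\<bar>"
        using k by simp
      moreover have "(1 :: real) / 4 ^ nat \<bar>k\<bar> > 0" by simp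
      ultimately show False unfolding z by linarith
    qed
  qed (simp add: word_dist_def)
  show "word_dist l l'' \<le> word_dist l l' + word_dist l' l''" for l l' l''
    unfolding word_dist_def infsum_add[OF word_dist_summable word_dist_summable, symmetric]
    by (rule infsum_mono[OF word_dist_summable summable_on_add[OF word_dist_summable word_dist_summable]])
       (auto simp: add_divide_distrib[symmetric] divide_right_mono)
qed

text \<open>If two words agree on \<open>K\<close>, their distance is at most the sum of the
  convergent series over the complement of \<open>K\<close>.\<close>

lemma word_dist_small:
  assumes "e > 0"
  obtains K where "finite K" "\<And>l l'. (\<And>k. k \<in> K \<Longrightarrow> l k = l' k) \<Longrightarrow> word_dist l l' < e"
proof -
  define g where "g k = (1 / 4 ^ nat \<bar>k\<bar> :: real)" for k :: int
  have gs: "g summable_on UNIV" unfolding g_def by (rule geometric_int_summable)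
  have "\<forall>\<^sub>F K in finite_subsets_at_top UNIV. infsum g UNIV - e < sum g K"
    using infsum_tendsto[OF gs] by (rule order_tendstoD(1)) (use assms in simp)
  then obtain K where K: "finite K" "infsum g UNIV - e < sum g K"
    using eventually_happens'[OF finite_subsets_at_top_neq_bot] by (auto simp: eventually_finite_subsets_at_top)
  have "word_dist l l' < e" if "\<And>k. k \<in> K \<Longrightarrow> l k = l' k" for l l'
  proof -
    have "word_dist l l' \<le> infsum (\<lambda>k. if k \<in> K then 0 else g k) UNIV"
      unfolding word_dist_def
    proof (rule infsum_mono[OF word_dist_summable])
      show "(\<lambda>k. if k \<in> K then 0 else g k) summable_on UNIV"
        by (rule summable_on_comparison_test[OF gs]) (auto simp: g_def)
    qed (use that in \<open>auto simp: g_def\<close>)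
    also have "\<dots> = infsum g (UNIV - K)" by (rule infsum_cong_neutral) auto
    also have "\<dots> = infsum g UNIV - sum g K"
      using infsum_Diff[OF gs summable_on_finite[OF K(1)]] K(1) by (simp add: infsum_finite)
    finally show ?thesis using K(2) by simp
  qed
  then show ?thesis using that K(1) by blast
qed

section \<open>Transversality at large energy\<close>

lemma continuous_on_kep_d:
  assumes "continuous_on S f" "continuous_on S g"
  shows "continuous_on S (\<lambda>x. kep_d (f x) (g x))"
  unfolding kep_d_def by (intro continuous_intros assms) simp

lemma continuous_on_kep_vel:
  assumes f: "continuous_on S f" and g: "continuous_on S g" and H: "\<mu> > 0" "H > 0"
    and na: "\<And>x. x \<in> S \<Longrightarrow> 0 \<notin> closed_segment (f x) (g x)"
  shows "continuous_on S (\<lambda>x. kep_vel \<mu> H (f x) (g x))"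
proof -
  have e: "\<mu> / H > 0" using H by simp
  have C: "continuous_on S (\<lambda>x. kep_C (\<mu> / H) (f x) (g x))"
    unfolding kep_C_def using H by (intro continuous_intros continuous_on_kep_d f g) auto
  have s: "sqrt ((kep_C (\<mu> / H) (f x) (g x))\<^sup>2 - 1) \<noteq> 0" if "x \<in> S" for x
  proof -
    have "kep_C (\<mu> / H) (f x) (g x) > 1" using kep_C_quadratic(2)[OF e kep_d_pos[OF na[OF that]]] .
    then have "(kep_C (\<mu> / H) (f x) (g x))\<^sup>2 > 1" by (simp add: one_less_power)
    then show ?thesis by simp
  qed
  have n: "norm (f x) \<noteq> 0" "2 * kep_d (f x) (g x) \<noteq> 0" if "x \<in> S" for x
    using na[OF that] kep_d_pos[OF na[OF that]] by auto
  show ?thesis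
    unfolding kep_vel_def by (intro continuous_intros continuous_on_kep_d C f g ballI s n)
qed

lemma continuous_on_lob_cos:
  assumes "continuous_on S f" "continuous_on S g" "\<rho> > 0"
  shows "continuous_on S (\<lambda>x. lob_cos \<rho> (f x) (g x))"
  unfolding lob_cos_def arc_disc_def using assms(3) by (intro continuous_intros assms(1,2)) auto

lemma continuous_on_lob_vec:
  assumes f: "continuous_on S f" and g: "continuous_on S g" and \<rho>: "\<rho> > 0"
    and c: "\<And>x. x \<in> S \<Longrightarrow> - 1 < lob_cos \<rho> (f x) (g x) \<and> lob_cos \<rho> (f x) (g x) < 1"
  shows "continuous_on S (\<lambda>x. lob_vec \<rho> (f x) (g x))"
proof -
  have "sqrt (1 - (lob_cos \<rho> (f x) (g x))\<^sup>2) \<noteq> 0" if "x \<in> S" for x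
  proof -
    have "(lob_cos \<rho> (f x) (g x))\<^sup>2 < 1" using c[OF that] by (simp add: abs_square_less_1 abs_less_iff)
    then show ?thesis by simp
  qed
  then show ?thesis unfolding lob_vec_def
    by (intro continuous_intros continuous_on_lob_cos f g \<rho> ballI)
qed

context refraction_domain
begin

lemma continuous_on_tangent: "continuous_on {0..L} tangent"
  using curve_C1 by (simp add: tangent_def[abs_def])

text \<open>The tangential component of the jump of velocity at \<open>x\<close>, when an outer arc joins
  \<open>x\<close> to \<open>e\<close> and an inner arc joins \<open>x\<close> to \<open>f\<close>.\<close>
definition snell_defect :: "real \<Rightarrow> real \<Rightarrow> real \<Rightarrow> real \<Rightarrow> real" where
  "snell_defect h e x f =
     inner (\<omega> *\<^sub>R lob_vec \<rho> (\<gamma> x) (\<gamma> e) + kep_vel \<mu> (\<E> + h) (\<gamma> x) (\<gamma> f)) (tangent x)"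

end

context arc_interval
begin

text \<open>Compactness makes the energy threshold of \<open>kep_vel_transversal\<close> uniform:
  \<open>f\<close> has a positive minimum and \<open>g\<close> a maximum, and their quotient is the
  threshold.\<close>

lemma eventually_transversal:
  assumes sub: "{c..d} \<subseteq> {a<..<b}" "{c'..d'} \<subseteq> {0..L}"
    and na: "\<And>\<xi> \<eta>. \<xi> \<in> {c..d} \<Longrightarrow> \<eta> \<in> {c'..d'} \<Longrightarrow> 0 \<notin> closed_segment (\<gamma> \<xi>) (\<gamma> \<eta>)"
  shows "\<forall>\<^sub>F h in at_top. \<forall>\<xi>\<in>{c..d}. \<forall>\<eta>\<in>{c'..d'}. inner (outward_normal \<xi>) (kep_vel \<mu> (\<E> + h) (\<gamma> \<xi>) (\<gamma> \<eta>)) < 0"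
proof (cases "{c..d} \<times> {c'..d'} = {}")
  case True
  then show ?thesis by auto
next
  case False
  define K where "K = {c..d} \<times> {c'..d'}"
  define f where "f x = 2 * (kep_d (\<gamma> (fst x)) (\<gamma> (snd x)))\<^sup>2 * (sg * wedge (\<gamma> (fst x)) (tangent (fst x)))" for x
  define g where "g x = \<mu> * (norm (\<gamma> (fst x)) * norm (\<gamma> (snd x)))" for x
  have sL: "{c..d} \<subseteq> {0..L}" using sub(1) subset_L(2) by blast
  have K: "compact K" "K \<noteq> {}" using False by (auto simp: K_def compact_Times)
  have c1: "continuous_on K (\<lambda>x. \<gamma> (fst x))" "continuous_on K (\<lambda>x. tangent (fst x))" "continuous_on K (\<lambda>x. \<gamma> (snd x))"
    using sL sub(2)
    by (auto simp: K_def intro!: continuous_on_compose2[OF continuous_on_curve] continuous_on_compose2[OF continuous_on_tangent]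
        continuous_on_fst continuous_on_snd continuous_on_id)
  have "continuous_on K f" unfolding f_def wedge_def by (intro continuous_intros continuous_on_kep_d c1)
  then obtain x0 where x0: "x0 \<in> K" "\<And>x. x \<in> K \<Longrightarrow> f x0 \<le> f x" using continuous_attains_inf[OF K] by blast
  have "continuous_on K g" unfolding g_def by (intro continuous_intros c1)
  then obtain x1 where x1: "x1 \<in> K" "\<And>x. x \<in> K \<Longrightarrow> g x \<le> g x1" using continuous_attains_sup[OF K] by blast
  have f0: "f x0 > 0"
  proof -
    have "kep_d (\<gamma> (fst x0)) (\<gamma> (snd x0)) > 0" using na[of "fst x0" "snd x0"] x0(1) by (intro kep_d_pos) (auto simp: K_def)
    moreover have "sg * wedge (\<gamma> (fst x0)) (tangent (fst x0)) > 0" using x0(1) sub(1) by (intro tangent_wedge_pos) (auto simp: K_def)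
    moreover have "2 * (kep_d (\<gamma> (fst x0)) (\<gamma> (snd x0)))\<^sup>2 > 0" using calculation(1) by simp
    ultimately show ?thesis unfolding f_def by (metis mult_pos_pos)
  qed
  have "inner (outward_normal \<xi>) (kep_vel \<mu> (\<E> + h) (\<gamma> \<xi>) (\<gamma> \<eta>)) < 0"
    if h: "h > max 0 (g x1 / f x0)" and \<xi>: "\<xi> \<in> {c..d}" and \<eta>: "\<eta> \<in> {c'..d'}" for h \<xi> \<eta>
  proof -
    have x: "\<xi> \<in> {a<..<b}" using \<xi> sub(1) by blast
    have k: "(\<xi>, \<eta>) \<in> K" using \<xi> \<eta> by (simp add: K_def)
    have H: "\<E> + h > 0" "h > g x1 / f x0" using h \<E>_pos by auto
    have "g (\<xi>, \<eta>) \<le> g x1" using x1 k by blast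
    also have "\<dots> < h * f x0" using H(2) f0 by (simp add: pos_divide_less_eq)
    also have "\<dots> \<le> (\<E> + h) * f x0" using f0 \<E>_pos by (intro mult_right_mono) simp_all
    also have "\<dots> \<le> (\<E> + h) * f (\<xi>, \<eta>)" using x0(2)[OF k] H(1) by (intro mult_left_mono) simp_all
    finally have big: "g (\<xi>, \<eta>) < (\<E> + h) * f (\<xi>, \<eta>)" .
    show ?thesis unfolding outward_normal_eq[OF x]
      by (rule kep_vel_transversal[OF H(1) na[OF \<xi> \<eta>] norm_nrm[OF x] normal_curve_pos[OF x]])
         (use big in \<open>simp only: f_def g_def inner_nrm fst_conv snd_conv mult_ac\<close>)
  qed
  then show ?thesis
    unfolding eventually_at_top_dense by blast
qed

end

text \<open>The consequences of admissibility at one large \<open>h\<close>, with derivatives of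
  lengths already replaced by velocities in \<open>snell_defect\<close>. Chains, continuity and
  itineraries are all treated at this fixed energy.\<close>

locale refraction_system = refraction_domain +
  fixes m :: nat and a b \<alpha> \<beta> :: "nat \<Rightarrow> real" and h :: real
  assumes arc: "i \<in> {1..m} \<Longrightarrow> arc_interval \<omega> \<mu> \<E> D \<gamma> L (a i) (b i)"
    and h_pos: "h > 0"
    and disjoint: "disjoint_family_on (\<lambda>i. {a i<..<b i}) {1..m}"
    and bounds: "i \<in> {1..m} \<Longrightarrow> a i < \<alpha> i \<and> \<alpha> i \<le> \<beta> i \<and> \<beta> i < b i"
    and inner_unique: "i \<in> {1..m} \<Longrightarrow> j \<in> NA m a b i \<Longrightarrow> \<xi> \<in> {a i<..<b i} \<Longrightarrow> \<eta> \<in> {a j<..<b j} \<Longrightarrow>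
      unique_arc (inner_arc h (\<gamma> \<xi>) (\<gamma> \<eta>))"
    and sign_change: "i \<in> {1..m} \<Longrightarrow> j \<in> NA m a b i \<Longrightarrow> e \<in> {\<alpha> i..\<beta> i} \<Longrightarrow> f \<in> {\<alpha> j..\<beta> j} \<Longrightarrow>
      snell_defect h e (\<alpha> i) f * snell_defect h e (\<beta> i) f < 0"
    and transversal: "i \<in> {1..m} \<Longrightarrow> j \<in> NA m a b i \<Longrightarrow> \<xi> \<in> {\<alpha> i..\<beta> i} \<Longrightarrow> \<eta> \<in> {\<alpha> j..\<beta> j} \<Longrightarrow>
      inner (outward_normal \<xi>) (kep_vel \<mu> (\<E> + h) (\<gamma> \<xi>) (\<gamma> \<eta>)) < 0"

lemma (in refraction_domain) eventually_refraction_system: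
  assumes "admissible_with m a b \<alpha> \<beta>"
  shows "\<forall>\<^sub>F h in at_top. refraction_system \<omega> \<mu> \<E> D \<gamma> L m a b \<alpha> \<beta> h"
proof -
  obtain h\<^sub>0 h\<^sub>1 where out: "\<And>i. i \<in> {1..m} \<Longrightarrow> outer_arc_property (a i) (b i)"
    and inn: "inner_arc_property m a b h\<^sub>0" and h: "h\<^sub>1 \<ge> h\<^sub>0" and cs: "change_sign_property m a b \<alpha> \<beta> h\<^sub>1"
    using assms by (auto simp: admissible_with_def)
  have arc: "arc_interval \<omega> \<mu> \<E> D \<gamma> L (a i) (b i)" if "i \<in> {1..m}" for i
    using admissible_arc_interval[OF out inn] that by blast
  have h0: "h\<^sub>0 > 0" and dis: "disjoint_family_on (\<lambda>i. {a i<..<b i}) {1..m}" using inn by (auto simp: inner_arc_property_def)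
  have ab: "0 \<le> a i \<and> a i < b i \<and> b i \<le> L" "i \<in> NA m a b i" if "i \<in> {1..m}" for i
    using inn that by (auto simp: inner_arc_property_def)
  have bd: "a i < \<alpha> i \<and> \<alpha> i \<le> \<beta> i \<and> \<beta> i < b i" if "i \<in> {1..m}" for i
    using cs that by (simp add: change_sign_property_def)
  have iu: "unique_arc (inner_arc h (\<gamma> \<xi>) (\<gamma> \<eta>))"
    if "h > h\<^sub>0" "i \<in> {1..m}" "j \<in> NA m a b i" "\<xi> \<in> {a i<..<b i}" "\<eta> \<in> {a j<..<b j}" for h i j \<xi> \<eta>
    using inn that unfolding inner_arc_property_def by blast
  have NAm: "j \<in> {1..m}" if "j \<in> NA m a b i" for i j using that by (simp add: NA_def)
  have sub: "{\<alpha> i..\<beta> i} \<subseteq> {a i<..<b i}" if "i \<in> {1..m}" for i using bd[OF that] by auto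
  have subL: "{\<alpha> i..\<beta> i} \<subseteq> {0..L}" if "i \<in> {1..m}" for i using bd[OF that] ab(1)[OF that] by auto
  have tr: "\<forall>\<^sub>F h in at_top. \<forall>i\<in>{1..m}. \<forall>j\<in>{1..m}. j \<in> NA m a b i \<longrightarrow>
      (\<forall>\<xi>\<in>{\<alpha> i..\<beta> i}. \<forall>\<eta>\<in>{\<alpha> j..\<beta> j}. inner (outward_normal \<xi>) (kep_vel \<mu> (\<E> + h) (\<gamma> \<xi>) (\<gamma> \<eta>)) < 0)"
  proof (intro eventually_ball_finite finite_atLeastAtMost ballI)
    fix i j assume i: "i \<in> {1..m}" and j: "j \<in> {1..m}"
    show "\<forall>\<^sub>F h in at_top. j \<in> NA m a b i \<longrightarrow>
      (\<forall>\<xi>\<in>{\<alpha> i..\<beta> i}. \<forall>\<eta>\<in>{\<alpha> j..\<beta> j}. inner (outward_normal \<xi>) (kep_vel \<mu> (\<E> + h) (\<gamma> \<xi>) (\<gamma> \<eta>)) < 0)"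
    proof (cases "j \<in> NA m a b i")
      case True
      interpret A: arc_interval \<omega> \<mu> \<E> D \<gamma> L "a i" "b i" by (rule arc[OF i])
      have na: "0 \<notin> closed_segment (\<gamma> \<xi>) (\<gamma> \<eta>)" if "\<xi> \<in> {\<alpha> i..\<beta> i}" "\<eta> \<in> {\<alpha> j..\<beta> j}" for \<xi> \<eta>
        by (rule NA_nonzero[OF True]) (use that sub[OF i] sub[OF j] in blast)+
      show ?thesis using A.eventually_transversal[OF sub[OF i] subL[OF j] na] True by simp
    qed simp
  qed
  show ?thesis using tr eventually_gt_at_top[of h\<^sub>1]
  proof eventually_elim
    fix h assume tr: "\<forall>i\<in>{1..m}. \<forall>j\<in>{1..m}. j \<in> NA m a b i \<longrightarrow>
      (\<forall>\<xi>\<in>{\<alpha> i..\<beta> i}. \<forall>\<eta>\<in>{\<alpha> j..\<beta> j}. inner (outward_normal \<xi>) (kep_vel \<mu> (\<E> + h) (\<gamma> \<xi>) (\<gamma> \<eta>)) < 0)"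
      and hh: "h\<^sub>1 < h"
    have hp: "h > 0" "h > h\<^sub>0" using hh h h0 by auto
    \<comment> \<open>First variation: the sum of the two partial derivatives is a negative multiple
      of the defect. The factor cancels in the product over both ends, so the sign condition carries
      over.\<close>
    have dS: "deriv (\<lambda>x. S\<^sub>E e x) z + deriv (\<lambda>x. S\<^sub>I h x f) z = - (snell_defect h e z f) / sqrt 2"
      if i: "i \<in> {1..m}" and j: "j \<in> NA m a b i" and e: "e \<in> {\<alpha> i..\<beta> i}" and f: "f \<in> {\<alpha> j..\<beta> j}" and z: "z \<in> {a i<..<b i}" for i j e f z
    proof -
      interpret A: arc_interval \<omega> \<mu> \<E> D \<gamma> L "a i" "b i" by (rule arc[OF i])
      have e': "e \<in> {a i<..<b i}" using e sub[OF i] by blast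
      have f': "f \<in> {a j<..<b j}" using f sub[OF NAm[OF j]] by blast
      have "deriv (\<lambda>x. S\<^sub>E e x) z = - (\<omega> * inner (lob_vec \<rho> (\<gamma> z) (\<gamma> e)) (tangent z)) / sqrt 2"
        by (rule DERIV_imp_deriv[OF A.S\<^sub>E_derivative[OF e' z]])
      moreover have "deriv (\<lambda>x. S\<^sub>I h x f) z = - inner (kep_vel \<mu> (\<E> + h) (\<gamma> z) (\<gamma> f)) (tangent z) / sqrt 2"
        by (rule DERIV_imp_deriv[OF S\<^sub>I_derivative[OF z _ _ hp(1) iu[OF hp(2) i j _ f'] NA_nonzero[OF j _ f']]])
           (use ab[OF i] in auto)
      ultimately show ?thesis unfolding snell_defect_def inner_add_left inner_scaleR_left
        by (simp add: diff_divide_distrib)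
    qed
    show "refraction_system \<omega> \<mu> \<E> D \<gamma> L m a b \<alpha> \<beta> h"
    proof (intro refraction_system.intro refraction_domain_axioms refraction_system_axioms.intro)
      show "snell_defect h e (\<alpha> i) f * snell_defect h e (\<beta> i) f < 0"
        if i: "i \<in> {1..m}" and j: "j \<in> NA m a b i" and e: "e \<in> {\<alpha> i..\<beta> i}" and f: "f \<in> {\<alpha> j..\<beta> j}" for i j e f
      proof -
        have "f \<in> (\<Union>j\<in>NA m a b i. {\<alpha> j..\<beta> j})" using j f by blast
        then have "(deriv (\<lambda>x. S\<^sub>E e x) (\<alpha> i) + deriv (\<lambda>x. S\<^sub>I h x f) (\<alpha> i)) *
          (deriv (\<lambda>x. S\<^sub>E e x) (\<beta> i) + deriv (\<lambda>x. S\<^sub>I h x f) (\<beta> i)) < 0"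
          using cs hh i e unfolding change_sign_property_def by blast
        moreover have "\<alpha> i \<in> {a i<..<b i}" "\<beta> i \<in> {a i<..<b i}" using bd[OF i] by auto
        ultimately have "(- snell_defect h e (\<alpha> i) f / sqrt 2) * (- snell_defect h e (\<beta> i) f / sqrt 2) < 0"
          using dS[OF i j e f] by metis
        then show ?thesis by simp
      qed
    next
      fix i j \<xi> \<eta> assume "i \<in> {1..m}" "j \<in> NA m a b i" "\<xi> \<in> {\<alpha> i..\<beta> i}" "\<eta> \<in> {\<alpha> j..\<beta> j}"
      then show "inner (outward_normal \<xi>) (kep_vel \<mu> (\<E> + h) (\<gamma> \<xi>) (\<gamma> \<eta>)) < 0" using tr NAm by blast
    qed (fact arc hp(1) dis bd iu[OF hp(2)])+
  qed
qed

section \<open>Chains of arcs\<close>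

context refraction_system
begin

lemma cell_subset: "i \<in> {1..m} \<Longrightarrow> \<xi> \<in> {\<alpha> i..\<beta> i} \<Longrightarrow> \<xi> \<in> {a i<..<b i}"
  using bounds[of i] by auto

lemma NA_mem: "j \<in> NA m a b i \<Longrightarrow> j \<in> {1..m}"
  by (simp add: NA_def)

lemma cell_L: "i \<in> {1..m} \<Longrightarrow> \<xi> \<in> {\<alpha> i..\<beta> i} \<Longrightarrow> \<xi> \<in> {0<..<L}" "i \<in> {1..m} \<Longrightarrow> \<xi> \<in> {\<alpha> i..\<beta> i} \<Longrightarrow> \<xi> \<in> {0..L}"
  using arc_interval.subset_L[OF arc] cell_subset by blast+

lemma cell_nonzero:
  "i \<in> {1..m} \<Longrightarrow> j \<in> NA m a b i \<Longrightarrow> \<xi> \<in> {\<alpha> i..\<beta> i} \<Longrightarrow> \<eta> \<in> {\<alpha> j..\<beta> j} \<Longrightarrow> 0 \<notin> closed_segment (\<gamma> \<xi>) (\<gamma> \<eta>)"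
  using NA_nonzero cell_subset NA_mem by blast

lemma continuous_on_cell:
  assumes "i \<in> {1..m}"
  shows "continuous_on {\<alpha> i..\<beta> i} \<gamma>" "continuous_on {\<alpha> i..\<beta> i} tangent"
  using continuous_on_subset[OF continuous_on_curve] continuous_on_subset[OF continuous_on_tangent] cell_L(2)[OF assms] by blast+

text \<open>The change-sign property speaks about derivatives at the ends of a cell only. Continuity
  on the whole cell comes from the closed formulas for the velocities.\<close>

lemma continuous_on_defect:
  assumes i: "i \<in> {1..m}" and j: "j \<in> NA m a b i"
    and e: "continuous_on S e" "e ` S \<subseteq> {\<alpha> i..\<beta> i}" and x: "continuous_on S x" "x ` S \<subseteq> {\<alpha> i..\<beta> i}"
    and f: "continuous_on S f" "f ` S \<subseteq> {\<alpha> j..\<beta> j}"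
  shows "continuous_on S (\<lambda>u. snell_defect h (e u) (x u) (f u))"
proof -
  interpret A: arc_interval \<omega> \<mu> \<E> D \<gamma> L "a i" "b i" by (rule arc[OF i])
  have ge: "continuous_on S (\<lambda>u. \<gamma> (e u))" and gx: "continuous_on S (\<lambda>u. \<gamma> (x u))" and tx: "continuous_on S (\<lambda>u. tangent (x u))"
    by (rule continuous_on_compose2[OF continuous_on_cell(1)[OF i] e] continuous_on_compose2[OF continuous_on_cell(1)[OF i] x]
        continuous_on_compose2[OF continuous_on_cell(2)[OF i] x])+
  have gf: "continuous_on S (\<lambda>u. \<gamma> (f u))"
    by (rule continuous_on_compose2[OF continuous_on_cell(1)[OF NA_mem[OF j]] f])
  have lv: "continuous_on S (\<lambda>u. lob_vec \<rho> (\<gamma> (x u)) (\<gamma> (e u)))"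
  proof (rule continuous_on_lob_vec[OF gx ge rho_pos])
    fix u assume u: "u \<in> S"
    have "x u \<in> {\<alpha> i..\<beta> i}" "e u \<in> {\<alpha> i..\<beta> i}" using u e(2) x(2) by (auto simp: image_subset_iff)
    then have "x u \<in> {a i<..<b i}" "e u \<in> {a i<..<b i}" using cell_subset[OF i] by blast+
    then show "- 1 < lob_cos \<rho> (\<gamma> (x u)) (\<gamma> (e u)) \<and> lob_cos \<rho> (\<gamma> (x u)) (\<gamma> (e u)) < 1"
      using A.lob_arc(2,3) by blast
  qed
  have kv: "continuous_on S (\<lambda>u. kep_vel \<mu> (\<E> + h) (\<gamma> (x u)) (\<gamma> (f u)))"
  proof (rule continuous_on_kep_vel[OF gx gf \<mu>_pos])
    show "\<E> + h > 0" using h_pos \<E>_pos by simp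
    fix u assume u: "u \<in> S"
    then have "x u \<in> {\<alpha> i..\<beta> i}" "f u \<in> {\<alpha> j..\<beta> j}" using x(2) f(2) by (auto simp: image_subset_iff)
    then show "0 \<notin> closed_segment (\<gamma> (x u)) (\<gamma> (f u))" by (rule cell_nonzero[OF i j])
  qed
  show ?thesis unfolding snell_defect_def by (intro continuous_intros lv kv tx)
qed

text \<open>The defects at the two ends of a cell have opposite signs, but which one is negative
  could depend on the neighbours. On the connected rectangle of neighbours the sign cannot switch,
  so one factor \<sigma> normalizes it as the product theorem requires.\<close>

lemma defect_sign:
  assumes i: "i \<in> {1..m}" and j: "j \<in> NA m a b i"
  shows "\<exists>\<sigma>. \<forall>e\<in>{\<alpha> i..\<beta> i}. \<forall>f\<in>{\<alpha> j..\<beta> j}. \<sigma> * snell_defect h e (\<alpha> i) f < 0 \<and> \<sigma> * snell_defect h e (\<beta> i) f > 0"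
proof -
  define S where "S = {\<alpha> i..\<beta> i} \<times> {\<alpha> j..\<beta> j}"
  define g where "g u = snell_defect h (fst u) (\<alpha> i) (snd u)" for u
  have "continuous_on S g" unfolding g_def
    by (rule continuous_on_defect[OF i j]) (use bounds[OF i] in \<open>auto simp: S_def intro!: continuous_intros\<close>)
  moreover have "connected S" unfolding S_def by (intro connected_Times convex_connected) auto
  ultimately have con: "connected (g ` S)" by (rule connected_continuous_image)
  have nz: "0 \<notin> g ` S" using sign_change[OF i j] by (force simp: g_def S_def)
  define u0 where "u0 = (\<alpha> i, \<alpha> j)"
  have u0: "u0 \<in> S" using bounds[OF i] bounds[OF NA_mem[OF j]] by (simp add: u0_def S_def)
  have same: "g u0 * g u > 0" if "u \<in> S" for u
  proof (rule ccontr)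
    assume n: "\<not> g u0 * g u > 0"
    have "g u0 \<noteq> 0" "g u \<noteq> 0" using nz u0 that by (metis imageI)+
    then have "g u0 < 0 \<and> 0 < g u \<or> g u < 0 \<and> 0 < g u0" using n by (metis linorder_neqE_linordered_idom mult_neg_neg mult_pos_pos)
    moreover have "{g u0..g u} \<subseteq> g ` S" "{g u..g u0} \<subseteq> g ` S"
      using connected_contains_Icc[OF con] u0 that by blast+
    ultimately show False using nz by (auto simp: subset_iff)
  qed
  have "- g u0 * snell_defect h e (\<alpha> i) f < 0 \<and> - g u0 * snell_defect h e (\<beta> i) f > 0" if "e \<in> {\<alpha> i..\<beta> i}" "f \<in> {\<alpha> j..\<beta> j}" for e f
  proof -
    define A B where "A = snell_defect h e (\<alpha> i) f" and "B = snell_defect h e (\<beta> i) f"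
    have p: "g u0 * A > 0" using same[of "(e, f)"] that by (simp add: S_def g_def A_def)
    have "A * B < 0" using sign_change[OF i j that] by (simp add: A_def B_def)
    then have "(A > 0 \<and> B < 0) \<or> (A < 0 \<and> B > 0)" by (simp add: mult_less_0_iff)
    then have "g u0 * B < 0" using p by (auto simp: mult_less_0_iff zero_less_mult_iff)
    then show ?thesis using p by (simp add: A_def B_def)
  qed
  then show ?thesis by blast
qed

text \<open>Node \<open>2 j\<close> is the exit point and node \<open>2 j + 1\<close> the re-entry point of the \<open>j\<close>-th outer arc.\<close>
lemma equilibrium_nodes:
  assumes l: "l \<in> admissible_words m a b"
  shows "\<exists>y :: int \<Rightarrow> real. (\<forall>k. y k \<in> {\<alpha> (l (k div 2))..\<beta> (l (k div 2))}) \<and>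
    (\<forall>j. snell_defect h (y (2 * j + 1)) (y (2 * j)) (y (2 * j - 1)) = 0) \<and>
    (\<forall>j. snell_defect h (y (2 * j)) (y (2 * j + 1)) (y (2 * j + 2)) = 0)"
proof -
  \<comment> \<open>Every node has one neighbour across its outer arc, in the same cell, and one
    across its inner arc, in the preceding or following cell of the word.\<close>
  define ou inn :: "int \<Rightarrow> int" where "ou k = (if even k then k + 1 else k - 1)" and "inn k = (if even k then k - 1 else k + 1)" for k
  define c where "c k = l (k div 2)" for k :: int
  have cm: "c k \<in> {1..m}" for k using l by (simp add: c_def admissible_words_def)
  have ou: "c (ou k) = c k" for k by (auto simp: c_def ou_def elim!: evenE oddE)
  have inn: "c (inn k) \<in> NA m a b (c k)" for k
  proof (cases "even k")
    case True
    then obtain j where k: "k = 2 * j" by blast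
    have "(2 * j - 1) div 2 = j - 1" by presburger
    then have e: "c (inn k) = l (j - 1)" "c k = l j" unfolding c_def inn_def k by simp_all
    have "l (j - 1 + 1) \<in> NA m a b (l (j - 1))" "l (j - 1) \<in> {1..m}" using l unfolding admissible_words_def by blast+
    then show ?thesis unfolding e using NA_commute by simp
  next
    case False
    then obtain j where k: "k = 2 * j + 1" by (elim oddE)
    have "(2 * j + 1 + 1) div 2 = j + 1" by presburger
    then have "c (inn k) = l (j + 1)" "c k = l j" unfolding c_def inn_def k by (simp_all add: add.commute)
    then show ?thesis using l by (simp add: admissible_words_def)
  qed
  have "\<forall>k. \<exists>\<sigma>. \<forall>e\<in>{\<alpha> (c k)..\<beta> (c k)}. \<forall>f\<in>{\<alpha> (c (inn k))..\<beta> (c (inn k))}.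
      \<sigma> * snell_defect h e (\<alpha> (c k)) f < 0 \<and> \<sigma> * snell_defect h e (\<beta> (c k)) f > 0"
    using defect_sign[OF cm inn] by blast
  then obtain \<sigma> where \<sigma>: "\<And>k e f. e \<in> {\<alpha> (c k)..\<beta> (c k)} \<Longrightarrow> f \<in> {\<alpha> (c (inn k))..\<beta> (c (inn k))} \<Longrightarrow>
      \<sigma> k * snell_defect h e (\<alpha> (c k)) f < 0 \<and> \<sigma> k * snell_defect h e (\<beta> (c k)) f > 0" by metis
  \<comment> \<open>The product theorem is indexed by natural numbers, so the nodes are enumerated
    by \<open>int_decode\<close>.\<close>
  define lo hi where "lo n = \<alpha> (c (int_decode n))" and "hi n = \<beta> (c (int_decode n))" for n
  define G where "G n x = (let k = int_decode n in
      \<sigma> k * snell_defect h (x (int_encode (ou k))) (x n) (x (int_encode (inn k))))" for n and x :: "nat \<Rightarrow> real"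
  define B where "B = {x :: nat \<Rightarrow> real. \<forall>i. lo i \<le> x i \<and> x i \<le> hi i}"
  have Bm: "x (int_encode k) \<in> {\<alpha> (c k)..\<beta> (c k)}" if "x \<in> B" for x k
    using that by (auto simp: B_def lo_def hi_def dest: spec[of _ "int_encode k"])
  have Bou: "x (int_encode (ou k)) \<in> {\<alpha> (c k)..\<beta> (c k)}" if "x \<in> B" for x k
    using Bm[OF that, of "ou k"] unfolding ou .
  have coord: "continuous_on B (\<lambda>x. x n)" for n :: nat
    by (rule continuous_on_subset[OF continuous_on_product_coordinates]) simp
  have "\<exists>x\<in>{x. \<forall>i. lo i \<le> x i \<and> x i \<le> hi i}. \<forall>i. G i x = 0"
  proof (rule poincare_miranda_product; (fold B_def)?)
    show "lo n \<le> hi n" for n using bounds[OF cm] by (simp add: lo_def hi_def)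
    show "continuous_on B (G n)" for n
    proof -
      define k where "k = int_decode n"
      have n: "n = int_encode k" by (simp add: k_def)
      have "continuous_on B (\<lambda>x. snell_defect h (x (int_encode (ou k))) (x n) (x (int_encode (inn k))))"
        by (rule continuous_on_defect[OF cm[of k] inn[of k] coord _ coord _ coord]) (use Bm Bou in \<open>auto simp: n\<close>)
      then show ?thesis unfolding G_def Let_def k_def[symmetric] by (intro continuous_intros)
    qed
    show "G n x \<le> 0" if "x \<in> B" "x n = lo n" for n x
      using \<sigma>[OF Bou[OF that(1)] Bm[OF that(1)], of "int_decode n"] that(2)
      unfolding G_def Let_def lo_def by (simp add: less_imp_le)
    show "G n x \<ge> 0" if "x \<in> B" "x n = hi n" for n x
      using \<sigma>[OF Bou[OF that(1)] Bm[OF that(1)], of "int_decode n"] that(2)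
      unfolding G_def Let_def hi_def by (simp add: less_imp_le)
  qed
  then obtain x where x: "x \<in> B" "\<And>n. G n x = 0" unfolding B_def by blast
  define y where "y k = x (int_encode k)" for k
  have z: "snell_defect h (y (ou k)) (y k) (y (inn k)) = 0" for k
  proof -
    have "\<sigma> k \<noteq> 0" using \<sigma>[OF Bou[OF x(1)] Bm[OF x(1)], of k] by auto
    then show ?thesis using x(2)[of "int_encode k"] by (simp add: G_def y_def)
  qed
  have "y k \<in> {\<alpha> (l (k div 2))..\<beta> (l (k div 2))}" for k using Bm[OF x(1), of k] by (simp add: y_def c_def)
  moreover have "snell_defect h (y (2 * j + 1)) (y (2 * j)) (y (2 * j - 1)) = 0" for j
    using z[of "2 * j"] by (simp add: ou_def inn_def)
  moreover have "snell_defect h (y (2 * j)) (y (2 * j + 1)) (y (2 * j + 2)) = 0" for j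
    using z[of "2 * j + 1"] by (simp add: ou_def inn_def add.commute)
  ultimately show ?thesis by blast
qed

end

section \<open>Continuity of the return relation\<close>

text \<open>Sequential continuity of a partial map given by its graph. The limit is required to lie
  in the domain, which need not be closed. Constant sequences show that such a relation is
  single-valued.\<close>

definition cont_rel :: "('a::metric_space \<times> 'b::metric_space) set \<Rightarrow> bool" where
  "cont_rel P \<longleftrightarrow> (\<forall>x y x0 y0. (\<forall>n. (x n, y n) \<in> P) \<longrightarrow> x \<longlonglongrightarrow> x0 \<longrightarrow> (x0, y0) \<in> P \<longrightarrow> y \<longlonglongrightarrow> y0)"

lemma cont_relD: "cont_rel P \<Longrightarrow> (\<And>n. (x n, y n) \<in> P) \<Longrightarrow> x \<longlonglongrightarrow> x0 \<Longrightarrow> (x0, y0) \<in> P \<Longrightarrow> y \<longlonglongrightarrow> y0"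
  unfolding cont_rel_def by blast

lemma cont_rel_unique:
  assumes "cont_rel P" "(x, y) \<in> P" "(x, y') \<in> P"
  shows "y = y'"
  using cont_relD[OF assms(1), of "\<lambda>_. x" "\<lambda>_. y" x y'] assms(2,3) by (simp add: LIMSEQ_const_iff)

lemma cont_rel_relcomp:
  assumes "cont_rel P" "cont_rel Q"
  shows "cont_rel (P O Q)"
  unfolding cont_rel_def
proof (intro allI impI)
  fix x z x0 z0 assume xz: "\<forall>n. (x n, z n) \<in> P O Q" and x: "x \<longlonglongrightarrow> x0" and xz0: "(x0, z0) \<in> P O Q"
  obtain y where y: "\<And>n. (x n, y n) \<in> P \<and> (y n, z n) \<in> Q" using xz unfolding relcomp_unfold by simp metis
  obtain y0 where y0: "(x0, y0) \<in> P" "(y0, z0) \<in> Q" using xz0 by blast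
  have "y \<longlonglongrightarrow> y0" using cont_relD[OF assms(1) _ x y0(1)] y by blast
  then show "z \<longlonglongrightarrow> z0" using cont_relD[OF assms(2) _ _ y0(2)] y by blast
qed

text \<open>If convergence failed, infinitely many terms would stay away from \<open>y0\<close>;
  among them one index recurs infinitely often, and compactness yields a cluster point, which by
  hypothesis is \<open>y0\<close> after all.\<close>

lemma cont_relI:
  fixes P :: "'i \<Rightarrow> ('a::metric_space \<times> 'b::metric_space) set"
  assumes I: "finite I" and K: "compact K" "\<And>i. i \<in> I \<Longrightarrow> Range (P i) \<subseteq> K"
    and cl: "\<And>i x y x0 y' y0. i \<in> I \<Longrightarrow> (\<And>n. (x n, y n) \<in> P i) \<Longrightarrow> x \<longlonglongrightarrow> x0 \<Longrightarrow> y \<longlonglongrightarrow> y' \<Longrightarrow>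
      (x0, y0) \<in> (\<Union>i\<in>I. P i) \<Longrightarrow> y' = y0"
  shows "cont_rel (\<Union>i\<in>I. P i)"
  unfolding cont_rel_def
proof (intro allI impI, rule ccontr)
  fix x y x0 y0 assume xy: "\<forall>n. (x n, y n) \<in> (\<Union>i\<in>I. P i)" and x: "x \<longlonglongrightarrow> x0" and xy0: "(x0, y0) \<in> (\<Union>i\<in>I. P i)"
    and n: "\<not> y \<longlonglongrightarrow> y0"
  obtain e where e: "e > 0" "\<And>N. \<exists>n\<ge>N. dist (y n) y0 \<ge> e" using n unfolding LIMSEQ_def by (auto simp: not_less)
  define A where "A = {n. dist (y n) y0 \<ge> e}"
  have "infinite A" unfolding A_def infinite_nat_iff_unbounded_le using e(2) by blast
  obtain i where i: "\<And>n. i n \<in> I \<and> (x n, y n) \<in> P (i n)" using xy by simp metis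
  have "finite (i ` A)" using I i by (metis finite_subset image_subsetI)
  then obtain n0 where n0: "n0 \<in> A" "infinite {n \<in> A. i n = i n0}"
    using pigeonhole_infinite[OF \<open>infinite A\<close>] by blast
  obtain r :: "nat \<Rightarrow> nat" where r: "strict_mono r" "\<And>n. r n \<in> {n \<in> A. i n = i n0}" using infinite_enumerate[OF n0(2)] by auto
  have yK: "\<forall>n. (y \<circ> r) n \<in> K"
  proof
    fix n
    have "(x (r n), y (r n)) \<in> P (i (r n))" using i by blast
    then have "y (r n) \<in> Range (P (i (r n)))" by (rule RangeI)
    then show "(y \<circ> r) n \<in> K" using K(2)[of "i (r n)"] i[of "r n"] by auto
  qed
  obtain y' r' where r': "strict_mono (r' :: nat \<Rightarrow> nat)" "((y \<circ> r) \<circ> r') \<longlonglongrightarrow> y'"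
    using seq_compactE[OF compact_imp_seq_compact[OF K(1)] yK] by metis
  have "(x \<circ> (r \<circ> r')) \<longlonglongrightarrow> x0" by (rule LIMSEQ_subseq_LIMSEQ[OF x strict_mono_o[OF r(1) r'(1)]])
  moreover have "(x (r (r' k)), y (r (r' k))) \<in> P (i n0)" for k using i[of "r (r' k)"] r(2)[of "r' k"] by simp
  ultimately have "y' = y0" using cl[of "i n0" "x \<circ> (r \<circ> r')" "(y \<circ> r) \<circ> r'"] i[of n0] r'(2) xy0 by simp
  then have "(\<lambda>k. dist (y (r (r' k))) y0) \<longlonglongrightarrow> 0"
    using tendsto_dist[OF r'(2) tendsto_const[of y0]] by (simp add: o_def)
  moreover have "e \<le> dist (y (r (r' k))) y0" for k using r(2)[of "r' k"] by (simp add: A_def)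
  ultimately have "e \<le> 0" by (intro LIMSEQ_le_const) auto
  then show False using e(1) by simp
qed

section \<open>Time reversal and regularized passages\<close>

lemma newton_solution_reverse:
  assumes "newton_solution f T z v"
  shows "newton_solution f T (\<lambda>s. z (T - s)) (\<lambda>s. - v (T - s))"
  unfolding newton_solution_def
proof (intro ballI conjI)
  fix s assume s: "s \<in> {0..T}"
  have im: "(\<lambda>s. T - s) ` {0..T} = {0..T}" by (simp add: image_diff_atLeastAtMost)
  have d: "((\<lambda>s. T - s) has_vector_derivative - 1) (at s within {0..T})" by (auto intro!: derivative_eq_intros)
  have "(z has_vector_derivative v (T - s)) (at (T - s) within (\<lambda>s. T - s) ` {0..T})"
    "(v has_vector_derivative f (z (T - s))) (at (T - s) within (\<lambda>s. T - s) ` {0..T})"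
    using assms s unfolding newton_solution_def im by auto
  from vector_diff_chain_within[OF d this(1)] vector_diff_chain_within[OF d this(2)]
  show "((\<lambda>s. z (T - s)) has_vector_derivative - v (T - s)) (at s within {0..T})"
    "((\<lambda>s. - v (T - s)) has_vector_derivative f (z (T - s))) (at s within {0..T})"
    by (auto simp: o_def intro: has_vector_derivative_minus[of "\<lambda>s. v (T - s)" "- f (z (T - s))", simplified])
qed

lemma lc_arc_reverse:
  assumes "lc_arc \<mu> H S w w'"
  shows "lc_arc \<mu> H S (\<lambda>\<tau>. w (S - \<tau>)) (\<lambda>\<tau>. - w' (S - \<tau>))"
  using assms newton_solution_reverse[of "\<lambda>u. (H / 2) *\<^sub>R u" S w w'] unfolding lc_arc_def by auto

context refraction_domain
begin

text \<open>The inner step in regularized variables, where a collision is an ordinary point;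
  \<open>u\<close> and \<open>u'\<close> stand for the refracted velocities at the ends.\<close>

definition kepler_passage ::
  "real \<Rightarrow> real \<Rightarrow> complex \<Rightarrow> real \<Rightarrow> complex \<Rightarrow> real \<Rightarrow> (real \<Rightarrow> complex) \<Rightarrow> (real \<Rightarrow> complex) \<Rightarrow> bool" where
  "kepler_passage h \<xi> u \<eta> u' S w w' \<longleftrightarrow> lc_arc \<mu> (\<E> + h) S w w' \<and> (w 0)\<^sup>2 = \<gamma> \<xi> \<and> 2 * w' 0 / cnj (w 0) = u \<and>
     (w S)\<^sup>2 = \<gamma> \<eta> \<and> 2 * w' S / cnj (w S) = u' \<and> (\<forall>\<tau>\<in>{0<..<S}. (w \<tau>)\<^sup>2 \<in> D)"

lemma inner_step_iff:
  assumes h: "h > 0" and \<xi>: "\<xi> \<in> {0..L}" "\<eta> \<in> {0..L}"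
  shows "inner_step h (\<xi>, v) (\<eta>, v') \<longleftrightarrow> (\<exists>S w w'. kepler_passage h \<xi> (refract h \<xi> v) \<eta> (refract h \<eta> v') S w w')"
proof
  have H: "\<E> + h > 0" using h \<E>_pos by simp
  {
    assume "inner_step h (\<xi>, v) (\<eta>, v')"
    then obtain T z u where T: "T > 0" and lc: "levi_civita_solution \<mu> (\<E> + h) T z u"
      and z: "z 0 = \<gamma> \<xi>" "u 0 = refract h \<xi> v" "\<And>s. s \<in> {0<..<T} \<Longrightarrow> z s \<in> D" "z T = \<gamma> \<eta>" "u T = refract h \<eta> v'"
      by (auto simp: inner_step_def)
    obtain S w w' where l: "lc_arc \<mu> (\<E> + h) S w w'" "T = lc_arc.sf w S"
      and zv: "\<And>\<tau>. \<tau> \<in> {0..S} \<Longrightarrow> z (lc_arc.sf w \<tau>) = (w \<tau>)\<^sup>2 \<and> (w \<tau> \<noteq> 0 \<longrightarrow> u (lc_arc.sf w \<tau>) = 2 * w' \<tau> / cnj (w \<tau>))"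
      using lc unfolding levi_civita_iff[OF \<mu>_pos H] by blast
    interpret lc_arc \<mu> "\<E> + h" S w w' by (rule l)
    have e: "(w 0)\<^sup>2 = \<gamma> \<xi>" "(w S)\<^sup>2 = \<gamma> \<eta>" using zv[of 0] zv[of S] S sf0 l(2) z by auto
    then have "w 0 \<noteq> 0" "w S \<noteq> 0" using curve_nonzero[OF \<xi>(1)] curve_nonzero[OF \<xi>(2)] by (metis zero_power2)+
    then have "2 * w' 0 / cnj (w 0) = refract h \<xi> v" "2 * w' S / cnj (w S) = refract h \<eta> v'"
      using zv[of 0] zv[of S] S sf0 l(2) z by auto
    moreover have "(w \<tau>)\<^sup>2 \<in> D" if t: "\<tau> \<in> {0<..<S}" for \<tau>
    proof -
      have "z (sf \<tau>) \<in> D" using z(3) sf_open[OF t] l(2) by blast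
      then show ?thesis using zv[of \<tau>] t by auto
    qed
    ultimately show "\<exists>S w w'. kepler_passage h \<xi> (refract h \<xi> v) \<eta> (refract h \<eta> v') S w w'"
      unfolding kepler_passage_def using e l(1) by blast
  }
  {
    assume "\<exists>S w w'. kepler_passage h \<xi> (refract h \<xi> v) \<eta> (refract h \<eta> v') S w w'"
    then obtain S w w' where k: "kepler_passage h \<xi> (refract h \<xi> v) \<eta> (refract h \<eta> v') S w w'" by blast
    then interpret lc_arc \<mu> "\<E> + h" S w w' by (simp add: kepler_passage_def)
    define z where "z s = (w (tau s))\<^sup>2" for s
    define u where "u s = 2 * w' (tau s) / cnj (w (tau s))" for s
    have zu: "z (sf \<tau>) = (w \<tau>)\<^sup>2" "u (sf \<tau>) = 2 * w' \<tau> / cnj (w \<tau>)" if "\<tau> \<in> {0..S}" for \<tau>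
      using tau_sf[OF that] by (simp_all add: z_def u_def)
    have "levi_civita_solution \<mu> (\<E> + h) (sf S) z u"
      unfolding levi_civita_iff[OF \<mu>_pos H] using zu lc_arc_axioms by blast
    moreover have "z s \<in> D" if s: "s \<in> {0<..<sf S}" for s
      using tau_open[OF s] k by (auto simp: kepler_passage_def z_def)
    moreover have "z 0 = \<gamma> \<xi>" "u 0 = refract h \<xi> v" "z (sf S) = \<gamma> \<eta>" "u (sf S) = refract h \<eta> v'"
      using zu[of 0] zu[of S] S k sf0 by (auto simp: kepler_passage_def)
    ultimately show "inner_step h (\<xi>, v) (\<eta>, v')" unfolding inner_step_def prod.case using sf_pos by blast
  }
qed

lemma kepler_passage_reverse:
  assumes "kepler_passage h \<xi> u \<eta> u' S w w'"
  shows "kepler_passage h \<eta> (- u') \<xi> (- u) S (\<lambda>\<tau>. w (S - \<tau>)) (\<lambda>\<tau>. - w' (S - \<tau>))"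
  using assms lc_arc_reverse[of \<mu> "\<E> + h" S w w'] unfolding kepler_passage_def by auto

lemma inner_arc_passage:
  assumes h: "h > 0" and u: "unique_arc (inner_arc h (\<gamma> \<xi>) (\<gamma> \<eta>))" and pq: "0 \<notin> closed_segment (\<gamma> \<xi>) (\<gamma> \<eta>)"
  shows "\<exists>S w w'. kepler_passage h \<xi> (kep_vel \<mu> (\<E> + h) (\<gamma> \<xi>) (\<gamma> \<eta>)) \<eta> (- kep_vel \<mu> (\<E> + h) (\<gamma> \<eta>) (\<gamma> \<xi>)) S w w'"
proof -
  obtain T z where i: "inner_arc h (\<gamma> \<xi>) (\<gamma> \<eta>) T z" using u by (auto simp: unique_arc_def)
  obtain v S w w' where v: "levi_civita_solution \<mu> (\<E> + h) T z v" and l: "lc_arc \<mu> (\<E> + h) S w w'" "T = lc_arc.sf w S"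
    and zv: "\<And>\<tau>. \<tau> \<in> {0..S} \<Longrightarrow> z (lc_arc.sf w \<tau>) = (w \<tau>)\<^sup>2 \<and> (w \<tau> \<noteq> 0 \<longrightarrow> v (lc_arc.sf w \<tau>) = 2 * w' \<tau> / cnj (w \<tau>))"
    and neg: "inner (w 0) (w S) < 0" and p: "(w 0)\<^sup>2 = \<gamma> \<xi>" "(w S)\<^sup>2 = \<gamma> \<eta>"
    using inner_arc_levi_civita[OF h i pq] by blast
  interpret lc_arc \<mu> "\<E> + h" S w w' by (rule l)
  have "(w \<tau>)\<^sup>2 \<in> D" if t: "\<tau> \<in> {0<..<S}" for \<tau>
  proof -
    have "z (sf \<tau>) \<in> D" using i sf_open[OF t] l(2) unfolding inner_arc_def by blast
    then show ?thesis using zv[of \<tau>] t by auto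
  qed
  then show ?thesis unfolding kepler_passage_def using l(1) p lc_endpoints(1,2)[OF neg, unfolded p] by blast
qed

lemma kepler_passage_energy:
  assumes "kepler_passage h \<xi> u \<eta> u' S w w'" "\<xi> \<in> {0..L}"
  shows "(norm u)\<^sup>2 / 2 = V\<^sub>I h (\<gamma> \<xi>)"
proof -
  interpret lc_arc \<mu> "\<E> + h" S w w' using assms by (simp add: kepler_passage_def)
  have w: "(w 0)\<^sup>2 = \<gamma> \<xi>" "u = 2 * w' 0 / cnj (w 0)" using assms by (auto simp: kepler_passage_def)
  have n: "norm (\<gamma> \<xi>) = (norm (w 0))\<^sup>2" by (simp add: w(1)[symmetric] norm_power)
  have "w 0 \<noteq> 0" using w(1) curve_nonzero[OF assms(2)] by auto
  then have "(norm u)\<^sup>2 / 2 = 2 * (norm (w' 0))\<^sup>2 / (norm (w 0))\<^sup>2"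
    by (simp add: w(2) norm_divide norm_mult power_divide power_mult_distrib)
  also have "\<dots> = \<E> + h + \<mu> / (norm (w 0))\<^sup>2"
    using energy[of 0] S \<open>w 0 \<noteq> 0\<close> by (simp add: field_simps)
  finally show ?thesis by (simp add: V\<^sub>I_def n)
qed

lemma V_less: "h > 0 \<Longrightarrow> V\<^sub>E z < V\<^sub>I h z"
proof -
  assume "h > 0"
  moreover have "\<omega>\<^sup>2 / 2 * (norm z)\<^sup>2 \<ge> 0" "\<mu> / norm z \<ge> 0" using \<mu>_pos by auto
  ultimately show ?thesis unfolding V\<^sub>E_def V\<^sub>I_def by linarith
qed

lemma refract_uminus: "refract h \<xi> (- v) = - refract h \<xi> v"
  unfolding refract_def Let_def by (simp add: sgn_minus)

end

section \<open>Refraction in the frame of tangent and normal\<close>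

context arc_interval
begin

lemma norm_decomp: "\<xi> \<in> {a<..<b} \<Longrightarrow> (norm v)\<^sup>2 = (inner v (tangent \<xi>))\<^sup>2 + (inner v (nrm \<xi>))\<^sup>2"
proof -
  assume x: "\<xi> \<in> {a<..<b}"
  have "inner v v = inner v (inner v (tangent \<xi>) *\<^sub>R tangent \<xi> + inner v (nrm \<xi>) *\<^sub>R nrm \<xi>)"
    using orth_decomp[OF x, of v] by simp
  then show ?thesis unfolding power2_norm_eq_inner by (simp add: inner_add_right power2_eq_square)
qed

lemma vector_eqI:
  assumes x: "\<xi> \<in> {a<..<b}" and t: "inner u (tangent \<xi>) = inner v (tangent \<xi>)"
    and n: "norm u = norm v" and s: "inner u (nrm \<xi>) > 0" "inner v (nrm \<xi>) \<ge> 0"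
  shows "u = v"
proof -
  have "(inner u (nrm \<xi>))\<^sup>2 = (inner v (nrm \<xi>))\<^sup>2"
    using norm_decomp[OF x, of u] norm_decomp[OF x, of v] t n by simp
  then have "inner u (nrm \<xi>) = inner v (nrm \<xi>)" using s by (simp add: power2_eq_iff_nonneg)
  then show ?thesis using orth_decomp[OF x, of u] orth_decomp[OF x, of v] t by simp
qed

lemma refract_components:
  assumes x: "\<xi> \<in> {a<..<b}"
  shows "inner (refract h \<xi> v) (tangent \<xi>) = inner v (tangent \<xi>)"
    and "inner (refract h \<xi> v) (nrm \<xi>) = sgn (inner v (nrm \<xi>)) * sqrt (2 * V\<^sub>I h (\<gamma> \<xi>) - (inner v (tangent \<xi>))\<^sup>2)"
proof -
  have "inner (tangent \<xi>) (tangent \<xi>) = 1" "inner (nrm \<xi>) (nrm \<xi>) = 1" "inner (tangent \<xi>) (nrm \<xi>) = 0"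
    "inner (nrm \<xi>) (tangent \<xi>) = 0"
    using norm_tangent[OF subset_L(2)[OF x]] norm_nrm[OF x] inner_nrm_tangent[of \<xi>]
    by (auto simp: power2_norm_eq_inner[symmetric] inner_commute)
  then show "inner (refract h \<xi> v) (tangent \<xi>) = inner v (tangent \<xi>)"
    "inner (refract h \<xi> v) (nrm \<xi>) = sgn (inner v (nrm \<xi>)) * sqrt (2 * V\<^sub>I h (\<gamma> \<xi>) - (inner v (tangent \<xi>))\<^sup>2)"
    unfolding refract_def Let_def outward_normal_eq[OF x] by (simp_all add: inner_add_left)
qed

lemma refract_radicand:
  assumes x: "\<xi> \<in> {a<..<b}" and h: "h > 0" and v: "(norm v)\<^sup>2 / 2 = V\<^sub>E (\<gamma> \<xi>)"
  shows "2 * V\<^sub>I h (\<gamma> \<xi>) - (inner v (tangent \<xi>))\<^sup>2 > 0"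
  using V_less[OF h, of "\<gamma> \<xi>"] norm_decomp[OF x, of v] v zero_le_power2[of "inner v (nrm \<xi>)"] by linarith

lemma refract_sgn:
  assumes x: "\<xi> \<in> {a<..<b}" and h: "h > 0" and v: "(norm v)\<^sup>2 / 2 = V\<^sub>E (\<gamma> \<xi>)"
  shows "sgn (inner (refract h \<xi> v) (nrm \<xi>)) = sgn (inner v (nrm \<xi>))"
  using refract_radicand[OF assms] by (simp add: refract_components[OF x] sgn_mult)

text \<open>Snell's law preserves the tangential component; the inner energy then fixes the size of
  the normal component, and the side of the boundary its sign.\<close>

lemma refract_eqI:
  assumes x: "\<xi> \<in> {a<..<b}" and u: "(norm u)\<^sup>2 / 2 = V\<^sub>I h (\<gamma> \<xi>)"
    and t: "inner u (tangent \<xi>) = inner v (tangent \<xi>)" and s: "sgn (inner u (nrm \<xi>)) = sgn (inner v (nrm \<xi>))"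
  shows "refract h \<xi> v = u"
proof -
  have "2 * V\<^sub>I h (\<gamma> \<xi>) - (inner v (tangent \<xi>))\<^sup>2 = (inner u (nrm \<xi>))\<^sup>2"
    using norm_decomp[OF x, of u] u t by simp
  then have "inner (refract h \<xi> v) (nrm \<xi>) = inner u (nrm \<xi>)"
    by (simp only: refract_components(2)[OF x] s[symmetric] real_sqrt_abs sgn_mult_abs)
  then show ?thesis
    using orth_decomp[OF x, of u] orth_decomp[OF x, of "refract h \<xi> v"] t by (simp add: refract_components(1)[OF x])
qed

end

text \<open>Both steps follow the same harmonic solution and stop when it first returns to the
  closure of \<open>D\<close>.\<close>

lemma (in refraction_domain) outer_step_unique:
  assumes 1: "outer_step (\<xi>, v) (\<xi>\<^sub>1, v\<^sub>1)" and 2: "outer_step (\<xi>, v) (\<xi>\<^sub>2, v\<^sub>2)"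
    and \<xi>: "\<xi>\<^sub>1 \<in> {0<..<L}" "\<xi>\<^sub>2 \<in> {0<..<L}"
  shows "(\<xi>\<^sub>1, v\<^sub>1) = (\<xi>\<^sub>2, v\<^sub>2)"
proof -
  obtain s\<^sub>1 z\<^sub>1 u\<^sub>1 where 1: "s\<^sub>1 > 0" "newton_solution harmonic_force s\<^sub>1 z\<^sub>1 u\<^sub>1" "z\<^sub>1 0 = \<gamma> \<xi>" "u\<^sub>1 0 = v"
    "\<And>s. s \<in> {0<..<s\<^sub>1} \<Longrightarrow> z\<^sub>1 s \<notin> closure D" "z\<^sub>1 s\<^sub>1 = \<gamma> \<xi>\<^sub>1" "u\<^sub>1 s\<^sub>1 = v\<^sub>1"
    using assms(1) by (auto simp: outer_step_def)
  obtain s\<^sub>2 z\<^sub>2 u\<^sub>2 where 2: "s\<^sub>2 > 0" "newton_solution harmonic_force s\<^sub>2 z\<^sub>2 u\<^sub>2" "z\<^sub>2 0 = \<gamma> \<xi>" "u\<^sub>2 0 = v"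
    "\<And>s. s \<in> {0<..<s\<^sub>2} \<Longrightarrow> z\<^sub>2 s \<notin> closure D" "z\<^sub>2 s\<^sub>2 = \<gamma> \<xi>\<^sub>2" "u\<^sub>2 s\<^sub>2 = v\<^sub>2"
    using assms(2) by (auto simp: outer_step_def)
  note e1 = newton_solution_harmonic[OF 1(2)[unfolded harmonic_force_def[abs_def]] \<omega>_pos, unfolded 1(3,4)]
  note e2 = newton_solution_harmonic[OF 2(2)[unfolded harmonic_force_def[abs_def]] \<omega>_pos, unfolded 2(3,4)]
  have c: "\<gamma> \<xi>\<^sub>1 \<in> closure D" "\<gamma> \<xi>\<^sub>2 \<in> closure D" using \<xi> curve_closure by auto
  have "\<not> s\<^sub>1 < s\<^sub>2"
  proof
    assume l: "s\<^sub>1 < s\<^sub>2"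
    have "z\<^sub>2 s\<^sub>1 = z\<^sub>1 s\<^sub>1" using e1(1)[of s\<^sub>1] e2(1)[of s\<^sub>1] l 1(1) by simp
    then show False using 2(5)[of s\<^sub>1] l 1(1,6) c by simp
  qed
  moreover have "\<not> s\<^sub>2 < s\<^sub>1"
  proof
    assume l: "s\<^sub>2 < s\<^sub>1"
    have "z\<^sub>1 s\<^sub>2 = z\<^sub>2 s\<^sub>2" using e1(1)[of s\<^sub>2] e2(1)[of s\<^sub>2] l 2(1) by simp
    then show False using 1(5)[of s\<^sub>2] l 2(1,6) c by simp
  qed
  ultimately have s: "s\<^sub>2 = s\<^sub>1" by simp
  have "z\<^sub>2 s\<^sub>1 = z\<^sub>1 s\<^sub>1" "u\<^sub>2 s\<^sub>1 = u\<^sub>1 s\<^sub>1" using e1[of s\<^sub>1] e2[of s\<^sub>1] s 1(1) by auto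
  then show ?thesis using 1(6,7) 2(6,7) s curve_inj[OF \<xi>] by simp
qed

lemma (in refraction_domain) outer_step_reverse:
  assumes "outer_step (\<xi>, v) (\<xi>\<^sub>1, v\<^sub>1)"
  shows "outer_step (\<xi>\<^sub>1, - v\<^sub>1) (\<xi>, - v)"
proof -
  obtain s\<^sub>1 z u where 1: "s\<^sub>1 > 0" "newton_solution harmonic_force s\<^sub>1 z u" "z 0 = \<gamma> \<xi>" "u 0 = v"
    "\<And>s. s \<in> {0<..<s\<^sub>1} \<Longrightarrow> z s \<notin> closure D" "z s\<^sub>1 = \<gamma> \<xi>\<^sub>1" "u s\<^sub>1 = v\<^sub>1"
    using assms by (auto simp: outer_step_def)
  have "newton_solution harmonic_force s\<^sub>1 (\<lambda>s. z (s\<^sub>1 - s)) (\<lambda>s. - u (s\<^sub>1 - s))" by (rule newton_solution_reverse[OF 1(2)])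
  moreover have "\<forall>s\<in>{0<..<s\<^sub>1}. z (s\<^sub>1 - s) \<notin> closure D" using 1(5) by auto
  ultimately show ?thesis unfolding outer_step_def prod.case using 1(1,3,4,6,7)
    by (intro exI[of _ s\<^sub>1] conjI exI[of _ "\<lambda>s. z (s\<^sub>1 - s)"] exI[of _ "\<lambda>s. - u (s\<^sub>1 - s)"]) auto
qed

definition flip :: "real \<times> complex \<Rightarrow> real \<times> complex" where "flip x = (fst x, - snd x)"

lemma flip_flip [simp]: "flip (flip x) = x" by (simp add: flip_def)

lemma fst_flip [simp]: "fst (flip x) = fst x" by (simp add: flip_def)

lemma tendsto_flip: "(f \<longlongrightarrow> l) F \<Longrightarrow> ((\<lambda>x. flip (f x)) \<longlongrightarrow> flip l) F"
  unfolding flip_def by (intro tendsto_intros)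

text \<open>When reversal of velocities maps the relation into its converse, backward continuity is
  forward continuity of the reversed sequences.\<close>

lemma cont_rel_flip:
  assumes c: "cont_rel P" and f: "\<And>x y. (x, y) \<in> P \<Longrightarrow> (flip y, flip x) \<in> P"
  shows "cont_rel (P\<inverse>)"
  unfolding cont_rel_def
proof (intro allI impI)
  fix y x y0 x0 assume yx: "\<forall>n. (y n, x n) \<in> P\<inverse>" and y: "y \<longlonglongrightarrow> y0" and yx0: "(y0, x0) \<in> P\<inverse>"
  have "(\<lambda>n. flip (x n)) \<longlonglongrightarrow> flip x0"
    by (rule cont_relD[OF c _ tendsto_flip[OF y]]) (use f yx yx0 in auto)
  from tendsto_flip[OF this] show "x \<longlonglongrightarrow> x0" by simp
qed

section \<open>Outer and inner halves of the return map\<close>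

context refraction_system
begin

lemma cell_unique: "r \<in> {1..m} \<Longrightarrow> s \<in> {1..m} \<Longrightarrow> \<xi> \<in> {\<alpha> r..\<beta> r} \<Longrightarrow> \<xi> \<in> {\<alpha> s..\<beta> s} \<Longrightarrow> r = s"
  using disjoint cell_subset[of r \<xi>] cell_subset[of s \<xi>] unfolding disjoint_family_on_def by blast

definition outer_pairs :: "nat \<Rightarrow> ((real \<times> complex) \<times> (real \<times> complex)) set" where
  "outer_pairs r = {(x, y). x \<in> \<Xi>_plus \<alpha> \<beta> r \<and> y \<in> \<Xi>_minus \<alpha> \<beta> r \<and> outer_step x y}"

definition inner_pairs :: "nat \<times> nat \<Rightarrow> ((real \<times> complex) \<times> (real \<times> complex)) set" where
  "inner_pairs = (\<lambda>(r, r'). {(x, y). x \<in> \<Xi>_minus \<alpha> \<beta> r \<and> y \<in> \<Xi>_plus \<alpha> \<beta> r' \<and> inner_step h x y})"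

lemma sectionD:
  "x \<in> \<Xi>_plus \<alpha> \<beta> r \<Longrightarrow> fst x \<in> {\<alpha> r..\<beta> r} \<and> (norm (snd x))\<^sup>2 / 2 = V\<^sub>E (\<gamma> (fst x)) \<and> inner (outward_normal (fst x)) (snd x) > 0"
  "x \<in> \<Xi>_minus \<alpha> \<beta> r \<Longrightarrow> fst x \<in> {\<alpha> r..\<beta> r} \<and> (norm (snd x))\<^sup>2 / 2 = V\<^sub>E (\<gamma> (fst x)) \<and> inner (outward_normal (fst x)) (snd x) < 0"
  by (auto simp: \<Xi>_plus_def \<Xi>_minus_def)

lemma flip_section: "flip x \<in> \<Xi>_plus \<alpha> \<beta> r \<longleftrightarrow> x \<in> \<Xi>_minus \<alpha> \<beta> r" "flip x \<in> \<Xi>_minus \<alpha> \<beta> r \<longleftrightarrow> x \<in> \<Xi>_plus \<alpha> \<beta> r"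
  by (auto simp: \<Xi>_plus_def \<Xi>_minus_def flip_def case_prod_beta)

text \<open>The halves can be composed without recording the cell of the intermediate point: the
  cells are disjoint, so the outer and the inner half name the same one.\<close>

lemma return_rel_eq:
  "return_rel m a b \<alpha> \<beta> h = (\<Union>r\<in>{1..m}. outer_pairs r) O (\<Union>p\<in>Sigma {1..m} (NA m a b). inner_pairs p)"
proof (rule set_eqI, safe)
  fix x y assume "(x, y) \<in> return_rel m a b \<alpha> \<beta> h"
  then show "(x, y) \<in> (\<Union>r\<in>{1..m}. outer_pairs r) O (\<Union>p\<in>Sigma {1..m} (NA m a b). inner_pairs p)"
    unfolding return_rel_def outer_pairs_def inner_pairs_def by blast
next
  fix x y x\<^sub>1 r r\<^sub>1 r' assume r: "r \<in> {1..m}" and o: "(x, x\<^sub>1) \<in> outer_pairs r"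
    and r1: "r\<^sub>1 \<in> {1..m}" "r' \<in> NA m a b r\<^sub>1" and i: "(x\<^sub>1, y) \<in> inner_pairs (r\<^sub>1, r')"
  have x: "x\<^sub>1 \<in> \<Xi>_minus \<alpha> \<beta> r" "x\<^sub>1 \<in> \<Xi>_minus \<alpha> \<beta> r\<^sub>1" using o i by (auto simp: outer_pairs_def inner_pairs_def)
  then have "r\<^sub>1 = r" using cell_unique[OF r1(1) r] sectionD(2) by blast
  then show "(x, y) \<in> return_rel m a b \<alpha> \<beta> h"
    using o i r r1 unfolding return_rel_def outer_pairs_def inner_pairs_def by blast
qed

text \<open>An outer step is an outer arc, so both end velocities are functions of the two
  positions; the final one is read off from the reversed arc.\<close>

lemma outer_pairs_formula:
  assumes r: "r \<in> {1..m}" and xy: "((\<xi>, v), (\<eta>, v')) \<in> outer_pairs r"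
  shows "v = \<omega> *\<^sub>R lob_vec \<rho> (\<gamma> \<xi>) (\<gamma> \<eta>)" "v' = - (\<omega> *\<^sub>R lob_vec \<rho> (\<gamma> \<eta>) (\<gamma> \<xi>))"
proof -
  interpret A: arc_interval \<omega> \<mu> \<E> D \<gamma> L "a r" "b r" by (rule arc[OF r])
  have x: "\<xi> \<in> {\<alpha> r..\<beta> r}" "(norm v)\<^sup>2 / 2 = V\<^sub>E (\<gamma> \<xi>)" "\<eta> \<in> {\<alpha> r..\<beta> r}"
    using xy sectionD by (auto simp: outer_pairs_def \<Xi>_plus_def \<Xi>_minus_def)
  note c = cell_subset[OF r x(1)] cell_subset[OF r x(3)]
  obtain s z u where s: "s > 0" "newton_solution harmonic_force s z u" "z 0 = \<gamma> \<xi>" "u 0 = v"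
    "\<And>t. t \<in> {0<..<s} \<Longrightarrow> z t \<notin> closure D" "z s = \<gamma> \<eta>" "u s = v'"
    using xy by (auto simp: outer_pairs_def outer_step_def)
  note e = newton_solution_harmonic[OF s(2)[unfolded harmonic_force_def[abs_def]] \<omega>_pos, unfolded s(3,4)]
  define w where "w = v /\<^sub>R \<omega>"
  have hk: "hooke_arc D \<rho> (\<gamma> \<xi>) (\<gamma> \<eta>) (\<omega> * s) w"
    unfolding hooke_arc_def
  proof (intro conjI ballI)
    show "0 < \<omega> * s" using s(1) \<omega>_pos by simp
    have "(norm v)\<^sup>2 = \<omega>\<^sup>2 * (\<rho> - (norm (\<gamma> \<xi>))\<^sup>2)" using x(2) unfolding V\<^sub>E_rho by (simp add: field_simps)
    then show "(norm w)\<^sup>2 = \<rho> - (norm (\<gamma> \<xi>))\<^sup>2" using \<omega>_pos by (simp add: w_def power_mult_distrib power_inverse field_simps)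
    show "cos (\<omega> * s) *\<^sub>R \<gamma> \<xi> + sin (\<omega> * s) *\<^sub>R w = \<gamma> \<eta>" using e(1)[of s] s by (simp add: w_def)
    fix \<phi> assume p: "\<phi> \<in> {0<..<\<omega> * s}"
    then have "\<phi> / \<omega> \<in> {0<..<s}" using \<omega>_pos by (simp add: field_simps)
    then have "z (\<phi> / \<omega>) \<notin> closure D" "\<phi> / \<omega> \<in> {0..s}" using s(5) by auto
    moreover have "z (\<phi> / \<omega>) = cos \<phi> *\<^sub>R \<gamma> \<xi> + sin \<phi> *\<^sub>R w"
      using e(1)[OF calculation(2)] \<omega>_pos by (simp add: w_def)
    ultimately show "cos \<phi> *\<^sub>R \<gamma> \<xi> + sin \<phi> *\<^sub>R w \<notin> D" using subsetD[OF closure_subset] by metis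
  qed
  have vw: "v = \<omega> *\<^sub>R w" using \<omega>_pos by (simp add: w_def)
  then show "v = \<omega> *\<^sub>R lob_vec \<rho> (\<gamma> \<xi>) (\<gamma> \<eta>)" unfolding A.lob_hooke(1)[OF c hk] .
  have "sin (\<omega> * s) *\<^sub>R \<gamma> \<xi> - cos (\<omega> * s) *\<^sub>R w = lob_vec \<rho> (\<gamma> \<eta>) (\<gamma> \<xi>)"
    by (rule A.lob_hooke(1)[OF c(2,1) hooke_arc_reverse[OF hk]])
  moreover have "v' = - (\<omega> *\<^sub>R (sin (\<omega> * s) *\<^sub>R \<gamma> \<xi> - cos (\<omega> * s) *\<^sub>R w))"
    using e(2)[of s] s(1,7) by (simp add: w_def[symmetric] flip: scaleR_minus_right)
  ultimately show "v' = - (\<omega> *\<^sub>R lob_vec \<rho> (\<gamma> \<eta>) (\<gamma> \<xi>))" by simp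
qed

lemma outer_pairsI:
  assumes r: "r \<in> {1..m}" and \<xi>: "\<xi> \<in> {\<alpha> r..\<beta> r}" "\<eta> \<in> {\<alpha> r..\<beta> r}"
  shows "((\<xi>, \<omega> *\<^sub>R lob_vec \<rho> (\<gamma> \<xi>) (\<gamma> \<eta>)), (\<eta>, - (\<omega> *\<^sub>R lob_vec \<rho> (\<gamma> \<eta>) (\<gamma> \<xi>)))) \<in> outer_pairs r"
proof -
  interpret A: arc_interval \<omega> \<mu> \<E> D \<gamma> L "a r" "b r" by (rule arc[OF r])
  note c = cell_subset[OF r \<xi>(1)] cell_subset[OF r \<xi>(2)]
  define p q \<theta> w where "p = \<gamma> \<xi>" and "q = \<gamma> \<eta>" and "\<theta> = arccos (lob_cos \<rho> p q)" and "w = lob_vec \<rho> p q"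
  have hk: "hooke_arc D \<rho> p q \<theta> w" using A.lob_arc(1)[OF c] by (simp add: p_def q_def \<theta>_def w_def)
  have en: "(norm (\<omega> *\<^sub>R lob_vec \<rho> (\<gamma> x) (\<gamma> y)))\<^sup>2 / 2 = V\<^sub>E (\<gamma> x)"
    "inner (outward_normal x) (\<omega> *\<^sub>R lob_vec \<rho> (\<gamma> x) (\<gamma> y)) > 0" if "x \<in> {a r<..<b r}" "y \<in> {a r<..<b r}" for x y
  proof -
    have "(norm (lob_vec \<rho> (\<gamma> x) (\<gamma> y)))\<^sup>2 = \<rho> - (norm (\<gamma> x))\<^sup>2" using A.lob_arc(1)[OF that] by (simp add: hooke_arc_def)
    then show "(norm (\<omega> *\<^sub>R lob_vec \<rho> (\<gamma> x) (\<gamma> y)))\<^sup>2 / 2 = V\<^sub>E (\<gamma> x)" by (simp add: V\<^sub>E_rho power_mult_distrib)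
    show "inner (outward_normal x) (\<omega> *\<^sub>R lob_vec \<rho> (\<gamma> x) (\<gamma> y)) > 0"
      using A.lob_vec_out[OF that] \<omega>_pos unfolding A.outward_normal_eq[OF that(1)] by simp
  qed
  have "outer_step (\<xi>, \<omega> *\<^sub>R w) (\<eta>, - (\<omega> *\<^sub>R lob_vec \<rho> q p))"
    unfolding outer_step_def prod.case
  proof (intro exI conjI)
    define z u where "z s = cos (\<omega> * s) *\<^sub>R p + sin (\<omega> * s) *\<^sub>R w" and
      "u s = \<omega> *\<^sub>R (cos (\<omega> * s) *\<^sub>R w - sin (\<omega> * s) *\<^sub>R p)" for s
    show "0 < \<theta> / \<omega>" using hk \<omega>_pos by (simp add: hooke_arc_def)
    show "newton_solution harmonic_force (\<theta> / \<omega>) z u"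
      unfolding z_def[abs_def] u_def[abs_def] harmonic_force_def[abs_def] by (rule harmonic_newton_solution)
    show "z 0 = \<gamma> \<xi>" "u 0 = \<omega> *\<^sub>R w" by (simp_all add: z_def u_def p_def)
    show "z (\<theta> / \<omega>) = \<gamma> \<eta>" using hk \<omega>_pos by (simp add: z_def hooke_arc_def q_def)
    have "sin \<theta> *\<^sub>R p - cos \<theta> *\<^sub>R w = lob_vec \<rho> q p"
      using A.lob_hooke(1)[OF c(2,1)] hooke_arc_reverse[OF hk] by (simp add: p_def q_def)
    then have "cos \<theta> *\<^sub>R w - sin \<theta> *\<^sub>R p = - lob_vec \<rho> q p" by (metis minus_diff_eq)
    then show "u (\<theta> / \<omega>) = - (\<omega> *\<^sub>R lob_vec \<rho> q p)" using \<omega>_pos by (simp add: u_def)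
    show "\<forall>s\<in>{0<..<\<theta> / \<omega>}. z s \<notin> closure D"
    proof
      fix s assume "s \<in> {0<..<\<theta> / \<omega>}"
      then have "0 < \<omega> * s" "\<omega> * s < \<theta>" using \<omega>_pos by (auto simp: field_simps)
      then obtain \<zeta> k where "\<zeta> \<in> {a r<..<b r}" "k > 1" "z s = k *\<^sub>R \<gamma> \<zeta>"
        using A.lob_arc(6)[OF c, of "\<omega> * s"] unfolding z_def p_def q_def \<theta>_def w_def by blast
      then show "z s \<notin> closure D" using A.beyond_notin_closure by simp
    qed
  qed
  moreover have "(norm (- (\<omega> *\<^sub>R lob_vec \<rho> (\<gamma> \<eta>) (\<gamma> \<xi>))))\<^sup>2 / 2 = V\<^sub>E (\<gamma> \<eta>)"
    "inner (outward_normal \<eta>) (- (\<omega> *\<^sub>R lob_vec \<rho> (\<gamma> \<eta>) (\<gamma> \<xi>))) < 0"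
    using en[OF c(2,1)] by simp_all
  ultimately show ?thesis using en[OF c] \<xi> unfolding outer_pairs_def \<Xi>_plus_def \<Xi>_minus_def
    by (simp add: p_def q_def w_def)
qed

lemma compact_phase: "compact ({0..L} \<times> cball (0 :: complex) (sqrt (2 * \<E>)))"
  by (intro compact_Times compact_cball compact_Icc)

lemma phase_bound:
  assumes "(norm v)\<^sup>2 / 2 = V\<^sub>E z"
  shows "v \<in> cball 0 (sqrt (2 * \<E>))"
proof -
  have "0 \<le> \<omega>\<^sup>2 / 2 * (norm z)\<^sup>2" by simp
  then have "(norm v)\<^sup>2 \<le> 2 * \<E>" using assms unfolding V\<^sub>E_def by linarith
  then have "norm v \<le> sqrt (2 * \<E>)" by (rule real_le_rsqrt)
  then show ?thesis by simp
qed

lemma tendsto_cell: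
  assumes "\<And>n. f n \<in> {\<alpha> r..\<beta> r}" "f \<longlonglongrightarrow> l"
  shows "l \<in> {\<alpha> r..\<beta> r}"
  using closed_sequentially[OF closed_atLeastAtMost] assms by blast

lemma tendsto_lob_vec:
  assumes r: "r \<in> {1..m}" and x: "\<And>n. x n \<in> {\<alpha> r..\<beta> r}" "x \<longlonglongrightarrow> x0" and y: "\<And>n. y n \<in> {\<alpha> r..\<beta> r}" "y \<longlonglongrightarrow> y0"
  shows "(\<lambda>n. lob_vec \<rho> (\<gamma> (x n)) (\<gamma> (y n))) \<longlonglongrightarrow> lob_vec \<rho> (\<gamma> x0) (\<gamma> y0)"
proof -
  interpret A: arc_interval \<omega> \<mu> \<E> D \<gamma> L "a r" "b r" by (rule arc[OF r])
  define S where "S = {\<alpha> r..\<beta> r} \<times> {\<alpha> r..\<beta> r}"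
  have g: "continuous_on S (\<lambda>u. \<gamma> (fst u))" "continuous_on S (\<lambda>u. \<gamma> (snd u))"
    by (rule continuous_on_compose2[OF continuous_on_cell(1)[OF r]]; auto simp: S_def intro!: continuous_intros)+
  have "continuous_on S (\<lambda>u. lob_vec \<rho> (\<gamma> (fst u)) (\<gamma> (snd u)))"
  proof (rule continuous_on_lob_vec[OF g rho_pos])
    fix u assume "u \<in> S"
    then have "fst u \<in> {a r<..<b r}" "snd u \<in> {a r<..<b r}" using cell_subset[OF r] by (auto simp: S_def)
    then show "- 1 < lob_cos \<rho> (\<gamma> (fst u)) (\<gamma> (snd u)) \<and> lob_cos \<rho> (\<gamma> (fst u)) (\<gamma> (snd u)) < 1"
      using A.lob_arc(2,3) by blast
  qed
  from continuous_on_tendsto_compose[OF this tendsto_Pair[OF x(2) y(2)]]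
  show ?thesis using x(1) y(1) tendsto_cell[OF x] tendsto_cell[OF y] by (simp add: S_def)
qed

text \<open>By \<open>outer_pairs_formula\<close> the velocities depend continuously on the end
  positions, so a limit of outer steps in one cell is again an outer step, and
  \<open>outer_step_unique\<close> identifies it.\<close>

lemma outer_pairs_cont: "cont_rel (\<Union>r\<in>{1..m}. outer_pairs r)"
proof (rule cont_relI[OF _ compact_phase])
  show "Range (outer_pairs r) \<subseteq> {0..L} \<times> cball 0 (sqrt (2 * \<E>))" if r: "r \<in> {1..m}" for r
  proof
    fix y assume "y \<in> Range (outer_pairs r)"
    then have y: "y \<in> \<Xi>_minus \<alpha> \<beta> r" by (auto simp: outer_pairs_def)
    have "fst y \<in> {0..L}" "snd y \<in> cball 0 (sqrt (2 * \<E>))"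
      using sectionD(2)[OF y] cell_L(2)[OF r] phase_bound by blast+
    then show "y \<in> {0..L} \<times> cball 0 (sqrt (2 * \<E>))" unfolding mem_Times_iff by blast
  qed
  fix r x y x0 y' y0
  assume r: "r \<in> {1..m}" and xy: "\<And>n. (x n, y n) \<in> outer_pairs r" and x: "x \<longlonglongrightarrow> x0" and y: "y \<longlonglongrightarrow> y'"
    and xy0: "(x0, y0) \<in> (\<Union>r\<in>{1..m}. outer_pairs r)"
  then obtain s where s: "s \<in> {1..m}" "(x0, y0) \<in> outer_pairs s" by blast
  have c: "fst (x n) \<in> {\<alpha> r..\<beta> r}" "fst (y n) \<in> {\<alpha> r..\<beta> r}" for n
    using xy[of n] sectionD by (auto simp: outer_pairs_def)
  note l = tendsto_fst[OF x] tendsto_fst[OF y]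
  have c0: "fst x0 \<in> {\<alpha> r..\<beta> r}" "fst y' \<in> {\<alpha> r..\<beta> r}" using tendsto_cell[OF c(1) l(1)] tendsto_cell[OF c(2) l(2)] by auto
  have c1: "fst x0 \<in> {\<alpha> s..\<beta> s}" "fst y0 \<in> {\<alpha> s..\<beta> s}" using s(2) sectionD by (auto simp: outer_pairs_def)
  have f: "snd (x n) = \<omega> *\<^sub>R lob_vec \<rho> (\<gamma> (fst (x n))) (\<gamma> (fst (y n)))"
    "snd (y n) = - (\<omega> *\<^sub>R lob_vec \<rho> (\<gamma> (fst (y n))) (\<gamma> (fst (x n))))" for n
    by (rule outer_pairs_formula[OF r, of "fst (x n)" "snd (x n)" "fst (y n)" "snd (y n)"]; simp add: xy)+
  have fl: "(\<lambda>n. snd (x n)) \<longlonglongrightarrow> \<omega> *\<^sub>R lob_vec \<rho> (\<gamma> (fst x0)) (\<gamma> (fst y'))"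
    "(\<lambda>n. snd (y n)) \<longlonglongrightarrow> - (\<omega> *\<^sub>R lob_vec \<rho> (\<gamma> (fst y')) (\<gamma> (fst x0)))"
    unfolding f by (intro tendsto_intros tendsto_lob_vec[OF r] c l)+
  have "snd x0 = \<omega> *\<^sub>R lob_vec \<rho> (\<gamma> (fst x0)) (\<gamma> (fst y'))"
    by (rule LIMSEQ_unique[OF tendsto_snd[OF x] fl(1)])
  moreover have "snd y' = - (\<omega> *\<^sub>R lob_vec \<rho> (\<gamma> (fst y')) (\<gamma> (fst x0)))"
    by (rule LIMSEQ_unique[OF tendsto_snd[OF y] fl(2)])
  ultimately have "(x0, y') \<in> outer_pairs r" using outer_pairsI[OF r c0] by (metis prod.collapse)
  then have "outer_step (fst x0, snd x0) (fst y', snd y')" "outer_step (fst x0, snd x0) (fst y0, snd y0)"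
    using s(2) by (simp_all add: outer_pairs_def)
  from outer_step_unique[OF this] show "y' = y0" using cell_L(1)[OF r c0(2)] cell_L(1)[OF s(1) c1(2)] by simp
qed simp

lemma outer_pairs_flip:
  assumes "(x, y) \<in> (\<Union>r\<in>{1..m}. outer_pairs r)"
  shows "(flip y, flip x) \<in> (\<Union>r\<in>{1..m}. outer_pairs r)"
proof -
  obtain r where r: "r \<in> {1..m}" "(x, y) \<in> outer_pairs r" using assms by blast
  then have "outer_step (fst x, snd x) (fst y, snd y)" by (simp add: outer_pairs_def)
  from outer_step_reverse[OF this] have "outer_step (flip y) (flip x)" by (simp add: flip_def)
  then have "(flip y, flip x) \<in> outer_pairs r" using r(2) flip_section by (simp add: outer_pairs_def)
  then show ?thesis using r(1) by blast
qed

lemma inner_pairs_flip: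
  assumes "(x, y) \<in> (\<Union>p\<in>Sigma {1..m} (NA m a b). inner_pairs p)"
  shows "(flip y, flip x) \<in> (\<Union>p\<in>Sigma {1..m} (NA m a b). inner_pairs p)"
proof -
  obtain r r' where r: "r \<in> {1..m}" "r' \<in> NA m a b r" "(x, y) \<in> inner_pairs (r, r')" using assms by blast
  have r': "r' \<in> {1..m}" "r \<in> NA m a b r'" using NA_mem[OF r(2)] NA_commute[OF r(1,2)] by auto
  have s: "x \<in> \<Xi>_minus \<alpha> \<beta> r" "y \<in> \<Xi>_plus \<alpha> \<beta> r'" "inner_step h (fst x, snd x) (fst y, snd y)" using r(3) by (auto simp: inner_pairs_def)
  have L: "fst x \<in> {0..L}" "fst y \<in> {0..L}" using cell_L(2)[OF r(1)] cell_L(2)[OF r'(1)] sectionD s(1,2) by blast+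
  obtain S w w' where "kepler_passage h (fst x) (refract h (fst x) (snd x)) (fst y) (refract h (fst y) (snd y)) S w w'"
    using s(3) unfolding inner_step_iff[OF h_pos L] by blast
  from kepler_passage_reverse[OF this]
  have "inner_step h (flip y) (flip x)" unfolding flip_def inner_step_iff[OF h_pos L(2,1)] refract_uminus by blast
  then have "(flip y, flip x) \<in> inner_pairs (r', r)" using s(1,2) flip_section by (simp add: inner_pairs_def)
  then show ?thesis using r' by blast
qed

end

section \<open>Limits of inner passages\<close>

definition hyp :: "real \<Rightarrow> complex \<Rightarrow> complex \<Rightarrow> real \<Rightarrow> complex" where
  "hyp \<kappa> A B \<tau> = cosh (\<kappa> * \<tau>) *\<^sub>R A + sinh (\<kappa> * \<tau>) *\<^sub>R B"

lemma tendsto_hyp: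
  assumes "(A \<longlongrightarrow> A0) F" "(B \<longlongrightarrow> B0) F" "(t \<longlongrightarrow> t0) F"
  shows "((\<lambda>n. hyp \<kappa> (A n) (B n) (t n)) \<longlongrightarrow> hyp \<kappa> A0 B0 t0) F"
  unfolding hyp_def by (intro tendsto_intros assms)

lemma hyp_minus: "hyp \<kappa> (- A) (- B) \<tau> = - hyp \<kappa> A B \<tau>"
  by (simp add: hyp_def)

lemma hyp_0 [simp]: "hyp \<kappa> A B 0 = A"
  by (simp add: hyp_def)

lemma hyp_derivative: "((\<lambda>s. hyp \<kappa> A B (c + s)) has_vector_derivative \<kappa> *\<^sub>R hyp \<kappa> B A (c + s)) (at s within X)"
  unfolding hyp_def by (auto intro!: derivative_eq_intros simp: algebra_simps)

text \<open>\<open>A + B\<close> is the amplitude of the exponentially growing mode. If its limit is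
  nonzero, bounded end values force bounded times.\<close>

lemma hyp_time_bound:
  fixes S :: "nat \<Rightarrow> real"
  assumes \<kappa>: "\<kappa> > 0" and A: "A \<longlonglongrightarrow> A0" and B: "B \<longlonglongrightarrow> B0" and nz: "A0 + B0 \<noteq> 0"
    and S: "\<And>n. S n \<ge> 0" and M: "\<And>n. norm (hyp \<kappa> (A n) (B n) (S n)) \<le> M"
  shows "bounded (range S)"
proof -
  have key: "\<kappa> * S n * norm (A n + B n) \<le> 2 * M + norm (A n - B n)" for n
  proof -
    define e where "e = exp (\<kappa> * S n)"
    define f where "f = exp (- (\<kappa> * S n))"
    have f: "0 < f" "f \<le> 1" using \<kappa> S[of n] by (auto simp: f_def)
    have e: "e \<ge> \<kappa> * S n" using exp_ge_add_one_self[of "\<kappa> * S n"] unfolding e_def by linarith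
    have "hyp \<kappa> (A n) (B n) (S n) = (e / 2) *\<^sub>R (A n + B n) + (f / 2) *\<^sub>R (A n - B n)"
      by (simp add: hyp_def cosh_field_def sinh_field_def e_def f_def scaleR_conv_of_real field_simps)
    then have "(e / 2) *\<^sub>R (A n + B n) = hyp \<kappa> (A n) (B n) (S n) - (f / 2) *\<^sub>R (A n - B n)" by simp
    then have "norm ((e / 2) *\<^sub>R (A n + B n)) \<le> norm (hyp \<kappa> (A n) (B n) (S n)) + norm ((f / 2) *\<^sub>R (A n - B n))"
      using norm_triangle_ineq4 by metis
    also have "\<dots> \<le> M + (f / 2) * norm (A n - B n)" using M[of n] f by simp
    also have "\<dots> \<le> M + (1 / 2) * norm (A n - B n)" using f by (intro add_left_mono mult_right_mono) auto
    finally have "e * norm (A n + B n) \<le> 2 * M + norm (A n - B n)" by (simp add: e_def)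
    moreover have "\<kappa> * S n * norm (A n + B n) \<le> e * norm (A n + B n)" using e by (rule mult_right_mono) simp
    ultimately show ?thesis by linarith
  qed
  define g where "g n = (2 * M + norm (A n - B n)) / (\<kappa> * norm (A n + B n))" for n
  have "g \<longlonglongrightarrow> (2 * M + norm (A0 - B0)) / (\<kappa> * norm (A0 + B0))"
    unfolding g_def using nz \<kappa> by (intro tendsto_intros A B) auto
  then have bg: "Bseq g" using convergentI convergent_imp_Bseq by blast
  have "(\<lambda>n. norm (A n + B n)) \<longlonglongrightarrow> norm (A0 + B0)" by (intro tendsto_intros A B)
  then have "\<forall>\<^sub>F n in sequentially. norm (A n + B n) > 0" by (rule order_tendstoD(1)) (use nz in simp)
  then have "\<forall>\<^sub>F n in sequentially. norm (S n) \<le> norm (g n)"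
  proof eventually_elim
    fix n assume n: "norm (A n + B n) > 0"
    have "S n \<le> g n" unfolding g_def using key[of n] n \<kappa> by (subst pos_le_divide_eq) (simp_all add: mult_ac)
    then show "norm (S n) \<le> norm (g n)" using S[of n] by simp
  qed
  then have "Bseq S" using bg by (rule Bseq_eventually_mono)
  then show ?thesis by (simp add: Bseq_eq_bounded)
qed

text \<open>|w - w0| |w + w0| = |w^2 - w0^2|, and the condition on the angle keeps |w + w0| at least
  |w0|.\<close>

lemma sqrt_branch_tendsto:
  fixes w :: "nat \<Rightarrow> complex"
  assumes l: "(\<lambda>n. (w n)\<^sup>2) \<longlonglongrightarrow> w0\<^sup>2" and i: "\<And>n. inner (w n) w0 \<ge> 0" and w0: "w0 \<noteq> 0"
  shows "w \<longlonglongrightarrow> w0"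
proof -
  have b: "norm (w n - w0) \<le> norm ((w n)\<^sup>2 - w0\<^sup>2) / norm w0" for n
  proof -
    have "(norm (w n + w0))\<^sup>2 = (norm (w n))\<^sup>2 + (norm w0)\<^sup>2 + 2 * inner (w n) w0"
      unfolding power2_norm_eq_inner by (simp add: inner_add_left inner_add_right inner_commute)
    then have "(norm w0)\<^sup>2 \<le> (norm (w n + w0))\<^sup>2" using i[of n] zero_le_power2[of "norm (w n)"] by linarith
    then have "norm w0 \<le> norm (w n + w0)" by (rule power2_le_imp_le) simp
    then have "norm (w n - w0) * norm w0 \<le> norm (w n - w0) * norm (w n + w0)" by (rule mult_left_mono) simp
    also have "\<dots> = norm ((w n)\<^sup>2 - w0\<^sup>2)" unfolding norm_mult[symmetric] by (simp add: power2_eq_square algebra_simps)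
    finally show ?thesis using w0 by (simp add: pos_le_divide_eq)
  qed
  have "(\<lambda>n. norm ((w n)\<^sup>2 - w0\<^sup>2) / norm w0) \<longlonglongrightarrow> norm (w0\<^sup>2 - w0\<^sup>2) / norm w0"
    using w0 by (intro tendsto_intros l) simp
  then have "(\<lambda>n. norm ((w n)\<^sup>2 - w0\<^sup>2) / norm w0) \<longlonglongrightarrow> 0" by simp
  then have "(\<lambda>n. w n - w0) \<longlonglongrightarrow> 0" by (rule Lim_null_comparison[rotated]) (simp add: b)
  then show ?thesis by (simp add: LIM_zero_iff)
qed

context refraction_domain
begin

text \<open>A passage expressed by its initial data: \<open>A\<close> is a square root of the entry
  point and \<open>B\<close> is determined by the entry velocity. The flow \<open>hyp\<close> is
  defined for all times, so passages of different durations can be compared and continued past their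
  ends.\<close>

definition free_passage :: "real \<Rightarrow> real \<Rightarrow> real \<Rightarrow> complex \<Rightarrow> real \<Rightarrow> complex \<Rightarrow> real \<Rightarrow> complex \<Rightarrow> complex \<Rightarrow> bool" where
  "free_passage h \<kappa> \<xi> u \<eta> u' S A B \<longleftrightarrow> S > 0 \<and> A\<^sup>2 = \<gamma> \<xi> \<and> B = u * cnj A / complex_of_real (2 * \<kappa>) \<and>
     (hyp \<kappa> A B S)\<^sup>2 = \<gamma> \<eta> \<and> 2 * (\<kappa> *\<^sub>R hyp \<kappa> B A S) / cnj (hyp \<kappa> A B S) = u' \<and>
     (\<forall>\<tau>\<in>{0<..<S}. (hyp \<kappa> A B \<tau>)\<^sup>2 \<in> D) \<and> (norm B)\<^sup>2 - (norm A)\<^sup>2 = \<mu> / (\<E> + h)"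

lemma free_passageD:
  assumes "free_passage h \<kappa> \<xi> u \<eta> u' S A B"
  shows "S > 0" "A\<^sup>2 = \<gamma> \<xi>" "B = u * cnj A / complex_of_real (2 * \<kappa>)" "(hyp \<kappa> A B S)\<^sup>2 = \<gamma> \<eta>"
    "2 * (\<kappa> *\<^sub>R hyp \<kappa> B A S) / cnj (hyp \<kappa> A B S) = u'"
    "\<And>\<tau>. 0 < \<tau> \<Longrightarrow> \<tau> < S \<Longrightarrow> (hyp \<kappa> A B \<tau>)\<^sup>2 \<in> D" "(norm B)\<^sup>2 - (norm A)\<^sup>2 = \<mu> / (\<E> + h)"
proof -
  note c = assms[unfolded free_passage_def]
  show "S > 0" by (rule conjunct1[OF c])
  note c = conjunct2[OF c]
  show "A\<^sup>2 = \<gamma> \<xi>" by (rule conjunct1[OF c])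
  note c = conjunct2[OF c]
  show "B = u * cnj A / complex_of_real (2 * \<kappa>)" by (rule conjunct1[OF c])
  note c = conjunct2[OF c]
  show "(hyp \<kappa> A B S)\<^sup>2 = \<gamma> \<eta>" by (rule conjunct1[OF c])
  note c = conjunct2[OF c]
  show "2 * (\<kappa> *\<^sub>R hyp \<kappa> B A S) / cnj (hyp \<kappa> A B S) = u'" by (rule conjunct1[OF c])
  note c = conjunct2[OF c]
  show "(norm B)\<^sup>2 - (norm A)\<^sup>2 = \<mu> / (\<E> + h)" by (rule conjunct2[OF c])
  have "\<forall>\<tau>\<in>{0<..<S}. (hyp \<kappa> A B \<tau>)\<^sup>2 \<in> D" by (rule conjunct1[OF c])
  then show "\<And>\<tau>. 0 < \<tau> \<Longrightarrow> \<tau> < S \<Longrightarrow> (hyp \<kappa> A B \<tau>)\<^sup>2 \<in> D" by simp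
qed

lemma free_passage_minus:
  assumes "free_passage h \<kappa> \<xi> u \<eta> u' S A B"
  shows "free_passage h \<kappa> \<xi> u \<eta> u' S (- A) (- B)"
proof -
  note d = free_passageD[OF assms]
  have "- B = u * cnj (- A) / complex_of_real (2 * \<kappa>)" by (subst d(3)) simp
  moreover have "2 * (\<kappa> *\<^sub>R hyp \<kappa> (- B) (- A) S) / cnj (hyp \<kappa> (- A) (- B) S) = u'"
    unfolding hyp_minus using d(5) by simp
  ultimately show ?thesis
    using d(1,2,4,6,7) unfolding free_passage_def hyp_minus by simp
qed

text \<open>The sign of the square root is free; it is taken on the side of a reference vector
  \<open>A0\<close>, which makes the roots along a sequence converge by
  \<open>sqrt_branch_tendsto\<close>.\<close>

lemma kepler_passage_free:
  assumes k: "kepler_passage h \<xi> u \<eta> u' S w w'" and \<kappa>: "\<kappa> = sqrt ((\<E> + h) / 2)" and \<xi>: "\<xi> \<in> {0..L}"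
  shows "\<exists>A B. free_passage h \<kappa> \<xi> u \<eta> u' S A B \<and> inner A A0 \<ge> 0"
proof -
  interpret lc_arc \<mu> "\<E> + h" S w w' using k by (simp add: kepler_passage_def)
  have kp: "\<kappa> > 0" "\<kappa>\<^sup>2 = (\<E> + h) / 2" using H by (auto simp: \<kappa>)
  define A B where "A = w 0" and "B = w' 0 /\<^sub>R \<kappa>"
  have e: "w \<tau> = hyp \<kappa> A B \<tau>" "w' \<tau> = \<kappa> *\<^sub>R hyp \<kappa> B A \<tau>" if "\<tau> \<in> {0..S}" for \<tau>
    using lc_explicit[OF sol H that \<kappa>] by (auto simp: hyp_def A_def B_def add.commute)
  have A0: "A \<noteq> 0" using k curve_nonzero[OF \<xi>] by (auto simp: kepler_passage_def A_def)
  have "B = u * cnj A / complex_of_real (2 * \<kappa>)"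
  proof -
    have "u = 2 * w' 0 / cnj A" using k by (simp add: kepler_passage_def A_def)
    then show ?thesis using A0 kp(1) by (simp add: B_def scaleR_conv_of_real field_simps)
  qed
  moreover have "(norm B)\<^sup>2 - (norm A)\<^sup>2 = \<mu> / (\<E> + h)"
  proof -
    have "w' 0 = \<kappa> *\<^sub>R B" using kp by (simp add: B_def)
    then have "2 * (\<kappa>\<^sup>2 * (norm B)\<^sup>2) - (\<E> + h) * (norm A)\<^sup>2 = \<mu>" using energy[of 0] S by (simp add: A_def power_mult_distrib)
    then have "(\<E> + h) * ((norm B)\<^sup>2 - (norm A)\<^sup>2) = \<mu>" unfolding kp(2) by (simp add: algebra_simps)
    then show ?thesis using H by (simp add: field_simps)
  qed
  ultimately have f: "free_passage h \<kappa> \<xi> u \<eta> u' S A B"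
    unfolding free_passage_def
  proof (intro conjI ballI)
    have SS: "S \<in> {0..S}" using S by simp
    show "(hyp \<kappa> A B S)\<^sup>2 = \<gamma> \<eta>" using k unfolding e(1)[OF SS, symmetric] kepler_passage_def by blast
    show "2 * (\<kappa> *\<^sub>R hyp \<kappa> B A S) / cnj (hyp \<kappa> A B S) = u'"
      using k unfolding e(1)[OF SS, symmetric] e(2)[OF SS, symmetric] kepler_passage_def by blast
    fix \<tau> assume t: "\<tau> \<in> {0<..<S}"
    then have "\<tau> \<in> {0..S}" by simp
    then show "(hyp \<kappa> A B \<tau>)\<^sup>2 \<in> D" using k t unfolding e(1)[OF \<open>\<tau> \<in> {0..S}\<close>, symmetric] kepler_passage_def by blast
  qed (use S k in \<open>simp_all add: A_def kepler_passage_def\<close>)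
  show ?thesis
  proof (cases "inner A A0 \<ge> 0")
    case True
    then show ?thesis using f by blast
  next
    case False
    then have "inner (- A) A0 \<ge> 0" by simp
    then show ?thesis using free_passage_minus[OF f] by blast
  qed
qed

end

context refraction_system
begin

lemma tendsto_cell_maps:
  assumes r: "r \<in> {1..m}" and x: "\<And>n. x n \<in> {\<alpha> r..\<beta> r}" "x \<longlonglongrightarrow> x0"
  shows "(\<lambda>n. \<gamma> (x n)) \<longlonglongrightarrow> \<gamma> x0" "(\<lambda>n. tangent (x n)) \<longlonglongrightarrow> tangent x0"
    "(\<lambda>n. outward_normal (x n)) \<longlonglongrightarrow> outward_normal x0"
proof -
  interpret A: arc_interval \<omega> \<mu> \<E> D \<gamma> L "a r" "b r" by (rule arc[OF r])
  note x0 = tendsto_cell[OF x]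
  show "(\<lambda>n. \<gamma> (x n)) \<longlonglongrightarrow> \<gamma> x0"
    by (rule continuous_on_tendsto_compose[OF continuous_on_cell(1)[OF r] x(2) x0]) (use x(1) in simp)
  show t: "(\<lambda>n. tangent (x n)) \<longlonglongrightarrow> tangent x0"
    by (rule continuous_on_tendsto_compose[OF continuous_on_cell(2)[OF r] x(2) x0]) (use x(1) in simp)
  have "(\<lambda>n. A.nrm (x n)) \<longlonglongrightarrow> A.nrm x0" unfolding A.nrm_def by (intro tendsto_intros t)
  then show "(\<lambda>n. outward_normal (x n)) \<longlonglongrightarrow> outward_normal x0"
    using A.outward_normal_eq cell_subset[OF r x(1)] cell_subset[OF r x0] by simp
qed

text \<open>Nearby passages cannot end before or after the limiting one: an earlier end would be an interior
  point, a later one is excluded because the limiting passage leaves \<open>D\<close> transversally, and the passage times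
  do not shrink to zero because entry and exit velocities point to opposite sides of the boundary.\<close>
lemma passage_cluster:
  assumes r: "r \<in> {1..m}" "r' \<in> {1..m}" "s' \<in> {1..m}"
    and p: "\<And>n. kepler_passage h (\<xi> n) (u n) (\<eta> n) (u' n) (S n) (w n) (w' n)"
    and p0: "kepler_passage h \<xi>0 u0 \<eta>0 u0' S0 w0 w0'"
    and \<xi>: "\<And>n. \<xi> n \<in> {\<alpha> r..\<beta> r}" "\<xi> \<longlonglongrightarrow> \<xi>0" and \<eta>: "\<And>n. \<eta> n \<in> {\<alpha> r'..\<beta> r'}" "\<eta> \<longlonglongrightarrow> \<eta>'"
    and \<eta>0: "\<eta>0 \<in> {\<alpha> s'..\<beta> s'}" and u: "u \<longlonglongrightarrow> u0"
    and neg: "inner (outward_normal \<xi>0) u0 < 0" and pos: "\<And>n. inner (outward_normal (\<eta> n)) (u' n) > 0"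
    and pos0: "inner (outward_normal \<eta>0) u0' > 0"
  shows "\<eta>' = \<eta>0 \<and> (\<exists>\<phi>. strict_mono (\<phi> :: nat \<Rightarrow> nat) \<and> (u' \<circ> \<phi>) \<longlonglongrightarrow> u0')"
proof -
  define \<kappa> where "\<kappa> = sqrt ((\<E> + h) / 2)"
  have H: "\<E> + h > 0" using h_pos \<E>_pos by simp
  have \<kappa>: "\<kappa> > 0" using H by (simp add: \<kappa>_def)
  have \<xi>0: "\<xi>0 \<in> {\<alpha> r..\<beta> r}" by (rule tendsto_cell[OF \<xi>])
  have \<eta>': "\<eta>' \<in> {\<alpha> r'..\<beta> r'}" by (rule tendsto_cell[OF \<eta>])
  obtain A0 B0 where f0: "free_passage h \<kappa> \<xi>0 u0 \<eta>0 u0' S0 A0 B0"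
    using kepler_passage_free[OF p0 \<kappa>_def cell_L(2)[OF r(1) \<xi>0], of 0] by blast
  have "\<forall>n. \<exists>A B. free_passage h \<kappa> (\<xi> n) (u n) (\<eta> n) (u' n) (S n) A B \<and> inner A A0 \<ge> 0"
    using kepler_passage_free[OF p \<kappa>_def cell_L(2)[OF r(1) \<xi>(1)]] by blast
  then obtain A B where f: "\<And>n. free_passage h \<kappa> (\<xi> n) (u n) (\<eta> n) (u' n) (S n) (A n) (B n)" "\<And>n. inner (A n) A0 \<ge> 0"
    by metis
  have nz: "\<gamma> \<xi>0 \<noteq> 0" "\<gamma> \<eta>' \<noteq> 0" using curve_nonzero cell_L(2)[OF r(1) \<xi>0] cell_L(2)[OF r(2) \<eta>'] by auto
  have A0: "A0\<^sup>2 = \<gamma> \<xi>0" "A0 \<noteq> 0" using free_passageD(2)[OF f0] nz by auto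
  have "(\<lambda>n. (A n)\<^sup>2) \<longlonglongrightarrow> A0\<^sup>2"
    using tendsto_cell_maps(1)[OF r(1) \<xi>] unfolding free_passageD(2)[OF f(1)] A0(1) .
  then have A: "A \<longlonglongrightarrow> A0" by (rule sqrt_branch_tendsto[OF _ f(2) A0(2)])
  have Beq: "B n = u n * cnj (A n) / complex_of_real (2 * \<kappa>)" for n by (rule free_passageD(3)[OF f(1)])
  have B0: "B0 = u0 * cnj A0 / complex_of_real (2 * \<kappa>)" by (rule free_passageD(3)[OF f0])
  have B: "B \<longlonglongrightarrow> B0" unfolding Beq[abs_def] by (subst B0, intro tendsto_intros u A) (use \<kappa> in simp)
  have S: "S n > 0" for n by (rule free_passageD(1)[OF f(1)])
  have "bounded (range S)"
  proof (rule hyp_time_bound[OF \<kappa> A B])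
    \<comment> \<open>Vanishing would make \<open>A0\<close> and \<open>B0\<close> equal in norm,
      whereas the energy relation separates their squared norms by a positive amount.\<close>
    show "A0 + B0 \<noteq> 0"
    proof
      assume "A0 + B0 = 0"
      then have "B0 = - A0" by (simp add: add_eq_0_iff)
      then have "\<mu> / (\<E> + h) = 0" using free_passageD(7)[OF f0] by simp
      then show False using H \<mu>_pos by simp
    qed
    show "S n \<ge> 0" for n using S[of n] by simp
    \<comment> \<open>If this norm is \<open>x\<close>, then \<open>x ^ 4\<close> is the squared
      norm of a boundary point, hence below \<open>\<rho>\<close>; for \<open>x \<ge> 1\<close> this
      bounds \<open>x\<close> itself.\<close>
    show "norm (hyp \<kappa> (A n) (B n) (S n)) \<le> \<rho> + 1" for n
    proof (rule ccontr)
      define x where "x = norm (hyp \<kappa> (A n) (B n) (S n))"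
      assume "\<not> norm (hyp \<kappa> (A n) (B n) (S n)) \<le> \<rho> + 1"
      then have x: "x > \<rho> + 1" by (simp add: x_def)
      then have "x \<ge> 1" using rho_pos by linarith
      then have "x ^ 1 \<le> x ^ 4" by (intro power_increasing) auto
      moreover have "x\<^sup>2 = norm (\<gamma> (\<eta> n))" unfolding x_def norm_power[symmetric] free_passageD(4)[OF f(1)] ..
      moreover have "x ^ 4 = (x\<^sup>2)\<^sup>2" by simp
      ultimately have "x ^ 4 = (norm (\<gamma> (\<eta> n)))\<^sup>2" "x ^ 1 \<le> x ^ 4" by simp_all
      moreover have "(norm (\<gamma> (\<eta> n)))\<^sup>2 < \<rho>" by (rule closure_norm[OF curve_closure[OF cell_L(2)[OF r(2) \<eta>(1)]]])
      ultimately show False using x by simp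
    qed
  qed
  then obtain K where K: "\<And>n. \<bar>S n\<bar> \<le> K" unfolding bounded_iff by auto
  have "\<forall>n. S n \<in> {0..K}" using K S by (auto intro: less_imp_le order_trans[OF abs_ge_self])
  then obtain S' \<phi> where S': "S' \<in> {0..K}" and \<phi>: "strict_mono (\<phi> :: nat \<Rightarrow> nat)" and lS: "(S \<circ> \<phi>) \<longlonglongrightarrow> S'"
    using seq_compactE[OF compact_imp_seq_compact[OF compact_Icc]] by metis
  note lA = LIMSEQ_subseq_LIMSEQ[OF A \<phi>] and lB = LIMSEQ_subseq_LIMSEQ[OF B \<phi>] and l\<eta> = LIMSEQ_subseq_LIMSEQ[OF \<eta>(2) \<phi>]
  have \<eta>\<phi>: "(\<eta> \<circ> \<phi>) n \<in> {\<alpha> r'..\<beta> r'}" for n using \<eta>(1) by simp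
  define P where "P = hyp \<kappa> A0 B0"
  have lP: "(\<lambda>n. hyp \<kappa> ((A \<circ> \<phi>) n) ((B \<circ> \<phi>) n) ((S \<circ> \<phi>) n)) \<longlonglongrightarrow> P S'"
    unfolding P_def by (rule tendsto_hyp[OF lA lB lS])
  have "(\<lambda>n. (hyp \<kappa> ((A \<circ> \<phi>) n) ((B \<circ> \<phi>) n) ((S \<circ> \<phi>) n))\<^sup>2) \<longlonglongrightarrow> \<gamma> \<eta>'"
    using tendsto_cell_maps(1)[OF r(2) \<eta>\<phi> l\<eta>] unfolding o_def free_passageD(4)[OF f(1)] .
  then have P: "(P S')\<^sup>2 = \<gamma> \<eta>'" using LIMSEQ_unique[OF tendsto_power[OF lP, of 2]] by blast
  have P0: "P S' \<noteq> 0" using P nz(2) by auto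
  have "(\<lambda>n. 2 * (\<kappa> *\<^sub>R hyp \<kappa> ((B \<circ> \<phi>) n) ((A \<circ> \<phi>) n) ((S \<circ> \<phi>) n)) / cnj (hyp \<kappa> ((A \<circ> \<phi>) n) ((B \<circ> \<phi>) n) ((S \<circ> \<phi>) n)))
      \<longlonglongrightarrow> 2 * (\<kappa> *\<^sub>R hyp \<kappa> B0 A0 S') / cnj (P S')"
    using P0 by (intro tendsto_intros lP tendsto_hyp lA lB lS) simp
  then have lu: "(u' \<circ> \<phi>) \<longlonglongrightarrow> 2 * (\<kappa> *\<^sub>R hyp \<kappa> B0 A0 S') / cnj (P S')"
    unfolding o_def free_passageD(5)[OF f(1)] .
  consider "S' = 0" | "0 < S'" "S' < S0" | "S0 < S'" | "S' = S0" 
  proof -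
    have "S' = 0 \<or> (0 < S' \<and> S' < S0) \<or> S0 < S' \<or> S' = S0" using S' unfolding atLeastAtMost_iff by linarith
    then show thesis using that by blast
  qed
  then have "S' = S0"
  proof cases
    case 1
    then have "\<gamma> \<eta>' = \<gamma> \<xi>0" using P A0 by (simp add: P_def)
    then have e: "\<eta>' = \<xi>0" using curve_inj[OF cell_L(1)[OF r(2) \<eta>'] cell_L(1)[OF r(1) \<xi>0]] by simp
    have "2 * (\<kappa> *\<^sub>R B0) / cnj A0 = u0"
      by (subst B0) (use A0(2) \<kappa> in \<open>simp add: scaleR_conv_of_real field_simps\<close>)
    then have "2 * (\<kappa> *\<^sub>R hyp \<kappa> B0 A0 S') / cnj (P S') = u0" using 1 by (simp add: P_def)
    then have "(\<lambda>n. inner (outward_normal ((\<eta> \<circ> \<phi>) n)) ((u' \<circ> \<phi>) n)) \<longlonglongrightarrow> inner (outward_normal \<xi>0) u0"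
      using tendsto_inner[OF tendsto_cell_maps(3)[OF r(2) \<eta>\<phi> l\<eta>] lu] e by simp
    then have "inner (outward_normal \<xi>0) u0 \<ge> 0"
      by (rule LIMSEQ_le_const) (use pos in \<open>auto intro: less_imp_le\<close>)
    then show ?thesis using neg by simp
  next
    case 2
    then have "(P S')\<^sup>2 \<in> D" using free_passageD(6)[OF f0] by (simp add: P_def)
    then show ?thesis using P curve_notin[OF cell_L(2)[OF r(2) \<eta>']] by simp
  next
    case 3
    interpret A: arc_interval \<omega> \<mu> \<E> D \<gamma> L "a s'" "b s'" by (rule arc[OF r(3)])
    note c = cell_subset[OF r(3) \<eta>0]
    have PS: "(P S0)\<^sup>2 = \<gamma> \<eta>0" "u0' = 2 * (\<kappa> *\<^sub>R hyp \<kappa> B0 A0 S0) / cnj (P S0)" "S0 > 0"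
      using free_passageD(1,4)[OF f0] free_passageD(5)[OF f0] by (simp_all add: P_def)
    then have PS0: "P S0 \<noteq> 0" using curve_nonzero[OF cell_L(2)[OF r(3) \<eta>0]] by auto
    define X where "X = \<kappa> *\<^sub>R hyp \<kappa> B0 A0 S0"
    have dP: "((\<lambda>s. P (S0 + s)) has_vector_derivative X) (at_right 0)"
      using hyp_derivative[of \<kappa> A0 B0 S0 0] by (simp add: P_def X_def)
    \<comment> \<open>Regularized time multiplies the physical velocity by the positive factor
      |w|^2, so the direction needed for \<open>crossing\<close> is that of
      \<open>u0'\<close>.\<close>
    have "((\<lambda>s. P (S0 + s) * P (S0 + s)) has_vector_derivative (P S0 * X + X * P S0)) (at_right 0)"
      using has_vector_derivative_mult[OF dP dP] by simp
    moreover have "P S0 * X + X * P S0 = (norm (P S0))\<^sup>2 *\<^sub>R u0'"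
    proof -
      have "(norm (P S0))\<^sup>2 *\<^sub>R u0' = (P S0 * cnj (P S0)) * (2 * X / cnj (P S0))"
        unfolding PS(2) X_def scaleR_conv_of_real complex_norm_square ..
      then show ?thesis using PS0 by simp
    qed
    ultimately have dv: "((\<lambda>s. (P (S0 + s))\<^sup>2) has_vector_derivative (norm (P S0))\<^sup>2 *\<^sub>R u0') (at_right 0)"
      by (simp add: power2_eq_square)
    have "inner (A.nrm \<eta>0) ((norm (P S0))\<^sup>2 *\<^sub>R u0') > 0"
      using pos0 PS0 unfolding A.outward_normal_eq[OF c] by simp
    then have g: "A.sg * wedge ((norm (P S0))\<^sup>2 *\<^sub>R u0') (tangent \<eta>0) > 0" unfolding A.inner_nrm .
    have "(P (S0 + 0))\<^sup>2 = \<gamma> \<eta>0" using PS(1) by simp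
    from A.crossing(1)[OF c dv this g] have "\<forall>\<^sub>F s in at_right 0. (P (S0 + s))\<^sup>2 \<notin> closure D" .
    moreover have "\<forall>\<^sub>F s in at_right 0. s \<in> {0<..<S' - S0}"
      using 3 by (intro eventually_at_right_real) simp
    ultimately have "\<forall>\<^sub>F s in at_right 0. (P (S0 + s))\<^sup>2 \<notin> closure D \<and> s \<in> {0<..<S' - S0}"
      by (rule eventually_conj)
    then obtain s where s: "(P (S0 + s))\<^sup>2 \<notin> closure D" "s \<in> {0<..<S' - S0}"
      using eventually_happens'[OF trivial_limit_at_right_real] by blast
    have "\<forall>\<^sub>F n in sequentially. S0 + s < (S \<circ> \<phi>) n" by (rule order_tendstoD(1)[OF lS]) (use s in simp)
    then have "\<forall>\<^sub>F n in sequentially. (hyp \<kappa> ((A \<circ> \<phi>) n) ((B \<circ> \<phi>) n) (S0 + s))\<^sup>2 \<in> closure D"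
    proof eventually_elim
      fix n assume n: "S0 + s < (S \<circ> \<phi>) n"
      have "0 < S0 + s" "S0 + s < S (\<phi> n)" using n s PS(3) by auto
      then have "(hyp \<kappa> (A (\<phi> n)) (B (\<phi> n)) (S0 + s))\<^sup>2 \<in> D" by (rule free_passageD(6)[OF f(1)])
      then show "(hyp \<kappa> ((A \<circ> \<phi>) n) ((B \<circ> \<phi>) n) (S0 + s))\<^sup>2 \<in> closure D" using closure_subset by (auto simp: subset_iff)
    qed
    moreover have "(\<lambda>n. (hyp \<kappa> ((A \<circ> \<phi>) n) ((B \<circ> \<phi>) n) (S0 + s))\<^sup>2) \<longlonglongrightarrow> (P (S0 + s))\<^sup>2"
      unfolding P_def by (intro tendsto_intros tendsto_hyp lA lB)
    ultimately have "(P (S0 + s))\<^sup>2 \<in> closure D"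
      by (intro Lim_in_closed_set[OF closed_closure _ sequentially_bot])
    then show ?thesis using s(1) by blast
  qed
  then have "\<gamma> \<eta>' = \<gamma> \<eta>0" "2 * (\<kappa> *\<^sub>R hyp \<kappa> B0 A0 S') / cnj (P S') = u0'" 
    using P free_passageD(4,5)[OF f0] by (simp_all add: P_def)
  then show ?thesis using curve_inj[OF cell_L(1)[OF r(2) \<eta>'] cell_L(1)[OF r(3) \<eta>0]] lu \<phi> by auto
qed

text \<open>The factor \<open>sgn\<close> in refraction is the constant -1 for incoming velocities,
  so its jump is never met.\<close>

lemma tendsto_refract:
  assumes r: "r \<in> {1..m}" and x: "\<And>n. x n \<in> {\<alpha> r..\<beta> r}" "x \<longlonglongrightarrow> x0" and v: "v \<longlonglongrightarrow> v0"
    and neg: "\<And>n. inner (outward_normal (x n)) (v n) < 0" "inner (outward_normal x0) v0 < 0"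
  shows "(\<lambda>n. refract h (x n) (v n)) \<longlonglongrightarrow> refract h x0 v0"
proof -
  note t = tendsto_cell_maps[OF r x]
  have nz: "norm (\<gamma> x0) \<noteq> 0" using curve_nonzero[OF cell_L(2)[OF r tendsto_cell[OF x]]] by simp
  have s: "sgn (inner (v n) (outward_normal (x n))) = - 1" "sgn (inner v0 (outward_normal x0)) = - 1" for n
    using neg(1)[of n] neg(2) by (simp_all add: inner_commute)
  show ?thesis unfolding refract_def Let_def s V\<^sub>I_def
    using nz by (intro tendsto_intros t v)
qed

lemma inner_pairs_cont: "cont_rel (\<Union>p\<in>Sigma {1..m} (NA m a b). inner_pairs p)"
proof (rule cont_relI[OF _ compact_phase])
  show "finite (Sigma {1..m} (NA m a b))" by (intro finite_SigmaI) (auto simp: NA_def)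
  show "Range (inner_pairs p) \<subseteq> {0..L} \<times> cball 0 (sqrt (2 * \<E>))" if p: "p \<in> Sigma {1..m} (NA m a b)" for p
  proof
    fix y assume "y \<in> Range (inner_pairs p)"
    then have y: "y \<in> \<Xi>_plus \<alpha> \<beta> (snd p)" by (cases p) (auto simp: inner_pairs_def)
    have r: "snd p \<in> {1..m}" using p NA_mem by auto
    have "fst y \<in> {0..L}" "snd y \<in> cball 0 (sqrt (2 * \<E>))"
      using sectionD(1)[OF y] cell_L(2)[OF r] phase_bound by blast+
    then show "y \<in> {0..L} \<times> cball 0 (sqrt (2 * \<E>))" unfolding mem_Times_iff by blast
  qed
  fix p x y x0 y' y0
  assume p: "p \<in> Sigma {1..m} (NA m a b)" and xy: "\<And>n. (x n, y n) \<in> inner_pairs p" and x: "x \<longlonglongrightarrow> x0" and y: "y \<longlonglongrightarrow> y'"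
    and xy0: "(x0, y0) \<in> (\<Union>p\<in>Sigma {1..m} (NA m a b). inner_pairs p)"
  obtain r r' where pr: "p = (r, r')" and r: "r \<in> {1..m}" "r' \<in> {1..m}" using p NA_mem by auto
  obtain s s' where s: "s \<in> {1..m}" "s' \<in> {1..m}" and xy0: "(x0, y0) \<in> inner_pairs (s, s')"
    using xy0 NA_mem by blast
  have sx: "x n \<in> \<Xi>_minus \<alpha> \<beta> r" and sy: "y n \<in> \<Xi>_plus \<alpha> \<beta> r'" and st: "inner_step h (fst (x n), snd (x n)) (fst (y n), snd (y n))" for n
    using xy[of n] by (auto simp: inner_pairs_def pr)
  have sx0: "x0 \<in> \<Xi>_minus \<alpha> \<beta> s" and sy0: "y0 \<in> \<Xi>_plus \<alpha> \<beta> s'" and st0: "inner_step h (fst x0, snd x0) (fst y0, snd y0)"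
    using xy0 by (auto simp: inner_pairs_def)
  have cx: "fst (x n) \<in> {\<alpha> r..\<beta> r}" "fst (y n) \<in> {\<alpha> r'..\<beta> r'}" for n using sectionD sx sy by blast+
  have cx0: "fst x0 \<in> {\<alpha> s..\<beta> s}" "fst y0 \<in> {\<alpha> s'..\<beta> s'}" using sectionD sx0 sy0 by blast+
  note l = tendsto_fst[OF x] tendsto_fst[OF y] tendsto_snd[OF x] tendsto_snd[OF y]
  have "r = s" using cell_unique[OF r(1) s(1) tendsto_cell[OF cx(1) l(1)] cx0(1)] .
  interpret A: arc_interval \<omega> \<mu> \<E> D \<gamma> L "a r" "b r" by (rule arc[OF r(1)])
  interpret B: arc_interval \<omega> \<mu> \<E> D \<gamma> L "a r'" "b r'" by (rule arc[OF r(2)])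
  interpret C: arc_interval \<omega> \<mu> \<E> D \<gamma> L "a s'" "b s'" by (rule arc[OF s(2)])
  have "\<forall>n. \<exists>S w w'. kepler_passage h (fst (x n)) (refract h (fst (x n)) (snd (x n))) (fst (y n)) (refract h (fst (y n)) (snd (y n))) S w w'"
    using st inner_step_iff[OF h_pos cell_L(2)[OF r(1) cx(1)] cell_L(2)[OF r(2) cx(2)]] by blast
  then obtain S w w' where k: "\<And>n. kepler_passage h (fst (x n)) (refract h (fst (x n)) (snd (x n))) (fst (y n)) (refract h (fst (y n)) (snd (y n))) (S n) (w n) (w' n)"
    by metis
  obtain S0 w0 w0' where k0: "kepler_passage h (fst x0) (refract h (fst x0) (snd x0)) (fst y0) (refract h (fst y0) (snd y0)) S0 w0 w0'"
    using st0 inner_step_iff[OF h_pos cell_L(2)[OF s(1) cx0(1)] cell_L(2)[OF s(2) cx0(2)]] by blast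
  have neg: "inner (outward_normal (fst x0)) (refract h (fst x0) (snd x0)) < 0"
  proof -
    have c: "fst x0 \<in> {a r<..<b r}" using cell_subset[OF s(1) cx0(1)] \<open>r = s\<close> by simp
    show ?thesis using A.refract_sgn[OF c h_pos, of "snd x0"] sectionD(2)[OF sx0] unfolding A.outward_normal_eq[OF c]
      by (simp add: inner_commute sgn_if split: if_splits)
  qed
  have pos: "inner (outward_normal (fst (y n))) (refract h (fst (y n)) (snd (y n))) > 0" for n
    using B.refract_sgn[OF cell_subset[OF r(2) cx(2)] h_pos, of "snd (y n)" n] sectionD(1)[OF sy[of n]]
    unfolding B.outward_normal_eq[OF cell_subset[OF r(2) cx(2)]]
    by (simp add: inner_commute sgn_if split: if_splits)
  have pos0: "inner (outward_normal (fst y0)) (refract h (fst y0) (snd y0)) > 0"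
    using C.refract_sgn[OF cell_subset[OF s(2) cx0(2)] h_pos, of "snd y0"] sectionD(1)[OF sy0]
    unfolding C.outward_normal_eq[OF cell_subset[OF s(2) cx0(2)]]
    by (simp add: inner_commute sgn_if split: if_splits)
  have lr: "(\<lambda>n. refract h (fst (x n)) (snd (x n))) \<longlonglongrightarrow> refract h (fst x0) (snd x0)"
    by (rule tendsto_refract[OF r(1) cx(1) l(1) l(3)]) (use sectionD(2) sx sx0 in blast)+
  obtain \<phi> where e: "fst y' = fst y0" and \<phi>: "strict_mono (\<phi> :: nat \<Rightarrow> nat)"
    and lu: "((\<lambda>n. refract h (fst (y n)) (snd (y n))) \<circ> \<phi>) \<longlonglongrightarrow> refract h (fst y0) (snd y0)"
    using passage_cluster[OF r(1) r(2) s(2) k k0 cx(1) l(1) cx(2) l(2) cx0(2) lr neg pos pos0] by blast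
  have c0: "fst y0 \<in> {a r'<..<b r'}" using cell_subset[OF r(2) tendsto_cell[OF cx(2) l(2)]] e by simp
  have tn: "(\<lambda>n. tangent (fst (y (\<phi> n)))) \<longlonglongrightarrow> tangent (fst y0)"
    using LIMSEQ_subseq_LIMSEQ[OF tendsto_cell_maps(2)[OF r(2) cx(2) l(2)] \<phi>] e by (simp add: o_def)
  have ly: "(\<lambda>n. snd (y (\<phi> n))) \<longlonglongrightarrow> snd y'" using LIMSEQ_subseq_LIMSEQ[OF l(4) \<phi>] by (simp add: o_def)
  \<comment> \<open>So far only refracted velocities are known to converge to that of
    \<open>y0\<close>. Refraction preserves tangential components, the outer energy fixes the norm,
    and the limiting normal component is nonnegative; so \<open>vector_eqI\<close> identifies the
    velocities.\<close>
  have "snd y0 = snd y'"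
  proof (rule B.vector_eqI[OF c0])
    have "(\<lambda>n. inner (refract h (fst (y (\<phi> n))) (snd (y (\<phi> n)))) (tangent (fst (y (\<phi> n))))) \<longlonglongrightarrow>
        inner (refract h (fst y0) (snd y0)) (tangent (fst y0))"
      using tendsto_inner[OF lu tn] by (simp add: o_def)
    then have "(\<lambda>n. inner (snd (y (\<phi> n))) (tangent (fst (y (\<phi> n))))) \<longlonglongrightarrow> inner (snd y0) (tangent (fst y0))"
      unfolding B.refract_components(1)[OF c0] B.refract_components(1)[OF cell_subset[OF r(2) cx(2)]] .
    then show "inner (snd y0) (tangent (fst y0)) = inner (snd y') (tangent (fst y0))"
      using LIMSEQ_unique tendsto_inner[OF ly tn] by blast
    have "(\<lambda>n. (norm (snd (y n)))\<^sup>2 / 2) \<longlonglongrightarrow> V\<^sub>E (\<gamma> (fst y0))"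
    proof -
      have "(\<lambda>n. V\<^sub>E (\<gamma> (fst (y n)))) \<longlonglongrightarrow> V\<^sub>E (\<gamma> (fst y0))"
        unfolding V\<^sub>E_def using tendsto_cell_maps(1)[OF r(2) cx(2) l(2)] e by (intro tendsto_intros) simp
      moreover have "V\<^sub>E (\<gamma> (fst (y n))) = (norm (snd (y n)))\<^sup>2 / 2" for n using sectionD(1)[OF sy[of n]] by simp
      ultimately show ?thesis by simp
    qed
    moreover have "(\<lambda>n. (norm (snd (y n)))\<^sup>2 / 2) \<longlonglongrightarrow> (norm (snd y'))\<^sup>2 / 2" by (intro tendsto_intros l(4)) simp
    ultimately have "(norm (snd y'))\<^sup>2 / 2 = V\<^sub>E (\<gamma> (fst y0))" using LIMSEQ_unique by blast
    then have "(norm (snd y0))\<^sup>2 = (norm (snd y'))\<^sup>2" using sectionD(1)[OF sy0] by simp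
    then show "norm (snd y0) = norm (snd y')" by simp
    show "inner (snd y0) (B.nrm (fst y0)) > 0"
      using sectionD(1)[OF sy0] unfolding B.outward_normal_eq[OF c0] by (simp add: inner_commute)
    have "(\<lambda>n. inner (outward_normal (fst (y n))) (snd (y n))) \<longlonglongrightarrow> inner (outward_normal (fst y0)) (snd y')"
      using tendsto_inner[OF tendsto_cell_maps(3)[OF r(2) cx(2) l(2)] l(4)] e by simp
    then have "inner (outward_normal (fst y0)) (snd y') \<ge> 0"
      by (rule LIMSEQ_le_const) (use sectionD(1) sy in \<open>blast intro: less_imp_le\<close>)
    then show "inner (snd y') (B.nrm (fst y0)) \<ge> 0"
      unfolding B.outward_normal_eq[OF c0] by (simp add: inner_commute)
  qed
  then show "y' = y0" using e by (simp add: prod_eq_iff)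
qed

end

section \<open>Symbolic dynamics\<close>

context refraction_system
begin

abbreviation "R \<equiv> return_rel m a b \<alpha> \<beta> h"
abbreviation "X \<equiv> initial_set m a b \<alpha> \<beta> h"
abbreviation "F \<equiv> return_map m a b \<alpha> \<beta> h"

lemma return_cont: "cont_rel R" "cont_rel (R\<inverse>)"
proof -
  show "cont_rel R" unfolding return_rel_eq by (intro cont_rel_relcomp outer_pairs_cont inner_pairs_cont)
  show "cont_rel (R\<inverse>)" unfolding return_rel_eq converse_relcomp
    by (intro cont_rel_relcomp cont_rel_flip outer_pairs_cont inner_pairs_cont outer_pairs_flip inner_pairs_flip)
qed

lemma return_unique: "(x, y) \<in> R \<Longrightarrow> (x, y') \<in> R \<Longrightarrow> y = y'" "(x, y) \<in> R \<Longrightarrow> (x', y) \<in> R \<Longrightarrow> x = x'"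
  using cont_rel_unique[OF return_cont(1)] cont_rel_unique[OF return_cont(2)] by blast+

lemma return_map_eq: "(x, y) \<in> R \<Longrightarrow> F x = y"
  unfolding return_map_def using return_unique(1) by blast

section \<open>Bi-infinite orbits and itineraries\<close>

definition orbit :: "(int \<Rightarrow> real \<times> complex) \<Rightarrow> bool" where
  "orbit z \<longleftrightarrow> (\<forall>j. (z j, z (j + 1)) \<in> R)"

lemma orbit_relpow:
  assumes "orbit z"
  shows "(z j, z (j + int k)) \<in> R ^^ k"
proof (induction k)
  case (Suc k)
  have "(z (j + int k), z (j + int k + 1)) \<in> R" using assms by (simp add: orbit_def)
  then show ?case using Suc relpow_Suc_I[of "z j" "z (j + int k)" k R] by (simp add: add_ac)
qed simp

lemma orbit_initial:
  assumes "orbit z"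
  shows "z j \<in> X"
proof -
  have "z j \<in> Domain (R ^^ k) \<inter> Range (R ^^ k)" for k
    using orbit_relpow[OF assms, of j k] orbit_relpow[OF assms, of "j - int k" k] by auto
  then show ?thesis by (simp add: initial_set_def)
qed

text \<open>Membership in \<open>X\<close> asks for finite chains of every length. Because the
  relation is single-valued, all forward chains start with the same successor, which inherits them;
  backward chains are extended by one step.\<close>

lemma initial_succ:
  assumes "x \<in> X"
  shows "\<exists>y\<in>X. (x, y) \<in> R"
proof -
  have d: "x \<in> Domain (R ^^ k)" "x \<in> Range (R ^^ k)" for k using assms by (auto simp: initial_set_def)
  obtain y where y: "(x, y) \<in> R" using d(1)[of 1] by auto
  have "y \<in> Domain (R ^^ k) \<inter> Range (R ^^ k)" for k
  proof
    obtain z where "(x, z) \<in> R ^^ Suc k" using d(1)[of "Suc k"] by blast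
    then obtain y' where "(x, y') \<in> R" "(y', z) \<in> R ^^ k" by (rule relpow_Suc_E2)
    then show "y \<in> Domain (R ^^ k)" using return_unique(1)[OF y] by blast
    show "y \<in> Range (R ^^ k)"
    proof (cases k)
      case (Suc n)
      obtain z where "(z, x) \<in> R ^^ n" using d(2)[of n] by blast
      then show ?thesis using y Suc by (blast intro: relpow_Suc_I)
    qed auto
  qed
  then have "y \<in> X" by (simp add: initial_set_def)
  then show ?thesis using y by blast
qed

lemma initial_pred:
  assumes "x \<in> X"
  shows "\<exists>y\<in>X. (y, x) \<in> R"
proof -
  have d: "x \<in> Domain (R ^^ k)" "x \<in> Range (R ^^ k)" for k using assms by (auto simp: initial_set_def)
  obtain y where y: "(y, x) \<in> R" using d(2)[of 1] by auto
  have "y \<in> Domain (R ^^ k) \<inter> Range (R ^^ k)" for k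
  proof
    obtain z where "(z, x) \<in> R ^^ Suc k" using d(2)[of "Suc k"] by blast
    then obtain y' where "(z, y') \<in> R ^^ k" "(y', x) \<in> R" by (rule relpow_Suc_E)
    then show "y \<in> Range (R ^^ k)" using return_unique(2)[OF y] by blast
    show "y \<in> Domain (R ^^ k)"
    proof (cases k)
      case (Suc n)
      obtain z where "(x, z) \<in> R ^^ n" using d(1)[of n] by blast
      then show ?thesis using y Suc by (blast intro: relpow_Suc_I2)
    qed auto
  qed
  then have "y \<in> X" by (simp add: initial_set_def)
  then show ?thesis using y by blast
qed

lemma orbit_through:
  assumes x: "x \<in> X"
  shows "\<exists>z. orbit z \<and> z 0 = x"
proof -
  obtain f where f: "\<And>x. x \<in> X \<Longrightarrow> f x \<in> X \<and> (x, f x) \<in> R" using initial_succ by metis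
  obtain g where g: "\<And>x. x \<in> X \<Longrightarrow> g x \<in> X \<and> (g x, x) \<in> R" using initial_pred by metis
  have fX: "(f ^^ n) x \<in> X" and gX: "(g ^^ n) x \<in> X" for n by (induction n) (use x f g in auto)
  define z where "z j = (if j \<ge> 0 then (f ^^ nat j) x else (g ^^ nat (- j)) x)" for j :: int
  have "(z j, z (j + 1)) \<in> R" for j
  proof (cases "j \<ge> 0")
    case True
    then have "nat (j + 1) = Suc (nat j)" by simp
    then show ?thesis using True f[OF fX[of "nat j"]] by (simp add: z_def)
  next
    case False
    have s: "nat (- j) = Suc (nat (- (j + 1)))" using False by simp
    have "z (j + 1) = (g ^^ nat (- (j + 1))) x" using False by (cases "j = - 1") (auto simp: z_def)
    moreover have "z j = g ((g ^^ nat (- (j + 1))) x)" using False unfolding z_def s by simp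
    ultimately show ?thesis using g[OF gX] by simp
  qed
  moreover have "z 0 = x" by (simp add: z_def)
  ultimately show ?thesis unfolding orbit_def by blast
qed

lemma iterate_orbit:
  assumes z: "orbit z"
  shows "return_iterate m a b \<alpha> \<beta> h j (z 0) = z j"
proof -
  have R: "(z j, z (j + 1)) \<in> R" for j using z by (simp add: orbit_def)
  \<comment> \<open>Negative iterates are taken with \<open>inv_into\<close>; single-valuedness of
    the converse relation makes this a genuine inverse along the orbit.\<close>
  have "inj_on F X"
  proof (rule inj_onI)
    fix x y assume "x \<in> X" "y \<in> X" "F x = F y"
    then show "x = y" using initial_succ return_map_eq return_unique(2) by metis
  qed
  then have inv: "inv_into X F (z (j + 1)) = z j" for j
    using orbit_initial[OF z] return_map_eq[OF R] by (intro inv_into_f_eq) auto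
  have p: "(F ^^ n) (z 0) = z (int n)" for n
    by (induction n) (use return_map_eq[OF R] in \<open>auto simp: add.commute\<close>)
  have q: "(inv_into X F ^^ n) (z 0) = z (- int n)" for n
  proof (induction n)
    case (Suc n)
    then show ?case using inv[of "- int (Suc n)"] by simp
  qed simp
  show ?thesis using p[of "nat j"] q[of "nat (- j)"] by (simp add: return_iterate_def)
qed

text \<open>Convergence is passed on one step at a time, backwards through the converse relation.
  The limiting orbit is given in advance, as \<open>cont_rel\<close> requires.\<close>

lemma orbit_tendsto:
  assumes Z: "\<And>n. orbit (Z n)" and z: "orbit z" and l: "(\<lambda>n. Z n 0) \<longlonglongrightarrow> z 0"
  shows "(\<lambda>n. Z n j) \<longlonglongrightarrow> z j"
proof -
  have R: "(Z n j, Z n (j + 1)) \<in> R" "(z j, z (j + 1)) \<in> R" for n j using Z z by (auto simp: orbit_def)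
  have "(\<lambda>n. Z n (int k)) \<longlonglongrightarrow> z (int k)" for k
  proof (induction k)
    case (Suc k)
    have "(\<lambda>n. Z n (int (Suc k))) \<longlonglongrightarrow> z (int (Suc k))"
    proof (rule cont_relD[OF return_cont(1) _ Suc])
      show "(Z n (int k), Z n (int (Suc k))) \<in> R" for n using R(1)[of n "int k"] by (simp add: add.commute)
      show "(z (int k), z (int (Suc k))) \<in> R" using R(2)[of "int k"] by (simp add: add.commute)
    qed
    then show ?case .
  qed (use l in simp)
  moreover have "(\<lambda>n. Z n (- int k)) \<longlonglongrightarrow> z (- int k)" for k
  proof (induction k)
    case (Suc k)
    have "(\<lambda>n. Z n (- int (Suc k))) \<longlonglongrightarrow> z (- int (Suc k))"
    proof (rule cont_relD[OF return_cont(2) _ Suc])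
      show "(Z n (- int k), Z n (- int (Suc k))) \<in> R\<inverse>" for n using R(1)[of n "- int (Suc k)"] by simp
      show "(z (- int k), z (- int (Suc k))) \<in> R\<inverse>" using R(2)[of "- int (Suc k)"] by simp
    qed
    then show ?case .
  qed (use l in simp)
  ultimately show ?thesis by (cases j rule: int_cases2) auto
qed

lemma return_cells:
  assumes "(x, y) \<in> R"
  shows "\<exists>r\<in>{1..m}. \<exists>r'\<in>NA m a b r. fst x \<in> {\<alpha> r..\<beta> r} \<and> fst y \<in> {\<alpha> r'..\<beta> r'}"
  using assms sectionD(1) unfolding return_rel_def by blast

lemma symbol_eq:
  assumes "r \<in> {1..m}" "fst x \<in> {\<alpha> r..\<beta> r}"
  shows "symbol m \<alpha> \<beta> x = r"
  unfolding symbol_def by (rule the_equality) (use assms cell_unique in blast)+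

lemma itinerary_orbit: "orbit z \<Longrightarrow> itinerary m a b \<alpha> \<beta> h (z 0) = (\<lambda>j. symbol m \<alpha> \<beta> (z j))"
  by (simp add: itinerary_def iterate_orbit)

lemma orbit_symbol:
  assumes "orbit z"
  shows "symbol m \<alpha> \<beta> (z j) \<in> {1..m}" "fst (z j) \<in> {\<alpha> (symbol m \<alpha> \<beta> (z j))..\<beta> (symbol m \<alpha> \<beta> (z j))}"
    "symbol m \<alpha> \<beta> (z (j + 1)) \<in> NA m a b (symbol m \<alpha> \<beta> (z j))"
proof -
  have "(z j, z (j + 1)) \<in> R" using assms by (simp add: orbit_def)
  then obtain r r' where r: "r \<in> {1..m}" "r' \<in> NA m a b r" "fst (z j) \<in> {\<alpha> r..\<beta> r}" "fst (z (j + 1)) \<in> {\<alpha> r'..\<beta> r'}"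
    using return_cells by blast
  have "symbol m \<alpha> \<beta> (z j) = r" "symbol m \<alpha> \<beta> (z (j + 1)) = r'"
    using symbol_eq[OF r(1,3)] symbol_eq[OF NA_mem[OF r(2)] r(4)] by auto
  then show "symbol m \<alpha> \<beta> (z j) \<in> {1..m}" "fst (z j) \<in> {\<alpha> (symbol m \<alpha> \<beta> (z j))..\<beta> (symbol m \<alpha> \<beta> (z j))}"
    "symbol m \<alpha> \<beta> (z (j + 1)) \<in> NA m a b (symbol m \<alpha> \<beta> (z j))" using r by auto
qed

lemma itinerary_word: "x \<in> X \<Longrightarrow> itinerary m a b \<alpha> \<beta> h x \<in> admissible_words m a b"
proof -
  assume "x \<in> X"
  then obtain z where z: "orbit z" "z 0 = x" using orbit_through by blast
  show ?thesis using itinerary_orbit[OF z(1)] orbit_symbol(1,3)[OF z(1)] z(2) by (simp add: admissible_words_def)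
qed

lemma return_map_initial: "x \<in> X \<Longrightarrow> F x \<in> X"
  using initial_succ return_map_eq by metis

lemma itinerary_shift: "x \<in> X \<Longrightarrow> itinerary m a b \<alpha> \<beta> h (F x) = bernoulli_shift (itinerary m a b \<alpha> \<beta> h x)"
proof -
  assume "x \<in> X"
  then obtain z where z: "orbit z" "z 0 = x" using orbit_through by blast
  have z1: "orbit (\<lambda>j. z (j + 1))" using z(1) unfolding orbit_def by blast
  have "(z 0, z (0 + 1)) \<in> R" using z(1) unfolding orbit_def by blast
  then have "F x = z 1" using return_map_eq z(2) by simp
  then show ?thesis using itinerary_orbit[OF z1] itinerary_orbit[OF z(1)] z(2) by (simp add: bernoulli_shift_def)
qed

text \<open>Symbols are read off from compact cells inside disjoint open intervals. A position that
  depends continuously on the initial point stays in the open interval of its cell, and this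
  interval contains no part of another cell.\<close>

lemma itinerary_locally_constant:
  assumes x: "x \<in> X"
  shows "\<exists>U. openin (top_of_set X) U \<and> x \<in> U \<and> (\<forall>y\<in>U. itinerary m a b \<alpha> \<beta> h y k = itinerary m a b \<alpha> \<beta> h x k)"
proof -
  define \<phi> where "\<phi> y = fst (return_iterate m a b \<alpha> \<beta> h k y)" for y
  have cont: "continuous_on X \<phi>"
    unfolding continuous_on_sequentially
  proof (intro allI ballI impI)
    fix u y assume y: "y \<in> X" and u: "(\<forall>n. u n \<in> X) \<and> u \<longlonglongrightarrow> y"
    obtain z where z: "orbit z" "z 0 = y" using orbit_through[OF y] by blast
    have "\<forall>n. \<exists>Z. orbit Z \<and> Z 0 = u n" using orbit_through u by blast
    then obtain Z where Z: "\<And>n. orbit (Z n)" "\<And>n. Z n 0 = u n" by metis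
    have "(\<lambda>n. Z n k) \<longlonglongrightarrow> z k" by (rule orbit_tendsto[OF Z(1) z(1)]) (use Z(2) z(2) u in simp)
    then have "(\<lambda>n. fst (Z n k)) \<longlonglongrightarrow> fst (z k)" by (rule tendsto_fst)
    moreover have "\<phi> (u n) = fst (Z n k)" for n using iterate_orbit[OF Z(1)] Z(2) by (simp add: \<phi>_def)
    moreover have "\<phi> y = fst (z k)" using iterate_orbit[OF z(1)] z(2) by (simp add: \<phi>_def)
    ultimately show "(\<phi> \<circ> u) \<longlonglongrightarrow> \<phi> y" by (simp add: o_def)
  qed
  have it: "itinerary m a b \<alpha> \<beta> h y k \<in> {1..m} \<and> \<phi> y \<in> {\<alpha> (itinerary m a b \<alpha> \<beta> h y k)..\<beta> (itinerary m a b \<alpha> \<beta> h y k)}"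
    if y: "y \<in> X" for y
  proof -
    obtain z where z: "orbit z" "z 0 = y" using orbit_through[OF y] by blast
    have "\<phi> y = fst (z k)" using iterate_orbit[OF z(1)] z(2) by (simp add: \<phi>_def)
    then show ?thesis using itinerary_orbit[OF z(1)] z(2) orbit_symbol(1,2)[OF z(1)] by simp
  qed
  define r where "r = itinerary m a b \<alpha> \<beta> h x k"
  define U where "U = X \<inter> \<phi> -` {a r<..<b r}"
  have r: "r \<in> {1..m}" "\<phi> x \<in> {\<alpha> r..\<beta> r}" using it[OF x] by (auto simp: r_def)
  have "openin (top_of_set X) U" unfolding U_def
    by (rule continuous_openin_preimage_gen[OF cont open_greaterThanLessThan])
  moreover have "x \<in> U" using x cell_subset[OF r] by (simp add: U_def)
  moreover have "itinerary m a b \<alpha> \<beta> h y k = r" if y: "y \<in> U" for y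
  proof -
    define s where "s = itinerary m a b \<alpha> \<beta> h y k"
    have s: "s \<in> {1..m}" "\<phi> y \<in> {\<alpha> s..\<beta> s}" using it[of y] y by (auto simp: s_def U_def)
    have "\<phi> y \<in> {a s<..<b s}" "\<phi> y \<in> {a r<..<b r}" using cell_subset[OF s] y by (auto simp: U_def)
    then have "s = r" using disjoint s(1) r(1) unfolding disjoint_family_on_def by blast
    then show ?thesis by (simp add: s_def)
  qed
  ultimately show ?thesis unfolding r_def by blast
qed

text \<open>Up to a given error only finitely many symbols matter, and each of them is locally
  constant.\<close>

lemma itinerary_continuous:
  "continuous_map (top_of_set X) (Metric_space.mtopology (admissible_words m a b) word_dist) (itinerary m a b \<alpha> \<beta> h)"
proof -
  interpret W: Metric_space "admissible_words m a b" word_dist by (rule word_dist_metric)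
  show ?thesis
    unfolding W.continuous_map_to_metric
  proof (intro ballI allI impI)
    fix x and e :: real assume "x \<in> topspace (top_of_set X)" and e: "e > 0"
    then have x: "x \<in> X" by simp
    obtain K where K: "finite K" "\<And>l l'. (\<And>k. k \<in> K \<Longrightarrow> l k = l' k) \<Longrightarrow> word_dist l l' < e" using word_dist_small[OF e] by blast
    obtain U where U: "\<And>k. openin (top_of_set X) (U k)" "\<And>k. x \<in> U k"
      "\<And>k y. y \<in> U k \<Longrightarrow> itinerary m a b \<alpha> \<beta> h y k = itinerary m a b \<alpha> \<beta> h x k"
      using itinerary_locally_constant[OF x] by metis
    define V where "V = (\<Inter>k\<in>K. U k) \<inter> topspace (top_of_set X)"
    have "openin (top_of_set X) V" unfolding V_def by (rule openin_INT[OF K(1) U(1)])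
    moreover have "x \<in> V" using x U(2) by (simp add: V_def)
    moreover have "itinerary m a b \<alpha> \<beta> h y \<in> W.mball (itinerary m a b \<alpha> \<beta> h x) e" if y: "y \<in> V" for y
    proof -
      have "y \<in> X" using y by (simp add: V_def)
      moreover have "word_dist (itinerary m a b \<alpha> \<beta> h x) (itinerary m a b \<alpha> \<beta> h y) < e"
        by (rule K(2)) (use y U(3) in \<open>simp add: V_def\<close>)
      ultimately show ?thesis using itinerary_word x by (simp add: W.in_mball)
    qed
    ultimately show "\<exists>U. openin (top_of_set X) U \<and> x \<in> U \<and> (\<forall>y\<in>U. itinerary m a b \<alpha> \<beta> h y \<in> W.mball (itinerary m a b \<alpha> \<beta> h x) e)"
      by blast
  qed
qed

text \<open>Only the tangential components are matched by hypothesis. Transversality of the inner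
  arc gives the sign of the normal components, and the energy their size, so refraction produces
  exactly the velocities of the arc.\<close>

lemma inner_pairsI:
  assumes r: "r \<in> {1..m}" "r' \<in> NA m a b r" and x: "(\<xi>, v) \<in> \<Xi>_minus \<alpha> \<beta> r" and y: "(\<eta>, v') \<in> \<Xi>_plus \<alpha> \<beta> r'"
    and tx: "inner v (tangent \<xi>) = inner (kep_vel \<mu> (\<E> + h) (\<gamma> \<xi>) (\<gamma> \<eta>)) (tangent \<xi>)"
    and ty: "inner v' (tangent \<eta>) = - inner (kep_vel \<mu> (\<E> + h) (\<gamma> \<eta>) (\<gamma> \<xi>)) (tangent \<eta>)"
  shows "((\<xi>, v), (\<eta>, v')) \<in> inner_pairs (r, r')"
proof -
  have r': "r' \<in> {1..m}" "r \<in> NA m a b r'" using NA_mem[OF r(2)] NA_commute[OF r] by auto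
  interpret A: arc_interval \<omega> \<mu> \<E> D \<gamma> L "a r" "b r" by (rule arc[OF r(1)])
  interpret B: arc_interval \<omega> \<mu> \<E> D \<gamma> L "a r'" "b r'" by (rule arc[OF r'(1)])
  have \<xi>: "\<xi> \<in> {\<alpha> r..\<beta> r}" and \<eta>: "\<eta> \<in> {\<alpha> r'..\<beta> r'}" and vn: "inner (outward_normal \<xi>) v < 0" "inner (outward_normal \<eta>) v' > 0"
    using sectionD(2)[OF x] sectionD(1)[OF y] by auto
  note c = cell_subset[OF r(1) \<xi>] cell_subset[OF r'(1) \<eta>]
  obtain S w w' where k: "kepler_passage h \<xi> (kep_vel \<mu> (\<E> + h) (\<gamma> \<xi>) (\<gamma> \<eta>)) \<eta> (- kep_vel \<mu> (\<E> + h) (\<gamma> \<eta>) (\<gamma> \<xi>)) S w w'"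
    using inner_arc_passage[OF h_pos inner_unique[OF r c] cell_nonzero[OF r \<xi> \<eta>]] by blast
  have e: "(norm (kep_vel \<mu> (\<E> + h) (\<gamma> \<xi>) (\<gamma> \<eta>)))\<^sup>2 / 2 = V\<^sub>I h (\<gamma> \<xi>)"
    "(norm (- kep_vel \<mu> (\<E> + h) (\<gamma> \<eta>) (\<gamma> \<xi>)))\<^sup>2 / 2 = V\<^sub>I h (\<gamma> \<eta>)"
    using kepler_passage_energy[OF k cell_L(2)[OF r(1) \<xi>]] kepler_passage_energy[OF kepler_passage_reverse[OF k] cell_L(2)[OF r'(1) \<eta>]]
    by simp_all
  have "refract h \<xi> v = kep_vel \<mu> (\<E> + h) (\<gamma> \<xi>) (\<gamma> \<eta>)"
  proof (rule A.refract_eqI[OF c(1) e(1)])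
    show "sgn (inner (kep_vel \<mu> (\<E> + h) (\<gamma> \<xi>) (\<gamma> \<eta>)) (A.nrm \<xi>)) = sgn (inner v (A.nrm \<xi>))"
      using transversal[OF r \<xi> \<eta>] vn(1) unfolding A.outward_normal_eq[OF c(1)] by (simp add: inner_commute)
  qed (use tx in simp)
  moreover have "refract h \<eta> v' = - kep_vel \<mu> (\<E> + h) (\<gamma> \<eta>) (\<gamma> \<xi>)"
  proof (rule B.refract_eqI[OF c(2) e(2)])
    show "sgn (inner (- kep_vel \<mu> (\<E> + h) (\<gamma> \<eta>) (\<gamma> \<xi>)) (B.nrm \<eta>)) = sgn (inner v' (B.nrm \<eta>))"
      using transversal[OF r' \<eta> \<xi>] vn(2) unfolding B.outward_normal_eq[OF c(2)] by (simp add: inner_commute)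
  qed (use ty in simp)
  ultimately have "inner_step h (\<xi>, v) (\<eta>, v')"
    using k inner_step_iff[OF h_pos cell_L(2)[OF r(1) \<xi>] cell_L(2)[OF r'(1) \<eta>]] by metis
  then show ?thesis using x y by (simp add: inner_pairs_def)
qed

text \<open>A vanishing defect at an odd node is Snell's law on entering \<open>D\<close>, at an
  even node Snell's law on leaving it. The arcs between the equilibrium nodes therefore link up to
  an orbit with the prescribed word.\<close>

lemma itinerary_surj:
  assumes l: "l \<in> admissible_words m a b"
  shows "l \<in> itinerary m a b \<alpha> \<beta> h ` X"
proof -
  have lm: "l j \<in> {1..m}" "l (j + 1) \<in> NA m a b (l j)" for j using l by (auto simp: admissible_words_def)
  obtain y :: "int \<Rightarrow> real" where y: "\<And>k. y k \<in> {\<alpha> (l (k div 2))..\<beta> (l (k div 2))}"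
    and d0: "\<And>j. snell_defect h (y (2 * j + 1)) (y (2 * j)) (y (2 * j - 1)) = 0"
    and d1: "\<And>j. snell_defect h (y (2 * j)) (y (2 * j + 1)) (y (2 * j + 2)) = 0"
    using equilibrium_nodes[OF l] by blast
  have y0: "y (2 * j) \<in> {\<alpha> (l j)..\<beta> (l j)}" and y1: "y (2 * j + 1) \<in> {\<alpha> (l j)..\<beta> (l j)}" for j
    using y[of "2 * j"] y[of "2 * j + 1"] by simp_all
  define z where "z j = (y (2 * j), \<omega> *\<^sub>R lob_vec \<rho> (\<gamma> (y (2 * j))) (\<gamma> (y (2 * j + 1))))" for j
  define z1 where "z1 j = (y (2 * j + 1), - (\<omega> *\<^sub>R lob_vec \<rho> (\<gamma> (y (2 * j + 1))) (\<gamma> (y (2 * j)))))" for j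
  have o: "(z j, z1 j) \<in> outer_pairs (l j)" for j unfolding z_def z1_def by (rule outer_pairsI[OF lm(1) y0 y1])
  have i: "(z1 j, z (j + 1)) \<in> inner_pairs (l j, l (j + 1))" for j
  proof -
    have s: "z1 j \<in> \<Xi>_minus \<alpha> \<beta> (l j)" "z (j + 1) \<in> \<Xi>_plus \<alpha> \<beta> (l (j + 1))" using o[of j] o[of "j + 1"] by (auto simp: outer_pairs_def)
    have n: "2 * (j + 1) = 2 * j + 2" "2 * (j + 1) - 1 = 2 * j + 1" by simp_all
    show ?thesis unfolding z_def z1_def
    proof (rule inner_pairsI[OF lm])
      show "inner (- (\<omega> *\<^sub>R lob_vec \<rho> (\<gamma> (y (2 * j + 1))) (\<gamma> (y (2 * j))))) (tangent (y (2 * j + 1))) =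
          inner (kep_vel \<mu> (\<E> + h) (\<gamma> (y (2 * j + 1))) (\<gamma> (y (2 * (j + 1))))) (tangent (y (2 * j + 1)))"
        using d1[of j] unfolding snell_defect_def n(1) inner_add_left inner_minus_left by linarith
      show "inner (\<omega> *\<^sub>R lob_vec \<rho> (\<gamma> (y (2 * (j + 1)))) (\<gamma> (y (2 * (j + 1) + 1)))) (tangent (y (2 * (j + 1)))) =
          - inner (kep_vel \<mu> (\<E> + h) (\<gamma> (y (2 * (j + 1)))) (\<gamma> (y (2 * j + 1)))) (tangent (y (2 * (j + 1))))"
        using d0[of "j + 1"] unfolding snell_defect_def n(2) inner_add_left by linarith
    qed (use s in \<open>simp_all add: z_def z1_def\<close>)
  qed
  have "orbit z"
    unfolding orbit_def return_rel_eq
  proof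
    fix j
    have "(z j, z1 j) \<in> (\<Union>r\<in>{1..m}. outer_pairs r)" using o lm(1) by blast
    moreover have "(z1 j, z (j + 1)) \<in> (\<Union>p\<in>Sigma {1..m} (NA m a b). inner_pairs p)" using i lm by blast
    ultimately show "(z j, z (j + 1)) \<in> (\<Union>r\<in>{1..m}. outer_pairs r) O (\<Union>p\<in>Sigma {1..m} (NA m a b). inner_pairs p)" by (rule relcompI)
  qed
  moreover have "symbol m \<alpha> \<beta> (z j) = l j" for j by (rule symbol_eq[OF lm(1)]) (use y0 in \<open>simp add: z_def\<close>)
  ultimately have "itinerary m a b \<alpha> \<beta> h (z 0) = l" "z 0 \<in> X" using itinerary_orbit orbit_initial by auto
  then show ?thesis by blast
qed

end

theorem theorem1p5:
  fixes \<omega> \<mu> \<E> L :: real and D :: "complex set" and \<gamma> :: "real \<Rightarrow> complex"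
    and m :: nat and a b \<alpha> \<beta> :: "nat \<Rightarrow> real"
  assumes "refraction_domain \<omega> \<mu> \<E> D \<gamma> L"
    and "refraction_domain.admissible_with \<omega> \<mu> \<E> D \<gamma> L m a b \<alpha> \<beta>"
  shows "\<forall>\<^sub>F h in at_top.
    (let X = refraction_domain.initial_set \<omega> \<mu> \<E> D \<gamma> L m a b \<alpha> \<beta> h;
         F = refraction_domain.return_map \<omega> \<mu> \<E> D \<gamma> L m a b \<alpha> \<beta> h;
         \<pi> = refraction_domain.itinerary \<omega> \<mu> \<E> D \<gamma> L m a b \<alpha> \<beta> h;
         W = refraction_domain.admissible_words \<gamma> m a b
     in F ` X \<subseteq> X \<and>
        continuous_map (top_of_set X) (Metric_space.mtopology W word_dist) \<pi> \<and>
        \<pi> ` X = W \<and>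
        (\<forall>x\<in>X. \<pi> (F x) = bernoulli_shift (\<pi> x)))"
  using refraction_domain.eventually_refraction_system[OF assms]
proof eventually_elim
  fix h assume "refraction_system \<omega> \<mu> \<E> D \<gamma> L m a b \<alpha> \<beta> h"
  then interpret refraction_system \<omega> \<mu> \<E> D \<gamma> L m a b \<alpha> \<beta> h .
  show "let X = initial_set m a b \<alpha> \<beta> h; F = return_map m a b \<alpha> \<beta> h; \<pi> = itinerary m a b \<alpha> \<beta> h; W = admissible_words m a b
     in F ` X \<subseteq> X \<and> continuous_map (top_of_set X) (Metric_space.mtopology W word_dist) \<pi> \<and> \<pi> ` X = W \<and>
        (\<forall>x\<in>X. \<pi> (F x) = bernoulli_shift (\<pi> x))"
    unfolding Let_def
    using return_map_initial itinerary_continuous itinerary_word itinerary_surj itinerary_shift by blast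
qed

end
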